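(* Let $S$ be a truncation set; all rings are commutative and unital. a) Let $$\begin{array}{ccc} R_0 & \to & R_0' \\ \downarrow & & \downarrow \\ R & \to & R' \end{array}$$ be a commutative square of rings, let $(\pi)$ be a free presentation of the $R_0$-algebra $R$ and let $(\pi')$ be a presentation of the $R_0'$-algebra $R'$. View $E_S\Omega^\bullet(\pi')$ as a differential graded algebra over $E_S(R_0)$ via $E_S(R_0)\to E_S(R_0')$. Then there is a unique continuous homomorphism of differential graded $E_S(R_0)$-algebras $$E_S\Omega^\bullet(\pi)\to E_S\Omega^\bullet(\pi')$$ which in degree zero is the map $E_S(R)\to E_S(R')$ induced by $R\to R'$. b) For two free presentations $(\pi)$ and $(\pi')$ of the same $R_0$-algebra $R$ there is a unique topological isomorphism of differential graded $E_S(R_0)$-algebras $E_S\Omega^\bullet(\pi)\to E_S\Omega^\bullet(\pi')$ which is the identity on $E_S(R)$ in degree zero (more precisely, which in degree zero is the canonical identification $E_S(R,\pi)\equiv E_S(R,\pi')$).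
   Context: A truncation set is a non-empty subset $S\subset\mathbb{N}=\{1,2,\ldots\}$ closed under taking positive divisors; for $n\in S$, $S/n=\{\nu\in\mathbb{N}\mid\nu n\in S\}$. For a ring $A$ (discrete), $A^S$ has componentwise operations and the product topology; $V_n : A^{S/n}\to A^S$, $V_n((a_\nu)) = n(\delta_{n\mid\nu}a_{\nu/n})_{\nu\in S}$ ($\delta_{n\mid\nu}=1$ if $n\mid\nu$, else $0$); for $a\in A$, $V_n\langle a\rangle := V_n((a^\nu)_{\nu\in S/n})$. $X_S(A)$ is the closed additive subgroup of $A^S$ generated by all $V_n\langle a\rangle$, $n\in S$, $a\in A$; it is a closed subring and $X_S(I)$ (same definition with $a \in I$) is a closed ideal for any ideal $I$. If $0\to I\to A\xrightarrow{\pi}R\to0$ is exact with $A$ a ring in which multiplication by every $n\in S$ is injective, $E_S(R,\pi)=X_S(A)/X_S(I)$ with the quotient topology. $E_S(R)$ is $E_S(R,\pi)$ for the standard presentation $\mathbb{Z}R\to R$, $[r]\mapsto r$, where $\mathbb{Z}R$ is the free $\mathbb{Z}$-module on symbols $[r]$, $r\in R$, with $[r][s]=[rs]$. All the topological rings $E_S(R,\pi)$ are canonically isomorphic to $E_S(R)$: the class of $V_n\langle a\rangle$ in $E_S(R,\pi)$ corresponds to the class of $V_n\langle[\pi(a)]\rangle$; and $R\mapsto E_S(R)$ is functorial. A presentation $(\pi)$ of an $R_0$-algebra $R$ is a commutative diagram with exact rows $0\to I_0\to A_0\xrightarrow{\pi_0}R_0\to0$ and $0\to I\to A\xrightarrow{\pi}R\to0$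 and vertical maps $I_0\hookrightarrow I$, $A_0\hookrightarrow A$, $R_0\to R$ (from the first row to the second), where $A_0$ has no $\mathbb{Z}$-torsion and $A$ is a polynomial ring over $A_0$ via $A_0\hookrightarrow A$. It is free if in addition $A_0$ is a polynomial ring over $\mathbb{Z}$. Let $\Omega=\Omega^\bullet_{A/A_0}$ be the differential graded algebra of relative differential forms and $\Omega_{\mathbb{Q}}=\Omega\otimes_{\mathbb{Z}}\mathbb{Q}$ (discrete). $\Omega_{\mathbb{Q}}^S$ with the product topology is a differential graded ring with differential $\mathrm{dl}((\omega_n)_{n\in S})=(n^{-1}d\omega_n)_{n\in S}$. $X_S^\bullet(A)$ is the closed differential graded subring of $(\Omega_{\mathbb{Q}}^S,\mathrm{dl})$ generated by $X_S(A)\subset A^S\subset\Omega_{\mathbb{Q}}^S$, $X_S^\bullet(I,A)$ is the closed differential graded ideal of $X_S^\bullet(A)$ generated by $X_S(I)$, and $E_S\Omega^\bullet(\pi)=X_S^\bullet(A)/X_S^\bullet(I,A)$, a topological differential graded ring. Its degree zero part is $E_S(R,\pi)\equiv E_S(R)$, and it is a differential graded algebra over $X_S(A_0)/X_S(I_0)=E_S(R_0,\pi_0)\equiv E_S(R_0)$. *)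

theory Defs
  imports "HOL-Algebra.Algebra" "HOL-Analysis.Analysis"
begin

section \<open>Truncation sets, the rings \<open>A\<^sup>S\<close> and the subgroups \<open>X\<^sub>S(I)\<close>\<close>

text \<open>Rings are the records of HOL-Algebra. In contrast to the type class of commutative rings,
  the predicate \<^const>\<open>cring\<close> also admits the zero ring.\<close>

definition truncation_set :: "nat set \<Rightarrow> bool"
  where "truncation_set S \<longleftrightarrow> S \<noteq> {} \<and> 0 \<notin> S \<and> (\<forall>n\<in>S. \<forall>d. d dvd n \<longrightarrow> d \<in> S)"

definition trunc_quotient :: "nat set \<Rightarrow> nat \<Rightarrow> nat set"
  where "trunc_quotient S n = {\<nu>. 0 < \<nu> \<and> \<nu> * n \<in> S}"

definition pow_ring :: "nat set \<Rightarrow> ('a, 'm) ring_scheme \<Rightarrow> (nat \<Rightarrow> 'a) ring"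
  where "pow_ring S A =
    \<lparr>carrier = (\<Pi>\<^sub>E n\<in>S. carrier A),
     monoid.mult = (\<lambda>x y. \<lambda>n\<in>S. x n \<otimes>\<^bsub>A\<^esub> y n),
     monoid.one = (\<lambda>n\<in>S. \<one>\<^bsub>A\<^esub>),
     ring.zero = (\<lambda>n\<in>S. \<zero>\<^bsub>A\<^esub>),
     ring.add = (\<lambda>x y. \<lambda>n\<in>S. x n \<oplus>\<^bsub>A\<^esub> y n)\<rparr>"

definition pow_top :: "nat set \<Rightarrow> ('a, 'm) ring_scheme \<Rightarrow> (nat \<Rightarrow> 'a) topology"
  where "pow_top S A = product_topology (\<lambda>_. discrete_topology (carrier A)) S"

definition Ver :: "nat set \<Rightarrow> ('a, 'm) ring_scheme \<Rightarrow> nat \<Rightarrow> (nat \<Rightarrow> 'a) \<Rightarrow> nat \<Rightarrow> 'a"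
  where "Ver S A n x =
    (\<lambda>\<nu>\<in>S. if n dvd \<nu> then add_pow A n (x (\<nu> div n)) else \<zero>\<^bsub>A\<^esub>)"

text \<open>The element \<open>V\<^sub>n\<langle>a\<rangle>\<close>.\<close>

definition Ver_pow :: "nat set \<Rightarrow> ('a, 'm) ring_scheme \<Rightarrow> nat \<Rightarrow> 'a \<Rightarrow> nat \<Rightarrow> 'a"
  where "Ver_pow S A n a = Ver S A n (\<lambda>\<nu>\<in>trunc_quotient S n. a [^]\<^bsub>A\<^esub> \<nu>)"

definition X_group :: "nat set \<Rightarrow> ('a, 'm) ring_scheme \<Rightarrow> 'a set \<Rightarrow> (nat \<Rightarrow> 'a) set"
  where "X_group S A I =
    (\<lambda>H. additive_subgroup H (pow_ring S A) \<and> closedin (pow_top S A) H)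
      hull {Ver_pow S A n a | n a. n \<in> S \<and> a \<in> I}"

definition X_ring :: "nat set \<Rightarrow> ('a, 'm) ring_scheme \<Rightarrow> (nat \<Rightarrow> 'a) ring"
  where "X_ring S A = (pow_ring S A)\<lparr>carrier := X_group S A (carrier A)\<rparr>"


section \<open>The topological rings \<open>E\<^sub>S(R,\<pi>)\<close> and \<open>E\<^sub>S(R)\<close>\<close>

definition quot_topology :: "'a topology \<Rightarrow> ('a \<Rightarrow> 'b) \<Rightarrow> 'b topology"
  where "quot_topology T p =
    topology (\<lambda>U. U \<subseteq> p ` topspace T \<and> openin T {x \<in> topspace T. p x \<in> U})"

text \<open>The map on cosets induced by a map \<open>f\<close> into \<open>D\<close>: the coset of \<open>x\<close> goes to the
  coset \<open>J + f x\<close>.\<close>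

definition coset_map ::
  "('b, 'm) ring_scheme \<Rightarrow> 'b set \<Rightarrow> ('a \<Rightarrow> 'b) \<Rightarrow> 'a set \<Rightarrow> 'b set"
  where "coset_map D J f C = the_elem ((\<lambda>x. J +>\<^bsub>D\<^esub> f x) ` C)"

definition E_ring ::
  "nat set \<Rightarrow> ('a, 'm) ring_scheme \<Rightarrow> ('r, 'n) ring_scheme \<Rightarrow> ('a \<Rightarrow> 'r) \<Rightarrow> (nat \<Rightarrow> 'a) set ring"
  where "E_ring S A R \<pi> = X_ring S A Quot X_group S A (a_kernel A R \<pi>)"

definition E_class ::
  "nat set \<Rightarrow> ('a, 'm) ring_scheme \<Rightarrow> ('r, 'n) ring_scheme \<Rightarrow> ('a \<Rightarrow> 'r) \<Rightarrow> (nat \<Rightarrow> 'a) \<Rightarrow>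
    (nat \<Rightarrow> 'a) set"
  where "E_class S A R \<pi> x = X_group S A (a_kernel A R \<pi>) +>\<^bsub>X_ring S A\<^esub> x"

definition E_top ::
  "nat set \<Rightarrow> ('a, 'm) ring_scheme \<Rightarrow> ('r, 'n) ring_scheme \<Rightarrow> ('a \<Rightarrow> 'r) \<Rightarrow>
    (nat \<Rightarrow> 'a) set topology"
  where "E_top S A R \<pi> =
    quot_topology (subtopology (pow_top S A) (X_group S A (carrier A))) (E_class S A R \<pi>)"

definition monoid_ring :: "('g, 'm) monoid_scheme \<Rightarrow> ('g \<Rightarrow>\<^sub>0 'k::comm_ring_1) ring"
  where "monoid_ring M =
    \<lparr>carrier = {c. Poly_Mapping.keys c \<subseteq> carrier M},
     monoid.mult = (\<lambda>x y. \<Sum>g\<in>Poly_Mapping.keys x. \<Sum>h\<in>Poly_Mapping.keys y.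
        Poly_Mapping.single (g \<otimes>\<^bsub>M\<^esub> h) (Poly_Mapping.lookup x g * Poly_Mapping.lookup y h)),
     monoid.one = Poly_Mapping.single \<one>\<^bsub>M\<^esub> 1,
     ring.zero = 0,
     ring.add = (+)\<rparr>"

text \<open>The standard presentation: \<open>\<int>R\<close> is the integral monoid ring of the multiplicative monoid
  of \<open>R\<close>, the symbol \<open>[r]\<close> being \<^term>\<open>frag_of r\<close>.\<close>

abbreviation std_ring :: "('r, 'm) ring_scheme \<Rightarrow> ('r \<Rightarrow>\<^sub>0 int) ring"
  where "std_ring R \<equiv> monoid_ring R"

definition std_proj :: "('r, 'm) ring_scheme \<Rightarrow> ('r \<Rightarrow>\<^sub>0 int) \<Rightarrow> 'r"
  where "std_proj R c =
    (\<Oplus>\<^bsub>R\<^esub>r\<in>Poly_Mapping.keys c. add_pow R (Poly_Mapping.lookup c r) r)"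

abbreviation E_std :: "nat set \<Rightarrow> ('r, 'm) ring_scheme \<Rightarrow> (nat \<Rightarrow> 'r \<Rightarrow>\<^sub>0 int) set ring"
  where "E_std S R \<equiv> E_ring S (std_ring R) R (std_proj R)"

text \<open>The functoriality of \<open>E\<^sub>S\<close>, induced by \<open>[r] \<mapsto> [f r]\<close>.\<close>

definition E_map ::
  "nat set \<Rightarrow> ('s, 'm) ring_scheme \<Rightarrow> ('r \<Rightarrow> 's) \<Rightarrow>
    (nat \<Rightarrow> 'r \<Rightarrow>\<^sub>0 int) set \<Rightarrow> (nat \<Rightarrow> 's \<Rightarrow>\<^sub>0 int) set"
  where "E_map S R' f =
    coset_map (X_ring S (std_ring R'))
      (X_group S (std_ring R') (a_kernel (std_ring R') R' (std_proj R')))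
      (\<lambda>x. \<lambda>\<nu>\<in>S. frag_extend (frag_of \<circ> f) (x \<nu>))"

text \<open>The canonical identification \<open>E\<^sub>S(R) \<equiv> E\<^sub>S(R,\<pi>)\<close>: the isomorphism of topological rings
  under which the class of \<open>V\<^sub>n\<langle>[\<pi> a]\<rangle>\<close> corresponds to the class of \<open>V\<^sub>n\<langle>a\<rangle>\<close>.\<close>

definition E_canonical ::
  "nat set \<Rightarrow> ('a, 'm) ring_scheme \<Rightarrow> ('r, 'n) ring_scheme \<Rightarrow> ('a \<Rightarrow> 'r) \<Rightarrow>
    (nat \<Rightarrow> 'r \<Rightarrow>\<^sub>0 int) set \<Rightarrow> (nat \<Rightarrow> 'a) set"
  where "E_canonical S A R \<pi> = (THE \<kappa>.
    \<kappa> \<in> extensional (carrier (E_std S R)) \<and>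
    \<kappa> \<in> ring_iso (E_std S R) (E_ring S A R \<pi>) \<and>
    homeomorphic_map (E_top S (std_ring R) R (std_proj R)) (E_top S A R \<pi>) \<kappa> \<and>
    (\<forall>n\<in>S. \<forall>a\<in>carrier A.
      \<kappa> (E_class S (std_ring R) R (std_proj R) (Ver_pow S (std_ring R) n (frag_of (\<pi> a))))
        = E_class S A R \<pi> (Ver_pow S A n a)))"


section \<open>Topological differential graded rings\<close>

text \<open>The ring is the direct sum of its homogeneous components; each component carries its own
  topology, and closedness and continuity are understood degreewise.\<close>

record 'a dg_ring = "'a ring" +
  homog :: "nat \<Rightarrow> 'a set"
  dif :: "'a \<Rightarrow> 'a"
  htop :: "nat \<Rightarrow> 'a topology"

definition graded_subset :: "'a set \<Rightarrow> 'a dg_ring \<Rightarrow> bool"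
  where "graded_subset Y D \<longleftrightarrow> Y \<subseteq> generate (add_monoid D) (\<Union>q. Y \<inter> homog D q)"

definition dg_closed :: "'a set \<Rightarrow> 'a dg_ring \<Rightarrow> bool"
  where "dg_closed Y D \<longleftrightarrow> (\<forall>q. closedin (htop D q) (Y \<inter> homog D q))"

definition dg_subring :: "'a set \<Rightarrow> 'a dg_ring \<Rightarrow> bool"
  where "dg_subring Y D \<longleftrightarrow> subring Y D \<and> graded_subset Y D \<and> dif D ` Y \<subseteq> Y"

definition dg_ideal :: "'a set \<Rightarrow> 'a dg_ring \<Rightarrow> bool"
  where "dg_ideal J D \<longleftrightarrow> ideal J D \<and> graded_subset J D \<and> dif D ` J \<subseteq> J"

definition sub_dg_ring :: "'a dg_ring \<Rightarrow> 'a set \<Rightarrow> 'a dg_ring"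
  where "sub_dg_ring D Y =
    D\<lparr>carrier := Y,
      homog := (\<lambda>q. Y \<inter> homog D q),
      htop := (\<lambda>q. subtopology (htop D q) Y)\<rparr>"

definition quot_dg_ring :: "'a dg_ring \<Rightarrow> 'a set \<Rightarrow> 'a set dg_ring"
  where "quot_dg_ring D J = ring.extend (D Quot J)
    (dg_ring.fields
      (\<lambda>q. (\<lambda>x. J +>\<^bsub>D\<^esub> x) ` homog D q)
      (coset_map D J (dif D))
      (\<lambda>q. quot_topology (htop D q) (\<lambda>x. J +>\<^bsub>D\<^esub> x)))"

text \<open>A differential graded algebra over \<open>K\<close> is given by its structure map from \<open>K\<close>;
  homomorphisms of algebras are compatible with the structure maps \<open>u\<close> and \<open>v\<close>.\<close>

definition dga_hom ::
  "('k, 'm) ring_scheme \<Rightarrow> ('k \<Rightarrow> 'a) \<Rightarrow> ('k \<Rightarrow> 'b) \<Rightarrow> 'a dg_ring \<Rightarrow> 'b dg_ring \<Rightarrow> ('a \<Rightarrow> 'b) set"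
  where "dga_hom K u v D E =
    {\<phi> \<in> ring_hom D E.
      (\<forall>q. \<phi> ` homog D q \<subseteq> homog E q) \<and>
      (\<forall>x\<in>carrier D. \<phi> (dif D x) = dif E (\<phi> x)) \<and>
      (\<forall>k\<in>carrier K. \<phi> (u k) = v k)}"

definition dg_continuous :: "'a dg_ring \<Rightarrow> 'b dg_ring \<Rightarrow> ('a \<Rightarrow> 'b) \<Rightarrow> bool"
  where "dg_continuous D E \<phi> \<longleftrightarrow> (\<forall>q. continuous_map (htop D q) (htop E q) \<phi>)"

definition dg_homeomorphic :: "'a dg_ring \<Rightarrow> 'b dg_ring \<Rightarrow> ('a \<Rightarrow> 'b) \<Rightarrow> bool"
  where "dg_homeomorphic D E \<phi> \<longleftrightarrow>
    bij_betw \<phi> (carrier D) (carrier E) \<and> (\<forall>q. homeomorphic_map (htop D q) (htop E q) \<phi>)"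


section \<open>Relative differential forms with rational coefficients\<close>

text \<open>The \<open>\<rat>\<close>-algebra on symbols \<open>(a, [b\<^sub>1, \<dots>, b\<^sub>q])\<close>, standing for
  \<open>a db\<^sub>1 \<cdots> db\<^sub>q\<close>, with \<open>(a, bs)(a', bs') = (aa', bs @ bs')\<close>.\<close>

definition form_symbols :: "('a, 'm) ring_scheme \<Rightarrow> ('a \<times> 'a list) monoid"
  where "form_symbols A =
    A \<times>\<times> \<lparr>carrier = lists (carrier A), monoid.mult = (@), monoid.one = []\<rparr>"

abbreviation symbol_ring :: "('a, 'm) ring_scheme \<Rightarrow> ('a \<times> 'a list \<Rightarrow>\<^sub>0 rat) ring"
  where "symbol_ring A \<equiv> monoid_ring (form_symbols A)"

abbreviation form :: "'a \<Rightarrow> 'a list \<Rightarrow> 'a \<times> 'a list \<Rightarrow>\<^sub>0 rat"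
  where "form a bs \<equiv> Poly_Mapping.single (a, bs) 1"

text \<open>The exterior algebra over \<open>A\<close> of the Kaehler differentials of \<open>A\<close> over \<open>A\<^sub>0\<close>, tensored
  with \<open>\<rat>\<close>, is the quotient by the two-sided ideal generated by the relations below: additivity
  of \<open>a \<mapsto> a\<close> and of \<open>d\<close>, the Leibniz rule, vanishing of \<open>d\<close> on \<open>A\<^sub>0\<close>, and \<open>da da = 0\<close>.\<close>

definition form_relations ::
  "('b, 'm) ring_scheme \<Rightarrow> ('a, 'n) ring_scheme \<Rightarrow> ('b \<Rightarrow> 'a) \<Rightarrow> ('a \<times> 'a list \<Rightarrow>\<^sub>0 rat) set"
  where "form_relations A0 A \<iota> =
    {form (a \<oplus>\<^bsub>A\<^esub> b) [] - form a [] - form b [] | a b. a \<in> carrier A \<and> b \<in> carrier A} \<union>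
    {form \<one>\<^bsub>A\<^esub> [a \<oplus>\<^bsub>A\<^esub> b] - form \<one>\<^bsub>A\<^esub> [a] - form \<one>\<^bsub>A\<^esub> [b] | a b. a \<in> carrier A \<and> b \<in> carrier A} \<union>
    {form \<one>\<^bsub>A\<^esub> [a \<otimes>\<^bsub>A\<^esub> b] - form a [b] - form b [a] | a b. a \<in> carrier A \<and> b \<in> carrier A} \<union>
    {form \<one>\<^bsub>A\<^esub> [\<iota> r] | r. r \<in> carrier A0} \<union>
    {form \<one>\<^bsub>A\<^esub> [a, a] | a. a \<in> carrier A}"

definition form_ideal ::
  "('b, 'm) ring_scheme \<Rightarrow> ('a, 'n) ring_scheme \<Rightarrow> ('b \<Rightarrow> 'a) \<Rightarrow> ('a \<times> 'a list \<Rightarrow>\<^sub>0 rat) set"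
  where "form_ideal A0 A \<iota> = Idl\<^bsub>symbol_ring A\<^esub> (form_relations A0 A \<iota>)"

definition symbol_dif ::
  "('a, 'm) ring_scheme \<Rightarrow> ('a \<times> 'a list \<Rightarrow>\<^sub>0 rat) \<Rightarrow> 'a \<times> 'a list \<Rightarrow>\<^sub>0 rat"
  where "symbol_dif A c =
    (\<Sum>(a, bs)\<in>Poly_Mapping.keys c.
       Poly_Mapping.single (\<one>\<^bsub>A\<^esub>, a # bs) (Poly_Mapping.lookup c (a, bs)))"

definition form_class ::
  "('b, 'm) ring_scheme \<Rightarrow> ('a, 'n) ring_scheme \<Rightarrow> ('b \<Rightarrow> 'a) \<Rightarrow>
    ('a \<times> 'a list \<Rightarrow>\<^sub>0 rat) \<Rightarrow> ('a \<times> 'a list \<Rightarrow>\<^sub>0 rat) set"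
  where "form_class A0 A \<iota> c = form_ideal A0 A \<iota> +>\<^bsub>symbol_ring A\<^esub> c"

definition Omega_Q ::
  "('b, 'm) ring_scheme \<Rightarrow> ('a, 'n) ring_scheme \<Rightarrow> ('b \<Rightarrow> 'a) \<Rightarrow>
    ('a \<times> 'a list \<Rightarrow>\<^sub>0 rat) set dg_ring"
  where "Omega_Q A0 A \<iota> =
    (let deg = (\<lambda>q. form_class A0 A \<iota> `
           {c \<in> carrier (symbol_ring A). \<forall>(a, bs)\<in>Poly_Mapping.keys c. length bs = q})
     in ring.extend (symbol_ring A Quot form_ideal A0 A \<iota>)
       (dg_ring.fields
         deg
         (coset_map (symbol_ring A) (form_ideal A0 A \<iota>) (symbol_dif A))
         (\<lambda>q. discrete_topology (deg q))))"

text \<open>The product \<open>\<Omega>\<^sub>\<rat>\<^sup>S\<close> of differential graded rings is formed degree by degree. The factor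
  \<open>n\<^sup>-\<^sup>1\<close> in the differential is multiplication by the class of the scalar \<open>1/n\<close>.\<close>

definition Omega_pow ::
  "nat set \<Rightarrow> ('b, 'm) ring_scheme \<Rightarrow> ('a, 'n) ring_scheme \<Rightarrow> ('b \<Rightarrow> 'a) \<Rightarrow>
    (nat \<Rightarrow> ('a \<times> 'a list \<Rightarrow>\<^sub>0 rat) set) dg_ring"
  where "Omega_pow S A0 A \<iota> =
    (let \<Omega> = Omega_Q A0 A \<iota>;
         deg = (\<lambda>q. \<Pi>\<^sub>E n\<in>S. homog \<Omega> q);
         P = pow_ring S \<Omega>
     in ring.extend (P\<lparr>carrier := generate (add_monoid P) (\<Union>q. deg q)\<rparr>)
       (dg_ring.fields
         deg
         (\<lambda>x. \<lambda>n\<in>S. form_class A0 A \<iota> (Poly_Mapping.single (\<one>\<^bsub>A\<^esub>, []) (1 / of_nat n))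
                      \<otimes>\<^bsub>\<Omega>\<^esub> dif \<Omega> (x n))
         (\<lambda>q. product_topology (\<lambda>_. htop \<Omega> q) S)))"

text \<open>The map realising \<open>A\<^sup>S \<subseteq> \<Omega>\<^sub>\<rat>\<^sup>S\<close>; it is injective when \<open>A\<close> is a polynomial ring over a
  torsion-free ring.\<close>

definition Omega_emb ::
  "nat set \<Rightarrow> ('b, 'm) ring_scheme \<Rightarrow> ('a, 'n) ring_scheme \<Rightarrow> ('b \<Rightarrow> 'a) \<Rightarrow>
    (nat \<Rightarrow> 'a) \<Rightarrow> nat \<Rightarrow> ('a \<times> 'a list \<Rightarrow>\<^sub>0 rat) set"
  where "Omega_emb S A0 A \<iota> x = (\<lambda>n\<in>S. form_class A0 A \<iota> (form (x n) []))"


section \<open>Presentations of algebras and \<open>E\<^sub>S\<Omega>(\<pi>)\<close>\<close>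

text \<open>Evaluation at \<open>x \<mapsto> x\<close> of a polynomial over \<open>B\<close> in indeterminates from a subset of \<open>A\<close>;
  polynomials are coefficient functions on monomials, and monomials are multisets.\<close>

definition poly_eval ::
  "('a, 'n) ring_scheme \<Rightarrow> ('b, 'm) ring_scheme \<Rightarrow> ('b \<Rightarrow> 'a) \<Rightarrow> ('a multiset \<Rightarrow> 'b) \<Rightarrow> 'a"
  where "poly_eval A B \<iota> p =
    (\<Oplus>\<^bsub>A\<^esub>m\<in>{m. p m \<noteq> \<zero>\<^bsub>B\<^esub>}. \<iota> (p m) \<otimes>\<^bsub>A\<^esub> (\<Otimes>\<^bsub>A\<^esub>x\<in>set_mset m. x [^]\<^bsub>A\<^esub> count m x))"

definition polynomial_ring_over ::
  "('a, 'n) ring_scheme \<Rightarrow> ('b, 'm) ring_scheme \<Rightarrow> ('b \<Rightarrow> 'a) \<Rightarrow> bool"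
  where "polynomial_ring_over A B \<iota> \<longleftrightarrow>
    (\<exists>T\<subseteq>carrier A. bij_betw (poly_eval A B \<iota>) (ring.indexed_pset B T (carrier B)) (carrier A))"

record ('b, 'a, 's, 'r) algebra_presentation =
  base :: "'b ring"
  total :: "'a ring"
  incl :: "'b \<Rightarrow> 'a"
  proj0 :: "'b \<Rightarrow> 's"
  proj :: "'a \<Rightarrow> 'r"

definition presentation ::
  "'s ring \<Rightarrow> 'r ring \<Rightarrow> ('s \<Rightarrow> 'r) \<Rightarrow> ('b, 'a, 's, 'r) algebra_presentation \<Rightarrow> bool"
  where "presentation R0 R \<rho> P \<longleftrightarrow>
    cring (base P) \<and> cring (total P) \<and>
    proj0 P \<in> ring_hom (base P) R0 \<and> proj0 P ` carrier (base P) = carrier R0 \<and>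
    proj P \<in> ring_hom (total P) R \<and> proj P ` carrier (total P) = carrier R \<and>
    incl P \<in> ring_hom (base P) (total P) \<and> inj_on (incl P) (carrier (base P)) \<and>
    (\<forall>a\<in>carrier (base P). proj P (incl P a) = \<rho> (proj0 P a)) \<and>
    (\<forall>n>0. \<forall>a\<in>carrier (base P). add_pow (base P) (n::nat) a = \<zero>\<^bsub>base P\<^esub> \<longrightarrow> a = \<zero>\<^bsub>base P\<^esub>) \<and>
    polynomial_ring_over (total P) (base P) (incl P)"

definition free_presentation ::
  "'s ring \<Rightarrow> 'r ring \<Rightarrow> ('s \<Rightarrow> 'r) \<Rightarrow> ('b, 'a, 's, 'r) algebra_presentation \<Rightarrow> bool"
  where "free_presentation R0 R \<rho> P \<longleftrightarrow>
    presentation R0 R \<rho> P \<and>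
    polynomial_ring_over (base P) \<Z> (\<lambda>k. add_pow (base P) k \<one>\<^bsub>base P\<^esub>)"

abbreviation Omega_pow_of ::
  "nat set \<Rightarrow> ('b, 'a, 's, 'r) algebra_presentation \<Rightarrow>
    (nat \<Rightarrow> ('a \<times> 'a list \<Rightarrow>\<^sub>0 rat) set) dg_ring"
  where "Omega_pow_of S P \<equiv> Omega_pow S (base P) (total P) (incl P)"

abbreviation Omega_emb_of ::
  "nat set \<Rightarrow> ('b, 'a, 's, 'r) algebra_presentation \<Rightarrow>
    (nat \<Rightarrow> 'a) \<Rightarrow> nat \<Rightarrow> ('a \<times> 'a list \<Rightarrow>\<^sub>0 rat) set"
  where "Omega_emb_of S P \<equiv> Omega_emb S (base P) (total P) (incl P)"

definition X_dg ::
  "nat set \<Rightarrow> ('b, 'a, 's, 'r) algebra_presentation \<Rightarrow>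
    (nat \<Rightarrow> ('a \<times> 'a list \<Rightarrow>\<^sub>0 rat) set) dg_ring"
  where "X_dg S P = sub_dg_ring (Omega_pow_of S P)
    ((\<lambda>Y. dg_subring Y (Omega_pow_of S P) \<and> dg_closed Y (Omega_pow_of S P))
       hull (Omega_emb_of S P ` X_group S (total P) (carrier (total P))))"

definition X_dg_ideal ::
  "nat set \<Rightarrow> 'r ring \<Rightarrow> ('b, 'a, 's, 'r) algebra_presentation \<Rightarrow>
    (nat \<Rightarrow> ('a \<times> 'a list \<Rightarrow>\<^sub>0 rat) set) set"
  where "X_dg_ideal S R P =
    (\<lambda>J. dg_ideal J (X_dg S P) \<and> dg_closed J (X_dg S P))
      hull (Omega_emb_of S P ` X_group S (total P) (a_kernel (total P) R (proj P)))"

definition E_Omega ::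
  "nat set \<Rightarrow> 'r ring \<Rightarrow> ('b, 'a, 's, 'r) algebra_presentation \<Rightarrow>
    (nat \<Rightarrow> ('a \<times> 'a list \<Rightarrow>\<^sub>0 rat) set) set dg_ring"
  where "E_Omega S R P = quot_dg_ring (X_dg S P) (X_dg_ideal S R P)"

text \<open>The identification of \<open>E\<^sub>S(R) \<equiv> E\<^sub>S(R,\<pi>)\<close> with the degree zero part of \<open>E\<^sub>S\<Omega>(\<pi>)\<close>.\<close>

definition E_Omega_zero ::
  "nat set \<Rightarrow> 'r ring \<Rightarrow> ('b, 'a, 's, 'r) algebra_presentation \<Rightarrow>
    (nat \<Rightarrow> 'r \<Rightarrow>\<^sub>0 int) set \<Rightarrow> (nat \<Rightarrow> ('a \<times> 'a list \<Rightarrow>\<^sub>0 rat) set) set"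
  where "E_Omega_zero S R P y =
    coset_map (X_dg S P) (X_dg_ideal S R P) (Omega_emb_of S P)
      (E_canonical S (total P) R (proj P) y)"

text \<open>The structure map of \<open>E\<^sub>S\<Omega>(\<pi>)\<close> as an algebra over \<open>E\<^sub>S(R\<^sub>0) \<equiv> E\<^sub>S(R\<^sub>0,\<pi>\<^sub>0)\<close>, induced by
  \<open>A\<^sub>0 \<rightarrow> A\<close>.\<close>

definition E_Omega_structure ::
  "nat set \<Rightarrow> 's ring \<Rightarrow> 'r ring \<Rightarrow> ('b, 'a, 's, 'r) algebra_presentation \<Rightarrow>
    (nat \<Rightarrow> 's \<Rightarrow>\<^sub>0 int) set \<Rightarrow> (nat \<Rightarrow> ('a \<times> 'a list \<Rightarrow>\<^sub>0 rat) set) set"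
  where "E_Omega_structure S R0 R P y =
    coset_map (X_dg S P) (X_dg_ideal S R P)
      (\<lambda>x. Omega_emb_of S P (\<lambda>n\<in>S. incl P (x n)))
      (E_canonical S (base P) R0 (proj0 P) y)"

end

theory Submission imports Defs begin

text \<open>
  Existence in part a) comes from lifting and uniqueness from generation. As \<open>A\<^sub>0\<close> is a polynomial ring over
  \<open>\<int>\<close> and \<open>A\<close> is one over \<open>A\<^sub>0\<close>, the maps \<open>R\<^sub>0 \<rightarrow> R\<^sub>0'\<close> and \<open>R \<rightarrow> R'\<close> lift to a compatible pair
  \<open>A\<^sub>0 \<rightarrow> A\<^sub>0'\<close> and \<open>A \<rightarrow> A'\<close> (\<open>lift_exists\<close>, applied twice in \<open>free_map_exists\<close>). Relative differential forms
  are functorial, so the pair induces a continuous map \<open>\<Omega>\<^sub>\<rat>\<^sup>S \<rightarrow> \<Omega>'\<^sub>\<rat>\<^sup>S\<close> of differential graded rings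
  (\<open>hP_dg_map\<close>). It maps \<open>X\<^sub>S(A)\<close> to \<open>X\<^sub>S(A')\<close> and \<open>X\<^sub>S(I)\<close> to \<open>X\<^sub>S(I')\<close>, hence the closed differential
  graded subring and the closed differential graded ideal generated by them to those of the target, and a map of
  the quotients results. Conversely, two continuous maps out of \<open>E\<^sub>S\<Omega>\<^sup>\<bullet>(\<pi>)\<close> to a Hausdorff target agree on a
  closed differential graded subring; if they agree in degree zero, then it contains the generators
  (\<open>EO_map_unique\<close>). The target is Hausdorff because in each degree it is the quotient of a topological
  group by a closed subgroup (\<open>Hausdorff_quot\<close>). Part b) follows: maps in both directions exist, and their
  composites are identities by uniqueness.

  The identifications with \<open>E\<^sub>S(R)\<close> and \<open>E\<^sub>S(R\<^sub>0)\<close> in the statement take more work, because they rest on the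
  independence of \<open>E\<^sub>S(R,\<pi>)\<close> of the presentation \<open>\<pi>\<close>. This is a version of Witt's theorem: for an ideal \<open>I\<close>
  of a torsion-free ring the closed subgroup \<open>X\<^sub>S(I)\<close> consists of the convergent sums \<open>\<Sum> V\<^sub>n\<langle>a\<^sub>n\<rangle>\<close> with
  \<open>a\<^sub>n \<in> I\<close>, and the Witt components \<open>a\<^sub>n\<close> are unique (\<open>X_group_eq_witt\<close>, \<open>witt_inj\<close>). The proof views
  \<open>V\<^sub>n\<langle>a\<rangle>\<close> as the logarithmic derivative of \<open>1 / (1 - a t\<^sup>n)\<close>: sums of elements \<open>V\<^sub>n\<langle>a\<^sub>n\<rangle>\<close> correspond to
  power series in \<open>1 + t I[[t]]\<close>, which form a multiplicative group. In particular the class of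
  \<open>\<Sum> V\<^sub>n\<langle>a\<^sub>n\<rangle>\<close> modulo \<open>X\<^sub>S(I)\<close> depends only on the residue classes of the \<open>a\<^sub>n\<close> (\<open>witt_diff\<close>), and a
  surjective map between two rings that present \<open>R\<close> induces an isomorphism of topological rings
  (\<open>E_push_iso\<close>, \<open>E_push_homeomorphic\<close>). Through \<open>\<int>A\<close>, which maps onto \<open>A\<close> and onto \<open>\<int>R\<close>, this yields
  the canonical isomorphism \<open>E\<^sub>S(R) \<equiv> E\<^sub>S(R,\<pi>)\<close>. On Witt components it replaces symbols \<open>[\<pi> a]\<close> by \<open>a\<close>
  (\<open>E_canonical_witt\<close>), and this formula is all that the comparison in degree zero and over \<open>E\<^sub>S(R\<^sub>0)\<close> needs.

  Differential forms are given by generators and relations, so the grading and the differential of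
  \<open>\<Omega>\<^sub>\<rat>\<close> have to be shown to descend. The relations are homogeneous; that the differential preserves the
  ideal generated by them is a computation with the Leibniz rule and anticommutativity (\<open>FI_dif_gen\<close>).
\<close>

section \<open>Maps on cosets and quotient topologies\<close>

text \<open>Differentials, projections to homogeneous components and the inclusion of \<open>A\<^sup>S\<close> into the
  differential forms enter only through their additivity, so maps on cosets are studied for
  additive maps.\<close>

definition add_map :: "('a, 'm) ring_scheme \<Rightarrow> ('b, 'n) ring_scheme \<Rightarrow> ('a \<Rightarrow> 'b) set"
  where "add_map D E = {f \<in> carrier D \<rightarrow> carrier E.
    \<forall>x\<in>carrier D. \<forall>y\<in>carrier D. f (x \<oplus>\<^bsub>D\<^esub> y) = f x \<oplus>\<^bsub>E\<^esub> f y}"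

lemma ring_hom_add_map: "f \<in> ring_hom D E \<Longrightarrow> f \<in> add_map D E"
  by (auto simp: add_map_def ring_hom_def)

lemma add_map_closed: "f \<in> add_map D E \<Longrightarrow> x \<in> carrier D \<Longrightarrow> f x \<in> carrier E"
  by (auto simp: add_map_def)

lemma add_map_add:
  "f \<in> add_map D E \<Longrightarrow> x \<in> carrier D \<Longrightarrow> y \<in> carrier D \<Longrightarrow> f (x \<oplus>\<^bsub>D\<^esub> y) = f x \<oplus>\<^bsub>E\<^esub> f y"
  by (auto simp: add_map_def)

lemma add_map_group_hom:
  assumes "f \<in> add_map D E" "ring D" "ring E"
  shows "abelian_group_hom D E f"
  using assms by (intro abelian_group_homI ring.is_abelian_group group_hom.intro group_hom_axioms.intro
      abelian_group.a_group) (auto simp: add_map_def hom_def)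

lemma add_map_zero:
  assumes "f \<in> add_map D E" "ring D" "ring E"
  shows "f \<zero>\<^bsub>D\<^esub> = \<zero>\<^bsub>E\<^esub>"
  using abelian_group_hom.hom_zero[OF add_map_group_hom[OF assms]] .

lemma add_map_minus:
  assumes "f \<in> add_map D E" "ring D" "ring E" "x \<in> carrier D" "y \<in> carrier D"
  shows "f (x \<ominus>\<^bsub>D\<^esub> y) = f x \<ominus>\<^bsub>E\<^esub> f y"
proof -
  interpret abelian_group_hom D E f by (rule add_map_group_hom[OF assms(1-3)])
  show ?thesis using assms(4,5) by (simp add: a_minus_def)
qed

lemma coset_eq_iff:
  assumes "ideal J D" "x \<in> carrier D" "y \<in> carrier D"
  shows "J +>\<^bsub>D\<^esub> x = J +>\<^bsub>D\<^esub> y \<longleftrightarrow> x \<ominus>\<^bsub>D\<^esub> y \<in> J"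
  using ring.quotient_eq_iff_same_a_r_cos[OF ideal.axioms(2)[OF assms(1)] assms] by simp

lemma coset_mem_iff:
  assumes "ideal J D" "x \<in> carrier D" "y \<in> carrier D"
  shows "y \<in> J +>\<^bsub>D\<^esub> x \<longleftrightarrow> y \<ominus>\<^bsub>D\<^esub> x \<in> J"
proof -
  interpret ideal J D by fact
  show ?thesis using a_rcos_module_minus[OF ideal.axioms(2)[OF assms(1)] assms(2,3)] .
qed

lemma coset_subset:
  assumes "ideal J D" "x \<in> carrier D"
  shows "J +>\<^bsub>D\<^esub> x \<subseteq> carrier D"
proof -
  interpret ideal J D by fact
  show ?thesis by (rule a_r_coset_subset_G[OF a_subset assms(2)])
qed

text \<open>Since \<open>f\<close> maps \<open>I\<close> into \<open>J\<close>, all elements of a coset of \<open>I\<close> have images in one coset of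
  \<open>J\<close>; the image that \<^const>\<open>coset_map\<close> takes the element of is therefore a singleton.\<close>

lemma coset_map_coset:
  assumes I: "ideal I D" and J: "ideal J E" and f: "f \<in> add_map D E" and IJ: "f ` I \<subseteq> J"
    and x: "x \<in> carrier D"
  shows "coset_map E J f (I +>\<^bsub>D\<^esub> x) = J +>\<^bsub>E\<^esub> f x"
proof -
  interpret I: ideal I D by fact
  interpret J: ideal J E by fact
  have "J +>\<^bsub>E\<^esub> f y = J +>\<^bsub>E\<^esub> f x" if y: "y \<in> I +>\<^bsub>D\<^esub> x" for y
  proof -
    have yc: "y \<in> carrier D" using y coset_subset[OF I x] by blast
    have "y \<ominus>\<^bsub>D\<^esub> x \<in> I" using y coset_mem_iff[OF I x yc] by blast
    then have "f (y \<ominus>\<^bsub>D\<^esub> x) \<in> J" using IJ by blast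
    then have "f y \<ominus>\<^bsub>E\<^esub> f x \<in> J"
      using add_map_minus[OF f ideal.axioms(2)[OF I] ideal.axioms(2)[OF J] yc x] by simp
    then show ?thesis
      using coset_eq_iff[OF J] add_map_closed[OF f] x yc by blast
  qed
  moreover have "x \<in> I +>\<^bsub>D\<^esub> x" by (rule I.a_rcos_self[OF x])
  ultimately have "(\<lambda>y. J +>\<^bsub>E\<^esub> f y) ` (I +>\<^bsub>D\<^esub> x) = {J +>\<^bsub>E\<^esub> f x}" by blast
  then show ?thesis unfolding coset_map_def by simp
qed

lemma carrier_Quot: "carrier (D Quot I) = (\<lambda>x. I +>\<^bsub>D\<^esub> x) ` carrier D"
  by (auto simp: FactRing_def A_RCOSETS_def' a_r_coset_def')

lemma Quot_simps:
  assumes "ideal I D" "x \<in> carrier D" "y \<in> carrier D"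
  shows "(I +>\<^bsub>D\<^esub> x) \<oplus>\<^bsub>D Quot I\<^esub> (I +>\<^bsub>D\<^esub> y) = I +>\<^bsub>D\<^esub> (x \<oplus>\<^bsub>D\<^esub> y)"
    and "(I +>\<^bsub>D\<^esub> x) \<otimes>\<^bsub>D Quot I\<^esub> (I +>\<^bsub>D\<^esub> y) = I +>\<^bsub>D\<^esub> (x \<otimes>\<^bsub>D\<^esub> y)"
  using ring_hom_add[OF ideal.rcos_ring_hom[OF assms(1)] assms(2,3)]
    ring_hom_mult[OF ideal.rcos_ring_hom[OF assms(1)] assms(2,3)] by auto

lemma Quot_one: "ideal I D \<Longrightarrow> \<one>\<^bsub>D Quot I\<^esub> = I +>\<^bsub>D\<^esub> \<one>\<^bsub>D\<^esub>"
  by (simp add: FactRing_def)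

lemma coset_map_ring_hom:
  assumes I: "ideal I D" and J: "ideal J E" and f: "f \<in> ring_hom D E" and IJ: "f ` I \<subseteq> J"
  shows "coset_map E J f \<in> ring_hom (D Quot I) (E Quot J)"
proof -
  have cm: "coset_map E J f (I +>\<^bsub>D\<^esub> x) = J +>\<^bsub>E\<^esub> f x" if "x \<in> carrier D" for x
    using coset_map_coset[OF I J ring_hom_add_map[OF f] IJ that] .
  have fc: "f x \<in> carrier E" if "x \<in> carrier D" for x
    using ring_hom_closed[OF f that] .
  have cl: "x \<oplus>\<^bsub>D\<^esub> y \<in> carrier D" "x \<otimes>\<^bsub>D\<^esub> y \<in> carrier D" "\<one>\<^bsub>D\<^esub> \<in> carrier D"
    if "x \<in> carrier D" "y \<in> carrier D" for x y
    using ideal.axioms(2)[OF I] that ring.ring_simprules(1,5,6) by metis+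
  show ?thesis
  proof (intro ring_hom_memI)
    fix v assume "v \<in> carrier (D Quot I)"
    then show "coset_map E J f v \<in> carrier (E Quot J)"
      by (auto simp: carrier_Quot cm fc)
  next
    fix v w assume "v \<in> carrier (D Quot I)" "w \<in> carrier (D Quot I)"
    then show "coset_map E J f (v \<otimes>\<^bsub>D Quot I\<^esub> w) = coset_map E J f v \<otimes>\<^bsub>E Quot J\<^esub> coset_map E J f w"
      by (auto simp: carrier_Quot Quot_simps[OF I] Quot_simps[OF J] cm cl fc ring_hom_mult[OF f])
  next
    fix v w assume "v \<in> carrier (D Quot I)" "w \<in> carrier (D Quot I)"
    then show "coset_map E J f (v \<oplus>\<^bsub>D Quot I\<^esub> w) = coset_map E J f v \<oplus>\<^bsub>E Quot J\<^esub> coset_map E J f w"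
      by (auto simp: carrier_Quot Quot_simps[OF I] Quot_simps[OF J] cm cl fc ring_hom_add[OF f])
  next
    have "\<one>\<^bsub>D\<^esub> \<in> carrier D" using ring.ring_simprules(6)[OF ideal.axioms(2)[OF I]] .
    then show "coset_map E J f \<one>\<^bsub>D Quot I\<^esub> = \<one>\<^bsub>E Quot J\<^esub>"
      by (simp add: Quot_one[OF I] Quot_one[OF J] cm ring_hom_one[OF f])
  qed
qed

lemma openin_quot_topology:
  "openin (quot_topology T p) U \<longleftrightarrow> U \<subseteq> p ` topspace T \<and> openin T {x \<in> topspace T. p x \<in> U}"
proof -
  let ?P = "\<lambda>U. U \<subseteq> p ` topspace T \<and> openin T {x \<in> topspace T. p x \<in> U}"
  have "istopology ?P"
    unfolding istopology_def
  proof (intro conjI allI impI)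
    fix U V assume U: "?P U" and V: "?P V"
    have "{x \<in> topspace T. p x \<in> U \<inter> V} = {x \<in> topspace T. p x \<in> U} \<inter> {x \<in> topspace T. p x \<in> V}"
      by blast
    then show "openin T {x \<in> topspace T. p x \<in> U \<inter> V}" using U V by auto
    show "U \<inter> V \<subseteq> p ` topspace T" using U by blast
  next
    fix K assume K: "\<forall>U\<in>K. ?P U"
    have "{x \<in> topspace T. p x \<in> \<Union>K} = \<Union>((\<lambda>U. {x \<in> topspace T. p x \<in> U}) ` K)" by blast
    then show "openin T {x \<in> topspace T. p x \<in> \<Union>K}" using K by auto
    show "\<Union>K \<subseteq> p ` topspace T" using K by blast
  qed
  then show ?thesis unfolding quot_topology_def by simp
qed

lemma topspace_quot_topology: "topspace (quot_topology T p) = p ` topspace T"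
proof -
  have "{x \<in> topspace T. p x \<in> p ` topspace T} = topspace T" by blast
  then have "openin (quot_topology T p) (p ` topspace T)"
    by (simp add: openin_quot_topology)
  then show ?thesis
    by (metis openin_quot_topology openin_subset openin_topspace subset_antisym)
qed

lemma continuous_map_from_quot:
  assumes h: "continuous_map T Z h" and gh: "\<And>x. x \<in> topspace T \<Longrightarrow> g (p x) = h x"
  shows "continuous_map (quot_topology T p) Z g"
proof -
  have "openin (quot_topology T p) {x \<in> p ` topspace T. g x \<in> U}" if "openin Z U" for U
  proof -
    have "{x \<in> topspace T. p x \<in> {x \<in> p ` topspace T. g x \<in> U}} = {x \<in> topspace T. h x \<in> U}"
      using gh by (auto 0 0) (metis gh)+
    then show ?thesis using h that by (auto simp: openin_quot_topology continuous_map)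
  qed
  moreover have "g ` p ` topspace T \<subseteq> topspace Z"
    using h gh by (auto simp: continuous_map image_subset_iff)
  ultimately show ?thesis by (auto simp: continuous_map topspace_quot_topology)
qed

lemma continuous_map_quot_proj: "continuous_map T (quot_topology T p) p"
  by (auto simp: continuous_map topspace_quot_topology openin_quot_topology)

text \<open>The basic neighbourhoods in a power of a discrete space prescribe finitely many
  coordinates. This turns the topological questions below into statements on agreement on
  finite subsets of \<open>S\<close>.\<close>

lemma openin_subpower:
  "openin (subtopology (product_topology (\<lambda>_. discrete_topology C) S) Y) U \<longleftrightarrow>
    U \<subseteq> Y \<inter> (\<Pi>\<^sub>E n\<in>S. C) \<and>
    (\<forall>x\<in>U. \<exists>F. finite F \<and> F \<subseteq> S \<and> (\<forall>y\<in>Y \<inter> (\<Pi>\<^sub>E n\<in>S. C). (\<forall>n\<in>F. y n = x n) \<longrightarrow> y \<in> U))"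
    (is "?l \<longleftrightarrow> ?r")
proof
  let ?P = "product_topology (\<lambda>_. discrete_topology C) S"
  have tp: "topspace ?P = (\<Pi>\<^sub>E n\<in>S. C)" by simp
  assume ?l
  then obtain V where V: "openin ?P V" "U = V \<inter> Y" by (auto simp: openin_subtopology)
  have "V \<subseteq> (\<Pi>\<^sub>E n\<in>S. C)" using openin_subset[OF V(1)] tp by simp
  moreover have "\<exists>F. finite F \<and> F \<subseteq> S \<and> (\<forall>y\<in>Y \<inter> (\<Pi>\<^sub>E n\<in>S. C). (\<forall>n\<in>F. y n = x n) \<longrightarrow> y \<in> U)"
    if x: "x \<in> U" for x
  proof -
    from x V obtain W where W: "finite {i \<in> S. W i \<noteq> C}" "x \<in> Pi\<^sub>E S W" "Pi\<^sub>E S W \<subseteq> V"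
      unfolding openin_product_topology_alt by auto
    show ?thesis
    proof (intro exI conjI ballI impI)
      show "finite {i \<in> S. W i \<noteq> C}" by fact
      fix y assume y: "y \<in> Y \<inter> (\<Pi>\<^sub>E n\<in>S. C)" "\<forall>n\<in>{i \<in> S. W i \<noteq> C}. y n = x n"
      have "y \<in> Pi\<^sub>E S W"
      proof (rule PiE_I)
        fix n assume n: "n \<in> S"
        show "y n \<in> W n"
        proof (cases "W n = C")
          case True then show ?thesis using y(1) n by auto
        next
          case False
          then have "y n = x n" using y(2) n by blast
          then show ?thesis using W(2) n by auto
        qed
      next
        fix n assume "n \<notin> S" then show "y n = undefined" using y(1) by auto
      qed
      then show "y \<in> U" using W V y by blast
    qed auto
  qed
  ultimately show ?r using V(2) by (intro conjI ballI) auto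
next
  let ?P = "product_topology (\<lambda>_. discrete_topology C) S"
  assume r: ?r
  define B where "B F x = {y \<in> (\<Pi>\<^sub>E n\<in>S. C). \<forall>n\<in>F. y n = x n}" for F and x :: "'a \<Rightarrow> 'b"
  have B: "openin ?P (B F x)" if F: "finite F" "F \<subseteq> S" and x: "x \<in> (\<Pi>\<^sub>E n\<in>S. C)" for F x
  proof -
    define W where "W n = (if n \<in> F then {x n} else C)" for n
    have "B F x = Pi\<^sub>E S W"
    proof (intro equalityI subsetI)
      fix y assume "y \<in> B F x"
      then show "y \<in> Pi\<^sub>E S W" by (simp add: B_def W_def PiE_iff)
    next
      fix y assume y: "y \<in> Pi\<^sub>E S W"
      have "y n \<in> C" if "n \<in> S" for n
        using that y x by (cases "n \<in> F") (auto simp: W_def PiE_iff)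
      moreover have "y n = x n" if "n \<in> F" for n
      proof -
        have "y n \<in> W n" using y F(2) that by auto
        then show ?thesis using that by (simp add: W_def)
      qed
      ultimately show "y \<in> B F x" using y by (auto simp: B_def PiE_iff)
    qed
    moreover have "openin ?P (Pi\<^sub>E S W)"
      unfolding openin_PiE_gen
    proof (intro disjI2 conjI)
      show "finite {i \<in> S. W i \<noteq> topspace (discrete_topology C)}"
        by (rule finite_subset[OF _ F(1)]) (auto simp: W_def)
      show "\<forall>i\<in>S. openin (discrete_topology C) (W i)"
        using x by (auto simp: W_def PiE_iff)
    qed
    ultimately show ?thesis by simp
  qed
  from r obtain F where F: "\<And>x. x \<in> U \<Longrightarrow> finite (F x) \<and> F x \<subseteq> S \<and>
      (\<forall>y\<in>Y \<inter> (\<Pi>\<^sub>E n\<in>S. C). (\<forall>n\<in>F x. y n = x n) \<longrightarrow> y \<in> U)" by metis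
  have "openin ?P (\<Union>x\<in>U. B (F x) x)" using F r B by (intro openin_Union) auto
  moreover have "U = (\<Union>x\<in>U. B (F x) x) \<inter> Y"
  proof (intro equalityI subsetI)
    fix y assume "y \<in> U" then show "y \<in> (\<Union>x\<in>U. B (F x) x) \<inter> Y"
      using r by (auto simp: B_def)
  next
    fix y assume "y \<in> (\<Union>x\<in>U. B (F x) x) \<inter> Y"
    then obtain x where x: "x \<in> U" "y \<in> B (F x) x" "y \<in> Y" by blast
    show "y \<in> U" using conjunct2[OF conjunct2[OF F[OF x(1)]]] x(2,3) by (auto simp: B_def)
  qed
  ultimately show ?l by (metis openin_subtopology)
qed

lemma closedin_subpower:
  "closedin (subtopology (product_topology (\<lambda>_. discrete_topology C) S) Y) H \<longleftrightarrow>
    H \<subseteq> Y \<inter> (\<Pi>\<^sub>E n\<in>S. C) \<and>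
    (\<forall>x\<in>Y \<inter> (\<Pi>\<^sub>E n\<in>S. C). (\<forall>F. finite F \<longrightarrow> F \<subseteq> S \<longrightarrow> (\<exists>y\<in>H. \<forall>n\<in>F. y n = x n)) \<longrightarrow> x \<in> H)"
    (is "?l \<longleftrightarrow> ?r")
proof -
  let ?T = "subtopology (product_topology (\<lambda>_. discrete_topology C) S) Y"
  have tp: "topspace ?T = Y \<inter> (\<Pi>\<^sub>E n\<in>S. C)" by auto
  have "?l \<longleftrightarrow> H \<subseteq> Y \<inter> (\<Pi>\<^sub>E n\<in>S. C) \<and> openin ?T (Y \<inter> (\<Pi>\<^sub>E n\<in>S. C) - H)"
    unfolding closedin_def tp ..
  also have "\<dots> \<longleftrightarrow> ?r"
    unfolding openin_subpower
  proof (intro conj_cong refl iffI conjI ballI impI)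
    fix x assume H: "H \<subseteq> Y \<inter> (\<Pi>\<^sub>E n\<in>S. C)"
      and o: "Y \<inter> (S \<rightarrow>\<^sub>E C) - H \<subseteq> Y \<inter> (S \<rightarrow>\<^sub>E C) \<and>
         (\<forall>x\<in>Y \<inter> (S \<rightarrow>\<^sub>E C) - H. \<exists>F. finite F \<and> F \<subseteq> S \<and>
           (\<forall>y\<in>Y \<inter> (S \<rightarrow>\<^sub>E C). (\<forall>n\<in>F. y n = x n) \<longrightarrow> y \<in> Y \<inter> (S \<rightarrow>\<^sub>E C) - H))"
      and x: "x \<in> Y \<inter> (S \<rightarrow>\<^sub>E C)"
      and a: "\<forall>F. finite F \<longrightarrow> F \<subseteq> S \<longrightarrow> (\<exists>y\<in>H. \<forall>n\<in>F. y n = x n)"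
    show "x \<in> H"
    proof (rule ccontr)
      assume "x \<notin> H"
      then obtain F where F: "finite F" "F \<subseteq> S"
        "\<And>y. y\<in>Y \<inter> (S \<rightarrow>\<^sub>E C) \<Longrightarrow> \<forall>n\<in>F. y n = x n \<Longrightarrow> y \<notin> H"
        using conjunct2[OF o] x by (metis DiffE DiffI)
      then obtain y where "y \<in> H" "\<forall>n\<in>F. y n = x n" using a by blast
      then show False using F(3) H by blast
    qed
  next
    fix x assume H: "H \<subseteq> Y \<inter> (\<Pi>\<^sub>E n\<in>S. C)"
      and o: "\<forall>x\<in>Y \<inter> (S \<rightarrow>\<^sub>E C). (\<forall>F. finite F \<longrightarrow> F \<subseteq> S \<longrightarrow> (\<exists>y\<in>H. \<forall>n\<in>F. y n = x n)) \<longrightarrow> x \<in> H"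
      and x: "x \<in> Y \<inter> (S \<rightarrow>\<^sub>E C) - H"
    then obtain F where F: "finite F" "F \<subseteq> S" "\<not> (\<exists>y\<in>H. \<forall>n\<in>F. y n = x n)" by (metis DiffE)
    then show "\<exists>F. finite F \<and> F \<subseteq> S \<and>
        (\<forall>y\<in>Y \<inter> (S \<rightarrow>\<^sub>E C). (\<forall>n\<in>F. y n = x n) \<longrightarrow> y \<in> Y \<inter> (S \<rightarrow>\<^sub>E C) - H)"
      by (intro exI[of _ F]) auto
  qed auto
  finally show ?thesis .
qed

text \<open>To prescribe the image on a finite set of coordinates it is enough to prescribe the
  argument on the same coordinates.\<close>

lemma continuous_subpower:
  assumes "\<And>x. x \<in> Y \<inter> (\<Pi>\<^sub>E n\<in>S. C) \<Longrightarrow> (\<lambda>n\<in>S. g n (x n)) \<in> Y' \<inter> (\<Pi>\<^sub>E n\<in>S. C')"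
  shows "continuous_map (subtopology (product_topology (\<lambda>_. discrete_topology C) S) Y)
    (subtopology (product_topology (\<lambda>_. discrete_topology C') S) Y') (\<lambda>x. \<lambda>n\<in>S. g n (x n))"
proof -
  have *: "openin (subtopology (product_topology (\<lambda>_. discrete_topology C) S) Y)
      {x \<in> Y \<inter> (\<Pi>\<^sub>E n\<in>S. C). (\<lambda>n\<in>S. g n (x n)) \<in> U}"
    if U: "openin (subtopology (product_topology (\<lambda>_. discrete_topology C') S) Y') U" for U
    unfolding openin_subpower
  proof (intro conjI ballI)
    fix x assume x: "x \<in> {x \<in> Y \<inter> (\<Pi>\<^sub>E n\<in>S. C). (\<lambda>n\<in>S. g n (x n)) \<in> U}"
    then have gx: "(\<lambda>n\<in>S. g n (x n)) \<in> U" by simp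
    obtain F where F0: "finite F \<and> F \<subseteq> S \<and>
        (\<forall>y\<in>Y' \<inter> (\<Pi>\<^sub>E n\<in>S. C'). (\<forall>n\<in>F. y n = (\<lambda>n\<in>S. g n (x n)) n) \<longrightarrow> y \<in> U)"
      using bspec[OF conjunct2[OF U[unfolded openin_subpower]] gx] by (elim exE) (rule that)
    then have F: "finite F" "F \<subseteq> S"
      and FU: "\<And>y. y\<in>Y' \<inter> (\<Pi>\<^sub>E n\<in>S. C') \<Longrightarrow> (\<forall>n\<in>F. y n = (\<lambda>n\<in>S. g n (x n)) n) \<Longrightarrow> y \<in> U"
      by simp_all
    show "\<exists>F. finite F \<and> F \<subseteq> S \<and>
            (\<forall>y\<in>Y \<inter> (S \<rightarrow>\<^sub>E C). (\<forall>n\<in>F. y n = x n) \<longrightarrow>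
               y \<in> {x \<in> Y \<inter> (S \<rightarrow>\<^sub>E C). (\<lambda>n\<in>S. g n (x n)) \<in> U})"
    proof (intro exI conjI ballI impI)
      fix y assume y: "y \<in> Y \<inter> (\<Pi>\<^sub>E n\<in>S. C)" "\<forall>n\<in>F. y n = x n"
      have "(\<lambda>n\<in>S. g n (y n)) \<in> U"
        by (rule FU[OF assms[OF y(1)]]) (use y F in auto)
      then show "y \<in> {x \<in> Y \<inter> (S \<rightarrow>\<^sub>E C). (\<lambda>n\<in>S. g n (x n)) \<in> U}" using y by blast
    qed (use F in auto)
  qed auto
  have t: "topspace (subtopology (product_topology (\<lambda>_. discrete_topology C) S) Y) = Y \<inter> (\<Pi>\<^sub>E n\<in>S. C)"
     "topspace (subtopology (product_topology (\<lambda>_. discrete_topology C') S) Y') = Y' \<inter> (\<Pi>\<^sub>E n\<in>S. C')"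
    by auto
  show ?thesis
    unfolding continuous_map t
  proof (intro conjI allI impI)
    show "(\<lambda>x. \<lambda>n\<in>S. g n (x n)) ` (Y \<inter> (S \<rightarrow>\<^sub>E C)) \<subseteq> Y' \<inter> (S \<rightarrow>\<^sub>E C')"
      using assms by blast
  qed (rule *)
qed

section \<open>Rings of sequences with componentwise addition\<close>

text \<open>The carrier may be any subset of the product: among the instances are \<open>X\<^sub>S(A)\<close> and the
  differential graded ring generated by it.\<close>

locale pointwise =
  fixes D :: "(nat \<Rightarrow> 'a, 'm) ring_scheme" and S :: "nat set" and A :: "('a, 'n) ring_scheme"
  assumes ring_D: "ring D" and ring_A: "ring A"
    and car: "carrier D \<subseteq> (\<Pi>\<^sub>E n\<in>S. carrier A)"
    and add_at: "\<And>x y. x \<in> carrier D \<Longrightarrow> y \<in> carrier D \<Longrightarrow> x \<oplus>\<^bsub>D\<^esub> y = (\<lambda>n\<in>S. x n \<oplus>\<^bsub>A\<^esub> y n)"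
begin

interpretation D: ring D by (rule ring_D)
interpretation A: ring A by (rule ring_A)

lemma closed_at: "x \<in> carrier D \<Longrightarrow> n \<in> S \<Longrightarrow> x n \<in> carrier A"
  using car by auto

lemma minus_at:
  assumes x: "x \<in> carrier D" and y: "y \<in> carrier D"
  shows "x \<ominus>\<^bsub>D\<^esub> y = (\<lambda>n\<in>S. x n \<ominus>\<^bsub>A\<^esub> y n)"
proof -
  let ?z = "x \<ominus>\<^bsub>D\<^esub> y"
  have z: "?z \<in> carrier D" using x y by simp
  have "?z \<oplus>\<^bsub>D\<^esub> y = x" using x y
    by (simp add: a_minus_def D.a_assoc D.l_neg)
  then have e: "(\<lambda>n\<in>S. ?z n \<oplus>\<^bsub>A\<^esub> y n) = x" using add_at[OF z y] by simp
  have "?z n = x n \<ominus>\<^bsub>A\<^esub> y n" if n: "n \<in> S" for n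
  proof -
    have "x n = ?z n \<oplus>\<^bsub>A\<^esub> y n" using fun_cong[OF e, of n] n by simp
    then show ?thesis using closed_at[OF z n] closed_at[OF y n]
      by (simp add: a_minus_def A.a_assoc A.r_neg)
  qed
  moreover have "?z \<in> extensional S" using z car by (auto simp: PiE_def)
  ultimately show ?thesis by (intro extensionalityI) auto
qed

text \<open>If the cosets of \<open>x\<close> and \<open>y\<close> differ, then \<open>x - y\<close> lies outside of the closed set \<open>J \<inter> G\<close>,
  and finitely many coordinates \<open>F\<close> testify to it. The neighbourhoods of \<open>x\<close> and \<open>y\<close> given by
  \<open>F\<close> then have disjoint images, and these images are open because translation by an element of
  \<open>J \<inter> G\<close> is a homeomorphism of \<open>G\<close>. The set \<open>G\<close> stands for one homogeneous component, whereas
  \<open>J\<close> is an ideal of the whole ring.\<close>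

lemma Hausdorff_quot:
  assumes J: "ideal J D" and G: "G \<subseteq> carrier D" "G \<subseteq> (\<Pi>\<^sub>E n\<in>S. C)"
    and Gm: "\<And>x y. x \<in> G \<Longrightarrow> y \<in> G \<Longrightarrow> x \<ominus>\<^bsub>D\<^esub> y \<in> G"
    and T: "T = subtopology (product_topology (\<lambda>_. discrete_topology C) S) G"
    and cl: "closedin T (J \<inter> G)"
  shows "Hausdorff_space (quot_topology T (\<lambda>x. J +>\<^bsub>D\<^esub> x))"
proof -
  have tT: "topspace T = G" using G(2) T by auto
  let ?p = "\<lambda>x. J +>\<^bsub>D\<^esub> x"
  define U where "U F x = ?p ` {x' \<in> G. \<forall>n\<in>F. x' n = x n}" for F x
  have GI: "G \<inter> (\<Pi>\<^sub>E n\<in>S. C) = G" using G(2) by blast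
  have U: "openin (quot_topology T ?p) (U F x)" if F: "finite F" "F \<subseteq> S" and x: "x \<in> G" for F x
    unfolding openin_quot_topology tT
  proof
    show "U F x \<subseteq> ?p ` G" by (auto simp: U_def)
    show "openin T {u \<in> G. ?p u \<in> U F x}"
      unfolding T openin_subpower GI
    proof (intro conjI ballI)
      fix u assume "u \<in> {u \<in> G. ?p u \<in> U F x}"
      then obtain x' where u: "u \<in> G" and x': "x' \<in> G" "\<forall>n\<in>F. x' n = x n" "?p u = ?p x'"
        by (auto simp: U_def)
      have ux: "u \<ominus>\<^bsub>D\<^esub> x' \<in> J" using coset_eq_iff[OF J] u x' G(1) by blast
      have "v \<in> {u \<in> G. ?p u \<in> U F x}" if v: "v \<in> G" "\<forall>n\<in>F. v n = u n" for v
      proof -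
        let ?w = "v \<ominus>\<^bsub>D\<^esub> (u \<ominus>\<^bsub>D\<^esub> x')"
        have uxG: "u \<ominus>\<^bsub>D\<^esub> x' \<in> G" using Gm u x' by blast
        have w: "?w \<in> G" using Gm v uxG by blast
        have c: "u \<in> carrier D" "x' \<in> carrier D" "v \<in> carrier D" using u x' v G by auto
        have "?w n = x n" if "n \<in> F" for n
        proof -
          have n: "n \<in> S" using that F by blast
          have "?w n = u n \<ominus>\<^bsub>A\<^esub> (u n \<ominus>\<^bsub>A\<^esub> x' n)"
            using fun_cong[OF minus_at[of v "u \<ominus>\<^bsub>D\<^esub> x'"], of n] fun_cong[OF minus_at[of u x'], of n]
              c v(2) that n uxG G(1) by (simp add: subset_iff)
          also have "\<dots> = x' n" using closed_at[OF c(1) n] closed_at[OF c(2) n]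
            by (simp add: a_minus_def A.minus_add A.minus_minus A.r_neg2)
          finally show ?thesis using x'(2) that by simp
        qed
        moreover have "?p v = ?p ?w"
        proof -
          have "v \<ominus>\<^bsub>D\<^esub> ?w = u \<ominus>\<^bsub>D\<^esub> x'" using c
            by (simp add: a_minus_def D.minus_add D.minus_minus D.r_neg2)
          then show ?thesis using coset_eq_iff[OF J c(3), of ?w] w G ux by auto
        qed
        ultimately show ?thesis using v w unfolding U_def by blast
      qed
      then show "\<exists>F'. finite F' \<and> F' \<subseteq> S \<and> (\<forall>y\<in>G. (\<forall>n\<in>F'. y n = u n) \<longrightarrow> y \<in> {u \<in> G. ?p u \<in> U F x})"
        using F by blast
    qed auto
  qed
  show ?thesis
    unfolding Hausdorff_space_def topspace_quot_topology tT
  proof (intro allI impI)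
    fix v w assume XY: "v \<in> ?p ` G \<and> w \<in> ?p ` G \<and> v \<noteq> w"
    then obtain x y where x: "x \<in> G" "v = ?p x" and y: "y \<in> G" "w = ?p y" by blast
    have "x \<ominus>\<^bsub>D\<^esub> y \<notin> J" using XY x y coset_eq_iff[OF J] G by blast
    moreover have "x \<ominus>\<^bsub>D\<^esub> y \<in> G" by (rule Gm[OF x(1) y(1)])
    moreover have "\<forall>z\<in>G. (\<forall>F. finite F \<longrightarrow> F \<subseteq> S \<longrightarrow> (\<exists>w\<in>J \<inter> G. \<forall>n\<in>F. w n = z n)) \<longrightarrow> z \<in> J \<inter> G"
      using cl unfolding T closedin_subpower GI by (rule conjunct2)
    ultimately have "\<not> (\<forall>F. finite F \<longrightarrow> F \<subseteq> S \<longrightarrow> (\<exists>w\<in>J \<inter> G. \<forall>n\<in>F. w n = (x \<ominus>\<^bsub>D\<^esub> y) n))"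
      by (meson IntD1)
    then obtain F where "finite F \<and> F \<subseteq> S \<and> (\<forall>w\<in>J \<inter> G. \<exists>n\<in>F. w n \<noteq> (x \<ominus>\<^bsub>D\<^esub> y) n)"
      unfolding not_all not_imp bex_simps ball_simps by (elim exE) simp
    then have F: "finite F" "F \<subseteq> S" "\<And>w. w \<in> J \<inter> G \<Longrightarrow> \<exists>n\<in>F. w n \<noteq> (x \<ominus>\<^bsub>D\<^esub> y) n"
      by auto
    have "disjnt (U F x) (U F y)"
    proof (rule ccontr)
      assume "\<not> disjnt (U F x) (U F y)"
      then obtain x' y' where x': "x' \<in> G" "\<forall>n\<in>F. x' n = x n" and y': "y' \<in> G" "\<forall>n\<in>F. y' n = y n"
        and "?p x' = ?p y'" unfolding disjnt_def U_def by blast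
      then have "x' \<ominus>\<^bsub>D\<^esub> y' \<in> J \<inter> G" using coset_eq_iff[OF J] Gm G by blast
      from F(3)[OF this] obtain n where n: "n \<in> F" "(x' \<ominus>\<^bsub>D\<^esub> y') n \<noteq> (x \<ominus>\<^bsub>D\<^esub> y) n" by blast
      have "x \<in> carrier D" "y \<in> carrier D" "x' \<in> carrier D" "y' \<in> carrier D"
        using x y x' y' G(1) by auto
      then show False using n x'(2) y'(2) F(2) by (auto simp: minus_at)
    qed
    then show "\<exists>V W. openin (quot_topology T ?p) V \<and> openin (quot_topology T ?p) W \<and>
        v \<in> V \<and> w \<in> W \<and> disjnt V W"
      using U[OF F(1,2)] x y by (intro exI[of _ "U F x"] exI[of _ "U F y"]) (auto simp: U_def)
  qed
qed

end

section \<open>Newton's identities and ghost components\<close>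

lemma dvd_eq_mult_Suc:
  assumes "n dvd (k::nat)" "0 < k"
  shows "\<exists>m. k = n * Suc m"
proof -
  obtain j where j: "k = n * j" using assms(1) by (rule dvdE)
  then obtain m where "j = Suc m" using assms(2) by (cases j) auto
  then show ?thesis using j by blast
qed

lemma (in ring) add_pow_eq_mult:
  "a \<in> carrier R \<Longrightarrow> add_pow R (n::nat) a = (add_pow R n \<one>) \<otimes> a"
  by (simp add: add_pow_ldistr)

locale torsion_free_cring = cring R for R (structure) +
  assumes torsion_free: "\<And>n a. 0 < (n::nat) \<Longrightarrow> a \<in> carrier R \<Longrightarrow> add_pow R n a = \<zero> \<Longrightarrow> a = \<zero>"

lemma (in torsion_free_cring) add_pow_cancel:
  assumes "0 < (n::nat)" "a \<in> carrier R" "b \<in> carrier R" "add_pow R n a = add_pow R n b"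
  shows "a = b"
proof -
  have "add_pow R n (a \<ominus> b) = (add_pow R n \<one>) \<otimes> a \<ominus> (add_pow R n \<one>) \<otimes> b"
    using assms by (subst add_pow_eq_mult) (auto simp: a_minus_def r_distr r_minus)
  also have "\<dots> = \<zero>" using assms add_pow_eq_mult[of a n] add_pow_eq_mult[of b n]
    by (simp add: a_minus_def r_neg)
  finally have "a \<ominus> b = \<zero>" using torsion_free assms by auto
  then show ?thesis using assms by (simp add: r_right_minus_eq)
qed

text \<open>Power series are given by their coefficient sequences, so that \<open>shift A n\<close> is
  multiplication by \<open>t\<^sup>n\<close> and \<open>cauchy\<close> is the product of power series.\<close>

definition shift :: "('a, 'm) ring_scheme \<Rightarrow> nat \<Rightarrow> (nat \<Rightarrow> 'a) \<Rightarrow> nat \<Rightarrow> 'a"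
  where "shift A n e k = (if n \<le> k then e (k - n) else \<zero>\<^bsub>A\<^esub>)"

definition cauchy :: "('a, 'm) ring_scheme \<Rightarrow> (nat \<Rightarrow> 'a) \<Rightarrow> (nat \<Rightarrow> 'a) \<Rightarrow> nat \<Rightarrow> 'a"
  where "cauchy A w e k = (\<Oplus>\<^bsub>A\<^esub>i\<in>{..k}. w i \<otimes>\<^bsub>A\<^esub> e (k - i))"

text \<open>This is \<open>V\<^sub>n\<langle>a\<rangle>\<close> for the truncation set of all positive integers. As a power series it is
  \<open>\<Sum>\<^sub>m n a\<^sup>m t\<^bsup>nm\<^esup>\<close> with \<open>m \<ge> 1\<close>, hence the value zero at \<open>\<nu> = 0\<close>; this is the logarithmic
  derivative \<open>t e' / e\<close> of \<open>e = 1 / (1 - a t\<^sup>n)\<close>.\<close>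

definition ver_seq :: "('a, 'm) ring_scheme \<Rightarrow> nat \<Rightarrow> 'a \<Rightarrow> nat \<Rightarrow> 'a"
  where "ver_seq A n a \<nu> = (if 0 < \<nu> \<and> n dvd \<nu> then add_pow A n (a [^]\<^bsub>A\<^esub> (\<nu> div n)) else \<zero>\<^bsub>A\<^esub>)"

text \<open>The partial sums of \<open>\<Sum> V\<^sub>n\<langle>a\<^sub>n\<rangle>\<close>. Since \<open>V\<^sub>n\<langle>a\<rangle>\<close> vanishes at \<open>\<nu>\<close> unless \<open>n\<close> divides \<open>\<nu>\<close>,
  the infinite sum has the value \<open>ghost A a \<nu> \<nu>\<close> at \<open>\<nu>\<close>.\<close>

definition ghost :: "('a, 'm) ring_scheme \<Rightarrow> (nat \<Rightarrow> 'a) \<Rightarrow> nat \<Rightarrow> nat \<Rightarrow> 'a"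
  where "ghost A a N \<nu> = (\<Oplus>\<^bsub>A\<^esub>n\<in>{..N}. if n = 0 then \<zero>\<^bsub>A\<^esub> else ver_seq A n (a n) \<nu>)"

text \<open>Newton's identities: \<open>t e' = w e\<close> for a power series \<open>e\<close> with constant term one, that is,
  \<open>w\<close> is the logarithmic derivative of \<open>e\<close>.\<close>

definition newton :: "('a, 'm) ring_scheme \<Rightarrow> (nat \<Rightarrow> 'a) \<Rightarrow> (nat \<Rightarrow> 'a) \<Rightarrow> bool"
  where "newton A e w \<longleftrightarrow> e \<in> UNIV \<rightarrow> carrier A \<and> w \<in> UNIV \<rightarrow> carrier A \<and> e 0 = \<one>\<^bsub>A\<^esub> \<and>
    (\<forall>k. add_pow A k (e k) = cauchy A w e k)"

context cring begin

lemma shift_closed [simp]: "e \<in> UNIV \<rightarrow> carrier R \<Longrightarrow> shift R n e k \<in> carrier R"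
  by (auto simp: shift_def)

lemma shift_0 [simp]: "shift R 0 e = e"
  by (auto simp: shift_def)

lemma shift_Suc: "shift R (Suc n) e = shift R 1 (shift R n e)"
  by (auto simp: shift_def fun_eq_iff)

lemma cauchy_closed [simp]:
  "w \<in> UNIV \<rightarrow> carrier R \<Longrightarrow> e \<in> UNIV \<rightarrow> carrier R \<Longrightarrow> cauchy R w e k \<in> carrier R"
  unfolding cauchy_def by (intro finsum_closed) auto

lemma cauchy_shift1_left:
  assumes "w \<in> UNIV \<rightarrow> carrier R" "e \<in> UNIV \<rightarrow> carrier R"
  shows "cauchy R (shift R 1 w) e = shift R 1 (cauchy R w e)"
proof
  fix k show "cauchy R (shift R 1 w) e k = shift R 1 (cauchy R w e) k"
  proof (cases k)
    case 0 then show ?thesis using assms by (simp add: cauchy_def shift_def Pi_iff)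
  next
    case (Suc j)
    have "cauchy R (shift R 1 w) e k
        = (\<Oplus>i\<in>{..j}. shift R 1 w (Suc i) \<otimes> e (k - Suc i)) \<oplus> shift R 1 w 0 \<otimes> e (k - 0)"
      unfolding cauchy_def Suc using assms by (intro finsum_Suc2) (auto simp: Pi_iff)
    also have "\<dots> = (\<Oplus>i\<in>{..j}. shift R 1 w (Suc i) \<otimes> e (k - Suc i))"
      using assms by (simp add: shift_def Pi_iff)
    also have "\<dots> = cauchy R w e j" unfolding cauchy_def
      using assms Suc by (intro finsum_cong') (auto simp: Pi_iff shift_def)
    finally show ?thesis using Suc by (simp add: shift_def)
  qed
qed

lemma cauchy_shift1_right:
  assumes "w \<in> UNIV \<rightarrow> carrier R" "e \<in> UNIV \<rightarrow> carrier R"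
  shows "cauchy R w (shift R 1 e) = shift R 1 (cauchy R w e)"
proof
  fix k show "cauchy R w (shift R 1 e) k = shift R 1 (cauchy R w e) k"
  proof (cases k)
    case 0 then show ?thesis using assms by (simp add: cauchy_def shift_def Pi_iff)
  next
    case (Suc j)
    have "cauchy R w (shift R 1 e) k
        = w (Suc j) \<otimes> shift R 1 e (k - Suc j) \<oplus> (\<Oplus>i\<in>{..j}. w i \<otimes> shift R 1 e (k - i))"
      unfolding cauchy_def Suc using assms by (intro finsum_Suc) (auto simp: Pi_iff)
    also have "\<dots> = (\<Oplus>i\<in>{..j}. w i \<otimes> shift R 1 e (k - i))"
      using assms Suc by (simp add: shift_def Pi_iff)
    also have "\<dots> = cauchy R w e j" unfolding cauchy_def
      using assms Suc by (intro finsum_cong') (auto simp: Pi_iff shift_def)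
    finally show ?thesis using Suc by (simp add: shift_def)
  qed
qed

lemma cauchy_shift:
  assumes "w \<in> UNIV \<rightarrow> carrier R" "e \<in> UNIV \<rightarrow> carrier R"
  shows "cauchy R (shift R n w) e = shift R n (cauchy R w e)"
    and "cauchy R w (shift R n e) = shift R n (cauchy R w e)"
proof (induct n)
  case (Suc n)
  { case 1 show ?case using Suc(1) assms
      by (subst (1 2) shift_Suc) (subst cauchy_shift1_left, auto simp: Pi_iff) }
  { case 2 show ?case using Suc(2) assms
      by (subst (1 2) shift_Suc) (subst cauchy_shift1_right, auto simp: Pi_iff) }
qed auto

lemma cauchy_left_linear:
  assumes "w \<in> UNIV \<rightarrow> carrier R" "w' \<in> UNIV \<rightarrow> carrier R" "e \<in> UNIV \<rightarrow> carrier R" "a \<in> carrier R"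
  shows "cauchy R (\<lambda>k. w k \<oplus> a \<otimes> w' k) e k = cauchy R w e k \<oplus> a \<otimes> cauchy R w' e k"
proof -
  have "cauchy R (\<lambda>k. w k \<oplus> a \<otimes> w' k) e k = (\<Oplus>i\<in>{..k}. w i \<otimes> e (k - i) \<oplus> a \<otimes> (w' i \<otimes> e (k - i)))"
    unfolding cauchy_def using assms by (intro finsum_cong') (auto simp: Pi_iff l_distr m_assoc)
  also have "\<dots> = cauchy R w e k \<oplus> (\<Oplus>i\<in>{..k}. a \<otimes> (w' i \<otimes> e (k - i)))"
    unfolding cauchy_def using assms by (intro finsum_addf) (auto simp: Pi_iff)
  also have "(\<Oplus>i\<in>{..k}. a \<otimes> (w' i \<otimes> e (k - i))) = a \<otimes> cauchy R w' e k"
    unfolding cauchy_def using assms by (intro finsum_rdistr[symmetric]) (auto simp: Pi_iff)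
  finally show ?thesis .
qed

lemma cauchy_right_linear:
  assumes "w \<in> UNIV \<rightarrow> carrier R" "e \<in> UNIV \<rightarrow> carrier R" "e' \<in> UNIV \<rightarrow> carrier R" "a \<in> carrier R"
  shows "cauchy R w (\<lambda>k. e k \<oplus> a \<otimes> e' k) k = cauchy R w e k \<oplus> a \<otimes> cauchy R w e' k"
proof -
  have "cauchy R w (\<lambda>k. e k \<oplus> a \<otimes> e' k) k = (\<Oplus>i\<in>{..k}. w i \<otimes> e (k - i) \<oplus> a \<otimes> (w i \<otimes> e' (k - i)))"
    unfolding cauchy_def using assms by (intro finsum_cong') (auto simp: Pi_iff r_distr m_lcomm)
  also have "\<dots> = cauchy R w e k \<oplus> (\<Oplus>i\<in>{..k}. a \<otimes> (w i \<otimes> e' (k - i)))"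
    unfolding cauchy_def using assms by (intro finsum_addf) (auto simp: Pi_iff)
  also have "(\<Oplus>i\<in>{..k}. a \<otimes> (w i \<otimes> e' (k - i))) = a \<otimes> cauchy R w e' k"
    unfolding cauchy_def using assms by (intro finsum_rdistr[symmetric]) (auto simp: Pi_iff)
  finally show ?thesis .
qed

lemma ver_seq_closed [simp]: "a \<in> carrier R \<Longrightarrow> ver_seq R n a k \<in> carrier R"
  by (auto simp: ver_seq_def)

definition unit_seq :: "nat \<Rightarrow> 'a" where "unit_seq k = (if k = 0 then \<one> else \<zero>)"

lemma unit_seq_closed [simp]: "unit_seq k \<in> carrier R"
  by (auto simp: unit_seq_def)

lemma cauchy_unit: "e \<in> UNIV \<rightarrow> carrier R \<Longrightarrow> cauchy R unit_seq e k = e k"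
proof -
  assume e: "e \<in> UNIV \<rightarrow> carrier R"
  have "cauchy R unit_seq e k = (\<Oplus>i\<in>{..k}. if 0 = i then e (k - i) else \<zero>)"
    unfolding cauchy_def using e by (intro finsum_cong') (auto simp: unit_seq_def Pi_iff)
  also have "\<dots> = e k" using e by (subst finsum_singleton) (auto simp: Pi_iff)
  finally show ?thesis .
qed

lemma ver_seq_rec:
  assumes a: "a \<in> carrier R" and n: "0 < n"
  shows "ver_seq R n a k = (add_pow R n a) \<otimes> shift R n unit_seq k \<oplus> a \<otimes> shift R n (ver_seq R n a) k"
proof (cases "n dvd k \<and> 0 < k")
  case False
  then have "\<not> (n \<le> k \<and> k - n = 0)" using n by auto
  moreover have "\<not> (n \<le> k \<and> n dvd (k - n) \<and> 0 < k - n)" using False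
    using n dvd_diffD[of n k n] by auto
  ultimately show ?thesis using a False by (auto simp: ver_seq_def shift_def unit_seq_def)
next
  case True
  then obtain m where m: "k = n * Suc m" using dvd_eq_mult_Suc by blast
  have kn: "k - n = n * m" "n \<le> k" using m by auto
  show ?thesis
  proof (cases m)
    case 0
    then show ?thesis using a n m by (simp add: ver_seq_def shift_def unit_seq_def)
  next
    case (Suc j)
    have "ver_seq R n a k = add_pow R n (a [^] Suc m)" using m n by (simp add: ver_seq_def)
    also have "\<dots> = a \<otimes> add_pow R n (a [^] m)" using a by (simp add: add_pow_rdistr m_comm)
    also have "add_pow R n (a [^] m) = shift R n (ver_seq R n a) k"
      using kn Suc n by (simp add: shift_def ver_seq_def)
    finally show ?thesis using a kn Suc n by (simp add: shift_def unit_seq_def)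
  qed
qed

lemma cauchy_ver_seq:
  assumes a: "a \<in> carrier R" and n: "0 < n" and e: "e \<in> UNIV \<rightarrow> carrier R"
  shows "cauchy R (ver_seq R n a) e k
    = (add_pow R n a) \<otimes> shift R n e k \<oplus> a \<otimes> shift R n (cauchy R (ver_seq R n a) e) k"
proof -
  let ?v = "ver_seq R n a"
  have v: "?v \<in> UNIV \<rightarrow> carrier R" and u: "unit_seq \<in> UNIV \<rightarrow> carrier R" using a by auto
  have c: "(\<lambda>k. \<zero> \<oplus> (add_pow R n a) \<otimes> shift R n unit_seq k) \<in> UNIV \<rightarrow> carrier R" using a u by auto
  have "cauchy R ?v e k = cauchy R (\<lambda>k. (\<zero> \<oplus> (add_pow R n a) \<otimes> shift R n unit_seq k) \<oplus> a \<otimes> shift R n ?v k) e k"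
    using a u by (subst ver_seq_rec[OF a n, abs_def]) simp
  also have "\<dots> = cauchy R (\<lambda>k. \<zero> \<oplus> (add_pow R n a) \<otimes> shift R n unit_seq k) e k
      \<oplus> a \<otimes> cauchy R (shift R n ?v) e k"
    using a v u c e by (intro cauchy_left_linear) auto
  also have "cauchy R (\<lambda>k. \<zero> \<oplus> (add_pow R n a) \<otimes> shift R n unit_seq k) e k
      = cauchy R (\<lambda>k. \<zero>) e k \<oplus> (add_pow R n a) \<otimes> cauchy R (shift R n unit_seq) e k"
    using a u e by (intro cauchy_left_linear) auto
  also have "cauchy R (\<lambda>k. \<zero>) e k = \<zero>"
    unfolding cauchy_def using e by (intro add.finprod_one_eqI) (auto simp: Pi_iff)
  also have "cauchy R (shift R n unit_seq) e = shift R n e"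
    unfolding cauchy_shift(1)[OF u e] using cauchy_unit[OF e] by (auto simp: shift_def)
  finally show ?thesis using a v e by (simp add: cauchy_shift(1)[OF v e])
qed

text \<open>The logarithmic derivative of \<open>1 - a t\<^sup>n\<close> is \<open>- V\<^sub>n\<langle>a\<rangle>\<close>, and logarithmic derivatives turn
  products into sums.\<close>

lemma newton_sub:
  assumes nw: "newton R e w" and a: "a \<in> carrier R" and n: "0 < n"
  shows "newton R (\<lambda>k. e k \<ominus> a \<otimes> shift R n e k) (\<lambda>k. w k \<ominus> ver_seq R n a k)"
proof -
  have e: "e \<in> UNIV \<rightarrow> carrier R" and w: "w \<in> UNIV \<rightarrow> carrier R" and e0: "e 0 = \<one>"
    and id: "\<And>k. add_pow R k (e k) = cauchy R w e k" using nw by (auto simp: newton_def)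
  let ?v = "ver_seq R n a" let ?e = "\<lambda>k. e k \<oplus> (\<ominus> a) \<otimes> shift R n e k"
  let ?w = "\<lambda>k. w k \<oplus> (\<ominus> \<one>) \<otimes> ?v k"
  have v: "?v \<in> UNIV \<rightarrow> carrier R" and se: "shift R n e \<in> UNIV \<rightarrow> carrier R" using a e by auto
  have ec: "\<And>k. e k \<in> carrier R" and wc: "\<And>k. w k \<in> carrier R" using e w by auto
  have e': "?e \<in> UNIV \<rightarrow> carrier R" using ec se a by auto
  have main: "add_pow R k (?e k) = cauchy R ?w ?e k" for k
  proof -
    let ?cv = "cauchy R ?v e" let ?cw = "cauchy R w e"
    have cv: "?cv \<in> UNIV \<rightarrow> carrier R" and cw: "?cw \<in> UNIV \<rightarrow> carrier R" using v w e by auto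
    have "cauchy R ?w ?e k = cauchy R w ?e k \<oplus> (\<ominus> \<one>) \<otimes> cauchy R ?v ?e k"
      using w v e' by (intro cauchy_left_linear) auto
    also have "cauchy R w ?e k = ?cw k \<oplus> (\<ominus> a) \<otimes> shift R n ?cw k"
      using w e se a by (subst cauchy_right_linear) (auto simp: cauchy_shift(2)[OF w e])
    also have "cauchy R ?v ?e k = ?cv k \<oplus> (\<ominus> a) \<otimes> shift R n ?cv k"
      using v e se a by (subst cauchy_right_linear) (auto simp: cauchy_shift(2)[OF v e])
    also have "\<dots> = (add_pow R n a) \<otimes> shift R n e k"
      using a cv e by (subst cauchy_ver_seq[OF a n e]) (simp add: l_minus a_assoc r_neg)
    finally have 1: "cauchy R ?w ?e k = ?cw k \<oplus> (\<ominus> a) \<otimes> shift R n ?cw k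
        \<oplus> (\<ominus> \<one>) \<otimes> ((add_pow R n a) \<otimes> shift R n e k)" .
    show ?thesis
    proof (cases "n \<le> k")
      case False
      then show ?thesis unfolding 1 using a ec[of k] id[of k] cauchy_closed[OF w e, of k] by (simp add: shift_def)
    next
      case True
      let ?x = "e (k - n)"
      have x: "?x \<in> carrier R" using ec .
      have "add_pow R k (a \<otimes> ?x) = add_pow R ((k - n) + n) (a \<otimes> ?x)" using True by simp
      also have "\<dots> = add_pow R (k - n) (a \<otimes> ?x) \<oplus> add_pow R n (a \<otimes> ?x)"
        using a x by (intro add.nat_pow_mult[symmetric]) auto
      finally have 2: "add_pow R k (a \<otimes> ?x) = a \<otimes> (add_pow R (k - n) ?x) \<oplus> (add_pow R n a) \<otimes> ?x"
        using a x by (simp add: add_pow_ldistr add_pow_rdistr)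
      have "add_pow R k (?e k) = add_pow R k (e k) \<oplus> add_pow R k (\<ominus> (a \<otimes> ?x))"
        using True a x ec by (simp add: shift_def l_minus add.nat_pow_distrib)
      also have "add_pow R k (\<ominus> (a \<otimes> ?x)) = \<ominus> (add_pow R k (a \<otimes> ?x))"
        using a x by (simp add: add.nat_pow_inv)
      finally show ?thesis unfolding 1 2 using True a x ec[of k] id[of k] id[of "k - n"] cw
        by (simp add: shift_def l_minus r_minus minus_add a_assoc Pi_iff)
    qed
  qed
  have "(\<lambda>k. e k \<ominus> a \<otimes> shift R n e k) = ?e" using a e by (auto simp: a_minus_def l_minus)
  moreover have "(\<lambda>k. w k \<ominus> ver_seq R n a k) = ?w" using a w by (auto simp: a_minus_def l_minus)
  moreover have "newton R ?e ?w"
    unfolding newton_def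
  proof (intro conjI allI)
    show "?w \<in> UNIV \<rightarrow> carrier R" using wc a by auto
    show "?e 0 = \<one>" using e0 n a by (simp add: shift_def)
  qed (use e' main in blast)+
  ultimately show ?thesis by simp
qed

lemma newton_zero: "newton R unit_seq (\<lambda>_. \<zero>)"
proof -
  have "add_pow R k (unit_seq k) = \<zero>" for k by (cases k) (auto simp: unit_seq_def)
  moreover have "cauchy R (\<lambda>_. \<zero>) unit_seq k = \<zero>" for k
    unfolding cauchy_def by (intro add.finprod_one_eqI) auto
  ultimately show ?thesis by (auto simp: newton_def unit_seq_def)
qed

text \<open>The series is \<open>1 / (1 - a t\<^sup>n)\<close>. Its coefficients satisfy \<open>e\<^sub>k = a e\<^bsub>k-n\<^esub>\<close>, and the
  products with \<open>V\<^sub>n\<langle>a\<rangle>\<close> satisfy a corresponding recursion.\<close>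

lemma newton_geometric:
  assumes a: "a \<in> carrier R" and n: "0 < n"
  shows "newton R (\<lambda>k. if n dvd k then a [^] (k div n) else \<zero>) (ver_seq R n a)" (is "newton R ?e ?v")
proof -
  have e: "?e \<in> UNIV \<rightarrow> carrier R" and v: "?v \<in> UNIV \<rightarrow> carrier R" using a by auto
  have rec: "?e k = a \<otimes> ?e (k - n)" if kk: "n \<le> k" "0 < k" for k
  proof (cases "n dvd k")
    case False
    then have "\<not> n dvd (k - n)" using kk dvd_diffD[of n k n] by auto
    then show ?thesis using False a by simp
  next
    case True
    then obtain m where "k = n * Suc m" using kk dvd_eq_mult_Suc by blast
    then show ?thesis using a n by (simp add: m_comm)
  qed
  have "add_pow R k (?e k) = cauchy R ?v ?e k" for k
  proof (induct k rule: less_induct)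
    case (less k)
    have c: "cauchy R ?v ?e k = (add_pow R n a) \<otimes> shift R n ?e k \<oplus> a \<otimes> shift R n (cauchy R ?v ?e) k"
      by (rule cauchy_ver_seq[OF a n e])
    show ?case
    proof (cases "n \<le> k")
      case False
      then have "add_pow R k (?e k) = \<zero>" by (cases "k = 0") (auto dest: dvd_imp_le)
      then show ?thesis unfolding c using False a by (simp add: shift_def)
    next
      case True
      let ?x = "?e (k - n)"
      have x: "?x \<in> carrier R" using a by auto
      have IH: "cauchy R ?v ?e (k - n) = add_pow R (k - n) ?x" using less[of "k - n"] True n by simp
      have "add_pow R k (?e k) = add_pow R (n + (k - n)) (a \<otimes> ?x)" using rec[of k] True n by simp
      also have "\<dots> = add_pow R n (a \<otimes> ?x) \<oplus> add_pow R (k - n) (a \<otimes> ?x)"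
        using a x by (intro add.nat_pow_mult[symmetric] m_closed)
      also have "add_pow R n (a \<otimes> ?x) = (add_pow R n a) \<otimes> ?x" using a x by (intro add_pow_ldistr[symmetric])
      also have "add_pow R (k - n) (a \<otimes> ?x) = a \<otimes> (add_pow R (k - n) ?x)" using a x by (intro add_pow_rdistr[symmetric])
      finally show ?thesis unfolding c using True IH by (simp only: shift_def if_True)
    qed
  qed
  then show ?thesis unfolding newton_def using e v by auto
qed

end

text \<open>The logarithmic derivatives of the power series in \<open>1 + t I[[t]]\<close>. These power series
  form a group under multiplication, and this is the source of all statements below that sums
  and differences of elements \<open>V\<^sub>n\<langle>a\<rangle>\<close> with \<open>a \<in> I\<close> are again convergent sums of such
  elements.\<close>

definition log_derivs :: "('a, 'm) ring_scheme \<Rightarrow> 'a set \<Rightarrow> (nat \<Rightarrow> 'a) set"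
  where "log_derivs A I = {w. \<exists>e. newton A e w \<and> (\<forall>k>0. e k \<in> I)}"

lemma (in cring) zero_log_derivs: "ideal I R \<Longrightarrow> (\<lambda>_. \<zero>) \<in> log_derivs R I"
  using newton_zero by (auto simp: log_derivs_def unit_seq_def additive_subgroup.zero_closed ideal_def intro!: exI[of _ unit_seq])

lemma (in cring) log_derivs_sub:
  assumes I: "ideal I R" and w: "w \<in> log_derivs R I" and a: "a \<in> I" and n: "0 < n"
  shows "(\<lambda>k. w k \<ominus> ver_seq R n a k) \<in> log_derivs R I"
proof -
  interpret I: ideal I R by fact
  obtain e where e: "newton R e w" "\<And>k. k > 0 \<Longrightarrow> e k \<in> I" using w by (auto simp: log_derivs_def)
  have ac: "a \<in> carrier R" using a by simp
  have ec: "\<And>k. e k \<in> carrier R" using e(1) by (auto simp: newton_def)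
  have "e k \<ominus> a \<otimes> shift R n e k \<in> I" if "k > 0" for k
  proof -
    have "a \<otimes> shift R n e k \<in> I" using I.I_r_closed[OF a] ec by (auto simp: shift_def)
    then show ?thesis using e(2)[OF that] by (simp add: a_minus_def)
  qed
  then show ?thesis using newton_sub[OF e(1) ac n] by (auto simp: log_derivs_def)
qed

text \<open>This is the logarithmic derivative of \<open>(1 - b t\<^sup>n) / (1 - a t\<^sup>n)\<close>. The coefficients in
  positive degrees are multiples of \<open>a - b\<close>, although \<open>a\<close> and \<open>b\<close> themselves need not belong to
  \<open>I\<close>.\<close>

lemma (in cring) log_derivs_diff:
  assumes I: "ideal I R" and a: "a \<in> carrier R" and b: "b \<in> carrier R" and ab: "a \<ominus> b \<in> I" and n: "0 < n"
  shows "(\<lambda>k. ver_seq R n a k \<ominus> ver_seq R n b k) \<in> log_derivs R I"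
proof -
  interpret I: ideal I R by fact
  let ?e = "\<lambda>k. if n dvd k then a [^] (k div n) else \<zero>"
  have "?e k \<ominus> b \<otimes> shift R n ?e k \<in> I" if k: "k > 0" for k
  proof (cases "n dvd k")
    case False
    then have "shift R n ?e k = \<zero>" using dvd_diffD[of n k n] by (auto simp: shift_def)
    then show ?thesis using False b by (simp add: a_minus_def)
  next
    case True
    then obtain m where m: "k = n * Suc m" using k dvd_eq_mult_Suc by blast
    have "shift R n ?e k = a [^] m" "?e k = a \<otimes> a [^] m" using m n a by (auto simp: shift_def m_comm)
    then have "?e k \<ominus> b \<otimes> shift R n ?e k = (a \<ominus> b) \<otimes> a [^] m"
      using a b by (simp add: a_minus_def l_distr l_minus)
    then show ?thesis using I.I_r_closed[OF ab] a by simp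
  qed
  then show ?thesis using newton_sub[OF newton_geometric[OF a n] b n] by (auto simp: log_derivs_def)
qed

context cring begin

lemma ghost_0 [simp]: "ghost R a 0 \<nu> = \<zero>"
  by (simp add: ghost_def)

lemma ghost_Suc:
  "a \<in> UNIV \<rightarrow> carrier R \<Longrightarrow> ghost R a (Suc N) \<nu> = ver_seq R (Suc N) (a (Suc N)) \<nu> \<oplus> ghost R a N \<nu>"
  unfolding ghost_def by (subst finsum_Suc) (auto simp: Pi_iff)

lemma ghost_closed [simp]: "a \<in> UNIV \<rightarrow> carrier R \<Longrightarrow> ghost R a N \<nu> \<in> carrier R"
  unfolding ghost_def by (intro finsum_closed) (auto simp: Pi_iff)

lemma ver_seq_eq_0: "0 < \<nu> \<Longrightarrow> \<nu> < n \<Longrightarrow> ver_seq R n a \<nu> = \<zero>"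
  by (auto simp: ver_seq_def dest: dvd_imp_le)

lemma ghost_stable:
  assumes a: "a \<in> UNIV \<rightarrow> carrier R" and \<nu>: "0 < \<nu>" "\<nu> \<le> N"
  shows "ghost R a N \<nu> = ghost R a \<nu> \<nu>"
  using \<nu>(2)
proof (induct N rule: dec_induct)
  case (step N)
  then have "ver_seq R (Suc N) (a (Suc N)) \<nu> = \<zero>" using \<nu> by (intro ver_seq_eq_0) auto
  then show ?case using step a \<nu> by (simp add: ghost_Suc)
qed simp

lemma ghost_cong:
  assumes a: "a \<in> UNIV \<rightarrow> carrier R" and b: "b \<in> UNIV \<rightarrow> carrier R"
    and ab: "\<And>n. 0 < n \<Longrightarrow> n dvd \<nu> \<Longrightarrow> n \<le> N \<Longrightarrow> a n = b n"
  shows "ghost R a N \<nu> = ghost R b N \<nu>"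
  using ab
proof (induct N)
  case (Suc N)
  have "ver_seq R (Suc N) (a (Suc N)) \<nu> = ver_seq R (Suc N) (b (Suc N)) \<nu>"
    using Suc(2)[of "Suc N"] by (auto simp: ver_seq_def)
  then show ?case using Suc a b by (simp add: ghost_Suc)
qed simp

lemma log_derivs_closed: "w \<in> log_derivs R I \<Longrightarrow> w k \<in> carrier R"
  by (auto simp: log_derivs_def newton_def)

lemma log_derivs_sub_ghost:
  assumes I: "ideal I R" and w: "w \<in> log_derivs R I" and b: "b \<in> UNIV \<rightarrow> I"
  shows "(\<lambda>k. w k \<ominus> ghost R b N k) \<in> log_derivs R I"
proof (induct N)
  case 0
  have "(\<lambda>k. w k \<ominus> ghost R b 0 k) = w" using log_derivs_closed[OF w] by (auto simp: a_minus_def)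
  then show ?case using w by simp
next
  case (Suc N)
  interpret I: ideal I R by fact
  have bc: "b \<in> UNIV \<rightarrow> carrier R" using b by (auto simp: Pi_iff)
  then have bS: "b (Suc N) \<in> carrier R" by auto
  have "(\<lambda>k. w k \<ominus> ghost R b (Suc N) k) = (\<lambda>k. (w k \<ominus> ghost R b N k) \<ominus> ver_seq R (Suc N) (b (Suc N)) k)"
    using log_derivs_closed[OF w] bc bS
    by (simp add: ghost_Suc a_minus_def minus_add a_ac)
  moreover have "b (Suc N) \<in> I" using b by auto
  ultimately show ?case using log_derivs_sub[OF I Suc, of "b (Suc N)" "Suc N"] by simp
qed

end

context torsion_free_cring begin

text \<open>The Witt components of a logarithmic derivative \<open>w\<close> are split off one at a time: if \<open>w\<close>
  vanishes below \<open>n\<close>, then \<open>w\<^sub>n\<close> is \<open>n\<close> times the \<open>n\<close>-th coefficient of the power series, so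
  that subtracting \<open>V\<^sub>n\<close> of this coefficient makes \<open>w\<close> vanish below \<open>n + 1\<close>.\<close>

lemma log_derivs_imp_ghost:
  assumes I: "ideal I R" and w: "w \<in> log_derivs R I"
  shows "\<exists>c\<in>UNIV \<rightarrow> I. \<forall>\<nu>>0. w \<nu> = ghost R c \<nu> \<nu>"
proof -
  interpret I: ideal I R by fact
  \<comment> \<open>The pairs consist of the \<open>N\<close>-th component and of what remains of \<open>w\<close> once the first \<open>N\<close> are subtracted.\<close>
  let ?P = "\<lambda>N (a, v). a \<in> I \<and> v \<in> log_derivs R I \<and> (\<forall>k. 0 < k \<and> k \<le> N \<longrightarrow> v k = \<zero>) \<and> (N = 0 \<longrightarrow> v = w)"
  let ?Q = "\<lambda>N (a, v) (b, v'). \<forall>k. v' k = v k \<ominus> ver_seq R (Suc N) b k"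
  have "\<exists>f. \<forall>N. ?P N (f N) \<and> ?Q N (f N) (f (Suc N))"
  proof (rule dependent_nat_choice)
    show "\<exists>x. ?P 0 x" using w by (intro exI[of _ "(\<zero>, w)"]) auto
    fix x N assume "?P N x"
    then obtain a v where x: "x = (a, v)" and v: "v \<in> log_derivs R I"
      and v0: "\<And>k. 0 < k \<Longrightarrow> k \<le> N \<Longrightarrow> v k = \<zero>" by (cases x) auto
    obtain e where e: "newton R e v" and eI: "\<And>k. k > 0 \<Longrightarrow> e k \<in> I" using v by (auto simp: log_derivs_def)
    have vc: "v k \<in> carrier R" and ec: "e k \<in> carrier R" for k using e by (auto simp: newton_def)
    let ?n = "Suc N" let ?b = "e ?n"
    have b: "?b \<in> I" using eI by simp
    have e0: "e 0 = \<one>" and id: "\<And>k. add_pow R k (e k) = cauchy R v e k" using e by (auto simp: newton_def)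
    have "v 0 = \<zero>" using id[of 0] vc[of 0] e0 by (simp add: cauchy_def)
    then have vz: "v k = \<zero>" if "k \<le> N" for k using v0[of k] that by (cases k) auto
    have "add_pow R ?n ?b = (\<Oplus>i\<in>{..?n}. if ?n = i then v i \<otimes> e (?n - i) else \<zero>)"
      unfolding id cauchy_def using vc ec vz by (intro finsum_cong') (auto simp: le_Suc_eq)
    also have "\<dots> = v ?n" using vc ec e0 by (subst finsum_singleton) auto
    finally have vn: "v ?n = add_pow R ?n ?b" by simp
    let ?v = "\<lambda>k. v k \<ominus> ver_seq R ?n ?b k"
    have "?v \<in> log_derivs R I" by (rule log_derivs_sub[OF I v b]) simp
    moreover have "?v k = \<zero>" if "0 < k" "k \<le> ?n" for k
    proof (cases "k = ?n")
      case True then show ?thesis using vn ec[of ?n] by (simp add: ver_seq_def a_minus_def r_neg del: add_pow_def)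
    next
      case False
      then have "ver_seq R ?n ?b k = \<zero>" using that by (intro ver_seq_eq_0) auto
      then show ?thesis using vz[of k] False that by (simp add: a_minus_def)
    qed
    ultimately show "\<exists>y. ?P (Suc N) y \<and> ?Q N x y"
      using b x by (intro exI[of _ "(?b, ?v)"]) auto
  qed
  then obtain f where f: "\<forall>N. ?P N (f N) \<and> ?Q N (f N) (f (Suc N))" by (elim exE) (rule that)
  have fP: "?P N (f N)" and fQ: "?Q N (f N) (f (Suc N))" for N
    using spec[OF f, of N] by (rule conjunct1, rule conjunct2)
  define c where "c n = fst (f n)" for n
  define v where "v n = snd (f n)" for n
  have cI: "c n \<in> I" and vl: "v n \<in> log_derivs R I" for n
    using fP[of n] by (auto simp: c_def v_def split: prod.splits)
  have c: "c \<in> UNIV \<rightarrow> carrier R" using cI by auto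
  have v0: "v 0 = w" using fP[of 0] by (auto simp: v_def split: prod.splits)
  have vz: "v N k = \<zero>" if "0 < k" "k \<le> N" for k N
    using fP[of N] that by (auto simp: v_def split: prod.splits)
  have vS: "v (Suc N) k = v N k \<ominus> ver_seq R (Suc N) (c (Suc N)) k" for N k
    using fQ[of N] by (auto simp: v_def c_def split: prod.splits)
  have "w k = v N k \<oplus> ghost R c N k" for N k
  proof (induct N)
    case 0 then show ?case using v0 log_derivs_closed[OF w] by simp
  next
    case (Suc N)
    have vc: "v N k \<in> carrier R" using log_derivs_closed[OF vl] .
    have cc: "c (Suc N) \<in> carrier R" using c by auto
    show ?case unfolding vS using Suc vc cc c
      by (simp add: ghost_Suc a_minus_def a_assoc) (simp add: a_ac r_neg r_neg1 r_neg2)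
  qed
  then have "w \<nu> = ghost R c \<nu> \<nu>" if "0 < \<nu>" for \<nu>
    using vz[of \<nu> \<nu>] that c by (metis ghost_closed l_zero le_refl)
  then show ?thesis using cI by blast
qed

text \<open>Both ghost vectors are finite sums of elements \<open>V\<^sub>n\<langle>a\<rangle>\<close> in the range up to \<open>N\<close>, so their
  difference is a logarithmic derivative there, and its components can be read off. To add
  \<open>V\<^sub>n\<langle>a\<rangle>\<close>, the components of \<open>- V\<^sub>n\<langle>a\<rangle>\<close> are subtracted.\<close>

lemma ghost_diff:
  assumes I: "ideal I R" and a: "a \<in> UNIV \<rightarrow> I" and b: "b \<in> UNIV \<rightarrow> I"
  shows "\<exists>c\<in>UNIV \<rightarrow> I. \<forall>\<nu>. 0 < \<nu> \<and> \<nu> \<le> N \<longrightarrow> ghost R a \<nu> \<nu> \<ominus> ghost R b \<nu> \<nu> = ghost R c \<nu> \<nu>"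
proof -
  interpret I: ideal I R by fact
  have IC: "f \<in> UNIV \<rightarrow> carrier R" if "f \<in> UNIV \<rightarrow> I" for f using that by (auto simp: Pi_iff)
  have "\<exists>w\<in>log_derivs R I. \<forall>\<nu>. 0 < \<nu> \<and> \<nu> \<le> N \<longrightarrow> ghost R a M \<nu> = w \<nu>" for M
  proof (induct M)
    case 0 then show ?case using zero_log_derivs[OF I] by (intro bexI[of _ "\<lambda>_. \<zero>"]) auto
  next
    case (Suc M)
    then obtain w where w: "w \<in> log_derivs R I" "\<And>\<nu>. 0 < \<nu> \<Longrightarrow> \<nu> \<le> N \<Longrightarrow> ghost R a M \<nu> = w \<nu>" by blast
    let ?v = "ver_seq R (Suc M) (a (Suc M))"
    have aI: "a (Suc M) \<in> I" using a by auto
    have ac: "a (Suc M) \<in> carrier R" using aI by simp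
    have "(\<lambda>k. \<zero> \<ominus> ?v k) \<in> log_derivs R I"
      by (rule log_derivs_sub[OF I zero_log_derivs[OF I] aI]) simp
    then obtain c where c: "c \<in> UNIV \<rightarrow> I" and cv: "\<And>\<nu>. \<nu> > 0 \<Longrightarrow> \<zero> \<ominus> ?v \<nu> = ghost R c \<nu> \<nu>"
      using log_derivs_imp_ghost[OF I] by blast
    have "ghost R a (Suc M) \<nu> = w \<nu> \<ominus> ghost R c N \<nu>" if "0 < \<nu>" "\<nu> \<le> N" for \<nu>
    proof -
      have "ghost R c N \<nu> = \<ominus> ?v \<nu>" using ghost_stable[OF IC[OF c] that] cv[OF that(1)] ac
        by (simp add: a_minus_def)
      then show ?thesis using ac w(2)[OF that, symmetric] IC[OF a] by (simp add: ghost_Suc a_minus_def a_comm)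
    qed
    then show ?case
      by (intro bexI[of _ "\<lambda>k. w k \<ominus> ghost R c N k"] allI impI log_derivs_sub_ghost[OF I w(1) c]) auto
  qed
  from this[of N] obtain w where w: "w \<in> log_derivs R I" "\<And>\<nu>. 0 < \<nu> \<Longrightarrow> \<nu> \<le> N \<Longrightarrow> ghost R a N \<nu> = w \<nu>" by blast
  have "(\<lambda>k. w k \<ominus> ghost R b N k) \<in> log_derivs R I" by (rule log_derivs_sub_ghost[OF I w(1) b])
  then obtain c where c: "c \<in> UNIV \<rightarrow> I" "\<And>\<nu>. \<nu> > 0 \<Longrightarrow> w \<nu> \<ominus> ghost R b N \<nu> = ghost R c \<nu> \<nu>"
    using log_derivs_imp_ghost[OF I] by blast
  have "ghost R a \<nu> \<nu> \<ominus> ghost R b \<nu> \<nu> = ghost R c \<nu> \<nu>" if "0 < \<nu>" "\<nu> \<le> N" for \<nu>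
    using c(2)[OF that(1)] w(2)[OF that] ghost_stable[OF IC[OF a] that] ghost_stable[OF IC[OF b] that] by simp
  then show ?thesis using c(1) by blast
qed

text \<open>By induction on \<open>m\<close> along divisors: the two \<open>m\<close>-th ghost components differ by
  \<open>m (a\<^sub>m - b\<^sub>m)\<close>.\<close>

lemma ghost_inj:
  assumes a: "a \<in> UNIV \<rightarrow> carrier R" and b: "b \<in> UNIV \<rightarrow> carrier R" and m: "0 < m"
    and eq: "\<And>\<nu>. 0 < \<nu> \<Longrightarrow> \<nu> dvd m \<Longrightarrow> ghost R a \<nu> \<nu> = ghost R b \<nu> \<nu>"
  shows "a m = b m"
  using m eq
proof (induct m rule: less_induct)
  case (less m)
  have sub: "a d = b d" if "0 < d" "d dvd m" "d < m" for d
    using less(1)[OF that(3,1)] less(3) that by (meson dvd_trans)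
  obtain k where k: "m = Suc k" using less(2) by (cases m) auto
  have "ghost R a k m = ghost R b k m"
    by (rule ghost_cong[OF a b]) (use sub k in auto)
  moreover have "ghost R a m m = ghost R b m m" using less by simp
  moreover have "ghost R a k m \<in> carrier R" "a m \<in> carrier R" "b m \<in> carrier R" using a b by auto
  ultimately have "ver_seq R m (a m) m = ver_seq R m (b m) m"
    using a b by (auto simp: ghost_Suc k)
  then have "add_pow R m (a m) = add_pow R m (b m)"
    using less(2) \<open>a m \<in> carrier R\<close> \<open>b m \<in> carrier R\<close> by (simp add: ver_seq_def)
  then show ?case using add_pow_cancel less(2) a b by blast
qed

end

section \<open>The rings \<open>A\<^sup>S\<close> and the groups \<open>X\<^sub>S(I)\<close>\<close>

lemma pow_ring_simps [simp]:
  "carrier (pow_ring S A) = (\<Pi>\<^sub>E n\<in>S. carrier A)"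
  "x \<otimes>\<^bsub>pow_ring S A\<^esub> y = (\<lambda>n\<in>S. x n \<otimes>\<^bsub>A\<^esub> y n)"
  "\<one>\<^bsub>pow_ring S A\<^esub> = (\<lambda>n\<in>S. \<one>\<^bsub>A\<^esub>)"
  "\<zero>\<^bsub>pow_ring S A\<^esub> = (\<lambda>n\<in>S. \<zero>\<^bsub>A\<^esub>)"
  "x \<oplus>\<^bsub>pow_ring S A\<^esub> y = (\<lambda>n\<in>S. x n \<oplus>\<^bsub>A\<^esub> y n)"
  by (simp_all add: pow_ring_def)

lemma restrict_eqI: "y \<in> extensional S \<Longrightarrow> (\<And>n. n \<in> S \<Longrightarrow> f n = y n) \<Longrightarrow> restrict f S = y"
  by (auto simp: fun_eq_iff extensional_def)

lemma ring_pow_ring: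
  assumes "ring A"
  shows "ring (pow_ring S A)"
proof -
  interpret A: ring A by fact
  show ?thesis
  proof (intro ringI abelian_groupI monoidI)
    fix x assume x: "x \<in> carrier (pow_ring S A)"
    then have "(\<lambda>n\<in>S. \<ominus>\<^bsub>A\<^esub> x n) \<oplus>\<^bsub>pow_ring S A\<^esub> x = \<zero>\<^bsub>pow_ring S A\<^esub>"
      by (auto simp: PiE_iff A.l_neg intro!: restrict_eqI)
    then show "\<exists>y\<in>carrier (pow_ring S A). y \<oplus>\<^bsub>pow_ring S A\<^esub> x = \<zero>\<^bsub>pow_ring S A\<^esub>"
      using x by (intro bexI[of _ "\<lambda>n\<in>S. \<ominus>\<^bsub>A\<^esub> x n"]) (auto simp: PiE_iff)
  qed (auto simp: PiE_iff A.m_assoc A.a_ac A.l_distr A.r_distr intro!: restrict_eqI)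
qed

lemma pointwise_pow_ring: "ring A \<Longrightarrow> pointwise (pow_ring S A) S A"
  by (simp add: pointwise_def ring_pow_ring)

text \<open>For additive subgroups of \<open>A\<^sup>S\<close>, the last condition is closedness: whatever is
  approximated by elements of \<open>H\<close> on each finite set of coordinates belongs to \<open>H\<close>.\<close>

definition closed_subgroup :: "nat set \<Rightarrow> ('a, 'm) ring_scheme \<Rightarrow> (nat \<Rightarrow> 'a) set \<Rightarrow> bool"
  where "closed_subgroup S A H \<longleftrightarrow> H \<subseteq> (\<Pi>\<^sub>E n\<in>S. carrier A) \<and> (\<lambda>n\<in>S. \<zero>\<^bsub>A\<^esub>) \<in> H \<and>
    (\<forall>x\<in>H. \<forall>y\<in>H. (\<lambda>n\<in>S. x n \<ominus>\<^bsub>A\<^esub> y n) \<in> H) \<and>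
    (\<forall>x\<in>(\<Pi>\<^sub>E n\<in>S. carrier A). (\<forall>F. finite F \<longrightarrow> F \<subseteq> S \<longrightarrow> (\<exists>y\<in>H. \<forall>n\<in>F. y n = x n)) \<longrightarrow> x \<in> H)"

lemma closedin_pow_top:
  "closedin (pow_top S A) H \<longleftrightarrow> H \<subseteq> (\<Pi>\<^sub>E n\<in>S. carrier A) \<and>
    (\<forall>x\<in>(\<Pi>\<^sub>E n\<in>S. carrier A). (\<forall>F. finite F \<longrightarrow> F \<subseteq> S \<longrightarrow> (\<exists>y\<in>H. \<forall>n\<in>F. y n = x n)) \<longrightarrow> x \<in> H)"
  using closedin_subpower[of "carrier A" S UNIV H] by (simp add: pow_top_def)

lemma additive_subgroup_iff_minus:
  assumes "ring D"
  shows "additive_subgroup H D \<longleftrightarrow> H \<subseteq> carrier D \<and> \<zero>\<^bsub>D\<^esub> \<in> H \<and> (\<forall>x\<in>H. \<forall>y\<in>H. x \<ominus>\<^bsub>D\<^esub> y \<in> H)"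
proof
  interpret D: ring D by fact
  assume "additive_subgroup H D"
  then interpret additive_subgroup H D .
  show "H \<subseteq> carrier D \<and> \<zero>\<^bsub>D\<^esub> \<in> H \<and> (\<forall>x\<in>H. \<forall>y\<in>H. x \<ominus>\<^bsub>D\<^esub> y \<in> H)"
    using a_subset by (auto simp: a_minus_def)
next
  interpret D: ring D by fact
  assume H: "H \<subseteq> carrier D \<and> \<zero>\<^bsub>D\<^esub> \<in> H \<and> (\<forall>x\<in>H. \<forall>y\<in>H. x \<ominus>\<^bsub>D\<^esub> y \<in> H)"
  have n: "\<ominus>\<^bsub>D\<^esub> x \<in> H" if x: "x \<in> H" for x
  proof -
    have "\<zero>\<^bsub>D\<^esub> \<ominus>\<^bsub>D\<^esub> x \<in> H" using H x by blast
    moreover have "x \<in> carrier D" using H x by blast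
    ultimately show ?thesis by (simp add: a_minus_def)
  qed
  have "x \<oplus>\<^bsub>D\<^esub> y \<in> H" if "x \<in> H" "y \<in> H" for x y
  proof -
    have "x \<oplus>\<^bsub>D\<^esub> y = x \<ominus>\<^bsub>D\<^esub> (\<ominus>\<^bsub>D\<^esub> y)" using that H by (auto simp: a_minus_def)
    moreover have "x \<ominus>\<^bsub>D\<^esub> (\<ominus>\<^bsub>D\<^esub> y) \<in> H" using H n that by blast
    ultimately show ?thesis by simp
  qed
  then show "additive_subgroup H D"
    using H n by (intro additive_subgroupI D.add.subgroupI) (auto simp: a_inv_def[symmetric])
qed

lemma closed_subgroup_iff:
  assumes "ring A"
  shows "additive_subgroup H (pow_ring S A) \<and> closedin (pow_top S A) H \<longleftrightarrow> closed_subgroup S A H"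
proof -
  interpret pointwise "pow_ring S A" S A by (rule pointwise_pow_ring[OF assms])
  have "(\<forall>x\<in>H. \<forall>y\<in>H. x \<ominus>\<^bsub>pow_ring S A\<^esub> y \<in> H) \<longleftrightarrow> (\<forall>x\<in>H. \<forall>y\<in>H. (\<lambda>n\<in>S. x n \<ominus>\<^bsub>A\<^esub> y n) \<in> H)"
    if "H \<subseteq> (\<Pi>\<^sub>E n\<in>S. carrier A)" using that minus_at by (auto simp: subset_iff)
  then show ?thesis
    unfolding additive_subgroup_iff_minus[OF ring_pow_ring[OF assms]] closedin_pow_top closed_subgroup_def
    by auto
qed

lemma closed_subgroupD:
  assumes "closed_subgroup S A H"
  shows "H \<subseteq> (\<Pi>\<^sub>E n\<in>S. carrier A)" "(\<lambda>n\<in>S. \<zero>\<^bsub>A\<^esub>) \<in> H"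
    "\<And>x y. x \<in> H \<Longrightarrow> y \<in> H \<Longrightarrow> (\<lambda>n\<in>S. x n \<ominus>\<^bsub>A\<^esub> y n) \<in> H"
    "\<And>x. x \<in> (\<Pi>\<^sub>E n\<in>S. carrier A) \<Longrightarrow> (\<And>F. finite F \<Longrightarrow> F \<subseteq> S \<Longrightarrow> \<exists>y\<in>H. \<forall>n\<in>F. y n = x n) \<Longrightarrow> x \<in> H"
  using assms unfolding closed_subgroup_def by (simp_all add: Ball_def)

lemma closed_subgroup_add:
  assumes A: "ring A" and H: "closed_subgroup S A H" and xy: "x \<in> H" "y \<in> H"
  shows "(\<lambda>n\<in>S. x n \<oplus>\<^bsub>A\<^esub> y n) \<in> H"
proof -
  have "additive_subgroup H (pow_ring S A)" using closed_subgroup_iff[OF A] H by blast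
  then show ?thesis using additive_subgroup.a_closed[OF _ xy] by fastforce
qed

lemma closed_subgroup_carrier:
  assumes "ring A" shows "closed_subgroup S A (\<Pi>\<^sub>E n\<in>S. carrier A)"
proof -
  interpret A: ring A by fact
  show ?thesis by (auto simp: closed_subgroup_def PiE_iff)
qed

lemma closed_subgroup_Inter:
  assumes "K \<noteq> {}" "\<And>H. H \<in> K \<Longrightarrow> closed_subgroup S A H"
  shows "closed_subgroup S A (\<Inter>K)"
  unfolding closed_subgroup_def
proof (intro conjI ballI impI)
  show "\<Inter>K \<subseteq> (\<Pi>\<^sub>E n\<in>S. carrier A)" using assms closed_subgroupD(1) by blast
  show "(\<lambda>n\<in>S. \<zero>\<^bsub>A\<^esub>) \<in> \<Inter>K" using assms(2) closed_subgroupD(2) by blast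
  show "(\<lambda>n\<in>S. x n \<ominus>\<^bsub>A\<^esub> y n) \<in> \<Inter>K" if "x \<in> \<Inter>K" "y \<in> \<Inter>K" for x y
  proof
    fix H assume H: "H \<in> K"
    show "(\<lambda>n\<in>S. x n \<ominus>\<^bsub>A\<^esub> y n) \<in> H"
      by (rule closed_subgroupD(3)[OF assms(2)[OF H]]) (use that H in auto)
  qed
  show "x \<in> \<Inter>K" if x: "x \<in> (\<Pi>\<^sub>E n\<in>S. carrier A)"
    and a: "\<forall>F. finite F \<longrightarrow> F \<subseteq> S \<longrightarrow> (\<exists>y\<in>\<Inter>K. \<forall>n\<in>F. y n = x n)" for x
  proof
    fix H assume H: "H \<in> K"
    show "x \<in> H"
    proof (rule closed_subgroupD(4)[OF assms(2)[OF H] x])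
      fix F :: "nat set" assume "finite F" "F \<subseteq> S"
      then have "\<exists>y\<in>\<Inter>K. \<forall>n\<in>F. y n = x n" using a by simp
      then show "\<exists>y\<in>H. \<forall>n\<in>F. y n = x n" using H by (elim bexE) (rule bexI, auto)
    qed
  qed
qed

text \<open>Coordinatewise additive maps are continuous homomorphisms. Together with the minimality
  of \<open>X\<^sub>S(I)\<close> this reduces statements on its elements to the generators.\<close>

lemma closed_subgroup_vimage:
  assumes A: "ring A" and B: "ring B" and \<phi>: "\<And>n. n \<in> S \<Longrightarrow> \<phi> n \<in> add_map A B" and H: "closed_subgroup S B H"
  shows "closed_subgroup S A {x \<in> (\<Pi>\<^sub>E n\<in>S. carrier A). (\<lambda>n\<in>S. \<phi> n (x n)) \<in> H}"
proof -
  interpret A: ring A by fact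
  show ?thesis
    unfolding closed_subgroup_def
  proof (intro conjI ballI impI)
    let ?H = "{x \<in> (\<Pi>\<^sub>E n\<in>S. carrier A). (\<lambda>n\<in>S. \<phi> n (x n)) \<in> H}"
    show "?H \<subseteq> (\<Pi>\<^sub>E n\<in>S. carrier A)" by blast
    have "(\<lambda>n\<in>S. \<phi> n ((\<lambda>n\<in>S. \<zero>\<^bsub>A\<^esub>) n)) = (\<lambda>n\<in>S. \<zero>\<^bsub>B\<^esub>)"
      using add_map_zero[OF \<phi> A B] by (auto intro!: restrict_ext)
    then show "(\<lambda>n\<in>S. \<zero>\<^bsub>A\<^esub>) \<in> ?H" using closed_subgroupD(2)[OF H] by auto
    show "(\<lambda>n\<in>S. x n \<ominus>\<^bsub>A\<^esub> y n) \<in> ?H" if "x \<in> ?H" "y \<in> ?H" for x y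
    proof -
      have "(\<lambda>n\<in>S. \<phi> n ((\<lambda>n\<in>S. x n \<ominus>\<^bsub>A\<^esub> y n) n))
          = (\<lambda>n\<in>S. (\<lambda>n\<in>S. \<phi> n (x n)) n \<ominus>\<^bsub>B\<^esub> (\<lambda>n\<in>S. \<phi> n (y n)) n)"
        using add_map_minus[OF \<phi> A B] that by (auto simp: PiE_iff intro!: restrict_ext)
      also have "\<dots> \<in> H" using that
        by (intro closed_subgroupD(3)[OF H, of "\<lambda>n\<in>S. \<phi> n (x n)" "\<lambda>n\<in>S. \<phi> n (y n)"]) blast+
      finally show ?thesis using that by (auto simp: PiE_iff)
    qed
    show "x \<in> ?H" if x: "x \<in> (\<Pi>\<^sub>E n\<in>S. carrier A)"
      and a: "\<forall>F. finite F \<longrightarrow> F \<subseteq> S \<longrightarrow> (\<exists>y\<in>?H. \<forall>n\<in>F. y n = x n)" for x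
    proof -
      have "(\<lambda>n\<in>S. \<phi> n (x n)) \<in> H"
      proof (rule closed_subgroupD(4)[OF H])
        show "(\<lambda>n\<in>S. \<phi> n (x n)) \<in> (\<Pi>\<^sub>E n\<in>S. carrier B)"
          using x add_map_closed[OF \<phi>] by (auto simp: PiE_iff)
        fix F assume F: "finite F" "F \<subseteq> S"
        then obtain y where y: "y \<in> ?H" "\<forall>n\<in>F. y n = x n" using a by (elim allE impE bexE) auto
        have "\<forall>n\<in>F. (\<lambda>n\<in>S. \<phi> n (y n)) n = (\<lambda>n\<in>S. \<phi> n (x n)) n" using y(2) F(2) by auto
        then show "\<exists>y\<in>H. \<forall>n\<in>F. y n = (\<lambda>n\<in>S. \<phi> n (x n)) n" using y(1) by blast
      qed
      then show ?thesis using x by blast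
    qed
  qed
qed

lemma ring_hom_add_pow:
  assumes "f \<in> add_map A B" "ring A" "ring B" "a \<in> carrier A"
  shows "f (add_pow A (n::nat) a) = add_pow B n (f a)"
proof -
  interpret abelian_group_hom A B f by (rule add_map_group_hom[OF assms(1-3)])
  show ?thesis using group_hom.hom_nat_pow[OF a_group_hom, of a n] assms(4) by (simp add: add_pow_def)
qed

lemma ring_hom_pow:
  assumes "f \<in> ring_hom A B" "ring A" "ring B" "a \<in> carrier A"
  shows "f (a [^]\<^bsub>A\<^esub> (n::nat)) = f a [^]\<^bsub>B\<^esub> n"
  using ring_hom_ring.hom_nat_pow[OF ring_hom_ringI2[OF assms(2,3,1)] assms(4)] .

lemma ring_hom_ver_seq:
  assumes f: "f \<in> ring_hom A B" and A: "ring A" and B: "ring B" and a: "a \<in> carrier A"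
  shows "f (ver_seq A n a \<nu>) = ver_seq B n (f a) \<nu>"
proof -
  interpret A: ring A by fact
  show ?thesis
    using ring_hom_add_pow[OF ring_hom_add_map[OF f] A B, of "a [^]\<^bsub>A\<^esub> (\<nu> div n)" n]
      ring_hom_pow[OF f A B a] add_map_zero[OF ring_hom_add_map[OF f] A B] a
    by (simp add: ver_seq_def)
qed

lemma ring_hom_ghost:
  assumes f: "f \<in> ring_hom A B" and A: "cring A" and B: "cring B" and a: "a \<in> UNIV \<rightarrow> carrier A"
  shows "f (ghost A a N \<nu>) = ghost B (\<lambda>n. f (a n)) N \<nu>"
proof (induct N)
  interpret A: cring A by fact
  interpret B: cring B by fact
  note rA = A.ring_axioms and rB = B.ring_axioms
  have fa: "(\<lambda>n. f (a n)) \<in> UNIV \<rightarrow> carrier B" using a ring_hom_closed[OF f] by auto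
  { case 0 show ?case using add_map_zero[OF ring_hom_add_map[OF f] rA rB] by simp }
  { case (Suc N)
    have aS: "a (Suc N) \<in> carrier A" using a by auto
    show ?case using Suc a fa aS
      by (simp add: A.ghost_Suc B.ghost_Suc ring_hom_add[OF f] ring_hom_ver_seq[OF f rA rB]) }
qed

locale truncated =
  fixes S :: "nat set"
  assumes trunc: "truncation_set S"
begin

lemma S_pos: "n \<in> S \<Longrightarrow> 0 < n"
  using trunc by (cases n) (auto simp: truncation_set_def)

lemma S_dvd: "n \<in> S \<Longrightarrow> d dvd n \<Longrightarrow> d \<in> S"
  using trunc by (auto simp: truncation_set_def)

lemma one_S: "1 \<in> S"
  using trunc S_dvd by (auto simp: truncation_set_def)

lemma Ver_pow_eq:
  assumes n: "n \<in> S" shows "Ver_pow S A n a = (\<lambda>\<nu>\<in>S. ver_seq A n a \<nu>)"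
proof -
  have "\<nu> div n \<in> trunc_quotient S n" if "\<nu> \<in> S" "n dvd \<nu>" for \<nu>
  proof -
    have "\<nu> div n * n = \<nu>" using that(2) by simp
    moreover have "0 < \<nu> div n" using S_pos[OF that(1)] S_pos[OF n] that(2) by (simp add: dvd_imp_le div_greater_zero_iff)
    ultimately show ?thesis using that(1) by (simp add: trunc_quotient_def)
  qed
  then show ?thesis unfolding Ver_pow_def Ver_def
    using S_pos by (auto simp: ver_seq_def intro!: restrict_ext)
qed

lemma Ver_pow_PiE:
  assumes "ring A" "n \<in> S" "a \<in> carrier A" shows "Ver_pow S A n a \<in> (\<Pi>\<^sub>E n\<in>S. carrier A)"
proof -
  interpret ring A by fact
  show ?thesis using assms by (auto simp: Ver_pow_eq ver_seq_def)
qed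

lemma X_group_eq:
  "ring A \<Longrightarrow> X_group S A I = \<Inter>{H. closed_subgroup S A H \<and> {Ver_pow S A n a | n a. n \<in> S \<and> a \<in> I} \<subseteq> H}"
  by (simp add: X_group_def hull_def closed_subgroup_iff)

lemma X_group_closed:
  assumes A: "ring A" and I: "I \<subseteq> carrier A"
  shows "closed_subgroup S A (X_group S A I)"
  unfolding X_group_eq[OF A]
proof (rule closed_subgroup_Inter)
  have "(\<Pi>\<^sub>E n\<in>S. carrier A) \<in> {H. closed_subgroup S A H \<and> {Ver_pow S A n a | n a. n \<in> S \<and> a \<in> I} \<subseteq> H}"
    using closed_subgroup_carrier[OF A] Ver_pow_PiE[OF A] I by blast
  then show "{H. closed_subgroup S A H \<and> {Ver_pow S A n a | n a. n \<in> S \<and> a \<in> I} \<subseteq> H} \<noteq> {}" by blast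
qed blast

lemma X_group_gen:
  assumes A: "ring A" and n: "n \<in> S" and a: "a \<in> I"
  shows "Ver_pow S A n a \<in> X_group S A I"
  unfolding X_group_eq[OF A]
proof (rule InterI)
  fix H assume "H \<in> {H. closed_subgroup S A H \<and> {Ver_pow S A n a | n a. n \<in> S \<and> a \<in> I} \<subseteq> H}"
  then have "{Ver_pow S A n a | n a. n \<in> S \<and> a \<in> I} \<subseteq> H" by (elim CollectE conjE)
  moreover have "Ver_pow S A n a \<in> {Ver_pow S A n a | n a. n \<in> S \<and> a \<in> I}" using n a by blast
  ultimately show "Ver_pow S A n a \<in> H" by (rule subsetD)
qed

lemma X_group_minimal:
  assumes A: "ring A" and H: "closed_subgroup S A H"
    and g: "\<And>n a. n \<in> S \<Longrightarrow> a \<in> I \<Longrightarrow> Ver_pow S A n a \<in> H"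
  shows "X_group S A I \<subseteq> H"
  unfolding X_group_eq[OF A]
proof (rule Inter_lower, rule CollectI, rule conjI[OF H])
  show "{Ver_pow S A n a | n a. n \<in> S \<and> a \<in> I} \<subseteq> H" using g by auto
qed

lemma X_group_PiE: "ring A \<Longrightarrow> I \<subseteq> carrier A \<Longrightarrow> X_group S A I \<subseteq> (\<Pi>\<^sub>E n\<in>S. carrier A)"
  using closed_subgroupD(1)[OF X_group_closed] .

lemma Ver_pow_map:
  assumes A: "ring A" and B: "ring B" and g: "g \<in> ring_hom A B" and n: "n \<in> S" and a: "a \<in> carrier A"
  shows "(\<lambda>k\<in>S. g (Ver_pow S A n a k)) = Ver_pow S B n (g a)"
  using a n by (auto simp: Ver_pow_eq ring_hom_ver_seq[OF g A B] intro!: restrict_ext)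

lemma X_group_map:
  assumes A: "ring A" and B: "ring B" and g: "g \<in> ring_hom A B" and I: "I \<subseteq> carrier A" and J: "J \<subseteq> carrier B"
    and IJ: "g ` I \<subseteq> J" and x: "x \<in> X_group S A I"
  shows "(\<lambda>n\<in>S. g (x n)) \<in> X_group S B J"
proof -
  let ?H = "{x \<in> (\<Pi>\<^sub>E n\<in>S. carrier A). (\<lambda>n\<in>S. g (x n)) \<in> X_group S B J}"
  have "X_group S A I \<subseteq> ?H"
  proof (rule X_group_minimal[OF A])
    show "closed_subgroup S A ?H"
      by (rule closed_subgroup_vimage[OF A B ring_hom_add_map[OF g] X_group_closed[OF B J]])
    fix n a assume n: "n \<in> S" and a: "a \<in> I"
    have "(\<lambda>k\<in>S. g (Ver_pow S A n a k)) = Ver_pow S B n (g a)"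
      using Ver_pow_map[OF A B g n] a I by blast
    then show "Ver_pow S A n a \<in> ?H"
      using Ver_pow_PiE[OF A n] a I X_group_gen[OF B n, of "g a" J] IJ by auto
  qed
  then show ?thesis using x by blast
qed

lemma X_group_nat_mult:
  assumes A: "ring A" and I: "I \<subseteq> carrier A" and x: "x \<in> X_group S A I"
  shows "(\<lambda>n\<in>S. add_pow A (k::nat) (x n)) \<in> X_group S A I"
proof (induct k)
  interpret A: ring A by fact
  note cl = X_group_closed[OF A I]
  have xc: "x n \<in> carrier A" if "n \<in> S" for n using closed_subgroupD(1)[OF cl] x that by auto
  { case 0 have "(\<lambda>n\<in>S. add_pow A (0::nat) (x n)) = (\<lambda>n\<in>S. \<zero>\<^bsub>A\<^esub>)" by (simp add: add_pow_def)
    then show ?case using closed_subgroupD(2)[OF cl] by (simp only:) }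
  { case (Suc k)
    have "(\<lambda>n\<in>S. add_pow A (Suc k) (x n)) = (\<lambda>n\<in>S. (\<lambda>n\<in>S. add_pow A k (x n)) n \<oplus>\<^bsub>A\<^esub> x n)"
      using xc by (auto intro!: restrict_ext)
    then show ?case using closed_subgroup_add[OF A cl Suc x] by (simp only:) }
qed

text \<open>For \<open>l = lcm n m\<close> one has \<open>V\<^sub>n\<langle>a\<rangle> V\<^sub>m\<langle>b\<rangle> = gcd n m V\<^sub>l\<langle>c\<rangle>\<close> with \<open>c = a\<^bsup>l/n\<^esup> b\<^bsup>l/m\<^esup> \<in> I\<close>
  if \<open>l \<in> S\<close>; otherwise the product vanishes on \<open>S\<close>, since no element of \<open>S\<close> is divisible by
  both \<open>n\<close> and \<open>m\<close>.\<close>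

lemma Ver_pow_mult:
  assumes A: "cring A" and I: "ideal I A" and n: "n \<in> S" and m: "m \<in> S" and a: "a \<in> I" and b: "b \<in> carrier A"
  shows "(\<lambda>\<nu>\<in>S. Ver_pow S A n a \<nu> \<otimes>\<^bsub>A\<^esub> Ver_pow S A m b \<nu>) \<in> X_group S A I"
proof -
  interpret A: cring A by fact
  interpret I: ideal I A by fact
  note rA = A.ring_axioms
  define l where "l = lcm n m"
  define c where "c = a [^]\<^bsub>A\<^esub> (l div n) \<otimes>\<^bsub>A\<^esub> b [^]\<^bsub>A\<^esub> (l div m)"
  have n0: "0 < n" "0 < m" using S_pos n m by auto
  have ac: "a \<in> carrier A" using a by simp
  have cc: "c \<in> carrier A" using ac b by (simp add: c_def)
  have "0 < l div n" using n0 by (auto simp: l_def div_greater_zero_iff lcm_pos_nat dvd_imp_le)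
  then obtain k where k: "l div n = Suc k" by (cases "l div n") auto
  have cI: "c \<in> I" using I.I_r_closed[OF I.I_l_closed[OF a]] ac b by (simp add: c_def k)
  have eq: "ver_seq A n a \<nu> \<otimes>\<^bsub>A\<^esub> ver_seq A m b \<nu> = add_pow A (gcd n m) (ver_seq A l c \<nu>)" for \<nu>
  proof (cases "0 < \<nu> \<and> l dvd \<nu>")
    case False
    then have "\<not> (0 < \<nu> \<and> n dvd \<nu> \<and> m dvd \<nu>)" by (auto simp: l_def)
    then show ?thesis using False ac b by (auto simp: ver_seq_def)
  next
    case True
    then have d: "n dvd \<nu>" "m dvd \<nu>" by (auto simp: l_def)
    obtain j where j: "\<nu> = l * j" using True by (auto elim: dvdE)
    have l0: "0 < l" using True by (auto intro: Nat.gr0I)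
    have jn: "\<nu> div n = (l div n) * j" "\<nu> div m = (l div m) * j"
      unfolding j by (auto simp: l_def div_mult_swap mult.commute)
    have "ver_seq A n a \<nu> \<otimes>\<^bsub>A\<^esub> ver_seq A m b \<nu>
        = add_pow A n (a [^]\<^bsub>A\<^esub> (\<nu> div n)) \<otimes>\<^bsub>A\<^esub> add_pow A m (b [^]\<^bsub>A\<^esub> (\<nu> div m))"
      using True d by (simp add: ver_seq_def)
    also have "\<dots> = add_pow A (n * m) (a [^]\<^bsub>A\<^esub> (\<nu> div n) \<otimes>\<^bsub>A\<^esub> b [^]\<^bsub>A\<^esub> (\<nu> div m))"
      using ac b by (simp add: A.add_pow_ldistr A.add_pow_rdistr A.add.nat_pow_pow mult.commute)
    also have "a [^]\<^bsub>A\<^esub> (\<nu> div n) \<otimes>\<^bsub>A\<^esub> b [^]\<^bsub>A\<^esub> (\<nu> div m) = c [^]\<^bsub>A\<^esub> j"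
      unfolding c_def jn using ac b by (simp add: A.nat_pow_pow[symmetric] A.nat_pow_distrib)
    also have "n * m = gcd n m * l" unfolding l_def by (rule prod_gcd_lcm_nat)
    also have "add_pow A (gcd n m * l) (c [^]\<^bsub>A\<^esub> j) = add_pow A (gcd n m) (add_pow A l (c [^]\<^bsub>A\<^esub> j))"
      using cc by (simp add: A.add.nat_pow_pow mult.commute)
    also have "\<dots> = add_pow A (gcd n m) (ver_seq A l c \<nu>)"
      using True j l0 by (simp add: ver_seq_def)
    finally show ?thesis .
  qed
  have e: "(\<lambda>\<nu>\<in>S. Ver_pow S A n a \<nu> \<otimes>\<^bsub>A\<^esub> Ver_pow S A m b \<nu>)
      = (\<lambda>\<nu>\<in>S. add_pow A (gcd n m) (ver_seq A l c \<nu>))"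
    using n m eq by (auto simp: Ver_pow_eq intro!: restrict_ext)
  show ?thesis
  proof (cases "l \<in> S")
    case True
    have "(\<lambda>\<nu>\<in>S. add_pow A (gcd n m) (ver_seq A l c \<nu>)) = (\<lambda>\<nu>\<in>S. add_pow A (gcd n m) (Ver_pow S A l c \<nu>))"
      using True by (auto simp: Ver_pow_eq intro!: restrict_ext)
    then show ?thesis unfolding e
      using X_group_nat_mult[OF rA I.a_subset X_group_gen[OF rA True cI]] by simp
  next
    case False
    then have "ver_seq A l c \<nu> = \<zero>\<^bsub>A\<^esub>" if "\<nu> \<in> S" for \<nu> using that S_dvd by (auto simp: ver_seq_def)
    then have "(\<lambda>\<nu>\<in>S. add_pow A (gcd n m) (ver_seq A l c \<nu>)) = (\<lambda>\<nu>\<in>S. \<zero>\<^bsub>A\<^esub>)"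
      by (auto intro!: restrict_ext)
    then show ?thesis unfolding e using closed_subgroupD(2)[OF X_group_closed[OF rA I.a_subset]] by (simp only:)
  qed
qed

text \<open>Reduction to generators in one factor at a time, as multiplication by a fixed element is
  coordinatewise additive.\<close>

lemma X_group_mult:
  assumes A: "cring A" and I: "ideal I A" and x: "x \<in> X_group S A I" and y: "y \<in> X_group S A (carrier A)"
  shows "(\<lambda>\<nu>\<in>S. x \<nu> \<otimes>\<^bsub>A\<^esub> y \<nu>) \<in> X_group S A I"
proof -
  interpret A: cring A by fact
  interpret I: ideal I A by fact
  note rA = A.ring_axioms
  note cl = X_group_closed[OF rA I.a_subset]
  have 1: "(\<lambda>\<nu>\<in>S. x \<nu> \<otimes>\<^bsub>A\<^esub> Ver_pow S A m b \<nu>) \<in> X_group S A I"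
    if m: "m \<in> S" and b: "b \<in> carrier A" and x: "x \<in> X_group S A I" for m b x
  proof -
    let ?H = "{x \<in> (\<Pi>\<^sub>E n\<in>S. carrier A). (\<lambda>n\<in>S. x n \<otimes>\<^bsub>A\<^esub> Ver_pow S A m b n) \<in> X_group S A I}"
    have "X_group S A I \<subseteq> ?H"
    proof (rule X_group_minimal[OF rA])
      show "closed_subgroup S A ?H"
        by (rule closed_subgroup_vimage[OF rA rA _ cl])
          (use Ver_pow_PiE[OF rA m b] in \<open>auto simp: add_map_def A.l_distr PiE_iff\<close>)
      show "Ver_pow S A n a \<in> ?H" if "n \<in> S" "a \<in> I" for n a
        using Ver_pow_mult[OF A I that(1) m that(2) b] Ver_pow_PiE[OF rA that(1)] that(2) by auto
    qed
    then show ?thesis using x by blast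
  qed
  have xP: "x \<in> (\<Pi>\<^sub>E n\<in>S. carrier A)" using X_group_PiE[OF rA I.a_subset] x by blast
  let ?H = "{y \<in> (\<Pi>\<^sub>E n\<in>S. carrier A). (\<lambda>n\<in>S. x n \<otimes>\<^bsub>A\<^esub> y n) \<in> X_group S A I}"
  have "X_group S A (carrier A) \<subseteq> ?H"
  proof (rule X_group_minimal[OF rA])
    show "closed_subgroup S A ?H"
      by (rule closed_subgroup_vimage[OF rA rA _ cl]) (use xP in \<open>auto simp: add_map_def A.r_distr PiE_iff\<close>)
    show "Ver_pow S A n a \<in> ?H" if "n \<in> S" "a \<in> carrier A" for n a
      using 1[OF that x] Ver_pow_PiE[OF rA that] by auto
  qed
  then show ?thesis using y by blast
qed

lemma X_ring_simps [simp]: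
  "carrier (X_ring S A) = X_group S A (carrier A)"
  "x \<otimes>\<^bsub>X_ring S A\<^esub> y = (\<lambda>n\<in>S. x n \<otimes>\<^bsub>A\<^esub> y n)"
  "\<one>\<^bsub>X_ring S A\<^esub> = (\<lambda>n\<in>S. \<one>\<^bsub>A\<^esub>)"
  "\<zero>\<^bsub>X_ring S A\<^esub> = (\<lambda>n\<in>S. \<zero>\<^bsub>A\<^esub>)"
  "x \<oplus>\<^bsub>X_ring S A\<^esub> y = (\<lambda>n\<in>S. x n \<oplus>\<^bsub>A\<^esub> y n)"
  by (simp_all add: X_ring_def pow_ring_def)

lemma X_group_one:
  assumes A: "ring A" shows "(\<lambda>n\<in>S. \<one>\<^bsub>A\<^esub>) \<in> X_group S A (carrier A)"
proof -
  interpret A: ring A by fact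
  have "Ver_pow S A 1 \<one>\<^bsub>A\<^esub> = (\<lambda>n\<in>S. \<one>\<^bsub>A\<^esub>)"
    unfolding Ver_pow_eq[OF one_S] using S_pos by (auto simp: ver_seq_def intro!: restrict_ext)
  then show ?thesis using X_group_gen[OF A one_S, of "\<one>\<^bsub>A\<^esub>" "carrier A"] by simp
qed

lemma ring_X_ring:
  assumes A: "cring A" shows "ring (X_ring S A)"
proof -
  interpret A: cring A by fact
  interpret P: ring "pow_ring S A" by (rule ring_pow_ring[OF A.ring_axioms])
  note cl = X_group_closed[OF A.ring_axioms subset_refl]
  have sg: "additive_subgroup (X_group S A (carrier A)) (pow_ring S A)"
    using closed_subgroup_iff[OF A.ring_axioms] cl by blast
  have "subring (X_group S A (carrier A)) (pow_ring S A)"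
  proof (rule P.subringI)
    show "X_group S A (carrier A) \<subseteq> carrier (pow_ring S A)"
      using closed_subgroupD(1)[OF cl] by simp
    show "\<one>\<^bsub>pow_ring S A\<^esub> \<in> X_group S A (carrier A)" using X_group_one[OF A.ring_axioms] by simp
    show "x \<otimes>\<^bsub>pow_ring S A\<^esub> y \<in> X_group S A (carrier A)"
      if "x \<in> X_group S A (carrier A)" "y \<in> X_group S A (carrier A)" for x y
      using X_group_mult[OF A A.oneideal that] by simp
    show "x \<oplus>\<^bsub>pow_ring S A\<^esub> y \<in> X_group S A (carrier A)"
      if "x \<in> X_group S A (carrier A)" "y \<in> X_group S A (carrier A)" for x y
      using additive_subgroup.a_closed[OF sg that] .
    show "\<ominus>\<^bsub>pow_ring S A\<^esub> x \<in> X_group S A (carrier A)" if "x \<in> X_group S A (carrier A)" for x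
      using additive_subgroup.a_inv_closed[OF sg that] .
  qed
  then show ?thesis unfolding X_ring_def by (rule P.subring_is_ring)
qed

lemma pointwise_X_ring: "cring A \<Longrightarrow> pointwise (X_ring S A) S A"
  using X_group_PiE[of A "carrier A"] by (simp add: pointwise_def ring_X_ring cring.axioms(1))

lemma X_ring_minus:
  assumes "cring A" "x \<in> X_group S A (carrier A)" "y \<in> X_group S A (carrier A)"
  shows "x \<ominus>\<^bsub>X_ring S A\<^esub> y = (\<lambda>n\<in>S. x n \<ominus>\<^bsub>A\<^esub> y n)"
  using pointwise.minus_at[OF pointwise_X_ring[OF assms(1)], of x y] assms(2,3) by simp

lemma X_group_mono:
  assumes "ring A" "I \<subseteq> J" "J \<subseteq> carrier A" shows "X_group S A I \<subseteq> X_group S A J"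
  by (rule X_group_minimal[OF assms(1) X_group_closed[OF assms(1,3)]]) (use assms(2) in \<open>auto intro: X_group_gen[OF assms(1)]\<close>)

lemma ideal_X_group:
  assumes A: "cring A" and I: "ideal I A" shows "ideal (X_group S A I) (X_ring S A)"
proof -
  interpret A: cring A by fact
  interpret I: ideal I A by fact
  note rA = A.ring_axioms
  note cl = X_group_closed[OF rA I.a_subset]
  have sub: "X_group S A I \<subseteq> X_group S A (carrier A)" by (rule X_group_mono[OF rA I.a_subset subset_refl])
  show ?thesis
  proof (rule idealI[OF ring_X_ring[OF A]])
    have "x \<ominus>\<^bsub>X_ring S A\<^esub> y \<in> X_group S A I" if "x \<in> X_group S A I" "y \<in> X_group S A I" for x y
    proof -
      have "x \<in> X_group S A (carrier A)" "y \<in> X_group S A (carrier A)" using that sub by blast+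
      then show ?thesis using closed_subgroupD(3)[OF cl that] by (simp only: X_ring_minus[OF A])
    qed
    then have "additive_subgroup (X_group S A I) (X_ring S A)"
      using sub closed_subgroupD(2)[OF cl] unfolding additive_subgroup_iff_minus[OF ring_X_ring[OF A]] by simp
    then show "subgroup (X_group S A I) (add_monoid (X_ring S A))" by (rule additive_subgroup.a_subgroup)
    fix x y assume x: "x \<in> X_group S A I" and y: "y \<in> carrier (X_ring S A)"
    show "x \<otimes>\<^bsub>X_ring S A\<^esub> y \<in> X_group S A I" using X_group_mult[OF A I x] y by simp
    have "y \<otimes>\<^bsub>X_ring S A\<^esub> x = x \<otimes>\<^bsub>X_ring S A\<^esub> y"
      using x y sub X_group_PiE[OF rA subset_refl] by (auto intro!: restrict_ext A.m_comm simp: subset_iff PiE_iff)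
    then show "y \<otimes>\<^bsub>X_ring S A\<^esub> x \<in> X_group S A I" using X_group_mult[OF A I x] y by simp
  qed
qed

lemma X_ring_hom:
  assumes A: "cring A" and B: "cring B" and g: "g \<in> ring_hom A B"
  shows "(\<lambda>x. \<lambda>n\<in>S. g (x n)) \<in> ring_hom (X_ring S A) (X_ring S B)"
proof -
  have rA: "ring A" and rB: "ring B" using cring.axioms(1)[OF A] cring.axioms(1)[OF B] by blast+
  have xc: "x n \<in> carrier A" if "x \<in> X_group S A (carrier A)" "n \<in> S" for x n
    using that X_group_PiE[OF rA subset_refl] by auto
  show ?thesis
  proof (rule ring_hom_memI)
    fix x assume "x \<in> carrier (X_ring S A)"
    then have x: "x \<in> X_group S A (carrier A)" by simp
    have "g ` carrier A \<subseteq> carrier B" using ring_hom_closed[OF g] by blast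
    from X_group_map[OF rA rB g subset_refl subset_refl this x]
    show "(\<lambda>n\<in>S. g (x n)) \<in> carrier (X_ring S B)" by (simp only: X_ring_simps)
  next
    fix x y assume "x \<in> carrier (X_ring S A)" "y \<in> carrier (X_ring S A)"
    then show "(\<lambda>n\<in>S. g ((x \<otimes>\<^bsub>X_ring S A\<^esub> y) n)) = (\<lambda>n\<in>S. g (x n)) \<otimes>\<^bsub>X_ring S B\<^esub> (\<lambda>n\<in>S. g (y n))"
      by (auto simp: xc ring_hom_mult[OF g] intro!: restrict_ext)
  next
    fix x y assume "x \<in> carrier (X_ring S A)" "y \<in> carrier (X_ring S A)"
    then show "(\<lambda>n\<in>S. g ((x \<oplus>\<^bsub>X_ring S A\<^esub> y) n)) = (\<lambda>n\<in>S. g (x n)) \<oplus>\<^bsub>X_ring S B\<^esub> (\<lambda>n\<in>S. g (y n))"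
      by (auto simp: xc ring_hom_add[OF g] intro!: restrict_ext)
  qed (auto simp: ring_hom_one[OF g] intro!: restrict_ext)
qed

end

section \<open>Witt components\<close>

text \<open>The convergent sum \<open>\<Sum> V\<^sub>n\<langle>a\<^sub>n\<rangle>\<close> over \<open>n \<in> S\<close>; components outside of \<open>S\<close> are replaced by
  zero.\<close>

definition witt :: "nat set \<Rightarrow> ('a, 'm) ring_scheme \<Rightarrow> (nat \<Rightarrow> 'a) \<Rightarrow> nat \<Rightarrow> 'a"
  where "witt S A a = (\<lambda>\<nu>\<in>S. ghost A (\<lambda>n. if n \<in> S then a n else \<zero>\<^bsub>A\<^esub>) \<nu> \<nu>)"

context truncated begin

lemma witt_ghost:
  assumes "cring A" "c \<in> UNIV \<rightarrow> carrier A"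
  shows "(\<lambda>\<nu>\<in>S. ghost A c \<nu> \<nu>) = witt S A c"
proof -
  interpret A: cring A by fact
  show ?thesis unfolding witt_def
    by (intro restrict_ext A.ghost_cong) (use assms(2) S_dvd in \<open>auto simp: Pi_iff\<close>)
qed

lemma witt_cong:
  assumes "cring A" "a \<in> S \<rightarrow> carrier A" "b \<in> S \<rightarrow> carrier A" "\<nu> \<in> S" "\<And>n. n dvd \<nu> \<Longrightarrow> a n = b n"
  shows "witt S A a \<nu> = witt S A b \<nu>"
proof -
  interpret A: cring A by fact
  show ?thesis unfolding witt_def using assms(4)
    by (auto intro!: A.ghost_cong) (use assms in \<open>auto simp: Pi_iff\<close>)
qed

lemma witt_map:
  assumes g: "g \<in> ring_hom A B" and A: "cring A" and B: "cring B" and a: "a \<in> S \<rightarrow> carrier A"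
  shows "(\<lambda>n\<in>S. g (witt S A a n)) = witt S B (\<lambda>n. g (a n))"
proof -
  interpret A: cring A by fact
  interpret B: cring B by fact
  let ?a = "\<lambda>n. if n \<in> S then a n else \<zero>\<^bsub>A\<^esub>"
  have "?a \<in> UNIV \<rightarrow> carrier A" using a by auto
  moreover have "(\<lambda>n. g (?a n)) = (\<lambda>n. if n \<in> S then g (a n) else \<zero>\<^bsub>B\<^esub>)"
    using add_map_zero[OF ring_hom_add_map[OF g] A.ring_axioms B.ring_axioms] by auto
  ultimately show ?thesis
    unfolding witt_def by (auto simp: ring_hom_ghost[OF g A B] intro!: restrict_ext)
qed

text \<open>The partial sums lie in the closed subgroup \<open>X\<^sub>S(I)\<close>, and the sum up to \<open>Max F\<close> has the
  right coordinates on \<open>F\<close>.\<close>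

lemma witt_in_X_group:
  assumes A: "cring A" and I: "I \<subseteq> carrier A" and a: "a \<in> S \<rightarrow> I"
  shows "witt S A a \<in> X_group S A I"
proof -
  interpret A: cring A by fact
  note rA = A.ring_axioms
  note cl = X_group_closed[OF rA I]
  let ?a = "\<lambda>n. if n \<in> S then a n else \<zero>\<^bsub>A\<^esub>"
  have ac: "?a \<in> UNIV \<rightarrow> carrier A" using a I by (auto simp: Pi_iff)
  have part: "(\<lambda>\<nu>\<in>S. ghost A ?a N \<nu>) \<in> X_group S A I" for N
  proof (induct N)
    case 0
    then show ?case using closed_subgroupD(2)[OF cl] by (simp only: A.ghost_0)
  next
    case (Suc N)
    show ?case
    proof (cases "Suc N \<in> S")
      case True
      have "(\<lambda>\<nu>\<in>S. ghost A ?a (Suc N) \<nu>) =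
          (\<lambda>\<nu>\<in>S. Ver_pow S A (Suc N) (a (Suc N)) \<nu> \<oplus>\<^bsub>A\<^esub> (\<lambda>\<nu>\<in>S. ghost A ?a N \<nu>) \<nu>)"
        using True by (intro restrict_ext) (simp add: A.ghost_Suc[OF ac] Ver_pow_eq)
      moreover have "a (Suc N) \<in> I" using a True by auto
      ultimately show ?thesis
        using closed_subgroup_add[OF rA cl X_group_gen[OF rA True] Suc] by (simp only:)
    next
      case False
      have "ver_seq A (Suc N) \<zero>\<^bsub>A\<^esub> \<nu> = \<zero>\<^bsub>A\<^esub>" for \<nu>
        by (auto simp: ver_seq_def A.nat_pow_zero dvd_imp_le div_greater_zero_iff)
      then have "(\<lambda>\<nu>\<in>S. ghost A ?a (Suc N) \<nu>) = (\<lambda>\<nu>\<in>S. ghost A ?a N \<nu>)"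
        using False A.ghost_closed[OF ac] by (intro restrict_ext) (simp add: A.ghost_Suc[OF ac])
      then show ?thesis using Suc by (simp only:)
    qed
  qed
  show ?thesis
  proof (rule closed_subgroupD(4)[OF cl])
    show "witt S A a \<in> (\<Pi>\<^sub>E n\<in>S. carrier A)" using A.ghost_closed[OF ac] by (auto simp: witt_def)
    fix F assume F: "finite F" "F \<subseteq> S"
    have "\<forall>n\<in>F. (\<lambda>\<nu>\<in>S. ghost A ?a (Max F) \<nu>) n = witt S A a n"
    proof
      fix n assume n: "n \<in> F"
      then have n': "0 < n" "n \<le> Max F" "n \<in> S" using F S_pos by auto
      show "(\<lambda>\<nu>\<in>S. ghost A ?a (Max F) \<nu>) n = witt S A a n"
        unfolding witt_def using n'(3) A.ghost_stable[OF ac n'(1,2)] by (simp only: restrict_apply if_True)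
    qed
    then show "\<exists>y\<in>X_group S A I. \<forall>n\<in>F. y n = witt S A a n" using part by blast
  qed
qed

text \<open>The recursion that determines \<open>a\<^sub>m\<close> involves only the coordinates at divisors of \<open>m\<close>.
  This finiteness is used for limits and for openness of maps between quotients.\<close>

lemma witt_inj:
  assumes A: "torsion_free_cring A" and a: "a \<in> S \<rightarrow> carrier A" and b: "b \<in> S \<rightarrow> carrier A" and m: "m \<in> S"
    and eq: "\<And>\<nu>. \<nu> dvd m \<Longrightarrow> witt S A a \<nu> = witt S A b \<nu>"
  shows "a m = b m"
proof -
  interpret A: torsion_free_cring A by fact
  let ?a = "\<lambda>n. if n \<in> S then a n else \<zero>\<^bsub>A\<^esub>" let ?b = "\<lambda>n. if n \<in> S then b n else \<zero>\<^bsub>A\<^esub>"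
  have "?a m = ?b m"
  proof (rule A.ghost_inj)
    show "?a \<in> UNIV \<rightarrow> carrier A" "?b \<in> UNIV \<rightarrow> carrier A" using a b by auto
    show "0 < m" using S_pos[OF m] .
    show "ghost A ?a \<nu> \<nu> = ghost A ?b \<nu> \<nu>" if "0 < \<nu>" "\<nu> dvd m" for \<nu>
      using eq[OF that(2)] S_dvd[OF m that(2)] by (simp add: witt_def)
  qed
  then show ?thesis using m by simp
qed

lemma Ver_pow_eq_witt:
  assumes cA: "cring A" and n: "n \<in> S" and a: "a \<in> carrier A"
  shows "Ver_pow S A n a = witt S A (\<lambda>k. if k = n then a else \<zero>\<^bsub>A\<^esub>)"
proof -
  interpret A: cring A by fact
  let ?a = "\<lambda>k. if k = n then a else \<zero>\<^bsub>A\<^esub>"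
  have ac: "?a \<in> UNIV \<rightarrow> carrier A" using a by auto
  have g: "ghost A ?a N \<nu> = (if n \<le> N then ver_seq A n a \<nu> else \<zero>\<^bsub>A\<^esub>)" for N \<nu>
  proof (induct N)
    case (Suc N)
    have "ver_seq A (Suc N) \<zero>\<^bsub>A\<^esub> \<nu> = \<zero>\<^bsub>A\<^esub>"
      by (auto simp: ver_seq_def A.nat_pow_zero dvd_imp_le div_greater_zero_iff)
    then show ?case using Suc ac a by (auto simp: A.ghost_Suc[OF ac] le_Suc_eq)
  qed (use S_pos[OF n] in auto)
  have "Ver_pow S A n a = (\<lambda>\<nu>\<in>S. ghost A ?a \<nu> \<nu>)"
    unfolding Ver_pow_eq[OF n] g using S_pos by (auto simp: ver_seq_def dvd_imp_le intro!: restrict_ext)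
  also have "\<dots> = witt S A ?a" by (rule witt_ghost[OF cA ac])
  finally show ?thesis .
qed

text \<open>The right hand side contains the generators, so it has to be a closed subgroup. For
  differences, \<open>ghost_diff\<close> gives Witt components that are correct on a prescribed finite set
  of coordinates, so closedness is all that is left. For closedness, the approximations on the
  divisors of different \<open>m\<close> have compatible components by uniqueness.\<close>

lemma X_group_eq_witt:
  assumes A: "torsion_free_cring A" and I: "ideal I A"
  shows "X_group S A I = witt S A ` (S \<rightarrow> I)"
proof
  interpret A: torsion_free_cring A by fact
  interpret I: ideal I A by fact
  note cA = A.is_cring and rA = A.ring_axioms
  have IC: "f \<in> S \<rightarrow> carrier A" if "f \<in> S \<rightarrow> I" for f using that by (auto simp: Pi_iff)
  show "witt S A ` (S \<rightarrow> I) \<subseteq> X_group S A I" using witt_in_X_group[OF cA I.a_subset] by blast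
  have wc: "witt S A a \<in> (\<Pi>\<^sub>E n\<in>S. carrier A)" if "a \<in> S \<rightarrow> I" for a
    using witt_in_X_group[OF cA subset_refl IC[OF that]] X_group_PiE[OF rA subset_refl] by blast
  have closed: "x \<in> witt S A ` (S \<rightarrow> I)" if x: "x \<in> (\<Pi>\<^sub>E n\<in>S. carrier A)"
    and ex: "\<And>F. finite F \<Longrightarrow> F \<subseteq> S \<Longrightarrow> \<exists>y\<in>witt S A ` (S \<rightarrow> I). \<forall>n\<in>F. y n = x n" for x
  proof -
    have "\<exists>b\<in>S \<rightarrow> I. \<forall>d. d dvd m \<longrightarrow> witt S A b d = x d" if m: "m \<in> S" for m
    proof -
      have "finite {d. d dvd m}" "{d. d dvd m} \<subseteq> S" using S_pos[OF m] S_dvd[OF m] by auto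
      from ex[OF this] show ?thesis by auto
    qed
    then obtain b where bI: "\<And>m. m \<in> S \<Longrightarrow> b m \<in> S \<rightarrow> I"
      and bx: "\<And>m d. m \<in> S \<Longrightarrow> d dvd m \<Longrightarrow> witt S A (b m) d = x d" by metis
    \<comment> \<open>The components of \<open>b m\<close> are significant only at divisors of \<open>m\<close>.\<close>
    define c where "c m = b m m" for m
    have cI: "c \<in> S \<rightarrow> I"
    proof
      show "c m \<in> I" if "m \<in> S" for m using bI[OF that] that by (auto simp: c_def)
    qed
    have bc: "b m d = c d" if m: "m \<in> S" and d: "d dvd m" for m d
      unfolding c_def
    proof (rule witt_inj[OF A, where a = "b m" and b = "b d"])
      show dS: "d \<in> S" by (rule S_dvd[OF m d])
      show "b m \<in> S \<rightarrow> carrier A" "b d \<in> S \<rightarrow> carrier A" using IC bI m dS by blast+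
      show "witt S A (b m) \<nu> = witt S A (b d) \<nu>" if "\<nu> dvd d" for \<nu>
        using bx[OF m dvd_trans[OF that d]] bx[OF dS that] by simp
    qed
    have "witt S A c = x"
    proof (rule extensionalityI)
      show "witt S A c \<in> extensional S" by (simp add: witt_def)
      show "x \<in> extensional S" using x by (simp add: PiE_def)
      show "witt S A c m = x m" if m: "m \<in> S" for m
        using witt_cong[OF cA IC[OF cI] IC[OF bI[OF m]] m] bc[OF m] bx[OF m dvd_refl] by simp
    qed
    then show ?thesis using cI by blast
  qed
  show "X_group S A I \<subseteq> witt S A ` (S \<rightarrow> I)"
  proof (rule X_group_minimal[OF rA])
    fix n a assume n: "n \<in> S" and a: "a \<in> I"
    have "Ver_pow S A n a = witt S A (\<lambda>k. if k = n then a else \<zero>\<^bsub>A\<^esub>)"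
      using Ver_pow_eq_witt[OF cA n] a by simp
    then show "Ver_pow S A n a \<in> witt S A ` (S \<rightarrow> I)" using a by auto
  next
    show "closed_subgroup S A (witt S A ` (S \<rightarrow> I))"
      unfolding closed_subgroup_def
    proof (intro conjI ballI impI)
      show "witt S A ` (S \<rightarrow> I) \<subseteq> (\<Pi>\<^sub>E n\<in>S. carrier A)" using wc by blast
      show "x \<in> witt S A ` (S \<rightarrow> I)" if "x \<in> (\<Pi>\<^sub>E n\<in>S. carrier A)"
        "\<forall>F. finite F \<longrightarrow> F \<subseteq> S \<longrightarrow> (\<exists>y\<in>witt S A ` (S \<rightarrow> I). \<forall>n\<in>F. y n = x n)" for x
        by (rule closed[OF that(1)]) (use that(2) in simp)
      have diff: "(\<lambda>n\<in>S. x n \<ominus>\<^bsub>A\<^esub> y n) \<in> witt S A ` (S \<rightarrow> I)"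
        if xw: "x \<in> witt S A ` (S \<rightarrow> I)" and yw: "y \<in> witt S A ` (S \<rightarrow> I)" for x y
      proof -
        obtain a b where a: "a \<in> S \<rightarrow> I" "x = witt S A a" and b: "b \<in> S \<rightarrow> I" "y = witt S A b"
          using xw yw by blast
        let ?a = "\<lambda>n. if n \<in> S then a n else \<zero>\<^bsub>A\<^esub>" let ?b = "\<lambda>n. if n \<in> S then b n else \<zero>\<^bsub>A\<^esub>"
        have aI: "?a \<in> UNIV \<rightarrow> I" and bI: "?b \<in> UNIV \<rightarrow> I" using a b by auto
        have "x \<in> (\<Pi>\<^sub>E n\<in>S. carrier A)" "y \<in> (\<Pi>\<^sub>E n\<in>S. carrier A)" using wc a b by blast+
        then have xy: "(\<lambda>n\<in>S. x n \<ominus>\<^bsub>A\<^esub> y n) \<in> (\<Pi>\<^sub>E n\<in>S. carrier A)" by (auto simp: PiE_iff)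
        show ?thesis
        proof (rule closed[OF xy])
          fix F assume F: "finite F" "F \<subseteq> S"
          obtain c where c: "c \<in> UNIV \<rightarrow> I" and
            cd: "\<And>\<nu>. 0 < \<nu> \<Longrightarrow> \<nu> \<le> Max F \<Longrightarrow> ghost A ?a \<nu> \<nu> \<ominus>\<^bsub>A\<^esub> ghost A ?b \<nu> \<nu> = ghost A c \<nu> \<nu>"
            using A.ghost_diff[OF I aI bI, of "Max F"] by auto
          have cc: "c \<in> UNIV \<rightarrow> carrier A" using c by (auto simp: Pi_iff)
          have "\<forall>n\<in>F. witt S A c n = (\<lambda>n\<in>S. x n \<ominus>\<^bsub>A\<^esub> y n) n"
          proof
            fix n assume n: "n \<in> F"
            then have n': "0 < n" "n \<le> Max F" "n \<in> S" using F S_pos by auto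
            have "witt S A c n = ghost A c n n" using fun_cong[OF witt_ghost[OF cA cc], of n] n'(3) by simp
            moreover have "x n = ghost A ?a n n" "y n = ghost A ?b n n"
              unfolding a(2) b(2) witt_def using n'(3) by (simp_all only: restrict_apply if_True)
            ultimately show "witt S A c n = (\<lambda>n\<in>S. x n \<ominus>\<^bsub>A\<^esub> y n) n"
              using cd[OF n'(1,2)] n'(3) by (simp only: restrict_apply if_True)
          qed
          then show "\<exists>z\<in>witt S A ` (S \<rightarrow> I). \<forall>n\<in>F. z n = (\<lambda>n\<in>S. x n \<ominus>\<^bsub>A\<^esub> y n) n"
            using c by (intro bexI[of _ "witt S A c"] imageI) auto
        qed
      qed
      show "(\<lambda>n\<in>S. x n \<ominus>\<^bsub>A\<^esub> y n) \<in> witt S A ` (S \<rightarrow> I)"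
        if "x \<in> witt S A ` (S \<rightarrow> I)" "y \<in> witt S A ` (S \<rightarrow> I)" for x y
        using diff that by blast
      have w0: "witt S A (\<lambda>_. \<zero>\<^bsub>A\<^esub>) \<in> witt S A ` (S \<rightarrow> I)" by auto
      have "(\<lambda>n\<in>S. witt S A (\<lambda>_. \<zero>\<^bsub>A\<^esub>) n \<ominus>\<^bsub>A\<^esub> witt S A (\<lambda>_. \<zero>\<^bsub>A\<^esub>) n) = (\<lambda>n\<in>S. \<zero>\<^bsub>A\<^esub>)"
        using wc[of "\<lambda>_. \<zero>\<^bsub>A\<^esub>"] by (auto simp: A.r_neg a_minus_def PiE_iff intro!: restrict_ext)
      then show "(\<lambda>n\<in>S. \<zero>\<^bsub>A\<^esub>) \<in> witt S A ` (S \<rightarrow> I)" using diff[OF w0 w0] by (simp only:)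
    qed
  qed
qed

text \<open>Modulo \<open>X\<^sub>S(I)\<close> the components may be changed one at a time within their residue classes:
  the difference \<open>V\<^sub>n\<langle>a\<rangle> - V\<^sub>n\<langle>b\<rangle>\<close> is the logarithmic derivative of a power series in
  \<open>1 + t I[[t]]\<close>. The limit of these changes stays in the closed subgroup.\<close>

lemma witt_diff:
  assumes A: "torsion_free_cring A" and I: "ideal I A"
    and a: "a \<in> S \<rightarrow> carrier A" and b: "b \<in> S \<rightarrow> carrier A" and ab: "\<And>n. n \<in> S \<Longrightarrow> a n \<ominus>\<^bsub>A\<^esub> b n \<in> I"
  shows "(\<lambda>n\<in>S. witt S A a n \<ominus>\<^bsub>A\<^esub> witt S A b n) \<in> X_group S A I"
proof -
  interpret A: torsion_free_cring A by fact
  interpret I: ideal I A by fact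
  note cA = A.is_cring and rA = A.ring_axioms
  note cl = X_group_closed[OF rA I.a_subset]
  let ?a = "\<lambda>n. if n \<in> S then a n else \<zero>\<^bsub>A\<^esub>" let ?b = "\<lambda>n. if n \<in> S then b n else \<zero>\<^bsub>A\<^esub>"
  have ac: "?a \<in> UNIV \<rightarrow> carrier A" and bc: "?b \<in> UNIV \<rightarrow> carrier A" using a b by auto
  have abI: "?a n \<ominus>\<^bsub>A\<^esub> ?b n \<in> I" for n using ab by (auto simp: a_minus_def)
  have gen: "(\<lambda>\<nu>\<in>S. ver_seq A n (?a n) \<nu> \<ominus>\<^bsub>A\<^esub> ver_seq A n (?b n) \<nu>) \<in> X_group S A I" if n: "0 < n" for n
  proof -
    have "?a n \<in> carrier A" "?b n \<in> carrier A" using ac bc by blast+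
    from A.log_derivs_imp_ghost[OF I A.log_derivs_diff[OF I this abI n]]
    obtain c where c: "c \<in> UNIV \<rightarrow> I"
      "\<And>\<nu>. \<nu> > 0 \<Longrightarrow> ver_seq A n (?a n) \<nu> \<ominus>\<^bsub>A\<^esub> ver_seq A n (?b n) \<nu> = ghost A c \<nu> \<nu>" by blast
    have "(\<lambda>\<nu>\<in>S. ver_seq A n (?a n) \<nu> \<ominus>\<^bsub>A\<^esub> ver_seq A n (?b n) \<nu>) = (\<lambda>\<nu>\<in>S. ghost A c \<nu> \<nu>)"
      by (intro restrict_ext c(2) S_pos)
    also have "\<dots> = witt S A c" using c(1) by (intro witt_ghost[OF cA]) (auto simp: Pi_iff)
    also have "\<dots> \<in> X_group S A I" using c(1) by (intro witt_in_X_group[OF cA I.a_subset]) auto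
    finally show ?thesis .
  qed
  have part: "(\<lambda>\<nu>\<in>S. ghost A ?a N \<nu> \<ominus>\<^bsub>A\<^esub> ghost A ?b N \<nu>) \<in> X_group S A I" for N
  proof (induct N)
    case 0
    have "(\<lambda>\<nu>\<in>S. ghost A ?a 0 \<nu> \<ominus>\<^bsub>A\<^esub> ghost A ?b 0 \<nu>) = (\<lambda>\<nu>\<in>S. \<zero>\<^bsub>A\<^esub>)" by (simp add: a_minus_def)
    then show ?case using closed_subgroupD(2)[OF cl] by (simp only:)
  next
    case (Suc N)
    have c: "ver_seq A (Suc N) (?a (Suc N)) \<nu> \<in> carrier A" "ver_seq A (Suc N) (?b (Suc N)) \<nu> \<in> carrier A" for \<nu>
      using ac bc by (blast intro: A.ver_seq_closed)+
    have alg: "(p \<oplus>\<^bsub>A\<^esub> q) \<ominus>\<^bsub>A\<^esub> (r \<oplus>\<^bsub>A\<^esub> s) = (p \<ominus>\<^bsub>A\<^esub> r) \<oplus>\<^bsub>A\<^esub> (q \<ominus>\<^bsub>A\<^esub> s)"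
      if "p \<in> carrier A" "q \<in> carrier A" "r \<in> carrier A" "s \<in> carrier A" for p q r s
      using that by (simp add: a_minus_def A.minus_add A.a_ac)
    have "(\<lambda>\<nu>\<in>S. ghost A ?a (Suc N) \<nu> \<ominus>\<^bsub>A\<^esub> ghost A ?b (Suc N) \<nu>) =
        (\<lambda>\<nu>\<in>S. (\<lambda>\<nu>\<in>S. ver_seq A (Suc N) (?a (Suc N)) \<nu> \<ominus>\<^bsub>A\<^esub> ver_seq A (Suc N) (?b (Suc N)) \<nu>) \<nu>
          \<oplus>\<^bsub>A\<^esub> (\<lambda>\<nu>\<in>S. ghost A ?a N \<nu> \<ominus>\<^bsub>A\<^esub> ghost A ?b N \<nu>) \<nu>)"
      unfolding A.ghost_Suc[OF ac] A.ghost_Suc[OF bc]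
      by (intro restrict_ext) (simp only: restrict_apply if_True alg[OF c(1) A.ghost_closed[OF ac] c(2) A.ghost_closed[OF bc]])
    then show ?case
      using closed_subgroup_add[OF rA cl gen[of "Suc N"] Suc] by (simp only:)
  qed
  have wc: "witt S A a \<in> (\<Pi>\<^sub>E n\<in>S. carrier A)" "witt S A b \<in> (\<Pi>\<^sub>E n\<in>S. carrier A)"
    using witt_in_X_group[OF cA subset_refl] X_group_PiE[OF rA subset_refl] a b by blast+
  show ?thesis
  proof (rule closed_subgroupD(4)[OF cl])
    show "(\<lambda>n\<in>S. witt S A a n \<ominus>\<^bsub>A\<^esub> witt S A b n) \<in> (\<Pi>\<^sub>E n\<in>S. carrier A)" using wc by (auto simp: PiE_iff)
    fix F assume F: "finite F" "F \<subseteq> S"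
    have "\<forall>n\<in>F. (\<lambda>\<nu>\<in>S. ghost A ?a (Max F) \<nu> \<ominus>\<^bsub>A\<^esub> ghost A ?b (Max F) \<nu>) n
        = (\<lambda>n\<in>S. witt S A a n \<ominus>\<^bsub>A\<^esub> witt S A b n) n"
    proof
      fix n assume n: "n \<in> F"
      then have n': "0 < n" "n \<le> Max F" "n \<in> S" using F S_pos by auto
      show "(\<lambda>\<nu>\<in>S. ghost A ?a (Max F) \<nu> \<ominus>\<^bsub>A\<^esub> ghost A ?b (Max F) \<nu>) n
        = (\<lambda>n\<in>S. witt S A a n \<ominus>\<^bsub>A\<^esub> witt S A b n) n"
        unfolding witt_def using n'(3) A.ghost_stable[OF ac n'(1,2)] A.ghost_stable[OF bc n'(1,2)]
        by (simp only: restrict_apply if_True)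
    qed
    then show "\<exists>y\<in>X_group S A I. \<forall>n\<in>F. y n = (\<lambda>n\<in>S. witt S A a n \<ominus>\<^bsub>A\<^esub> witt S A b n) n"
      using part[of "Max F"] by (intro bexI)
  qed
qed

end

section \<open>The topological rings \<open>E\<^sub>S(R,\<pi>)\<close>\<close>

definition presents :: "('a, 'm) ring_scheme \<Rightarrow> ('r, 'n) ring_scheme \<Rightarrow> ('a \<Rightarrow> 'r) \<Rightarrow> bool"
  where "presents A R \<pi> \<longleftrightarrow> torsion_free_cring A \<and> cring R \<and> \<pi> \<in> ring_hom A R \<and> \<pi> ` carrier A = carrier R"

lemma presentsD:
  assumes "presents A R \<pi>"
  shows "torsion_free_cring A" "cring A" "ring A" "cring R" "ring R" "\<pi> \<in> ring_hom A R" "\<pi> ` carrier A = carrier R"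
  using assms torsion_free_cring.axioms(1)[of A] cring.axioms(1)[of A] cring.axioms(1)[of R]
  by (simp_all add: presents_def)

lemma mem_kernel: "a \<in> a_kernel A R \<pi> \<longleftrightarrow> a \<in> carrier A \<and> \<pi> a = \<zero>\<^bsub>R\<^esub>"
  by (simp add: a_kernel_def')

lemma ideal_kernel:
  assumes "presents A R \<pi>" shows "ideal (a_kernel A R \<pi>) A"
  using ring_hom_ring.kernel_is_ideal[OF ring_hom_ringI2[OF presentsD(3,5,6)[OF assms]]] .

lemma kernel_minus_iff:
  assumes P: "presents A R \<pi>" and "a \<in> carrier A" "b \<in> carrier A"
  shows "a \<ominus>\<^bsub>A\<^esub> b \<in> a_kernel A R \<pi> \<longleftrightarrow> \<pi> a = \<pi> b"
proof -
  note d = presentsD[OF P]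
  interpret A: ring A by (rule d(3))
  interpret R: ring R by (rule d(5))
  have "\<pi> (a \<ominus>\<^bsub>A\<^esub> b) = \<pi> a \<ominus>\<^bsub>R\<^esub> \<pi> b"
    using add_map_minus[OF ring_hom_add_map[OF d(6)] d(3,5)] assms by simp
  then show ?thesis using assms ring_hom_closed[OF d(6)] by (simp add: mem_kernel)
qed

lemma witt_eqI:
  assumes "\<And>n. n \<in> S \<Longrightarrow> a n = b n" shows "witt S A a = witt S A b"
proof -
  have "(\<lambda>n. if n \<in> S then a n else \<zero>\<^bsub>A\<^esub>) = (\<lambda>n. if n \<in> S then b n else \<zero>\<^bsub>A\<^esub>)" using assms by auto
  then show ?thesis by (simp only: witt_def)
qed

context truncated begin

lemma ideal_E:
  assumes "presents A R \<pi>"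
  shows "ideal (X_group S A (a_kernel A R \<pi>)) (X_ring S A)"
  by (rule ideal_X_group[OF presentsD(2)[OF assms] ideal_kernel[OF assms]])

lemma carrier_E_ring: "carrier (E_ring S A R \<pi>) = E_class S A R \<pi> ` X_group S A (carrier A)"
  by (simp add: E_ring_def carrier_Quot E_class_def)

lemma E_class_eq_iff:
  assumes P: "presents A R \<pi>" and x: "x \<in> X_group S A (carrier A)" and y: "y \<in> X_group S A (carrier A)"
  shows "E_class S A R \<pi> x = E_class S A R \<pi> y \<longleftrightarrow>
    (\<lambda>n\<in>S. x n \<ominus>\<^bsub>A\<^esub> y n) \<in> X_group S A (a_kernel A R \<pi>)"
  unfolding E_class_def
  using coset_eq_iff[OF ideal_E[OF P], of x y] x y X_ring_minus[OF presentsD(2)[OF P] x y] by (simp only: X_ring_simps)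

lemma E_class_witt_eq:
  assumes P: "presents A R \<pi>" and a: "a \<in> S \<rightarrow> carrier A" and b: "b \<in> S \<rightarrow> carrier A"
    and ab: "\<And>n. n \<in> S \<Longrightarrow> \<pi> (a n) = \<pi> (b n)"
  shows "E_class S A R \<pi> (witt S A a) = E_class S A R \<pi> (witt S A b)"
proof -
  note d = presentsD[OF P]
  have X: "witt S A c \<in> X_group S A (carrier A)" if "c \<in> S \<rightarrow> carrier A" for c
    by (rule witt_in_X_group[OF d(2) subset_refl that])
  have "a n \<ominus>\<^bsub>A\<^esub> b n \<in> a_kernel A R \<pi>" if "n \<in> S" for n
  proof -
    have "a n \<in> carrier A" "b n \<in> carrier A" using a b that by blast+
    then show ?thesis using kernel_minus_iff[OF P] ab[OF that] by blast
  qed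
  then show ?thesis
    using E_class_eq_iff[OF P X[OF a] X[OF b]] witt_diff[OF d(1) ideal_kernel[OF P] a b] by blast
qed

lemma X_group_carrier_witt:
  assumes "torsion_free_cring A" shows "X_group S A (carrier A) = witt S A ` (S \<rightarrow> carrier A)"
proof -
  interpret A: torsion_free_cring A by fact
  show ?thesis by (rule X_group_eq_witt[OF assms A.oneideal])
qed

lemma topspace_E_top:
  assumes "ring A"
  shows "topspace (E_top S A R \<pi>) = carrier (E_ring S A R \<pi>)"
  using X_group_PiE[OF assms subset_refl]
  by (simp add: E_top_def topspace_quot_topology carrier_E_ring pow_top_def Int_absorb1)

lemma Hausdorff_E_top:
  assumes P: "presents A R \<pi>" shows "Hausdorff_space (E_top S A R \<pi>)"
proof -
  note d = presentsD[OF P]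
  interpret A: ring A by (rule d(3))
  interpret pointwise "X_ring S A" S A by (rule pointwise_X_ring[OF d(2)])
  let ?K = "X_group S A (a_kernel A R \<pi>)" let ?X = "X_group S A (carrier A)"
  have KA: "a_kernel A R \<pi> \<subseteq> carrier A" by (auto simp: mem_kernel)
  have KX: "?K \<subseteq> ?X" by (rule X_group_mono[OF d(3) KA subset_refl])
  have XP: "?X \<subseteq> (\<Pi>\<^sub>E n\<in>S. carrier A)" by (rule X_group_PiE[OF d(3) subset_refl])
  have cl: "closed_subgroup S A ?K" by (rule X_group_closed[OF d(3) KA])
  have "closedin (subtopology (product_topology (\<lambda>_. discrete_topology (carrier A)) S) ?X) (?K \<inter> ?X)"
    unfolding closedin_subpower Int_absorb2[OF KX] Int_absorb2[OF XP]
  proof (intro conjI ballI impI KX)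
    fix x assume x: "x \<in> ?X" and a: "\<forall>F. finite F \<longrightarrow> F \<subseteq> S \<longrightarrow> (\<exists>y\<in>?K. \<forall>n\<in>F. y n = x n)"
    have "x \<in> (\<Pi>\<^sub>E n\<in>S. carrier A)" using x XP by blast
    then show "x \<in> ?K" by (rule closed_subgroupD(4)[OF cl]) (use a in simp)
  qed
  moreover have "x \<ominus>\<^bsub>X_ring S A\<^esub> y \<in> ?X" if "x \<in> ?X" "y \<in> ?X" for x y
    using ring.ring_simprules(4)[OF ring_X_ring[OF d(2)], of x y] that by simp
  ultimately show ?thesis unfolding E_top_def pow_top_def E_class_def
    by (intro Hausdorff_quot[OF ideal_E[OF P] _ XP _ refl]) auto
qed

text \<open>The map \<open>E\<^sub>S(R,\<pi>) \<rightarrow> E\<^sub>S(R',\<pi>')\<close> induced by a homomorphism \<open>g\<close> of the presenting rings.\<close>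

definition E_push ::
  "('b, 'm) ring_scheme \<Rightarrow> ('s, 'n) ring_scheme \<Rightarrow> ('b \<Rightarrow> 's) \<Rightarrow> ('a \<Rightarrow> 'b) \<Rightarrow> (nat \<Rightarrow> 'a) set \<Rightarrow> (nat \<Rightarrow> 'b) set"
  where "E_push B R' \<pi>' g =
    coset_map (X_ring S B) (X_group S B (a_kernel B R' \<pi>')) (\<lambda>x. \<lambda>n\<in>S. g (x n))"

context
  fixes A :: "('a, 'm) ring_scheme" and R :: "('r, 'n) ring_scheme" and \<pi> :: "'a \<Rightarrow> 'r"
    and B :: "('b, 'k) ring_scheme" and R' :: "('s, 'l) ring_scheme" and \<pi>' :: "'b \<Rightarrow> 's" and g :: "'a \<Rightarrow> 'b"
  assumes P: "presents A R \<pi>" and P': "presents B R' \<pi>'" and g: "g \<in> ring_hom A B"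
    and ker: "g ` a_kernel A R \<pi> \<subseteq> a_kernel B R' \<pi>'"
begin

lemma E_push_ker:
  "(\<lambda>x. \<lambda>n\<in>S. g (x n)) ` X_group S A (a_kernel A R \<pi>) \<subseteq> X_group S B (a_kernel B R' \<pi>')"
proof -
  have "a_kernel A R \<pi> \<subseteq> carrier A" "a_kernel B R' \<pi>' \<subseteq> carrier B" by (auto simp: mem_kernel)
  from X_group_map[OF presentsD(3)[OF P] presentsD(3)[OF P'] g this ker] show ?thesis by blast
qed

lemma E_push_class:
  assumes "x \<in> X_group S A (carrier A)"
  shows "E_push B R' \<pi>' g (E_class S A R \<pi> x) = E_class S B R' \<pi>' (\<lambda>n\<in>S. g (x n))"
  unfolding E_push_def E_class_def
  by (rule coset_map_coset[OF ideal_E[OF P] ideal_E[OF P']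
        ring_hom_add_map[OF X_ring_hom[OF presentsD(2)[OF P] presentsD(2)[OF P'] g]] E_push_ker])
    (use assms in simp)

lemma E_push_witt:
  assumes "a \<in> S \<rightarrow> carrier A"
  shows "E_push B R' \<pi>' g (E_class S A R \<pi> (witt S A a)) = E_class S B R' \<pi>' (witt S B (\<lambda>n. g (a n)))"
  unfolding E_push_class[OF witt_in_X_group[OF presentsD(2)[OF P] subset_refl assms]]
    witt_map[OF g presentsD(2)[OF P] presentsD(2)[OF P'] assms] ..

lemma E_push_hom: "E_push B R' \<pi>' g \<in> ring_hom (E_ring S A R \<pi>) (E_ring S B R' \<pi>')"
  unfolding E_push_def E_ring_def
  by (rule coset_map_ring_hom[OF ideal_E[OF P] ideal_E[OF P']
        X_ring_hom[OF presentsD(2)[OF P] presentsD(2)[OF P'] g] E_push_ker])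

lemma E_push_continuous: "continuous_map (E_top S A R \<pi>) (E_top S B R' \<pi>') (E_push B R' \<pi>' g)"
proof -
  note d = presentsD[OF P] and d' = presentsD[OF P']
  let ?X = "X_group S A (carrier A)" let ?Y = "X_group S B (carrier B)"
  have XP: "?X \<subseteq> (\<Pi>\<^sub>E n\<in>S. carrier A)" and YP: "?Y \<subseteq> (\<Pi>\<^sub>E n\<in>S. carrier B)"
    using X_group_PiE[OF d(3) subset_refl] X_group_PiE[OF d'(3) subset_refl] by blast+
  have gX: "(\<lambda>n\<in>S. g (x n)) \<in> ?Y" if "x \<in> ?X" for x
    by (rule X_group_map[OF d(3) d'(3) g subset_refl subset_refl _ that]) (use ring_hom_closed[OF g] in blast)
  have "continuous_map (subtopology (pow_top S A) ?X) (subtopology (pow_top S B) ?Y) (\<lambda>x. \<lambda>n\<in>S. g (x n))"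
    unfolding pow_top_def by (rule continuous_subpower) (use gX YP in blast)
  from continuous_map_compose[OF this continuous_map_quot_proj]
  have "continuous_map (subtopology (pow_top S A) ?X) (E_top S B R' \<pi>')
      (E_class S B R' \<pi>' \<circ> (\<lambda>x. \<lambda>n\<in>S. g (x n)))"
    unfolding E_top_def .
  then show ?thesis unfolding E_top_def[of S A]
  proof (rule continuous_map_from_quot)
    fix x assume "x \<in> topspace (subtopology (pow_top S A) ?X)"
    then have "x \<in> ?X" by simp
    then show "E_push B R' \<pi>' g (E_class S A R \<pi> x) = (E_class S B R' \<pi>' \<circ> (\<lambda>x. \<lambda>n\<in>S. g (x n))) x"
      using E_push_class by simp
  qed
qed

text \<open>If \<open>g\<close> is surjective and reflects the kernels, then Witt components can be lifted, and the
  uniqueness of Witt components in the target makes the induced map injective and open.\<close>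

context
  assumes surj: "g ` carrier A = carrier B"
    and ker_iff: "\<And>a. a \<in> carrier A \<Longrightarrow> g a \<in> a_kernel B R' \<pi>' \<Longrightarrow> a \<in> a_kernel A R \<pi>"
begin

lemma E_push_lift:
  assumes "b \<in> S \<rightarrow> carrier B"
  shows "\<exists>a\<in>S \<rightarrow> carrier A. \<forall>n\<in>S. g (a n) = b n"
proof -
  have "\<forall>n\<in>S. \<exists>a. a \<in> carrier A \<and> g a = b n" using assms surj by (metis (no_types, lifting) PiE imageE Pi_iff)
  then obtain a where "\<forall>n\<in>S. a n \<in> carrier A \<and> g (a n) = b n" by metis
  then show ?thesis by blast
qed

lemma E_push_inj: "inj_on (E_push B R' \<pi>' g) (carrier (E_ring S A R \<pi>))"
proof (rule inj_onI)
  note d = presentsD[OF P] and d' = presentsD[OF P']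
  interpret A: ring A by (rule d(3))
  interpret B: ring B by (rule d'(3))
  let ?X = "X_group S A (carrier A)"
  fix v w assume "v \<in> carrier (E_ring S A R \<pi>)" "w \<in> carrier (E_ring S A R \<pi>)"
    and eq: "E_push B R' \<pi>' g v = E_push B R' \<pi>' g w"
  then obtain x y where x: "x \<in> ?X" "v = E_class S A R \<pi> x" and y: "y \<in> ?X" "w = E_class S A R \<pi> y"
    unfolding carrier_E_ring by blast
  have xP: "x \<in> (\<Pi>\<^sub>E n\<in>S. carrier A)" "y \<in> (\<Pi>\<^sub>E n\<in>S. carrier A)"
    using x(1) y(1) X_group_PiE[OF d(3) subset_refl] by blast+
  have gX: "(\<lambda>n\<in>S. g (z n)) \<in> X_group S B (carrier B)" if "z \<in> ?X" for z
    by (rule X_group_map[OF d(3) d'(3) g subset_refl subset_refl _ that]) (use ring_hom_closed[OF g] in blast)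
  let ?z = "\<lambda>n\<in>S. x n \<ominus>\<^bsub>A\<^esub> y n"
  have z: "?z \<in> ?X" by (rule closed_subgroupD(3)[OF X_group_closed[OF d(3) subset_refl] x(1) y(1)])
  then obtain a where a: "a \<in> S \<rightarrow> carrier A" "?z = witt S A a" using X_group_carrier_witt[OF d(1)] by auto
  have "(\<lambda>n\<in>S. (\<lambda>n\<in>S. g (x n)) n \<ominus>\<^bsub>B\<^esub> (\<lambda>n\<in>S. g (y n)) n) \<in> X_group S B (a_kernel B R' \<pi>')"
    using eq E_class_eq_iff[OF P' gX[OF x(1)] gX[OF y(1)]] E_push_class[OF x(1)] E_push_class[OF y(1)] x(2) y(2) by simp
  also have "(\<lambda>n\<in>S. (\<lambda>n\<in>S. g (x n)) n \<ominus>\<^bsub>B\<^esub> (\<lambda>n\<in>S. g (y n)) n) = (\<lambda>n\<in>S. g (?z n))"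
    using add_map_minus[OF ring_hom_add_map[OF g] d(3) d'(3)] xP by (auto simp: PiE_iff intro!: restrict_ext)
  also have "\<dots> = witt S B (\<lambda>n. g (a n))" unfolding a(2) by (rule witt_map[OF g d(2) d'(2) a(1)])
  finally obtain c where c: "c \<in> S \<rightarrow> a_kernel B R' \<pi>'" "witt S B (\<lambda>n. g (a n)) = witt S B c"
    using X_group_eq_witt[OF d'(1) ideal_kernel[OF P']] by auto
  have "a n \<in> a_kernel A R \<pi>" if n: "n \<in> S" for n
  proof (rule ker_iff)
    show "a n \<in> carrier A" using a(1) n by blast
    have "g (a n) = c n"
    proof (rule witt_inj[OF d'(1) _ _ n, where a = "\<lambda>n. g (a n)" and b = c])
      show "(\<lambda>n. g (a n)) \<in> S \<rightarrow> carrier B" using a(1) ring_hom_closed[OF g] by blast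
      show "c \<in> S \<rightarrow> carrier B" using c(1) by (auto simp: mem_kernel Pi_iff)
    qed (simp add: c(2))
    then show "g (a n) \<in> a_kernel B R' \<pi>'" using c(1) n by auto
  qed
  then have "?z \<in> X_group S A (a_kernel A R \<pi>)"
    unfolding a(2) by (intro witt_in_X_group[OF d(2)]) (auto simp: mem_kernel)
  then show "v = w" using E_class_eq_iff[OF P x(1) y(1)] x(2) y(2) by blast
qed

lemma E_push_surj: "E_push B R' \<pi>' g ` carrier (E_ring S A R \<pi>) = carrier (E_ring S B R' \<pi>')"
proof
  note d = presentsD[OF P] and d' = presentsD[OF P']
  show "E_push B R' \<pi>' g ` carrier (E_ring S A R \<pi>) \<subseteq> carrier (E_ring S B R' \<pi>')"
    using ring_hom_closed[OF E_push_hom] by blast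
  show "carrier (E_ring S B R' \<pi>') \<subseteq> E_push B R' \<pi>' g ` carrier (E_ring S A R \<pi>)"
  proof
    fix w assume "w \<in> carrier (E_ring S B R' \<pi>')"
    then obtain b where b: "b \<in> S \<rightarrow> carrier B" "w = E_class S B R' \<pi>' (witt S B b)"
      unfolding carrier_E_ring X_group_carrier_witt[OF d'(1)] by blast
    obtain a where a: "a \<in> S \<rightarrow> carrier A" "\<forall>n\<in>S. g (a n) = b n" using E_push_lift[OF b(1)] by blast
    have "witt S B (\<lambda>n. g (a n)) = witt S B b" by (rule witt_eqI) (use a(2) in blast)
    then have "w = E_push B R' \<pi>' g (E_class S A R \<pi> (witt S A a))"
      unfolding b(2) E_push_witt[OF a(1)] by (simp only:)
    then show "w \<in> E_push B R' \<pi>' g ` carrier (E_ring S A R \<pi>)"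
      unfolding carrier_E_ring X_group_carrier_witt[OF d(1)] using a(1) by blast
  qed
qed

text \<open>A neighbourhood of an element is given by a finite set \<open>F\<close> of coordinates. If an element
  of the target agrees with \<open>x\<close> on all divisors of elements of \<open>F\<close>, then it has the same Witt
  components there, so a lift of \<open>x\<close> becomes a lift of this element by changing components that
  do not affect the coordinates in \<open>F\<close>.\<close>

lemma E_push_open: "open_map (E_top S A R \<pi>) (E_top S B R' \<pi>') (E_push B R' \<pi>' g)"
  unfolding open_map_def
proof (intro allI impI)
  note d = presentsD[OF P] and d' = presentsD[OF P']
  let ?X = "X_group S A (carrier A)" let ?Y = "X_group S B (carrier B)" let ?p = "E_push B R' \<pi>' g"
  have XP: "?X \<subseteq> (\<Pi>\<^sub>E n\<in>S. carrier A)" and YP: "?Y \<subseteq> (\<Pi>\<^sub>E n\<in>S. carrier B)"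
    using X_group_PiE[OF d(3) subset_refl] X_group_PiE[OF d'(3) subset_refl] by blast+
  have tX: "topspace (subtopology (pow_top S A) ?X) = ?X" "topspace (subtopology (pow_top S B) ?Y) = ?Y"
    using XP YP by (auto simp: pow_top_def)
  have gc: "(\<lambda>n. g (a n)) \<in> S \<rightarrow> carrier B" if "a \<in> S \<rightarrow> carrier A" for a
    using that ring_hom_closed[OF g] by blast
  fix U assume U: "openin (E_top S A R \<pi>) U"
  then have UE: "U \<subseteq> carrier (E_ring S A R \<pi>)" using openin_subset topspace_E_top[OF d(3)] by blast
  have oU: "openin (subtopology (pow_top S A) ?X) {x \<in> ?X. E_class S A R \<pi> x \<in> U}"
    using U unfolding E_top_def openin_quot_topology tX by blast
  show "openin (E_top S B R' \<pi>') (?p ` U)"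
    unfolding E_top_def openin_quot_topology tX
  proof
    have "?p ` U \<subseteq> carrier (E_ring S B R' \<pi>')" using UE E_push_surj by blast
    then show "?p ` U \<subseteq> E_class S B R' \<pi>' ` ?Y" by (simp add: carrier_E_ring)
    show "openin (subtopology (pow_top S B) ?Y) {x \<in> ?Y. E_class S B R' \<pi>' x \<in> ?p ` U}"
      unfolding pow_top_def openin_subpower Int_absorb2[OF YP]
    proof (intro conjI ballI)
      fix x assume "x \<in> {x \<in> ?Y. E_class S B R' \<pi>' x \<in> ?p ` U}"
      then have x: "x \<in> ?Y" and xU: "E_class S B R' \<pi>' x \<in> ?p ` U" by blast+
      obtain b where b: "b \<in> S \<rightarrow> carrier B" "x = witt S B b" using x X_group_carrier_witt[OF d'(1)] by blast
      obtain a where a: "a \<in> S \<rightarrow> carrier A" "\<forall>n\<in>S. g (a n) = b n" using E_push_lift[OF b(1)] by blast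
      have yX: "witt S A a \<in> ?X" using a X_group_carrier_witt[OF d(1)] by blast
      have "witt S B (\<lambda>n. g (a n)) = x" unfolding b(2) by (rule witt_eqI) (use a(2) in blast)
      then have "?p (E_class S A R \<pi> (witt S A a)) = E_class S B R' \<pi>' x"
        unfolding E_push_witt[OF a(1)] by (simp only:)
      then obtain u where u: "u \<in> U" "?p (E_class S A R \<pi> (witt S A a)) = ?p u" using xU by auto
      moreover have "E_class S A R \<pi> (witt S A a) \<in> carrier (E_ring S A R \<pi>)" using yX by (simp add: carrier_E_ring)
      ultimately have "E_class S A R \<pi> (witt S A a) \<in> U" using inj_onD[OF E_push_inj] UE by blast
      then have "witt S A a \<in> {x \<in> ?X. E_class S A R \<pi> x \<in> U}" using yX by blast
      then have "\<exists>F. finite F \<and> F \<subseteq> S \<and> (\<forall>y\<in>?X. (\<forall>n\<in>F. y n = witt S A a n) \<longrightarrow> y \<in> {x \<in> ?X. E_class S A R \<pi> x \<in> U})"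
        using oU unfolding pow_top_def openin_subpower Int_absorb2[OF XP] by (elim conjE) (erule bspec)
      then obtain F where F: "finite F" "F \<subseteq> S"
        and FU: "\<forall>y\<in>?X. (\<forall>n\<in>F. y n = witt S A a n) \<longrightarrow> y \<in> {x \<in> ?X. E_class S A R \<pi> x \<in> U}" by (elim exE conjE)
      define F' where "F' = {k. \<exists>n\<in>F. k dvd n}"
      have "F' = (\<Union>n\<in>F. {k. k dvd n})" by (auto simp: F'_def)
      moreover have "finite {k. k dvd n}" if "n \<in> F" for n using that F(2) S_pos by auto
      ultimately have F': "finite F'" "F' \<subseteq> S" using F S_dvd by (auto simp: F'_def)
      have "x' \<in> {x \<in> ?Y. E_class S B R' \<pi>' x \<in> ?p ` U}" if x': "x' \<in> ?Y" and ag: "\<forall>n\<in>F'. x' n = x n" for x'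
      proof -
        obtain b' where b': "b' \<in> S \<rightarrow> carrier B" "x' = witt S B b'" using x' X_group_carrier_witt[OF d'(1)] by blast
        obtain c where c: "c \<in> S \<rightarrow> carrier A" "\<forall>n\<in>S. g (c n) = b' n" using E_push_lift[OF b'(1)] by blast
        have bb: "b' n = b n" if n: "n \<in> F'" for n
        proof (rule witt_inj[OF d'(1) b'(1) b(1)])
          show "n \<in> S" using n F' by blast
          fix \<nu> assume "\<nu> dvd n"
          then have "\<nu> \<in> F'" using n dvd_trans by (auto simp: F'_def)
          then show "witt S B b' \<nu> = witt S B b \<nu>" using ag b(2) b'(2) by simp
        qed
        define a' where "a' n = (if n \<in> F' then a n else c n)" for n
        have a': "a' \<in> S \<rightarrow> carrier A" using a c by (auto simp: a'_def)
        have ga': "\<forall>n\<in>S. g (a' n) = b' n" using a c bb by (simp add: a'_def)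
        have "witt S B (\<lambda>n. g (a' n)) = x'" unfolding b'(2) by (rule witt_eqI) (use ga' in blast)
        then have e: "?p (E_class S A R \<pi> (witt S A a')) = E_class S B R' \<pi>' x'"
          unfolding E_push_witt[OF a'] by (simp only:)
        have "\<forall>n\<in>F. witt S A a' n = witt S A a n"
        proof
          fix n assume n: "n \<in> F"
          show "witt S A a' n = witt S A a n"
            by (rule witt_cong[OF d(2) a' a(1)]) (use n F in \<open>auto simp: a'_def F'_def\<close>)
        qed
        moreover have "witt S A a' \<in> ?X" using a' X_group_carrier_witt[OF d(1)] by blast
        ultimately have "E_class S A R \<pi> (witt S A a') \<in> U" using FU by blast
        then show ?thesis using e x' by (metis (mono_tags, lifting) imageI mem_Collect_eq)
      qed
      then show "\<exists>F. finite F \<and> F \<subseteq> S \<and>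
          (\<forall>y\<in>?Y. (\<forall>n\<in>F. y n = x n) \<longrightarrow> y \<in> {x \<in> ?Y. E_class S B R' \<pi>' x \<in> ?p ` U})"
        using F' by (intro exI[of _ F'] conjI ballI impI)
    qed blast
  qed
qed

lemma E_push_iso: "E_push B R' \<pi>' g \<in> ring_iso (E_ring S A R \<pi>) (E_ring S B R' \<pi>')"
  using E_push_hom E_push_inj E_push_surj by (simp add: ring_iso_def bij_betw_def)

lemma E_push_homeomorphic: "homeomorphic_map (E_top S A R \<pi>) (E_top S B R' \<pi>') (E_push B R' \<pi>' g)"
  using bijective_open_imp_homeomorphic_map[OF E_push_continuous E_push_open] E_push_inj E_push_surj
    topspace_E_top presentsD(3)[OF P] presentsD(3)[OF P'] by metis

end

end

end

section \<open>Monoid rings\<close>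

lemma poly_mapping_sum_single:
  "c = (\<Sum>k\<in>Poly_Mapping.keys c. Poly_Mapping.single k (Poly_Mapping.lookup c k))"
proof (rule poly_mapping_eqI)
  fix i
  have "Poly_Mapping.lookup (\<Sum>k\<in>Poly_Mapping.keys c. Poly_Mapping.single k (Poly_Mapping.lookup c k)) i
      = (\<Sum>k\<in>Poly_Mapping.keys c. if k = i then Poly_Mapping.lookup c i else 0)"
    by (auto simp: lookup_sum lookup_single when_def intro!: sum.cong)
  also have "\<dots> = Poly_Mapping.lookup c i" by (simp add: in_keys_iff)
  finally show "Poly_Mapping.lookup c i
      = Poly_Mapping.lookup (\<Sum>k\<in>Poly_Mapping.keys c. Poly_Mapping.single k (Poly_Mapping.lookup c k)) i" by simp
qed

lemma poly_mapping_induct [consumes 1, case_names zero single add]: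
  fixes c :: "'g \<Rightarrow>\<^sub>0 'k::comm_monoid_add"
  assumes "Poly_Mapping.keys c \<subseteq> Z"
    and zero: "P 0" and single: "\<And>g a. g \<in> Z \<Longrightarrow> P (Poly_Mapping.single g a)"
    and add: "\<And>c d. Poly_Mapping.keys c \<subseteq> Z \<Longrightarrow> Poly_Mapping.keys d \<subseteq> Z \<Longrightarrow> P c \<Longrightarrow> P d \<Longrightarrow> P (c + d)"
  shows "P c"
proof -
  have "P (\<Sum>k\<in>K. Poly_Mapping.single k (Poly_Mapping.lookup c k)) \<and>
      Poly_Mapping.keys (\<Sum>k\<in>K. Poly_Mapping.single k (Poly_Mapping.lookup c k)) \<subseteq> Z"
    if "finite K" "K \<subseteq> Z" for K
    using that
  proof (induct K rule: finite_induct)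
    case (insert k K)
    let ?s = "Poly_Mapping.single k (Poly_Mapping.lookup c k)"
    have ks: "Poly_Mapping.keys ?s \<subseteq> Z" using insert by (auto split: if_splits)
    show ?case using insert ks single[of k] add[OF ks] keys_add[of ?s] by (simp, blast)
  qed (simp add: zero)
  from this[of "Poly_Mapping.keys c"] show ?thesis using assms(1) poly_mapping_sum_single[of c] by simp
qed

text \<open>Maps out of monoid rings are defined in this way; additivity of \<open>\<phi> g\<close> in the coefficient
  makes them additive.\<close>

definition linear_extension :: "('g \<Rightarrow> 'k \<Rightarrow> 'b) \<Rightarrow> ('g \<Rightarrow>\<^sub>0 'k::comm_ring_1) \<Rightarrow> 'b::comm_monoid_add"
  where "linear_extension \<phi> c = (\<Sum>g\<in>Poly_Mapping.keys c. \<phi> g (Poly_Mapping.lookup c g))"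

lemma linear_extension_add:
  assumes "\<And>g. \<phi> g 0 = 0" "\<And>g a b. \<phi> g (a + b) = \<phi> g a + \<phi> g b"
  shows "linear_extension \<phi> (c + d) = linear_extension \<phi> c + linear_extension \<phi> d"
  unfolding linear_extension_def by (rule setsum_keys_plus_distrib) (simp_all add: assms)

lemma linear_extension_single:
  assumes "\<And>g. \<phi> g 0 = 0" shows "linear_extension \<phi> (Poly_Mapping.single g a) = \<phi> g a"
  using assms by (cases "a = 0") (simp_all add: linear_extension_def)

lemma linear_extension_zero [simp]: "linear_extension \<phi> 0 = 0"
  by (simp add: linear_extension_def)

text \<open>The multiplication of a monoid ring, written as a bilinear extension.\<close>

definition mr_mult :: "('g, 'm) monoid_scheme \<Rightarrow> ('g \<Rightarrow>\<^sub>0 'k::comm_ring_1) \<Rightarrow> ('g \<Rightarrow>\<^sub>0 'k) \<Rightarrow> ('g \<Rightarrow>\<^sub>0 'k)"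
  where "mr_mult M x y = linear_extension (\<lambda>g a. linear_extension (\<lambda>h b. Poly_Mapping.single (g \<otimes>\<^bsub>M\<^esub> h) (a * b)) y) x"

lemma monoid_ring_simps [simp]:
  "carrier (monoid_ring M) = {c. Poly_Mapping.keys c \<subseteq> carrier M}"
  "x \<otimes>\<^bsub>monoid_ring M\<^esub> y = mr_mult M x y"
  "\<one>\<^bsub>monoid_ring M\<^esub> = Poly_Mapping.single \<one>\<^bsub>M\<^esub> 1"
  "\<zero>\<^bsub>monoid_ring M\<^esub> = 0"
  "x \<oplus>\<^bsub>monoid_ring M\<^esub> y = x + y"
  by (simp_all add: monoid_ring_def mr_mult_def linear_extension_def)

lemma mr_mult_add_right: "mr_mult M x (y + z) = mr_mult M x y + mr_mult M x z"
proof -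
  have "linear_extension (\<lambda>h b. Poly_Mapping.single (g \<otimes>\<^bsub>M\<^esub> h) (a * b)) (y + z)
      = linear_extension (\<lambda>h b. Poly_Mapping.single (g \<otimes>\<^bsub>M\<^esub> h) (a * b)) y
      + linear_extension (\<lambda>h b. Poly_Mapping.single (g \<otimes>\<^bsub>M\<^esub> h) (a * b)) z" for g and a :: 'b
    by (rule linear_extension_add) (simp_all add: single_add[symmetric] distrib_left)
  then show ?thesis unfolding mr_mult_def by (simp add: linear_extension_def[of _ x] sum.distrib)
qed

lemma mr_mult_add_left: "mr_mult M (x + y) z = mr_mult M x z + mr_mult M y z"
  unfolding mr_mult_def
  by (rule linear_extension_add)
    (simp_all add: linear_extension_def sum.distrib single_add distrib_right)

lemma mr_mult_zero [simp]: "mr_mult M 0 y = 0" "mr_mult M x 0 = 0"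
  by (simp_all add: mr_mult_def) (simp add: linear_extension_def)

lemma mr_mult_single [simp]:
  "mr_mult M (Poly_Mapping.single g a) (Poly_Mapping.single h b) = Poly_Mapping.single (g \<otimes>\<^bsub>M\<^esub> h) (a * b)"
  unfolding mr_mult_def by (subst linear_extension_single) (simp_all add: linear_extension_single linear_extension_def)

lemma keys_add_subset: "Poly_Mapping.keys c \<subseteq> Z \<Longrightarrow> Poly_Mapping.keys d \<subseteq> Z \<Longrightarrow> Poly_Mapping.keys (c + d) \<subseteq> Z"
  using keys_add[of c d] by blast

lemma keys_single_subset: "g \<in> Z \<Longrightarrow> Poly_Mapping.keys (Poly_Mapping.single g a) \<subseteq> Z"
  by (cases "a = 0") auto

context
  fixes M :: "('g, 'm) monoid_scheme" (structure)
  assumes M: "monoid M"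
begin

lemma mr_mult_closed:
  assumes x: "Poly_Mapping.keys (x :: 'g \<Rightarrow>\<^sub>0 'k::comm_ring_1) \<subseteq> carrier M" and y: "Poly_Mapping.keys y \<subseteq> carrier M"
  shows "Poly_Mapping.keys (mr_mult M x y) \<subseteq> carrier M"
  using x
proof (induct x rule: poly_mapping_induct)
  case (single g a)
  show ?case using y
  proof (induct y rule: poly_mapping_induct)
    case (single h b)
    then show ?case using \<open>g \<in> carrier M\<close> monoid.m_closed[OF M] by (simp add: keys_single_subset)
  qed (simp_all add: mr_mult_add_right keys_add_subset)
qed (simp_all add: mr_mult_add_left keys_add_subset)

lemma mr_mult_assoc:
  assumes x: "Poly_Mapping.keys (x :: 'g \<Rightarrow>\<^sub>0 'k::comm_ring_1) \<subseteq> carrier M" and y: "Poly_Mapping.keys y \<subseteq> carrier M"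
    and z: "Poly_Mapping.keys z \<subseteq> carrier M"
  shows "mr_mult M (mr_mult M x y) z = mr_mult M x (mr_mult M y z)"
  using x
proof (induct x rule: poly_mapping_induct)
  case (single g a)
  show ?case using y
  proof (induct y rule: poly_mapping_induct)
    case (single h b)
    show ?case using z
    proof (induct z rule: poly_mapping_induct)
      case (single k c)
      then show ?case using \<open>g \<in> carrier M\<close> \<open>h \<in> carrier M\<close> by (simp add: monoid.m_assoc[OF M] mult.assoc)
    qed (auto simp: mr_mult_add_right)
  qed (auto simp: mr_mult_add_right mr_mult_add_left)
qed (auto simp: mr_mult_add_left)

lemma mr_mult_one:
  assumes "Poly_Mapping.keys (x :: 'g \<Rightarrow>\<^sub>0 'k::comm_ring_1) \<subseteq> carrier M"
  shows "mr_mult M (Poly_Mapping.single \<one> 1) x = x" "mr_mult M x (Poly_Mapping.single \<one> 1) = x"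
  using assms
  by (induct x rule: poly_mapping_induct)
    (auto simp: monoid.l_one[OF M] monoid.r_one[OF M] mr_mult_add_right mr_mult_add_left)

lemma ring_monoid_ring: "ring (monoid_ring M :: ('g \<Rightarrow>\<^sub>0 'k::comm_ring_1) ring)"
proof (intro ringI abelian_groupI monoidI)
  fix x :: "'g \<Rightarrow>\<^sub>0 'k" assume x: "x \<in> carrier (monoid_ring M)"
  have "Poly_Mapping.keys (- x) = Poly_Mapping.keys x" by (auto simp: in_keys_iff)
  then show "\<exists>y\<in>carrier (monoid_ring M). y \<oplus>\<^bsub>monoid_ring M\<^esub> x = \<zero>\<^bsub>monoid_ring M\<^esub>"
    using x by (intro bexI[of _ "- x"]) auto
qed (auto simp: mr_mult_closed mr_mult_assoc mr_mult_one mr_mult_add_left mr_mult_add_right add_ac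
      keys_single_subset monoid.one_closed[OF M] dest: keys_add_subset subsetD subsetD[OF keys_add])

lemma monoid_ring_minus:
  assumes "x \<in> carrier (monoid_ring M :: ('g \<Rightarrow>\<^sub>0 'k::comm_ring_1) ring)" "y \<in> carrier (monoid_ring M)"
  shows "x \<ominus>\<^bsub>monoid_ring M\<^esub> y = x - y"
proof -
  interpret ring "monoid_ring M :: ('g \<Rightarrow>\<^sub>0 'k) ring" by (rule ring_monoid_ring)
  have "Poly_Mapping.keys (- y) = Poly_Mapping.keys y" by (auto simp: in_keys_iff)
  then have "\<ominus>\<^bsub>monoid_ring M\<^esub> y = - y" using assms by (intro minus_equality) auto
  then show ?thesis by (simp add: a_minus_def)
qed

end

lemma cring_monoid_ring:
  assumes M: "comm_monoid M" shows "cring (monoid_ring M :: ('g \<Rightarrow>\<^sub>0 'k::comm_ring_1) ring)"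
proof -
  interpret comm_monoid M by fact
  have "mr_mult M x y = mr_mult M y x"
    if x: "Poly_Mapping.keys (x :: 'g \<Rightarrow>\<^sub>0 'k) \<subseteq> carrier M" and y: "Poly_Mapping.keys y \<subseteq> carrier M" for x y
    using x
  proof (induct x rule: poly_mapping_induct)
    case (single g a)
    show ?case using y
    proof (induct y rule: poly_mapping_induct)
      case (single h b)
      then show ?case using \<open>g \<in> carrier M\<close> by (simp add: m_comm mult.commute)
    qed (auto simp: mr_mult_add_right mr_mult_add_left)
  qed (auto simp: mr_mult_add_right mr_mult_add_left)
  then show ?thesis
    using ring_monoid_ring[OF monoid_axioms, where 'k='k] ring.is_monoid
    by (intro cring.intro comm_monoid.intro comm_monoid_axioms.intro) auto
qed

definition mr_map :: "('g \<Rightarrow> 'h) \<Rightarrow> ('g \<Rightarrow>\<^sub>0 'k::comm_ring_1) \<Rightarrow> ('h \<Rightarrow>\<^sub>0 'k)"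
  where "mr_map f = linear_extension (\<lambda>g a. Poly_Mapping.single (f g) a)"

lemma mr_map_single [simp]: "mr_map f (Poly_Mapping.single g a) = Poly_Mapping.single (f g) a"
  by (simp add: mr_map_def linear_extension_single)

lemma mr_map_add: "mr_map f (c + d) = mr_map f c + mr_map f d"
  unfolding mr_map_def by (rule linear_extension_add) (simp_all add: single_add)

lemma mr_map_zero [simp]: "mr_map f 0 = 0"
  by (simp add: mr_map_def)

lemma keys_mr_map:
  assumes "Poly_Mapping.keys c \<subseteq> Z" "f ` Z \<subseteq> W" shows "Poly_Mapping.keys (mr_map f c) \<subseteq> W"
  using assms(1)
  by (induct c rule: poly_mapping_induct)
    (use assms(2) in \<open>simp_all add: mr_map_add keys_add_subset keys_single_subset image_subset_iff\<close>)

lemma mr_map_mult: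
  assumes f: "\<And>g h. g \<in> carrier M \<Longrightarrow> h \<in> carrier M \<Longrightarrow> f (g \<otimes>\<^bsub>M\<^esub> h) = f g \<otimes>\<^bsub>N\<^esub> f h"
    and x: "Poly_Mapping.keys x \<subseteq> carrier M" and y: "Poly_Mapping.keys y \<subseteq> carrier M"
  shows "mr_map f (mr_mult M x y) = mr_mult N (mr_map f x) (mr_map f y)"
  using x
proof (induct x rule: poly_mapping_induct)
  case (single g a)
  show ?case using y
  proof (induct y rule: poly_mapping_induct)
    case (single h b)
    then show ?case using \<open>g \<in> carrier M\<close> by (simp add: f)
  qed (auto simp: mr_mult_add_right mr_map_add)
qed (auto simp: mr_mult_add_left mr_map_add)

lemma mr_map_ring_hom:
  assumes "\<And>g. g \<in> carrier M \<Longrightarrow> f g \<in> carrier N"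
    and "\<And>g h. g \<in> carrier M \<Longrightarrow> h \<in> carrier M \<Longrightarrow> f (g \<otimes>\<^bsub>M\<^esub> h) = f g \<otimes>\<^bsub>N\<^esub> f h" and "f \<one>\<^bsub>M\<^esub> = \<one>\<^bsub>N\<^esub>"
  shows "mr_map f \<in> ring_hom (monoid_ring M) (monoid_ring N)"
proof (rule ring_hom_memI)
  fix x assume "x \<in> carrier (monoid_ring M)"
  then show "mr_map f x \<in> carrier (monoid_ring N)"
    using keys_mr_map[of x "carrier M" f "carrier N"] assms(1) by auto
qed (auto simp: mr_map_mult[where M=M and N=N] assms(2,3) mr_map_add)

section \<open>The standard presentation and the canonical identification\<close>

lemma frag_extend_mr_map:
  fixes f :: "'g \<Rightarrow> 'h"
  shows "frag_extend (frag_of \<circ> f) c = mr_map f c"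
proof -
  have "frag_cmul a (frag_of i) = Poly_Mapping.single i a" for a and i :: 'h
    by (rule poly_mapping_eqI) (auto simp: lookup_single when_def)
  then show ?thesis by (simp add: frag_extend_def mr_map_def linear_extension_def)
qed

context cring begin

lemma add_pow_int_zero [simp]: "add_pow R (0::int) r = \<zero>"
  by (simp add: add_pow_def)

lemma std_proj_superset:
  assumes "finite K" "Poly_Mapping.keys c \<subseteq> K" "K \<subseteq> carrier R"
  shows "std_proj R c = (\<Oplus>r\<in>K. add_pow R (Poly_Mapping.lookup c r) r)"
  unfolding std_proj_def
  by (rule add.finprod_mono_neutral_cong_left)
    (use assms in \<open>auto simp: not_in_keys_iff_lookup_eq_zero subset_iff Pi_iff\<close>)

lemma std_proj_add:
  assumes "Poly_Mapping.keys c \<subseteq> carrier R" "Poly_Mapping.keys d \<subseteq> carrier R"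
  shows "std_proj R (c + d) = std_proj R c \<oplus> std_proj R d"
proof -
  let ?K = "Poly_Mapping.keys c \<union> Poly_Mapping.keys d"
  have K: "finite ?K" "?K \<subseteq> carrier R" using assms by auto
  have Kc: "r \<in> carrier R" if "r \<in> ?K" for r using K that by blast
  have "std_proj R (c + d) = (\<Oplus>r\<in>?K. add_pow R (Poly_Mapping.lookup c r) r \<oplus> add_pow R (Poly_Mapping.lookup d r) r)"
    unfolding std_proj_superset[OF K(1) keys_add K(2)]
    by (intro finsum_cong') (auto simp: lookup_add add.int_pow_mult Kc)
  also have "\<dots> = std_proj R c \<oplus> std_proj R d"
    unfolding std_proj_superset[OF K(1) Un_upper1 K(2)] std_proj_superset[OF K(1) Un_upper2 K(2)]
    by (intro finsum_addf) (auto simp: Kc)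
  finally show ?thesis .
qed

lemma std_proj_zero [simp]: "std_proj R 0 = \<zero>"
  by (simp add: std_proj_def)

lemma std_proj_single [simp]: "r \<in> carrier R \<Longrightarrow> std_proj R (Poly_Mapping.single r a) = add_pow R a r"
  by (cases "a = 0") (simp_all add: std_proj_def)

lemma std_proj_closed: "Poly_Mapping.keys c \<subseteq> carrier R \<Longrightarrow> std_proj R c \<in> carrier R"
  by (induct c rule: poly_mapping_induct) (auto simp: std_proj_add)

lemma std_proj_mult:
  assumes x: "Poly_Mapping.keys x \<subseteq> carrier R" and y: "Poly_Mapping.keys y \<subseteq> carrier R"
  shows "std_proj R (mr_mult R x y) = std_proj R x \<otimes> std_proj R y"
  using x
proof (induct x rule: poly_mapping_induct)
  case (single g a)
  show ?case using y
  proof (induct y rule: poly_mapping_induct)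
    case (single h b)
    then show ?case using \<open>g \<in> carrier R\<close>
      by (simp add: add_pow_ldistr_int add_pow_rdistr_int add.int_pow_pow mult.commute)
  next
    case (add c d)
    have "Poly_Mapping.keys (mr_mult R (Poly_Mapping.single g a) z) \<subseteq> carrier R"
      if "Poly_Mapping.keys z \<subseteq> carrier R" for z
      using mr_mult_closed[OF monoid_axioms keys_single_subset[OF \<open>g \<in> carrier R\<close>] that] .
    with add show ?case using \<open>g \<in> carrier R\<close>
      by (simp add: mr_mult_add_right std_proj_add r_distr std_proj_closed)
  qed (use single in auto)
next
  case (add c d)
  have "Poly_Mapping.keys (mr_mult R z y) \<subseteq> carrier R"
    if "Poly_Mapping.keys z \<subseteq> carrier R" for z
    using mr_mult_closed[OF monoid_axioms that y] .
  with add show ?case using y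
    by (simp add: mr_mult_add_left std_proj_add l_distr std_proj_closed)
qed (use std_proj_closed[OF y] in auto)

lemma presents_std: "presents (std_ring R) R (std_proj R)"
  unfolding presents_def torsion_free_cring_def torsion_free_cring_axioms_def
proof (intro conjI allI impI)
  show "cring (std_ring R)" by (rule cring_monoid_ring[OF comm_monoid_axioms])
  show "cring R" by (rule is_cring)
  show "std_proj R \<in> ring_hom (std_ring R) R"
    by (rule ring_hom_memI) (auto simp: std_proj_closed std_proj_mult std_proj_add)
  show "std_proj R ` carrier (std_ring R) = carrier R"
  proof
    show "carrier R \<subseteq> std_proj R ` carrier (std_ring R)"
    proof
      fix r assume r: "r \<in> carrier R"
      then have "r = std_proj R (frag_of r)" "frag_of r \<in> carrier (std_ring R)" by simp_all
      then show "r \<in> std_proj R ` carrier (std_ring R)" by (rule image_eqI)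
    qed
  qed (auto simp: std_proj_closed)
  fix n :: nat and a assume n: "0 < n" and "a \<in> carrier (std_ring R)" and z: "add_pow (std_ring R) n a = \<zero>\<^bsub>std_ring R\<^esub>"
  have "Poly_Mapping.lookup (add_pow (std_ring R) k a) i = int k * Poly_Mapping.lookup a i" for k i
    by (induct k) (auto simp: add_pow_def lookup_add algebra_simps)
  from this[of n] have "Poly_Mapping.lookup a i = 0" for i using z n by simp
  then show "a = \<zero>\<^bsub>std_ring R\<^esub>" by (simp add: poly_mapping_eqI)
qed

lemma std_proj_mr_map:
  assumes f: "f \<in> ring_hom R R'" and R': "cring R'" and c: "Poly_Mapping.keys c \<subseteq> carrier R"
  shows "std_proj R' (mr_map f c) = f (std_proj R c)"
proof -
  interpret R': cring R' by fact
  interpret h: abelian_group_hom R R' f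
    by (rule add_map_group_hom[OF ring_hom_add_map[OF f] ring_axioms R'.ring_axioms])
  have fR: "f ` carrier R \<subseteq> carrier R'" using ring_hom_closed[OF f] by blast
  show ?thesis using c
  proof (induct c rule: poly_mapping_induct)
    case (single g a)
    then show ?case using group_hom.hom_int_pow[OF h.a_group_hom, of g a] by (simp add: add_pow_def)
  next
    case (add c d)
    have "Poly_Mapping.keys (mr_map f z) \<subseteq> carrier R'" if "Poly_Mapping.keys z \<subseteq> carrier R"
      for z :: "'a \<Rightarrow>\<^sub>0 int"
      using keys_mr_map[OF that fR] .
    with add show ?case
      by (simp add: mr_map_add std_proj_add R'.std_proj_add std_proj_closed)
  qed auto
qed

end

lemma mr_map_std_hom:
  assumes "f \<in> ring_hom R R'" shows "mr_map f \<in> ring_hom (std_ring R) (std_ring R')"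
  by (rule mr_map_ring_hom) (use assms in \<open>auto simp: ring_hom_closed ring_hom_mult ring_hom_one\<close>)

lemma mr_map_surj:
  assumes "f ` carrier M = carrier N"
  shows "mr_map f ` carrier (monoid_ring M) = (carrier (monoid_ring N) :: ('h \<Rightarrow>\<^sub>0 'k::comm_ring_1) set)"
proof
  show "mr_map f ` carrier (monoid_ring M) \<subseteq> (carrier (monoid_ring N) :: ('h \<Rightarrow>\<^sub>0 'k) set)"
    using keys_mr_map[of _ "carrier M" f "carrier N"] assms by auto
  have "c \<in> mr_map f ` carrier (monoid_ring M)" if "Poly_Mapping.keys c \<subseteq> carrier N" for c :: "'h \<Rightarrow>\<^sub>0 'k"
    using that
  proof (induct c rule: poly_mapping_induct)
    case zero
    show ?case by (rule image_eqI[where x = 0]) auto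
  next
    case (single g a)
    then obtain h where "h \<in> carrier M" "g = f h" using assms by blast
    then show ?case by (intro image_eqI[where x = "Poly_Mapping.single h a"]) (auto simp: keys_single_subset)
  next
    case (add c d)
    then obtain c' d' where "Poly_Mapping.keys c' \<subseteq> carrier M" "c = mr_map f c'"
      "Poly_Mapping.keys d' \<subseteq> carrier M" "d = mr_map f d'" by auto
    then show ?case
      by (intro image_eqI[where x = "c' + d'"]) (auto simp: mr_map_add dest: subsetD[OF keys_add_subset])
  qed
  then show "(carrier (monoid_ring N) :: ('h \<Rightarrow>\<^sub>0 'k) set) \<subseteq> mr_map f ` carrier (monoid_ring M)" by auto
qed

lemma ring_iso_cong:
  assumes "ring D" "f \<in> ring_iso D E" "\<And>x. x \<in> carrier D \<Longrightarrow> g x = f x"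
  shows "g \<in> ring_iso D E"
proof -
  interpret ring D by fact
  show ?thesis using assms(2,3) by (auto simp: ring_iso_def ring_hom_def bij_betw_def inj_on_def image_def)
qed

context truncated begin

lemma ring_E_ring: "presents A R \<pi> \<Longrightarrow> ring (E_ring S A R \<pi>)"
  unfolding E_ring_def by (rule ideal.quotient_is_ring[OF ideal_E])

lemma E_class_add_map:
  assumes "presents A R \<pi>" shows "E_class S A R \<pi> \<in> add_map (X_ring S A) (E_ring S A R \<pi>)"
  unfolding E_class_def[abs_def] E_ring_def
  by (rule ring_hom_add_map[OF ideal.rcos_ring_hom[OF ideal_E[OF assms]]])

abbreviation E_std_class where "E_std_class R \<equiv> E_class S (std_ring R) R (std_proj R)"
abbreviation std_witt where "std_witt R r \<equiv> witt S (std_ring R) (\<lambda>n. frag_of (r n))"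

text \<open>The class of \<open>\<Sum> V\<^sub>n\<langle>b\<^sub>n\<rangle>\<close> depends on the images of the \<open>b\<^sub>n\<close> in \<open>R\<close> only, so each
  component may be replaced by a symbol.\<close>

lemma E_std_cases:
  assumes R: "cring R" and y: "y \<in> carrier (E_std S R)"
  shows "\<exists>r\<in>S \<rightarrow> carrier R. y = E_std_class R (std_witt R r)"
proof -
  interpret R: cring R by fact
  note P = R.presents_std
  obtain b where b: "b \<in> S \<rightarrow> carrier (std_ring R)" "y = E_std_class R (witt S (std_ring R) b)"
    using y unfolding carrier_E_ring X_group_carrier_witt[OF presentsD(1)[OF P]] by blast
  have r: "(\<lambda>n. std_proj R (b n)) \<in> S \<rightarrow> carrier R" using b(1) by (auto simp: Pi_iff R.std_proj_closed)
  have "E_std_class R (witt S (std_ring R) b) = E_std_class R (std_witt R (\<lambda>n. std_proj R (b n)))"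
    by (rule E_class_witt_eq[OF P b(1)]) (use r b(1) in \<open>auto simp: Pi_iff R.std_proj_closed\<close>)
  then show ?thesis using b(2) by (intro bexI[OF _ r]) (simp only:)
qed

lemma std_Ver_pow_class:
  assumes R: "cring R" and n: "n \<in> S" and b: "b \<in> carrier (std_ring R)"
  shows "E_std_class R (Ver_pow S (std_ring R) n b)
    = E_std_class R (Ver_pow S (std_ring R) n (frag_of (std_proj R b)))"
proof -
  interpret R: cring R by fact
  note P = R.presents_std
  interpret Z: cring "std_ring R" by (rule presentsD(2)[OF P])
  have r: "std_proj R b \<in> carrier R" using b by (simp add: R.std_proj_closed)
  then have f: "frag_of (std_proj R b) \<in> carrier (std_ring R)" by simp
  have z: "\<zero>\<^bsub>std_ring R\<^esub> \<in> carrier (std_ring R)" by (rule Z.zero_closed)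
  show ?thesis
    unfolding Ver_pow_eq_witt[OF presentsD(2)[OF P] n b] Ver_pow_eq_witt[OF presentsD(2)[OF P] n f]
  proof (rule E_class_witt_eq[OF P])
    show "(\<lambda>k. if k = n then b else \<zero>\<^bsub>std_ring R\<^esub>) \<in> S \<rightarrow> carrier (std_ring R)"
      "(\<lambda>k. if k = n then frag_of (std_proj R b) else \<zero>\<^bsub>std_ring R\<^esub>) \<in> S \<rightarrow> carrier (std_ring R)"
      using b f z by (auto simp only: Pi_iff split: if_split)
    show "std_proj R (if k = n then b else \<zero>\<^bsub>std_ring R\<^esub>)
        = std_proj R (if k = n then frag_of (std_proj R b) else \<zero>\<^bsub>std_ring R\<^esub>)" for k
      using r by simp
  qed
qed

text \<open>The set on which two continuous homomorphisms to a Hausdorff group agree is a closed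
  subgroup. It contains all generators, because \<open>V\<^sub>n\<langle>b\<rangle>\<close> and \<open>V\<^sub>n\<langle>[r]\<rangle>\<close> have the same class if
  \<open>b\<close> maps to \<open>r\<close>.\<close>

lemma E_std_hom_unique:
  assumes R: "cring R" and P: "presents A R \<pi>"
    and h1: "\<kappa>1 \<in> ring_hom (E_std S R) (E_ring S A R \<pi>)" and h2: "\<kappa>2 \<in> ring_hom (E_std S R) (E_ring S A R \<pi>)"
    and c1: "continuous_map (E_top S (std_ring R) R (std_proj R)) (E_top S A R \<pi>) \<kappa>1"
    and c2: "continuous_map (E_top S (std_ring R) R (std_proj R)) (E_top S A R \<pi>) \<kappa>2"
    and gen: "\<And>n r. n \<in> S \<Longrightarrow> r \<in> carrier R \<Longrightarrow>
      \<kappa>1 (E_std_class R (Ver_pow S (std_ring R) n (frag_of r))) = \<kappa>2 (E_std_class R (Ver_pow S (std_ring R) n (frag_of r)))"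
    and y: "y \<in> carrier (E_std S R)"
  shows "\<kappa>1 y = \<kappa>2 y"
proof -
  interpret R: cring R by fact
  note Z = R.presents_std
  note d = presentsD[OF Z]
  let ?Z = "std_ring R" let ?X = "X_group S (std_ring R) (carrier (std_ring R))"
  let ?c = "E_std_class R"
  have XP: "?X \<subseteq> (\<Pi>\<^sub>E n\<in>S. carrier ?Z)" by (rule X_group_PiE[OF d(3) subset_refl])
  note Xcl = X_group_closed[OF d(3) subset_refl]
  define H where "H = {x \<in> ?X. \<kappa>1 (?c x) = \<kappa>2 (?c x)}"
  have ca: "(\<lambda>x. \<kappa> (?c x)) \<in> add_map (X_ring S ?Z) (E_ring S A R \<pi>)"
    if "\<kappa> \<in> ring_hom (E_std S R) (E_ring S A R \<pi>)" for \<kappa>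
    using E_class_add_map[OF Z] ring_hom_add_map[OF that] by (auto simp: add_map_def Pi_iff)
  have cc: "continuous_map (subtopology (pow_top S ?Z) ?X) (E_top S A R \<pi>) (\<lambda>x. \<kappa> (?c x))"
    if "continuous_map (E_top S ?Z R (std_proj R)) (E_top S A R \<pi>) \<kappa>" for \<kappa>
    using continuous_map_compose[OF continuous_map_quot_proj that[unfolded E_top_def[of S ?Z]]] by (simp add: o_def)
  have tX: "topspace (subtopology (pow_top S ?Z) ?X) = ?X" using XP by (auto simp: pow_top_def)
  have clH: "closedin (subtopology (pow_top S ?Z) ?X) H"
    using closedin_continuous_maps_eq[OF Hausdorff_E_top[OF P] cc[OF c1] cc[OF c2]] unfolding tX H_def .
  have HX: "H \<subseteq> ?X" by (auto simp only: H_def)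
  have "?X \<subseteq> H"
  proof (rule X_group_minimal[OF d(3)])
    show "closed_subgroup S ?Z H"
      unfolding closed_subgroup_def
    proof (intro conjI ballI impI)
      show "H \<subseteq> (\<Pi>\<^sub>E n\<in>S. carrier ?Z)" using XP by (auto simp: H_def)
      have rr: "ring (X_ring S ?Z)" "ring (E_ring S A R \<pi>)" using ring_X_ring[OF d(2)] ring_E_ring[OF P] .
      have "\<kappa>1 (?c \<zero>\<^bsub>X_ring S ?Z\<^esub>) = \<kappa>2 (?c \<zero>\<^bsub>X_ring S ?Z\<^esub>)"
        using add_map_zero[OF ca[OF h1] rr] add_map_zero[OF ca[OF h2] rr] by simp
      then show "(\<lambda>n\<in>S. \<zero>\<^bsub>?Z\<^esub>) \<in> H" using closed_subgroupD(2)[OF Xcl] by (simp only: H_def mem_Collect_eq X_ring_simps)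
      show "(\<lambda>n\<in>S. x n \<ominus>\<^bsub>?Z\<^esub> y n) \<in> H" if xH: "x \<in> H" and yH: "y \<in> H" for x y
      proof -
        have xX: "x \<in> ?X" "y \<in> ?X" using xH yH by (auto simp: H_def)
        have "x \<ominus>\<^bsub>X_ring S ?Z\<^esub> y \<in> ?X" using ring.ring_simprules(4)[OF rr(1), of x y] xX by (simp only: X_ring_simps)
        moreover have "\<kappa>1 (?c (x \<ominus>\<^bsub>X_ring S ?Z\<^esub> y)) = \<kappa>2 (?c (x \<ominus>\<^bsub>X_ring S ?Z\<^esub> y))"
          using add_map_minus[OF ca[OF h1] rr, of x y] add_map_minus[OF ca[OF h2] rr, of x y] xX xH yH by (simp add: H_def)
        ultimately show ?thesis unfolding X_ring_minus[OF d(2) xX] H_def by blast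
      qed
      fix x assume x: "x \<in> (\<Pi>\<^sub>E n\<in>S. carrier ?Z)"
        and a: "\<forall>F. finite F \<longrightarrow> F \<subseteq> S \<longrightarrow> (\<exists>y\<in>H. \<forall>n\<in>F. y n = x n)"
      have "x \<in> ?X"
      proof (rule closed_subgroupD(4)[OF Xcl x])
        fix F assume "finite F" "F \<subseteq> S"
        then have "\<exists>y\<in>H. \<forall>n\<in>F. y n = x n" using a by simp
        then obtain y where "y \<in> H" "\<forall>n\<in>F. y n = x n" by (elim bexE)
        then show "\<exists>y\<in>?X. \<forall>n\<in>F. y n = x n" using HX by (intro bexI[of _ y]) blast+
      qed
      then have "x \<in> ?X \<inter> (\<Pi>\<^sub>E n\<in>S. carrier ?Z)" using x by blast
      from bspec[OF conjunct2[OF clH[unfolded pow_top_def closedin_subpower]] this] a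
      show "x \<in> H" by simp
    qed
    show "Ver_pow S ?Z n b \<in> H" if n: "n \<in> S" and b: "b \<in> carrier ?Z" for n b
    proof -
      have "std_proj R b \<in> carrier R" using b by (simp add: R.std_proj_closed)
      from gen[OF n this] have "\<kappa>1 (?c (Ver_pow S ?Z n b)) = \<kappa>2 (?c (Ver_pow S ?Z n b))"
        unfolding std_Ver_pow_class[OF R n b] .
      then show ?thesis using X_group_gen[OF d(3) n b] by (simp only: H_def mem_Collect_eq)
    qed
  qed
  then show ?thesis using y unfolding carrier_E_ring H_def by blast
qed

text \<open>The ring \<open>\<int>A\<close> presents \<open>R\<close> too, by the common composite of \<open>\<int>A \<rightarrow> A \<rightarrow> R\<close> and
  \<open>\<int>A \<rightarrow> \<int>R \<rightarrow> R\<close>. The maps to \<open>A\<close> and to \<open>\<int>R\<close> both induce isomorphisms, and the canonical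
  isomorphism is the second one inverted, followed by the first.\<close>

lemma E_canonical_exists:
  assumes P: "presents A R \<pi>"
  shows "\<exists>\<kappa>. \<kappa> \<in> ring_iso (E_std S R) (E_ring S A R \<pi>) \<and>
    homeomorphic_map (E_top S (std_ring R) R (std_proj R)) (E_top S A R \<pi>) \<kappa> \<and>
    (\<forall>a\<in>S \<rightarrow> carrier A. \<kappa> (E_std_class R (std_witt R (\<lambda>n. \<pi> (a n)))) = E_class S A R \<pi> (witt S A a)) \<and>
    (\<forall>n\<in>S. \<forall>a\<in>carrier A. \<kappa> (E_std_class R (Ver_pow S (std_ring R) n (frag_of (\<pi> a))))
        = E_class S A R \<pi> (Ver_pow S A n a))"
proof -
  note d = presentsD[OF P]
  interpret A: cring A by (rule d(2))
  interpret R: cring R by (rule d(4))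
  note ZA = A.presents_std and ZR = R.presents_std
  let ?p = "\<lambda>c. \<pi> (std_proj A c)"
  have pp: "std_proj R (mr_map \<pi> c) = ?p c" if "c \<in> carrier (std_ring A)" for c
    using A.std_proj_mr_map[OF d(6,4)] that by simp
  have Q: "presents (std_ring A) R ?p"
    unfolding presents_def
  proof (intro conjI)
    show "torsion_free_cring (std_ring A)" by (rule presentsD(1)[OF ZA])
    show "cring R" by (rule d(4))
    show "?p \<in> ring_hom (std_ring A) R"
      using ring_hom_trans[OF presentsD(6)[OF ZA] d(6)] by (simp add: o_def)
    show "?p ` carrier (std_ring A) = carrier R"
      unfolding image_image[symmetric] presentsD(7)[OF ZA] by (rule d(7))
  qed
  note h1 = presentsD(6)[OF ZA] and h2 = mr_map_std_hom[OF d(6)]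
  have k1: "std_proj A ` a_kernel (std_ring A) R ?p \<subseteq> a_kernel A R \<pi>"
    using ring_hom_closed[OF h1] by (auto simp: mem_kernel)
  have k1': "c \<in> a_kernel (std_ring A) R ?p" if "c \<in> carrier (std_ring A)" "std_proj A c \<in> a_kernel A R \<pi>" for c
    using that by (simp add: mem_kernel)
  have k2: "mr_map \<pi> ` a_kernel (std_ring A) R ?p \<subseteq> a_kernel (std_ring R) R (std_proj R)"
    using ring_hom_closed[OF h2] pp by (auto simp: mem_kernel simp del: monoid_ring_simps)
  have k2': "c \<in> a_kernel (std_ring A) R ?p"
    if "c \<in> carrier (std_ring A)" "mr_map \<pi> c \<in> a_kernel (std_ring R) R (std_proj R)" for c
    using that pp[OF that(1)] by (simp add: mem_kernel del: monoid_ring_simps)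
  note s1 = presentsD(7)[OF ZA]
  have s2: "mr_map \<pi> ` carrier (std_ring A) = carrier (std_ring R)" by (rule mr_map_surj[OF d(7)])
  let ?f1 = "E_push A R \<pi> (std_proj A)" let ?f2 = "E_push (std_ring R) R (std_proj R) (mr_map \<pi>)"
  let ?E = "E_ring S (std_ring A) R ?p"
  note i1 = E_push_iso[OF Q P h1 k1 s1 k1'] and i2 = E_push_iso[OF Q ZR h2 k2 s2 k2']
  note m1 = E_push_homeomorphic[OF Q P h1 k1 s1 k1'] and m2 = E_push_homeomorphic[OF Q ZR h2 k2 s2 k2']
  define g where "g = inv_into (carrier ?E) ?f2"
  have bij2: "bij_betw ?f2 (carrier ?E) (carrier (E_std S R))" using i2 by (simp add: ring_iso_def)
  have gf: "g (?f2 v) = v" if "v \<in> carrier ?E" for v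
    unfolding g_def using bij2 that by (simp add: bij_betw_def)
  have gi: "g \<in> ring_iso (E_std S R) ?E"
    unfolding g_def by (rule ring_iso_set_sym[OF ring_E_ring[OF Q] i2])
  have gm: "homeomorphic_map (E_top S (std_ring R) R (std_proj R)) (E_top S (std_ring A) R ?p) g"
  proof -
    obtain k where k: "homeomorphic_maps (E_top S (std_ring A) R ?p) (E_top S (std_ring R) R (std_proj R)) ?f2 k"
      using m2 homeomorphic_map_maps by blast
    have k': "homeomorphic_map (E_top S (std_ring R) R (std_proj R)) (E_top S (std_ring A) R ?p) k"
      using k homeomorphic_maps_map homeomorphic_maps_sym by blast
    show ?thesis
    proof (rule homeomorphic_map_eq[OF k'])
      fix z assume z: "z \<in> topspace (E_top S (std_ring R) R (std_proj R))"
      then have "k z \<in> carrier ?E" "?f2 (k z) = z"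
        using k unfolding homeomorphic_maps_def continuous_map topspace_E_top[OF presentsD(3)[OF Q]] by blast+
      then show "k z = g z" using gf by metis
    qed
  qed
  have one: "mr_map \<pi> (frag_of a) = frag_of (\<pi> a)" "a \<in> carrier A \<Longrightarrow> std_proj A (frag_of a) = a" for a
    by simp_all
  show ?thesis
  proof (intro exI[of _ "?f1 \<circ> g"] conjI ballI)
    show "?f1 \<circ> g \<in> ring_iso (E_std S R) (E_ring S A R \<pi>)" by (rule ring_iso_set_trans[OF gi i1])
    show "homeomorphic_map (E_top S (std_ring R) R (std_proj R)) (E_top S A R \<pi>) (?f1 \<circ> g)"
      by (rule homeomorphic_map_compose[OF gm m1])
    fix a assume a: "a \<in> S \<rightarrow> carrier A"
    have fa: "(\<lambda>n. frag_of (a n)) \<in> S \<rightarrow> carrier (std_ring A)" using a by (auto simp: Pi_iff)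
    let ?v = "E_class S (std_ring A) R ?p (witt S (std_ring A) (\<lambda>n. frag_of (a n)))"
    have v: "?v \<in> carrier ?E"
      unfolding carrier_E_ring by (intro imageI witt_in_X_group[OF presentsD(2)[OF Q] subset_refl fa])
    have "?f2 ?v = E_std_class R (std_witt R (\<lambda>n. \<pi> (a n)))"
      unfolding E_push_witt[OF Q ZR h2 k2 fa] one(1) ..
    moreover have "witt S A (\<lambda>n. std_proj A (frag_of (a n))) = witt S A a"
      by (rule witt_eqI, rule one(2)) (use a in blast)
    then have "?f1 ?v = E_class S A R \<pi> (witt S A a)"
      unfolding E_push_witt[OF Q P h1 k1 fa] by (simp only:)
    ultimately show "(?f1 \<circ> g) (E_std_class R (std_witt R (\<lambda>n. \<pi> (a n)))) = E_class S A R \<pi> (witt S A a)"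
      using gf[OF v] by (simp only: o_apply)
  next
    fix n a assume n: "n \<in> S" and a: "a \<in> carrier A"
    have fa: "frag_of a \<in> carrier (std_ring A)" using a by simp
    let ?w = "Ver_pow S (std_ring A) n (frag_of a)"
    have w: "?w \<in> X_group S (std_ring A) (carrier (std_ring A))" by (rule X_group_gen[OF presentsD(3)[OF Q] n fa])
    let ?v = "E_class S (std_ring A) R ?p ?w"
    have v: "?v \<in> carrier ?E" unfolding carrier_E_ring using w by (rule imageI)
    have "?f2 ?v = E_std_class R (Ver_pow S (std_ring R) n (frag_of (\<pi> a)))"
      unfolding E_push_class[OF Q ZR h2 k2 w] Ver_pow_map[OF presentsD(3)[OF Q] presentsD(3)[OF ZR] h2 n fa] one(1) ..
    moreover have "?f1 ?v = E_class S A R \<pi> (Ver_pow S A n a)"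
      unfolding E_push_class[OF Q P h1 k1 w] Ver_pow_map[OF presentsD(3)[OF Q] presentsD(3)[OF P] h1 n fa] one(2)[OF a] ..
    ultimately show "(?f1 \<circ> g) (E_std_class R (Ver_pow S (std_ring R) n (frag_of (\<pi> a)))) = E_class S A R \<pi> (Ver_pow S A n a)"
      using gf[OF v] by (simp only: o_apply)
  qed
qed

text \<open>The isomorphism just constructed is the one that the description of \<^const>\<open>E_canonical\<close>
  singles out, by uniqueness of continuous homomorphisms with given values on generators.\<close>

lemma E_canonical_witt:
  assumes P: "presents A R \<pi>" and a: "a \<in> S \<rightarrow> carrier A"
  shows "E_canonical S A R \<pi> (E_std_class R (std_witt R (\<lambda>n. \<pi> (a n)))) = E_class S A R \<pi> (witt S A a)"
proof -
  note d = presentsD[OF P]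
  interpret R: cring R by (rule d(4))
  note ZR = R.presents_std
  let ?C = "\<lambda>\<kappa>. \<kappa> \<in> extensional (carrier (E_std S R)) \<and>
    \<kappa> \<in> ring_iso (E_std S R) (E_ring S A R \<pi>) \<and>
    homeomorphic_map (E_top S (std_ring R) R (std_proj R)) (E_top S A R \<pi>) \<kappa> \<and>
    (\<forall>n\<in>S. \<forall>a\<in>carrier A.
      \<kappa> (E_std_class R (Ver_pow S (std_ring R) n (frag_of (\<pi> a)))) = E_class S A R \<pi> (Ver_pow S A n a))"
  obtain \<kappa> where \<kappa>: "\<kappa> \<in> ring_iso (E_std S R) (E_ring S A R \<pi>)"
    "homeomorphic_map (E_top S (std_ring R) R (std_proj R)) (E_top S A R \<pi>) \<kappa>"
    "\<And>a. a\<in>S \<rightarrow> carrier A \<Longrightarrow> \<kappa> (E_std_class R (std_witt R (\<lambda>n. \<pi> (a n)))) = E_class S A R \<pi> (witt S A a)"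
    "\<And>n a. n\<in>S \<Longrightarrow> a\<in>carrier A \<Longrightarrow> \<kappa> (E_std_class R (Ver_pow S (std_ring R) n (frag_of (\<pi> a))))
        = E_class S A R \<pi> (Ver_pow S A n a)"
    using E_canonical_exists[OF P] by blast
  let ?k = "restrict \<kappa> (carrier (E_std S R))"
  have Vin: "E_std_class R (Ver_pow S (std_ring R) n (frag_of r)) \<in> carrier (E_std S R)"
    if "n \<in> S" "r \<in> carrier R" for n r
    unfolding carrier_E_ring by (intro imageI X_group_gen[OF presentsD(3)[OF ZR] that(1)]) (use that in simp)
  have pa: "\<pi> a \<in> carrier R" if "a \<in> carrier A" for a using ring_hom_closed[OF d(6) that] .
  have k: "?C ?k"
  proof (intro conjI ballI)
    show "?k \<in> ring_iso (E_std S R) (E_ring S A R \<pi>)"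
      by (rule ring_iso_cong[OF ring_E_ring[OF ZR] \<kappa>(1)]) simp
    show "homeomorphic_map (E_top S (std_ring R) R (std_proj R)) (E_top S A R \<pi>) ?k"
      by (rule homeomorphic_map_eq[OF \<kappa>(2)]) (simp add: topspace_E_top[OF presentsD(3)[OF ZR]])
    show "?k (E_std_class R (Ver_pow S (std_ring R) n (frag_of (\<pi> a)))) = E_class S A R \<pi> (Ver_pow S A n a)"
      if "n \<in> S" "a \<in> carrier A" for n a
      using \<kappa>(4)[OF that] Vin[OF that(1) pa[OF that(2)]] by simp
  qed simp
  have "E_canonical S A R \<pi> = ?k"
    unfolding E_canonical_def
  proof (rule the_equality)
    show "?C ?k" by (rule k)
  next
    fix \<kappa>' assume k': "?C \<kappa>'"
    show "\<kappa>' = ?k"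
    proof (rule extensionalityI)
      show "\<kappa>' \<in> extensional (carrier (E_std S R))" "?k \<in> extensional (carrier (E_std S R))" using k' k by blast+
      fix y assume y: "y \<in> carrier (E_std S R)"
      show "\<kappa>' y = ?k y"
      proof (rule E_std_hom_unique[OF d(4) P _ _ _ _ _ y])
        show "\<kappa>' \<in> ring_hom (E_std S R) (E_ring S A R \<pi>)" "?k \<in> ring_hom (E_std S R) (E_ring S A R \<pi>)"
          using k' k by (auto simp only: ring_iso_def)
        show "continuous_map (E_top S (std_ring R) R (std_proj R)) (E_top S A R \<pi>) \<kappa>'"
          "continuous_map (E_top S (std_ring R) R (std_proj R)) (E_top S A R \<pi>) ?k"
          using k' k homeomorphic_imp_continuous_map by blast+
        fix n r assume n: "n \<in> S" and r: "r \<in> carrier R"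
        then obtain a where "a \<in> carrier A" "r = \<pi> a" using d(7) by blast
        then show "\<kappa>' (E_std_class R (Ver_pow S (std_ring R) n (frag_of r)))
            = ?k (E_std_class R (Ver_pow S (std_ring R) n (frag_of r)))"
          using k k' n by (elim conjE) (simp only:)
      qed
    qed
  qed
  moreover have "E_std_class R (std_witt R (\<lambda>n. \<pi> (a n))) \<in> carrier (E_std S R)"
    unfolding carrier_E_ring
    by (intro imageI witt_in_X_group[OF presentsD(2)[OF ZR] subset_refl]) (use a pa in \<open>auto simp: Pi_iff\<close>)
  ultimately show ?thesis using \<kappa>(3)[OF a] by (simp only: restrict_apply if_True)
qed

lemma E_map_witt:
  assumes R: "cring R" and R': "cring R'" and f: "f \<in> ring_hom R R'" and r: "r \<in> S \<rightarrow> carrier R"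
  shows "E_map S R' f (E_std_class R (std_witt R r)) = E_std_class R' (std_witt R' (\<lambda>n. f (r n)))"
proof -
  interpret R: cring R by fact
  interpret R': cring R' by fact
  note h = mr_map_std_hom[OF f]
  have "E_map S R' f = E_push (std_ring R') R' (std_proj R') (mr_map f)"
    unfolding E_map_def E_push_def frag_extend_mr_map ..
  moreover have k: "mr_map f ` a_kernel (std_ring R) R (std_proj R) \<subseteq> a_kernel (std_ring R') R' (std_proj R')"
  proof
    fix z assume "z \<in> mr_map f ` a_kernel (std_ring R) R (std_proj R)"
    then obtain c where c: "c \<in> carrier (std_ring R)" "std_proj R c = \<zero>\<^bsub>R\<^esub>" "z = mr_map f c" by (auto simp: mem_kernel)
    have "std_proj R' z = f \<zero>\<^bsub>R\<^esub>" using R.std_proj_mr_map[OF f R', of c] c by simp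
    also have "\<dots> = \<zero>\<^bsub>R'\<^esub>" by (rule add_map_zero[OF ring_hom_add_map[OF f] R.ring_axioms R'.ring_axioms])
    finally show "z \<in> a_kernel (std_ring R') R' (std_proj R')"
      using ring_hom_closed[OF h c(1)] c(3) by (simp add: mem_kernel)
  qed
  moreover have "(\<lambda>n. frag_of (r n)) \<in> S \<rightarrow> carrier (std_ring R)" using r by (auto simp: Pi_iff)
  ultimately show ?thesis
    using E_push_witt[OF R.presents_std R'.presents_std h k] by (simp only: mr_map_single)
qed

lemma E_std_class_in:
  assumes R: "cring R" and r: "r \<in> S \<rightarrow> carrier R"
  shows "E_std_class R (std_witt R r) \<in> carrier (E_std S R)"
proof -
  interpret R: cring R by fact
  show ?thesis unfolding carrier_E_ring
    by (intro imageI witt_in_X_group[OF presentsD(2)[OF R.presents_std] subset_refl]) (use r in \<open>auto simp: Pi_iff\<close>)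
qed

end

section \<open>Graded rings with differential\<close>

text \<open>This carries the ring axioms from quotients, subrings and products to the differential
  graded rings with the same operations, which are records of another type.\<close>

lemma ring_transfer:
  assumes D: "ring D" and "carrier E = carrier D" "\<one>\<^bsub>E\<^esub> = \<one>\<^bsub>D\<^esub>" "\<zero>\<^bsub>E\<^esub> = \<zero>\<^bsub>D\<^esub>"
    and "\<And>x y. x \<in> carrier D \<Longrightarrow> y \<in> carrier D \<Longrightarrow> x \<otimes>\<^bsub>E\<^esub> y = x \<otimes>\<^bsub>D\<^esub> y"
    and "\<And>x y. x \<in> carrier D \<Longrightarrow> y \<in> carrier D \<Longrightarrow> x \<oplus>\<^bsub>E\<^esub> y = x \<oplus>\<^bsub>D\<^esub> y"
  shows "ring E"
proof -
  interpret D: ring D by fact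
  show ?thesis
  proof (intro ringI abelian_groupI monoidI)
    fix x assume "x \<in> carrier E"
    then show "\<exists>y\<in>carrier E. y \<oplus>\<^bsub>E\<^esub> x = \<zero>\<^bsub>E\<^esub>"
      using assms by (intro bexI[of _ "\<ominus>\<^bsub>D\<^esub> x"]) (auto simp: D.l_neg)
  qed (use assms in \<open>simp_all add: D.a_ac D.m_assoc D.l_distr D.r_distr\<close>)
qed

lemma minus_unique_add:
  assumes "ring D" "x \<in> carrier D" "y \<in> carrier D" "z \<in> carrier D" "z \<oplus>\<^bsub>D\<^esub> y = x"
  shows "z = x \<ominus>\<^bsub>D\<^esub> y"
proof -
  interpret D: ring D by fact
  show ?thesis using assms(2-4) unfolding assms(5)[symmetric] by (simp add: a_minus_def D.a_assoc D.r_neg)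
qed

lemma ring_minus_add:
  assumes "ring D" "x \<in> carrier D" "y \<in> carrier D"
  shows "(x \<ominus>\<^bsub>D\<^esub> y) \<oplus>\<^bsub>D\<^esub> y = x" "x \<ominus>\<^bsub>D\<^esub> y \<in> carrier D"
proof -
  interpret D: ring D by fact
  show "(x \<ominus>\<^bsub>D\<^esub> y) \<oplus>\<^bsub>D\<^esub> y = x" "x \<ominus>\<^bsub>D\<^esub> y \<in> carrier D"
    using assms(2,3) by (simp_all add: a_minus_def D.a_assoc D.l_neg)
qed

lemma minus_transfer:
  assumes D: "ring D" and E: "ring E" and sub: "carrier E \<subseteq> carrier D"
    and add: "\<And>x y. x \<in> carrier E \<Longrightarrow> y \<in> carrier E \<Longrightarrow> x \<oplus>\<^bsub>E\<^esub> y = x \<oplus>\<^bsub>D\<^esub> y"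
    and x: "x \<in> carrier E" "y \<in> carrier E"
  shows "x \<ominus>\<^bsub>E\<^esub> y = x \<ominus>\<^bsub>D\<^esub> y"
  by (rule minus_unique_add[OF D]) (use ring_minus_add[OF E x] add sub x in auto)

lemma subring_iff:
  assumes D: "ring D"
  shows "subring Y D \<longleftrightarrow> additive_subgroup Y D \<and> \<one>\<^bsub>D\<^esub> \<in> Y \<and> (\<forall>x\<in>Y. \<forall>y\<in>Y. x \<otimes>\<^bsub>D\<^esub> y \<in> Y)"
proof
  interpret D: ring D by fact
  assume s: "subring Y D"
  have "additive_subgroup Y D" using subring.axioms(1)[OF s] by (rule additive_subgroupI)
  then show "additive_subgroup Y D \<and> \<one>\<^bsub>D\<^esub> \<in> Y \<and> (\<forall>x\<in>Y. \<forall>y\<in>Y. x \<otimes>\<^bsub>D\<^esub> y \<in> Y)"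
    using subringE(3,6)[OF s] by blast
next
  interpret D: ring D by fact
  assume a: "additive_subgroup Y D \<and> \<one>\<^bsub>D\<^esub> \<in> Y \<and> (\<forall>x\<in>Y. \<forall>y\<in>Y. x \<otimes>\<^bsub>D\<^esub> y \<in> Y)"
  then interpret additive_subgroup Y D by blast
  show "subring Y D" by (rule D.subringI) (use a a_subset in auto)
qed

lemma ideal_iff:
  assumes D: "ring D"
  shows "ideal J D \<longleftrightarrow> additive_subgroup J D \<and> (\<forall>a\<in>J. \<forall>x\<in>carrier D. x \<otimes>\<^bsub>D\<^esub> a \<in> J \<and> a \<otimes>\<^bsub>D\<^esub> x \<in> J)"
  using D by (auto simp: ideal_def ideal_axioms_def)

lemma add_map_vimage:
  assumes f: "f \<in> add_map D E" and D: "ring D" and E: "ring E" and H: "additive_subgroup H E"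
  shows "additive_subgroup {x \<in> carrier D. f x \<in> H} D"
  using H add_map_zero[OF f D E] add_map_minus[OF f D E] ring_minus_add(2)[OF D]
    ring.ring_simprules(2)[OF D]
  unfolding additive_subgroup_iff_minus[OF D] additive_subgroup_iff_minus[OF E] by auto

lemma add_map_equalizer:
  assumes f: "f \<in> add_map D E" and g: "g \<in> add_map D E" and D: "ring D" and E: "ring E"
  shows "additive_subgroup {x \<in> carrier D. f x = g x} D"
  using add_map_zero[OF f D E] add_map_minus[OF f D E] add_map_zero[OF g D E] add_map_minus[OF g D E]
    ring_minus_add(2)[OF D] ring.ring_simprules(2)[OF D]
  unfolding additive_subgroup_iff_minus[OF D] by auto

lemma add_map_comp: "f \<in> add_map D E \<Longrightarrow> g \<in> add_map E F \<Longrightarrow> (\<lambda>x. g (f x)) \<in> add_map D F"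
  by (auto simp: add_map_def Pi_iff)

lemma generate_minimal:
  assumes D: "ring D" and Z: "additive_subgroup Z D" and H: "H \<subseteq> Z"
  shows "generate (add_monoid D) H \<subseteq> Z"
proof -
  interpret D: ring D by fact
  show ?thesis by (rule D.add.generate_subgroup_incl[OF H additive_subgroup.a_subgroup[OF Z]])
qed

lemma generate_additive_subgroup:
  assumes D: "ring D" and H: "H \<subseteq> carrier D"
  shows "additive_subgroup (generate (add_monoid D) H) D"
proof -
  interpret D: ring D by fact
  show ?thesis by (rule additive_subgroupI[OF D.add.generate_is_subgroup]) (use H in simp)
qed

text \<open>The direct sum decomposition is encoded by the projections \<open>pr q\<close> to the homogeneous
  components: a subgroup is graded if and only if it is stable under them. That the components
  span the ring is expressed by an induction principle, which avoids finite sums.\<close>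

locale graded_dg =
  fixes D :: "'a dg_ring" and pr :: "nat \<Rightarrow> 'a \<Rightarrow> 'a"
  assumes ring_D: "ring D"
    and homog_carrier: "\<And>q. homog D q \<subseteq> carrier D"
    and pr_add: "\<And>q. pr q \<in> add_map D D"
    and pr_homog: "\<And>x q. x \<in> carrier D \<Longrightarrow> pr q x \<in> homog D q"
    and pr_same: "\<And>x q. x \<in> homog D q \<Longrightarrow> pr q x = x"
    and pr_other: "\<And>x q r. x \<in> homog D r \<Longrightarrow> q \<noteq> r \<Longrightarrow> pr q x = \<zero>\<^bsub>D\<^esub>"
    and spanned: "\<And>Z. additive_subgroup Z D \<Longrightarrow> (\<And>q. homog D q \<subseteq> Z) \<Longrightarrow> carrier D \<subseteq> Z"
    and dif_add: "dif D \<in> add_map D D"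
    and top: "\<And>q. topspace (htop D q) = homog D q"
begin

interpretation D: ring D by (rule ring_D)

lemma homog_minus: "x \<in> homog D q \<Longrightarrow> y \<in> homog D q \<Longrightarrow> x \<ominus>\<^bsub>D\<^esub> y \<in> homog D q"
  using add_map_minus[OF pr_add[of q] ring_D ring_D, of x y] pr_homog[of "x \<ominus>\<^bsub>D\<^esub> y" q] homog_carrier[of q]
    pr_same[of x q] pr_same[of y q] ring_minus_add(2)[OF ring_D, of x y]
  by (simp add: subset_iff)

text \<open>The elements that are the sum of sufficiently many of their components form a subgroup
  that contains the homogeneous elements.\<close>

lemma sum_pr:
  assumes x: "x \<in> carrier D"
  shows "\<exists>N. finsum D (\<lambda>q. pr q x) {..<N} = x"
proof -
  have prc: "pr q x \<in> carrier D" if "x \<in> carrier D" for q x using add_map_closed[OF pr_add that] .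
  have ps: "(\<lambda>x. finsum D (\<lambda>q. pr q x) {..<M}) \<in> add_map D D" for M :: nat
    unfolding add_map_def
  proof (intro CollectI conjI ballI funcsetI)
    fix x y assume "x \<in> carrier D" "y \<in> carrier D"
    then show "finsum D (\<lambda>q. pr q (x \<oplus>\<^bsub>D\<^esub> y)) {..<M} = finsum D (\<lambda>q. pr q x) {..<M} \<oplus>\<^bsub>D\<^esub> finsum D (\<lambda>q. pr q y) {..<M}"
      using prc by (simp add: add_map_add[OF pr_add] D.finsum_addf)
  qed (use prc in \<open>auto intro!: D.finsum_closed\<close>)
  let ?Z = "{x \<in> carrier D. \<exists>N. \<forall>M\<ge>N. finsum D (\<lambda>q. pr q x) {..<M} = x}"
  have "carrier D \<subseteq> ?Z"
  proof (rule spanned)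
    show "additive_subgroup ?Z D"
      unfolding additive_subgroup_iff_minus[OF ring_D]
    proof (intro conjI ballI)
      show "\<zero>\<^bsub>D\<^esub> \<in> ?Z" using add_map_zero[OF ps ring_D ring_D] by auto
      fix x y assume "x \<in> ?Z" "y \<in> ?Z"
      then obtain N N' where N: "\<And>M. M \<ge> N \<Longrightarrow> finsum D (\<lambda>q. pr q x) {..<M} = x" "\<And>M. M \<ge> N' \<Longrightarrow> finsum D (\<lambda>q. pr q y) {..<M} = y"
        and c: "x \<in> carrier D" "y \<in> carrier D" by blast
      have "finsum D (\<lambda>q. pr q (x \<ominus>\<^bsub>D\<^esub> y)) {..<M} = x \<ominus>\<^bsub>D\<^esub> y" if "M \<ge> max N N'" for M
        using add_map_minus[OF ps ring_D ring_D c, of M] N that by simp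
      then show "x \<ominus>\<^bsub>D\<^esub> y \<in> ?Z" using c by blast
    qed blast
    fix r show "homog D r \<subseteq> ?Z"
    proof
      fix h assume h: "h \<in> homog D r"
      have hc: "h \<in> carrier D" using h homog_carrier by blast
      have "finsum D (\<lambda>q. pr q h) {..<M} = h" if "M \<ge> Suc r" for M
      proof -
        have "finsum D (\<lambda>q. pr q h) {..<M} = finsum D (\<lambda>q. if r = q then h else \<zero>\<^bsub>D\<^esub>) {..<M}"
          using pr_same[OF h] pr_other[OF h] hc by (intro D.finsum_cong') auto
        also have "\<dots> = h" using that hc by (subst D.finsum_singleton) auto
        finally show ?thesis .
      qed
      then show "h \<in> ?Z" using hc by blast
    qed
  qed
  then show ?thesis using x by blast
qed

lemma graded_iff:
  assumes Y: "additive_subgroup Y D"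
  shows "graded_subset Y D \<longleftrightarrow> (\<forall>y\<in>Y. \<forall>q. pr q y \<in> Y)"
proof
  have Yc: "Y \<subseteq> carrier D" using additive_subgroup.a_subset[OF Y] .
  assume g: "graded_subset Y D"
  show "\<forall>y\<in>Y. \<forall>q. pr q y \<in> Y"
  proof (intro ballI allI)
    fix y q assume y: "y \<in> Y"
    have "generate (add_monoid D) (\<Union>q. Y \<inter> homog D q) \<subseteq> {x \<in> carrier D. pr q x \<in> Y}"
    proof (rule generate_minimal[OF ring_D add_map_vimage[OF pr_add ring_D ring_D Y]])
      have "pr q h \<in> Y" if "h \<in> Y" "h \<in> homog D r" for h r
        using that pr_same pr_other[of h r q] additive_subgroup.zero_closed[OF Y] by (cases "q = r") auto
      then show "(\<Union>q. Y \<inter> homog D q) \<subseteq> {x \<in> carrier D. pr q x \<in> Y}" using Yc by blast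
    qed
    then show "pr q y \<in> Y" using g y unfolding graded_subset_def by blast
  qed
next
  have Yc: "Y \<subseteq> carrier D" using additive_subgroup.a_subset[OF Y] .
  assume a: "\<forall>y\<in>Y. \<forall>q. pr q y \<in> Y"
  let ?G = "generate (add_monoid D) (\<Union>q. Y \<inter> homog D q)"
  have G: "additive_subgroup ?G D" by (rule generate_additive_subgroup[OF ring_D]) (use Yc in blast)
  show "graded_subset Y D"
    unfolding graded_subset_def
  proof
    fix y assume y: "y \<in> Y"
    have pG: "pr q y \<in> ?G" for q
    proof (rule generate.incl, rule UN_I[OF UNIV_I])
      have "y \<in> carrier D" using y Yc by (rule subsetD[rotated])
      then show "pr q y \<in> Y \<inter> homog D q" using a y pr_homog by simp
    qed
    have pc: "pr q y \<in> carrier D" for q using pG additive_subgroup.a_subset[OF G] by blast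
    have "finsum D (\<lambda>q. pr q y) {..<N} \<in> ?G" for N :: nat
    proof (induct N)
      case 0 show ?case using additive_subgroup.zero_closed[OF G] by simp
    next
      case (Suc N)
      have "finsum D (\<lambda>q. pr q y) {..<Suc N} = pr N y \<oplus>\<^bsub>D\<^esub> finsum D (\<lambda>q. pr q y) {..<N}"
        unfolding lessThan_Suc using pc by (subst D.finsum_insert) auto
      then show ?case using additive_subgroup.a_closed[OF G pG Suc] by simp
    qed
    then show "y \<in> ?G" using sum_pr[of y] y Yc by (metis subsetD)
  qed
qed

lemma dg_subring_iff:
  "dg_subring Y D \<longleftrightarrow> additive_subgroup Y D \<and> \<one>\<^bsub>D\<^esub> \<in> Y \<and> (\<forall>x\<in>Y. \<forall>y\<in>Y. x \<otimes>\<^bsub>D\<^esub> y \<in> Y) \<and>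
    (\<forall>y\<in>Y. \<forall>q. pr q y \<in> Y) \<and> (\<forall>y\<in>Y. dif D y \<in> Y)"
  unfolding dg_subring_def subring_iff[OF ring_D] using graded_iff[of Y] by (auto simp: image_subset_iff)

lemma dg_ideal_iff:
  "dg_ideal J D \<longleftrightarrow> additive_subgroup J D \<and> (\<forall>a\<in>J. \<forall>x\<in>carrier D. x \<otimes>\<^bsub>D\<^esub> a \<in> J \<and> a \<otimes>\<^bsub>D\<^esub> x \<in> J) \<and>
    (\<forall>y\<in>J. \<forall>q. pr q y \<in> J) \<and> (\<forall>y\<in>J. dif D y \<in> J)"
  unfolding dg_ideal_def ideal_iff[OF ring_D] using graded_iff[of J] by (auto simp: image_subset_iff)

lemma additive_subgroup_Inter:
  assumes "K \<noteq> {}" "\<And>H. H \<in> K \<Longrightarrow> additive_subgroup H D" shows "additive_subgroup (\<Inter>K) D"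
  unfolding additive_subgroup_iff_minus[OF ring_D]
proof (intro conjI ballI)
  have H: "H \<subseteq> carrier D" "\<zero>\<^bsub>D\<^esub> \<in> H" "\<And>x y. x \<in> H \<Longrightarrow> y \<in> H \<Longrightarrow> x \<ominus>\<^bsub>D\<^esub> y \<in> H" if "H \<in> K" for H
    using assms(2)[OF that] unfolding additive_subgroup_iff_minus[OF ring_D] by blast+
  obtain H0 where "H0 \<in> K" using assms(1) by blast
  then show "\<Inter>K \<subseteq> carrier D" using H(1) by blast
  show "\<zero>\<^bsub>D\<^esub> \<in> \<Inter>K" using H(2) by blast
  show "x \<ominus>\<^bsub>D\<^esub> y \<in> \<Inter>K" if "x \<in> \<Inter>K" "y \<in> \<Inter>K" for x y using H(3) that by blast
qed

lemma dg_closed_Inter: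
  assumes "K \<noteq> {}" "\<And>H. H \<in> K \<Longrightarrow> dg_closed H D" shows "dg_closed (\<Inter>K) D"
  unfolding dg_closed_def
proof
  fix q
  have "\<Inter>K \<inter> homog D q = \<Inter>((\<lambda>H. H \<inter> homog D q) ` K)" using assms(1) by blast
  moreover have "closedin (htop D q) (\<Inter>((\<lambda>H. H \<inter> homog D q) ` K))"
    by (rule closedin_Inter) (use assms in \<open>auto simp: dg_closed_def\<close>)
  ultimately show "closedin (htop D q) (\<Inter>K \<inter> homog D q)" by simp
qed

lemma carrier_subgroup: "additive_subgroup (carrier D) D"
  using ring_minus_add(2)[OF ring_D] by (simp add: additive_subgroup_iff_minus[OF ring_D])

lemma dg_closed_carrier: "dg_closed (carrier D) D"
proof -
  have "carrier D \<inter> homog D q = topspace (htop D q)" for q using homog_carrier top by blast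
  then show ?thesis unfolding dg_closed_def by simp
qed

lemma dg_subring_carrier: "dg_subring (carrier D) D"
  unfolding dg_subring_iff
  using carrier_subgroup add_map_closed[OF pr_add] add_map_closed[OF dif_add] by auto

lemma dg_ideal_carrier: "dg_ideal (carrier D) D"
  unfolding dg_ideal_iff
  using carrier_subgroup add_map_closed[OF pr_add] add_map_closed[OF dif_add] by auto

lemma dg_subring_hull:
  assumes "B \<subseteq> carrier D"
  shows "dg_subring ((\<lambda>Y. dg_subring Y D \<and> dg_closed Y D) hull B) D"
    and "dg_closed ((\<lambda>Y. dg_subring Y D \<and> dg_closed Y D) hull B) D"
proof -
  let ?K = "{Y. (dg_subring Y D \<and> dg_closed Y D) \<and> B \<subseteq> Y}"
  have ne: "?K \<noteq> {}" using dg_subring_carrier dg_closed_carrier assms by blast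
  have "additive_subgroup (\<Inter>?K) D" by (rule additive_subgroup_Inter[OF ne]) (simp add: dg_subring_iff)
  then show "dg_subring ((\<lambda>Y. dg_subring Y D \<and> dg_closed Y D) hull B) D"
    unfolding hull_def dg_subring_iff[of "\<Inter>?K"] by (simp add: dg_subring_iff)
  show "dg_closed ((\<lambda>Y. dg_subring Y D \<and> dg_closed Y D) hull B) D"
    unfolding hull_def by (rule dg_closed_Inter[OF ne]) blast
qed

lemma dg_ideal_hull:
  assumes "B \<subseteq> carrier D"
  shows "dg_ideal ((\<lambda>Y. dg_ideal Y D \<and> dg_closed Y D) hull B) D"
    and "dg_closed ((\<lambda>Y. dg_ideal Y D \<and> dg_closed Y D) hull B) D"
proof -
  let ?K = "{Y. (dg_ideal Y D \<and> dg_closed Y D) \<and> B \<subseteq> Y}"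
  have ne: "?K \<noteq> {}" using dg_ideal_carrier dg_closed_carrier assms by blast
  have "additive_subgroup (\<Inter>?K) D" by (rule additive_subgroup_Inter[OF ne]) (simp add: dg_ideal_iff)
  then show "dg_ideal ((\<lambda>Y. dg_ideal Y D \<and> dg_closed Y D) hull B) D"
    unfolding hull_def dg_ideal_iff[of "\<Inter>?K"] by (simp add: dg_ideal_iff)
  show "dg_closed ((\<lambda>Y. dg_ideal Y D \<and> dg_closed Y D) hull B) D"
    unfolding hull_def by (rule dg_closed_Inter[OF ne]) blast
qed

end

lemma sub_dg_ring_simps [simp]:
  "carrier (sub_dg_ring D Y) = Y" "homog (sub_dg_ring D Y) q = Y \<inter> homog D q" "dif (sub_dg_ring D Y) = dif D"
  "htop (sub_dg_ring D Y) q = subtopology (htop D q) Y"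
  "x \<otimes>\<^bsub>sub_dg_ring D Y\<^esub> y = x \<otimes>\<^bsub>D\<^esub> y" "x \<oplus>\<^bsub>sub_dg_ring D Y\<^esub> y = x \<oplus>\<^bsub>D\<^esub> y"
  "\<one>\<^bsub>sub_dg_ring D Y\<^esub> = \<one>\<^bsub>D\<^esub>" "\<zero>\<^bsub>sub_dg_ring D Y\<^esub> = \<zero>\<^bsub>D\<^esub>"
  by (simp_all add: sub_dg_ring_def)

context graded_dg begin

context
  fixes Y assumes Y: "dg_subring Y D"
begin

lemma ring_sub: "ring (sub_dg_ring D Y)"
proof -
  have "ring (D\<lparr>carrier := Y\<rparr>)" using Y ring.subring_is_ring[OF ring_D] by (simp add: dg_subring_def)
  then show ?thesis by (rule ring_transfer) simp_all
qed

lemma sub_carrier: "Y \<subseteq> carrier D"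
  using Y additive_subgroup.a_subset by (auto simp: dg_subring_iff)

lemma sub_minus: "x \<in> Y \<Longrightarrow> y \<in> Y \<Longrightarrow> x \<ominus>\<^bsub>sub_dg_ring D Y\<^esub> y = x \<ominus>\<^bsub>D\<^esub> y"
  by (rule minus_transfer[OF ring_D ring_sub]) (use sub_carrier in auto)

lemma sub_additive_subgroup:
  assumes "additive_subgroup Z (sub_dg_ring D Y)" shows "additive_subgroup Z D"
proof -
  have Z: "Z \<subseteq> Y" "\<zero>\<^bsub>D\<^esub> \<in> Z" "\<And>x y. x \<in> Z \<Longrightarrow> y \<in> Z \<Longrightarrow> x \<ominus>\<^bsub>sub_dg_ring D Y\<^esub> y \<in> Z"
    using assms unfolding additive_subgroup_iff_minus[OF ring_sub] by auto
  have "x \<ominus>\<^bsub>D\<^esub> y \<in> Z" if "x \<in> Z" "y \<in> Z" for x y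
    using Z(3)[OF that] sub_minus[of x y] that Z(1) by (metis subsetD)
  then show ?thesis using Z(1,2) sub_carrier unfolding additive_subgroup_iff_minus[OF ring_D] by blast
qed

lemma graded_sub: "graded_dg (sub_dg_ring D Y) pr"
proof (rule graded_dg.intro, goal_cases)
  case 1 show ?case by (rule ring_sub)
next
  case (2 q) show ?case by simp
next
  case (3 q) show ?case using Y sub_carrier add_map_add[OF pr_add] by (auto simp: add_map_def dg_subring_iff subset_iff)
next
  case (4 x q) then show ?case using Y sub_carrier pr_homog by (auto simp: dg_subring_iff)
next
  case (5 x q) then show ?case using pr_same[of x q] by simp
next
  case (6 x q r) then show ?case using pr_other[of x r q] by simp
next
  case (7 Z)
  have "Y \<subseteq> generate (add_monoid D) (\<Union>q. Y \<inter> homog D q)"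
    using Y by (simp add: dg_subring_def graded_subset_def)
  also have "\<dots> \<subseteq> Z"
    by (rule generate_minimal[OF ring_D sub_additive_subgroup[OF 7(1)]]) (use 7(2) in auto)
  finally show ?case by simp
next
  case 8 show ?case using Y sub_carrier add_map_add[OF dif_add] by (auto simp: add_map_def dg_subring_iff subset_iff)
next
  case (9 q) show ?case using top by auto
qed

lemma dg_closed_subring_trans:
  assumes cl: "dg_closed Y D" and Z: "dg_subring Z (sub_dg_ring D Y)" "dg_closed Z (sub_dg_ring D Y)"
  shows "dg_subring Z D" "dg_closed Z D"
proof -
  interpret s: graded_dg "sub_dg_ring D Y" pr by (rule graded_sub)
  have ZY: "Z \<subseteq> Y" using Z(1) additive_subgroup.a_subset unfolding s.dg_subring_iff by fastforce
  show "dg_subring Z D"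
    using Z(1) sub_additive_subgroup unfolding dg_subring_iff s.dg_subring_iff by simp
  show "dg_closed Z D"
    unfolding dg_closed_def
  proof
    fix q
    have "closedin (subtopology (htop D q) Y) (Z \<inter> (Y \<inter> homog D q))" using Z(2) by (simp add: dg_closed_def)
    moreover have "Z \<inter> (Y \<inter> homog D q) = Z \<inter> homog D q" using ZY by blast
    ultimately obtain C where C: "closedin (htop D q) C" "Z \<inter> homog D q = C \<inter> Y" unfolding closedin_subtopology by auto
    have "Z \<inter> homog D q = C \<inter> (Y \<inter> homog D q)" using C(2) by blast
    moreover have "closedin (htop D q) (Y \<inter> homog D q)" using cl by (simp add: dg_closed_def)
    ultimately show "closedin (htop D q) (Z \<inter> homog D q)" using C(1) closedin_Int by metis
  qed
qed

end

end

lemma quot_dg_ring_simps [simp]: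
  "carrier (quot_dg_ring D J) = (\<lambda>x. J +>\<^bsub>D\<^esub> x) ` carrier D" "homog (quot_dg_ring D J) q = (\<lambda>x. J +>\<^bsub>D\<^esub> x) ` homog D q"
  "dif (quot_dg_ring D J) = coset_map D J (dif D)"
  "htop (quot_dg_ring D J) q = quot_topology (htop D q) (\<lambda>x. J +>\<^bsub>D\<^esub> x)"
  "v \<otimes>\<^bsub>quot_dg_ring D J\<^esub> w = v \<otimes>\<^bsub>D Quot J\<^esub> w" "v \<oplus>\<^bsub>quot_dg_ring D J\<^esub> w = v \<oplus>\<^bsub>D Quot J\<^esub> w"
  "\<one>\<^bsub>quot_dg_ring D J\<^esub> = \<one>\<^bsub>D Quot J\<^esub>" "\<zero>\<^bsub>quot_dg_ring D J\<^esub> = \<zero>\<^bsub>D Quot J\<^esub>"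
  by (simp_all add: quot_dg_ring_def ring.defs dg_ring.defs carrier_Quot)

context graded_dg begin

context
  fixes J assumes J: "dg_ideal J D"
begin

lemma quot_ideal: "ideal J D"
  using J by (simp add: dg_ideal_def)

lemma ring_quot: "ring (quot_dg_ring D J)"
  by (rule ring_transfer[OF ideal.quotient_is_ring[OF quot_ideal]]) (simp_all add: carrier_Quot)

lemma quot_proj_hom: "(\<lambda>x. J +>\<^bsub>D\<^esub> x) \<in> ring_hom D (quot_dg_ring D J)"
  using ideal.rcos_ring_hom[OF quot_ideal] by (auto simp: ring_hom_def)

lemma quot_coset_map:
  assumes f: "f \<in> add_map D D" and fJ: "\<And>x. x \<in> J \<Longrightarrow> f x \<in> J" and x: "x \<in> carrier D"
  shows "coset_map D J f (J +>\<^bsub>D\<^esub> x) = J +>\<^bsub>D\<^esub> f x"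
  by (rule coset_map_coset[OF quot_ideal quot_ideal f _ x]) (use fJ in blast)

lemma quot_add_map:
  assumes f: "f \<in> add_map D D" and fJ: "\<And>x. x \<in> J \<Longrightarrow> f x \<in> J"
  shows "coset_map D J f \<in> add_map (quot_dg_ring D J) (quot_dg_ring D J)"
  using add_map_closed[OF f] ring.ring_simprules(1)[OF ring_D]
  by (auto simp: add_map_def Quot_simps[OF quot_ideal] quot_coset_map[OF f fJ] add_map_add[OF f])

lemma quot_pr: "x \<in> carrier D \<Longrightarrow> coset_map D J (pr q) (J +>\<^bsub>D\<^esub> x) = J +>\<^bsub>D\<^esub> pr q x"
  using J by (intro quot_coset_map[OF pr_add]) (simp add: dg_ideal_iff)

lemma quot_dif: "x \<in> carrier D \<Longrightarrow> dif (quot_dg_ring D J) (J +>\<^bsub>D\<^esub> x) = J +>\<^bsub>D\<^esub> dif D x"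
  using J by (simp add: quot_coset_map[OF dif_add] dg_ideal_iff)

lemma graded_quot: "graded_dg (quot_dg_ring D J) (\<lambda>q. coset_map D J (pr q))"
proof (rule graded_dg.intro, goal_cases)
  case 1 show ?case by (rule ring_quot)
next
  case (2 q) show ?case using homog_carrier by auto
next
  case (3 q) show ?case by (rule quot_add_map[OF pr_add]) (use J in \<open>simp add: dg_ideal_iff\<close>)
next
  case (4 x q) then show ?case using quot_pr pr_homog by auto
next
  case (5 x q) then show ?case using quot_pr pr_same homog_carrier by (auto simp: subset_iff)
next
  case (6 x q r)
  then obtain h where h: "h \<in> homog D r" "x = J +>\<^bsub>D\<^esub> h" by auto
  have "J +>\<^bsub>D\<^esub> \<zero>\<^bsub>D\<^esub> = \<zero>\<^bsub>quot_dg_ring D J\<^esub>"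
    using add_map_zero[OF ring_hom_add_map[OF quot_proj_hom] ring_D ring_quot] .
  then show ?case using h 6(2) quot_pr[of h q] pr_other[OF h(1)] homog_carrier by (auto simp: subset_iff)
next
  case (7 Z)
  have "carrier D \<subseteq> {x \<in> carrier D. J +>\<^bsub>D\<^esub> x \<in> Z}"
    by (rule spanned[OF add_map_vimage[OF ring_hom_add_map[OF quot_proj_hom] ring_D ring_quot 7(1)]])
      (use 7(2) homog_carrier in auto)
  then show ?case by auto
next
  case 8 show ?case using quot_add_map[OF dif_add] J by (simp add: dg_ideal_iff)
next
  case (9 q) show ?case by (simp add: topspace_quot_topology top)
qed

end

end

text \<open>The conditions on a homomorphism of topological differential graded algebras that do not
  refer to the base ring.\<close>

definition dg_map :: "'a dg_ring \<Rightarrow> 'b dg_ring \<Rightarrow> ('a \<Rightarrow> 'b) \<Rightarrow> bool"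
  where "dg_map D E \<Phi> \<longleftrightarrow> \<Phi> \<in> ring_hom D E \<and> (\<forall>q. \<Phi> ` homog D q \<subseteq> homog E q) \<and>
    (\<forall>x\<in>carrier D. \<Phi> (dif D x) = dif E (\<Phi> x)) \<and> dg_continuous D E \<Phi>"

lemma dg_mapD:
  assumes "dg_map D E \<Phi>"
  shows "\<Phi> \<in> ring_hom D E" "\<Phi> \<in> add_map D E" "\<And>q x. x \<in> homog D q \<Longrightarrow> \<Phi> x \<in> homog E q"
    "\<And>x. x \<in> carrier D \<Longrightarrow> \<Phi> (dif D x) = dif E (\<Phi> x)" "\<And>q. continuous_map (htop D q) (htop E q) \<Phi>"
  using assms ring_hom_add_map[of \<Phi> D E] unfolding dg_map_def dg_continuous_def by blast+

lemma dg_map_comp: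
  assumes "dg_map D E f" "dg_map E F g" shows "dg_map D F (\<lambda>x. g (f x))"
  unfolding dg_map_def dg_continuous_def
proof (intro conjI allI ballI)
  show "(\<lambda>x. g (f x)) \<in> ring_hom D F"
    using ring_hom_trans[OF dg_mapD(1)[OF assms(1)] dg_mapD(1)[OF assms(2)]] by (simp add: o_def)
  show "continuous_map (htop D q) (htop F q) (\<lambda>x. g (f x))" for q
    using continuous_map_compose[OF dg_mapD(5)[OF assms(1)] dg_mapD(5)[OF assms(2)]] by (simp add: o_def)
qed (use dg_mapD[OF assms(1)] dg_mapD[OF assms(2)] ring_hom_closed[OF dg_mapD(1)[OF assms(1)]] in auto)

lemma dg_map_cong:
  assumes D: "graded_dg D pr" and f: "dg_map D E f" and eq: "\<And>x. x \<in> carrier D \<Longrightarrow> g x = f x"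
  shows "dg_map D E g"
proof -
  interpret D: graded_dg D pr by fact
  interpret R: ring D by (rule D.ring_D)
  have h: "x \<in> homog D q \<Longrightarrow> g x = f x" for x q using eq D.homog_carrier by blast
  show ?thesis
    unfolding dg_map_def dg_continuous_def
  proof (intro conjI allI ballI)
    show "g \<in> ring_hom D E" using dg_mapD(1)[OF f] eq by (auto simp: ring_hom_def)
    show "g ` homog D q \<subseteq> homog E q" for q using dg_mapD(3)[OF f] h by auto
    show "g (dif D x) = dif E (g x)" if "x \<in> carrier D" for x
      using dg_mapD(4)[OF f that] eq that add_map_closed[OF D.dif_add that] by simp
    show "continuous_map (htop D q) (htop E q) g" for q
      by (rule continuous_map_eq[OF dg_mapD(5)[OF f]]) (simp add: D.top h)
  qed
qed

lemma dg_map_pr: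
  assumes "graded_dg D pr" "graded_dg E pr'" "dg_map D E \<Phi>" "x \<in> carrier D"
  shows "\<Phi> (pr q x) = pr' q (\<Phi> x)"
proof -
  interpret D: graded_dg D pr by fact
  interpret E: graded_dg E pr' by fact
  note f = dg_mapD[OF assms(3)]
  have "carrier D \<subseteq> {x \<in> carrier D. \<Phi> (pr q x) = pr' q (\<Phi> x)}"
  proof (rule D.spanned)
    show "additive_subgroup {x \<in> carrier D. \<Phi> (pr q x) = pr' q (\<Phi> x)} D"
      by (rule add_map_equalizer[OF add_map_comp[OF D.pr_add f(2)] add_map_comp[OF f(2) E.pr_add] D.ring_D E.ring_D])
    fix r show "homog D r \<subseteq> {x \<in> carrier D. \<Phi> (pr q x) = pr' q (\<Phi> x)}"
    proof
      fix h assume h: "h \<in> homog D r"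
      have "\<Phi> (pr q h) = pr' q (\<Phi> h)"
        using D.pr_same[OF h] E.pr_same[OF f(3)[OF h]] D.pr_other[OF h, of q] E.pr_other[OF f(3)[OF h], of q]
          add_map_zero[OF f(2) D.ring_D E.ring_D] by (cases "q = r") auto
      then show "h \<in> {x \<in> carrier D. \<Phi> (pr q x) = pr' q (\<Phi> x)}" using h D.homog_carrier by blast
    qed
  qed
  then show ?thesis using assms(4) by blast
qed

lemma dg_closed_vimage:
  assumes D: "graded_dg D pr" and E: "graded_dg E pr'" and \<Phi>: "dg_map D E \<Phi>" and Y: "dg_closed Y E"
  shows "dg_closed {x \<in> carrier D. \<Phi> x \<in> Y} D"
  unfolding dg_closed_def
proof
  interpret D: graded_dg D pr by fact
  interpret E: graded_dg E pr' by fact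
  fix q
  have "{x \<in> carrier D. \<Phi> x \<in> Y} \<inter> homog D q = {x \<in> topspace (htop D q). \<Phi> x \<in> Y \<inter> homog E q}"
    unfolding D.top using D.homog_carrier dg_mapD(3)[OF \<Phi>] by blast
  moreover have "closedin (htop E q) (Y \<inter> homog E q)" using Y by (simp add: dg_closed_def)
  ultimately show "closedin (htop D q) ({x \<in> carrier D. \<Phi> x \<in> Y} \<inter> homog D q)"
    using closedin_continuous_map_preimage[OF dg_mapD(5)[OF \<Phi>]] by presburger
qed

lemma dg_subring_vimage:
  assumes D: "graded_dg D pr" and E: "graded_dg E pr'" and \<Phi>: "dg_map D E \<Phi>" and Y: "dg_subring Y E"
  shows "dg_subring {x \<in> carrier D. \<Phi> x \<in> Y} D"
proof -
  interpret D: graded_dg D pr by fact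
  interpret E: graded_dg E pr' by fact
  interpret R: ring D by (rule D.ring_D)
  note f = dg_mapD[OF \<Phi>] and y = Y[unfolded E.dg_subring_iff]
  show ?thesis
    unfolding D.dg_subring_iff
    using y add_map_vimage[OF f(2) D.ring_D E.ring_D] f(4) dg_map_pr[OF D E \<Phi>]
      add_map_closed[OF D.pr_add] add_map_closed[OF D.dif_add]
    by (auto simp: ring_hom_one[OF f(1)] ring_hom_mult[OF f(1)])
qed

lemma dg_ideal_vimage:
  assumes D: "graded_dg D pr" and E: "graded_dg E pr'" and \<Phi>: "dg_map D E \<Phi>" and Y: "dg_ideal Y E"
  shows "dg_ideal {x \<in> carrier D. \<Phi> x \<in> Y} D"
proof -
  interpret D: graded_dg D pr by fact
  interpret E: graded_dg E pr' by fact
  interpret R: ring D by (rule D.ring_D)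
  note f = dg_mapD[OF \<Phi>] and y = Y[unfolded E.dg_ideal_iff]
  show ?thesis
    unfolding D.dg_ideal_iff
    using y add_map_vimage[OF f(2) D.ring_D E.ring_D] f(4) dg_map_pr[OF D E \<Phi>]
      add_map_closed[OF D.pr_add] add_map_closed[OF D.dif_add] ring_hom_closed[OF f(1)]
    by (auto simp: ring_hom_mult[OF f(1)])
qed

text \<open>This is the uniqueness principle for maps out of a ring that is generated, as a closed
  differential graded ring, by a given subset.\<close>

lemma dg_equalizer:
  assumes D: "graded_dg D pr" and E: "graded_dg E pr'" and \<Phi>: "dg_map D E \<Phi>" and \<Psi>: "dg_map D E \<Psi>"
    and H: "\<And>q. Hausdorff_space (htop E q)"
  shows "dg_subring {x \<in> carrier D. \<Phi> x = \<Psi> x} D" "dg_closed {x \<in> carrier D. \<Phi> x = \<Psi> x} D"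
proof -
  interpret D: graded_dg D pr by fact
  interpret E: graded_dg E pr' by fact
  interpret R: ring D by (rule D.ring_D)
  note f = dg_mapD[OF \<Phi>] and g = dg_mapD[OF \<Psi>]
  show "dg_subring {x \<in> carrier D. \<Phi> x = \<Psi> x} D"
    unfolding D.dg_subring_iff
    using add_map_equalizer[OF f(2) g(2) D.ring_D E.ring_D] f(4) g(4) dg_map_pr[OF D E \<Phi>] dg_map_pr[OF D E \<Psi>]
      add_map_closed[OF D.pr_add] add_map_closed[OF D.dif_add]
    by (auto simp: ring_hom_one[OF f(1)] ring_hom_mult[OF f(1)] ring_hom_one[OF g(1)] ring_hom_mult[OF g(1)])
  show "dg_closed {x \<in> carrier D. \<Phi> x = \<Psi> x} D"
    unfolding dg_closed_def
  proof
    fix q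
    have "{x \<in> carrier D. \<Phi> x = \<Psi> x} \<inter> homog D q = {x \<in> topspace (htop D q). \<Phi> x = \<Psi> x}"
      unfolding D.top using D.homog_carrier by blast
    then show "closedin (htop D q) ({x \<in> carrier D. \<Phi> x = \<Psi> x} \<inter> homog D q)"
      using closedin_continuous_maps_eq[OF H f(5) g(5)] by simp
  qed
qed

lemma dg_map_sub:
  assumes D: "graded_dg D pr" and \<Phi>: "dg_map D E \<Phi>" and Y: "Y \<subseteq> carrier D" and YZ: "\<Phi> ` Y \<subseteq> Z"
  shows "dg_map (sub_dg_ring D Y) (sub_dg_ring E Z) \<Phi>"
  unfolding dg_map_def dg_continuous_def
proof (intro conjI allI ballI)
  note f = dg_mapD[OF \<Phi>]
  show "\<Phi> \<in> ring_hom (sub_dg_ring D Y) (sub_dg_ring E Z)"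
    using f(1) Y YZ by (auto simp: ring_hom_def subset_iff)
  show "\<Phi> ` homog (sub_dg_ring D Y) q \<subseteq> homog (sub_dg_ring E Z) q" for q using f(3) YZ by auto
  show "\<Phi> (dif (sub_dg_ring D Y) x) = dif (sub_dg_ring E Z) (\<Phi> x)" if "x \<in> carrier (sub_dg_ring D Y)" for x
    using f(4) that Y by auto
  show "continuous_map (htop (sub_dg_ring D Y) q) (htop (sub_dg_ring E Z) q) \<Phi>" for q
    using f(5) YZ by (auto simp: continuous_map_in_subtopology continuous_map_from_subtopology)
qed

lemma dg_map_quot_proj:
  assumes D: "graded_dg D pr" and J: "dg_ideal J D"
  shows "dg_map D (quot_dg_ring D J) (\<lambda>x. J +>\<^bsub>D\<^esub> x)"
proof -
  interpret D: graded_dg D pr by fact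
  show ?thesis
    unfolding dg_map_def dg_continuous_def
    using D.quot_proj_hom[OF J] D.quot_dif[OF J] by (auto intro: continuous_map_quot_proj)
qed

lemma dg_map_quot:
  assumes D: "graded_dg D pr" and E: "graded_dg E pr'" and J: "dg_ideal J D" and J': "dg_ideal J' E"
    and \<Phi>: "dg_map D E \<Phi>" and JJ: "\<Phi> ` J \<subseteq> J'"
  shows "dg_map (quot_dg_ring D J) (quot_dg_ring E J') (coset_map E J' \<Phi>)"
    and "x \<in> carrier D \<Longrightarrow> coset_map E J' \<Phi> (J +>\<^bsub>D\<^esub> x) = J' +>\<^bsub>E\<^esub> \<Phi> x"
proof -
  interpret D: graded_dg D pr by fact
  interpret E: graded_dg E pr' by fact
  note f = dg_mapD[OF \<Phi>]
  note cm = coset_map_coset[OF D.quot_ideal[OF J] E.quot_ideal[OF J'] f(2) JJ]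
  show "x \<in> carrier D \<Longrightarrow> coset_map E J' \<Phi> (J +>\<^bsub>D\<^esub> x) = J' +>\<^bsub>E\<^esub> \<Phi> x" by (rule cm)
  show "dg_map (quot_dg_ring D J) (quot_dg_ring E J') (coset_map E J' \<Phi>)"
    unfolding dg_map_def dg_continuous_def
  proof (intro conjI allI ballI)
    show "coset_map E J' \<Phi> \<in> ring_hom (quot_dg_ring D J) (quot_dg_ring E J')"
      using coset_map_ring_hom[OF D.quot_ideal[OF J] E.quot_ideal[OF J'] f(1) JJ]
      by (auto simp: ring_hom_def carrier_Quot)
    show "coset_map E J' \<Phi> ` homog (quot_dg_ring D J) q \<subseteq> homog (quot_dg_ring E J') q" for q
      using f(3) cm D.homog_carrier by (auto simp: subset_iff)
    show "coset_map E J' \<Phi> (dif (quot_dg_ring D J) v) = dif (quot_dg_ring E J') (coset_map E J' \<Phi> v)"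
      if v: "v \<in> carrier (quot_dg_ring D J)" for v
    proof -
      obtain x where x: "x \<in> carrier D" "v = J +>\<^bsub>D\<^esub> x" using v by auto
      show ?thesis unfolding x(2) cm[OF x(1)] D.quot_dif[OF J x(1)] E.quot_dif[OF J' ring_hom_closed[OF f(1) x(1)]]
          cm[OF add_map_closed[OF D.dif_add x(1)]] f(4)[OF x(1)] ..
    qed
    show "continuous_map (htop (quot_dg_ring D J) q) (htop (quot_dg_ring E J') q) (coset_map E J' \<Phi>)" for q
      unfolding quot_dg_ring_simps
      by (rule continuous_map_from_quot[OF continuous_map_compose[OF f(5) continuous_map_quot_proj]])
        (use D.top D.homog_carrier cm in \<open>auto simp: subset_iff\<close>)
  qed
qed

section \<open>Relative differential forms\<close>

lemma form_symbols_simps [simp]: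
  "carrier (form_symbols A) = carrier A \<times> lists (carrier A)"
  "u \<otimes>\<^bsub>form_symbols A\<^esub> v = (fst u \<otimes>\<^bsub>A\<^esub> fst v, snd u @ snd v)"
  "\<one>\<^bsub>form_symbols A\<^esub> = (\<one>\<^bsub>A\<^esub>, [])"
  by (simp_all add: form_symbols_def DirProd_def split_beta)

lemma monoid_form_symbols:
  assumes "ring A" shows "monoid (form_symbols A)"
proof -
  interpret A: ring A by fact
  have "monoid \<lparr>carrier = lists (carrier A), monoid.mult = (@), monoid.one = []\<rparr>"
    by (rule monoidI) simp_all
  then show ?thesis unfolding form_symbols_def by (rule DirProd_monoid[OF A.monoid_axioms])
qed

lemma mr_mult_diff: "mr_mult M x (y - z) = mr_mult M x y - mr_mult M x z"
    "mr_mult M (x - y) z = mr_mult M x z - mr_mult M y z"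
  using mr_mult_add_right[of M x "y - z" z] mr_mult_add_left[of M "x - y" y z] by simp_all

definition deg_part :: "nat \<Rightarrow> ('a \<times> 'a list \<Rightarrow>\<^sub>0 rat) \<Rightarrow> 'a \<times> 'a list \<Rightarrow>\<^sub>0 rat"
  where "deg_part q = linear_extension (\<lambda>u s. if length (snd u) = q then Poly_Mapping.single u s else 0)"

lemma deg_part_add: "deg_part q (c + d) = deg_part q c + deg_part q d"
  unfolding deg_part_def by (rule linear_extension_add) (simp_all add: single_add)

lemma deg_part_diff: "deg_part q (c - d) = deg_part q c - deg_part q d"
  using deg_part_add[of q "c - d" d] by simp

lemma deg_part_single [simp]:
  "deg_part q (Poly_Mapping.single u s) = (if length (snd u) = q then Poly_Mapping.single u s else 0)"
  unfolding deg_part_def by (subst linear_extension_single) simp_all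

lemma deg_part_zero [simp]: "deg_part q 0 = 0"
  by (simp add: deg_part_def)

lemma symbol_dif_eq: "symbol_dif A = linear_extension (\<lambda>u s. Poly_Mapping.single (\<one>\<^bsub>A\<^esub>, fst u # snd u) s)"
  by (simp add: symbol_dif_def linear_extension_def split_beta fun_eq_iff)

lemma symbol_dif_add: "symbol_dif A (c + d) = symbol_dif A c + symbol_dif A d"
  unfolding symbol_dif_eq by (rule linear_extension_add) (simp_all add: single_add)

lemma symbol_dif_diff: "symbol_dif A (c - d) = symbol_dif A c - symbol_dif A d"
  using symbol_dif_add[of A "c - d" d] by simp

lemma symbol_dif_single [simp]:
  "symbol_dif A (Poly_Mapping.single u s) = Poly_Mapping.single (\<one>\<^bsub>A\<^esub>, fst u # snd u) s"
  unfolding symbol_dif_eq by (subst linear_extension_single) simp_all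

lemma symbol_dif_zero [simp]: "symbol_dif A 0 = 0"
  by (simp add: symbol_dif_eq)

locale forms =
  fixes A0 :: "('b, 'm) ring_scheme" and A :: "('a, 'n) ring_scheme" and \<iota> :: "'b \<Rightarrow> 'a"
  assumes cring_A: "cring A" and incl_closed: "\<And>r. r \<in> carrier A0 \<Longrightarrow> \<iota> r \<in> carrier A"
begin

interpretation A: cring A by (rule cring_A)

abbreviation "SR \<equiv> symbol_ring A"
abbreviation "FI \<equiv> form_ideal A0 A \<iota>"
abbreviation "mul \<equiv> mr_mult (form_symbols A)"
abbreviation "symb \<equiv> carrier A \<times> lists (carrier A)"

lemma mon: "monoid (form_symbols A)"
  by (rule monoid_form_symbols[OF A.ring_axioms])

lemma ring_SR: "ring SR"
  by (rule ring_monoid_ring[OF mon])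

interpretation SR: ring SR by (rule ring_SR)

lemma mul_closed: "Poly_Mapping.keys x \<subseteq> symb \<Longrightarrow> Poly_Mapping.keys y \<subseteq> symb \<Longrightarrow> Poly_Mapping.keys (mul x y) \<subseteq> symb"
  using mr_mult_closed[OF mon, of x y] by simp

lemma mul_assoc: "Poly_Mapping.keys x \<subseteq> symb \<Longrightarrow> Poly_Mapping.keys y \<subseteq> symb \<Longrightarrow> Poly_Mapping.keys z \<subseteq> symb \<Longrightarrow>
    mul (mul x y) z = mul x (mul y z)"
  using mr_mult_assoc[OF mon, of x y z] by simp

lemma keys_diff_subset: "Poly_Mapping.keys c \<subseteq> Z \<Longrightarrow> Poly_Mapping.keys d \<subseteq> Z \<Longrightarrow> Poly_Mapping.keys (c - d) \<subseteq> Z"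
  for c d :: "'g \<Rightarrow>\<^sub>0 rat"
proof
  fix x assume c: "Poly_Mapping.keys c \<subseteq> Z" and d: "Poly_Mapping.keys d \<subseteq> Z" and "x \<in> Poly_Mapping.keys (c - d)"
  then have "x \<in> Poly_Mapping.keys c \<or> x \<in> Poly_Mapping.keys d" by (auto simp: in_keys_iff lookup_minus)
  then show "x \<in> Z" using c d by blast
qed

lemma relations_closed: "form_relations A0 A \<iota> \<subseteq> carrier SR"
proof
  fix r assume "r \<in> form_relations A0 A \<iota>"
  then have "Poly_Mapping.keys r \<subseteq> symb"
    unfolding form_relations_def
    by (elim UnE CollectE exE conjE) (simp_all add: keys_diff_subset keys_single_subset incl_closed del: keys_single)
  then show "r \<in> carrier SR" by simp
qed

lemma ideal_FI: "ideal FI SR"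
  unfolding form_ideal_def by (rule SR.genideal_ideal[OF relations_closed])

lemma FI_rel: "r \<in> form_relations A0 A \<iota> \<Longrightarrow> r \<in> FI"
  unfolding form_ideal_def using SR.genideal_self[OF relations_closed] by blast

lemma FI_zero: "0 \<in> FI"
  using additive_subgroup.zero_closed[OF ideal.axioms(1)[OF ideal_FI]] by simp

lemma FI_add: "c \<in> FI \<Longrightarrow> d \<in> FI \<Longrightarrow> c + d \<in> FI"
  using additive_subgroup.a_closed[OF ideal.axioms(1)[OF ideal_FI], of c d] by simp

lemma FI_minus:
  assumes c: "c \<in> FI" and d: "d \<in> FI" shows "c - d \<in> FI"
proof -
  have "additive_subgroup FI SR" by (rule ideal.axioms(1)[OF ideal_FI])
  then have "c \<ominus>\<^bsub>SR\<^esub> d \<in> FI" using c d by (simp only: additive_subgroup_iff_minus[OF ring_SR])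
  moreover have "c \<ominus>\<^bsub>SR\<^esub> d = c - d"
    by (rule monoid_ring_minus[OF mon]) (rule ideal.Icarr[OF ideal_FI], fact)+
  ultimately show ?thesis by simp
qed

lemma FI_left: "c \<in> FI \<Longrightarrow> Poly_Mapping.keys x \<subseteq> symb \<Longrightarrow> mul x c \<in> FI"
  using ideal.I_l_closed[OF ideal_FI, of c x] by simp

lemma FI_right: "c \<in> FI \<Longrightarrow> Poly_Mapping.keys x \<subseteq> symb \<Longrightarrow> mul c x \<in> FI"
  using ideal.I_r_closed[OF ideal_FI, of c x] by simp

text \<open>The additive span of the two-sided multiples of relations by symbols. It is the ideal
  generated by the relations, and unlike the latter it comes with an induction principle.\<close>

inductive_set FI_span :: "('a \<times> 'a list \<Rightarrow>\<^sub>0 rat) set" where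
  zero: "0 \<in> FI_span"
| gen: "u \<in> symb \<Longrightarrow> v \<in> symb \<Longrightarrow> r \<in> form_relations A0 A \<iota> \<Longrightarrow>
    mul (Poly_Mapping.single u s) (mul r (Poly_Mapping.single v t)) \<in> FI_span"
| add: "c \<in> FI_span \<Longrightarrow> d \<in> FI_span \<Longrightarrow> c + d \<in> FI_span"

lemma rel_keys: "r \<in> form_relations A0 A \<iota> \<Longrightarrow> Poly_Mapping.keys r \<subseteq> symb"
  using relations_closed by auto

lemma sym_keys: "u \<in> symb \<Longrightarrow> Poly_Mapping.keys (Poly_Mapping.single u (s::rat)) \<subseteq> symb"
  by (rule keys_single_subset)

lemma sym_mult: "u \<in> symb \<Longrightarrow> v \<in> symb \<Longrightarrow> u \<otimes>\<^bsub>form_symbols A\<^esub> v \<in> symb"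
  by auto

lemma FI_span_keys: "c \<in> FI_span \<Longrightarrow> Poly_Mapping.keys c \<subseteq> symb"
proof (induct rule: FI_span.induct)
  case zero show ?case by simp
next
  case (gen u v r s t)
  show ?case by (rule mul_closed[OF sym_keys[OF gen(1)] mul_closed[OF rel_keys[OF gen(3)] sym_keys[OF gen(2)]]])
next
  case (add c d)
  show ?case by (rule keys_add_subset[OF add(2,4)])
qed

lemma FI_span_uminus: "c \<in> FI_span \<Longrightarrow> - c \<in> FI_span"
proof (induct rule: FI_span.induct)
  case (gen u v r s t)
  have "- mul (Poly_Mapping.single u s) (mul r (Poly_Mapping.single v t))
      = mul (0 - Poly_Mapping.single u s) (mul r (Poly_Mapping.single v t))"
    unfolding mr_mult_diff by simp
  also have "0 - Poly_Mapping.single u s = Poly_Mapping.single u (- s)" by (simp add: single_uminus)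
  finally show ?case using FI_span.gen[OF gen, of "- s" t] by simp
next
  case (add c d)
  then show ?case using FI_span.add[of "- d" "- c"] by (simp add: add.commute)
qed (simp add: FI_span.zero)

lemma FI_span_left:
  assumes c: "c \<in> FI_span" and x: "Poly_Mapping.keys x \<subseteq> symb"
  shows "mul x c \<in> FI_span"
  using x
proof (induct x rule: poly_mapping_induct)
  case (single w a)
  show ?case using c
  proof (induct rule: FI_span.induct)
    case (gen u v r s t)
    have "mul (Poly_Mapping.single w a) (mul (Poly_Mapping.single u s) (mul r (Poly_Mapping.single v t)))
        = mul (Poly_Mapping.single (w \<otimes>\<^bsub>form_symbols A\<^esub> u) (a * s)) (mul r (Poly_Mapping.single v t))"
      by (simp only: mr_mult_single
          mul_assoc[OF sym_keys[OF single] sym_keys[OF gen(1)] mul_closed[OF rel_keys[OF gen(3)] sym_keys[OF gen(2)]], symmetric])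
    also have "\<dots> \<in> FI_span" by (rule FI_span.gen[OF sym_mult[OF single gen(1)] gen(2,3)])
    finally show ?case .
  qed (auto simp: mr_mult_add_right intro: FI_span.intros)
qed (auto simp: mr_mult_add_left intro: FI_span.intros)

lemma FI_span_right:
  assumes c: "c \<in> FI_span" and x: "Poly_Mapping.keys x \<subseteq> symb"
  shows "mul c x \<in> FI_span"
  using x
proof (induct x rule: poly_mapping_induct)
  case (single w a)
  show ?case using c
  proof (induct rule: FI_span.induct)
    case (gen u v r s t)
    note k = sym_keys[OF single] sym_keys[OF gen(1)] sym_keys[OF gen(2)] rel_keys[OF gen(3)]
    have "mul (mul (Poly_Mapping.single u s) (mul r (Poly_Mapping.single v t))) (Poly_Mapping.single w a)
        = mul (Poly_Mapping.single u s) (mul r (Poly_Mapping.single (v \<otimes>\<^bsub>form_symbols A\<^esub> w) (t * a)))"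
      by (simp only: mul_assoc[OF k(2) mul_closed[OF k(4,3)] k(1)] mul_assoc[OF k(4,3,1)] mr_mult_single)
    also have "\<dots> \<in> FI_span" by (rule FI_span.gen[OF gen(1) sym_mult[OF gen(2) single] gen(3)])
    finally show ?case .
  qed (auto simp: mr_mult_add_left intro: FI_span.intros)
qed (auto simp: mr_mult_add_right intro: FI_span.intros)

lemma FI_subset_span: "FI \<subseteq> FI_span"
proof -
  have "ideal FI_span SR"
    unfolding ideal_iff[OF ring_SR] additive_subgroup_iff_minus[OF ring_SR]
  proof (intro conjI ballI)
    show "FI_span \<subseteq> carrier SR" using FI_span_keys by auto
    show "\<zero>\<^bsub>SR\<^esub> \<in> FI_span" by (simp add: FI_span.zero)
    show "x \<ominus>\<^bsub>SR\<^esub> y \<in> FI_span" if "x \<in> FI_span" "y \<in> FI_span" for x y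
      using FI_span.add[OF that(1) FI_span_uminus[OF that(2)]] FI_span_keys[OF that(1)] FI_span_keys[OF that(2)]
        monoid_ring_minus[OF mon, of x y] by simp
    show "x \<otimes>\<^bsub>SR\<^esub> c \<in> FI_span" "c \<otimes>\<^bsub>SR\<^esub> x \<in> FI_span" if "c \<in> FI_span" "x \<in> carrier SR" for c x
      using FI_span_left[OF that(1), of x] FI_span_right[OF that(1), of x] that(2) by simp_all
  qed
  moreover have "form_relations A0 A \<iota> \<subseteq> FI_span"
  proof
    fix r assume r: "r \<in> form_relations A0 A \<iota>"
    have o: "(\<one>\<^bsub>A\<^esub>, []) \<in> symb" by simp
    have "mul (Poly_Mapping.single (\<one>\<^bsub>A\<^esub>, []) 1) (mul r (Poly_Mapping.single (\<one>\<^bsub>A\<^esub>, []) 1)) = r"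
      using mr_mult_one[OF mon, of r] rel_keys[OF r] by simp
    then show "r \<in> FI_span" using FI_span.gen[OF o o r, of 1 1] by simp
  qed
  ultimately show ?thesis unfolding form_ideal_def by (rule SR.genideal_minimal)
qed

text \<open>Multiplication by symbols shifts the degree, so the homogeneity of the ideal follows from
  that of the relations.\<close>

lemma deg_part_mul_single:
  "deg_part q (mul (Poly_Mapping.single u s) (mul c (Poly_Mapping.single v t)))
    = (if length (snd u) + length (snd v) \<le> q
       then mul (Poly_Mapping.single u s) (mul (deg_part (q - length (snd u) - length (snd v)) c) (Poly_Mapping.single v t))
       else 0)"
proof -
  have "Poly_Mapping.keys c \<subseteq> UNIV" by simp
  then show ?thesis
    by (induct c rule: poly_mapping_induct)
      (auto simp: mr_mult_add_left mr_mult_add_right deg_part_add)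
qed

lemma deg_part_relation: "r \<in> form_relations A0 A \<iota> \<Longrightarrow> deg_part q r = r \<or> deg_part q r = 0"
  unfolding form_relations_def by (auto simp: deg_part_diff)

lemma FI_deg_part: "c \<in> FI \<Longrightarrow> deg_part q c \<in> FI"
proof -
  assume "c \<in> FI"
  then have "c \<in> FI_span" using FI_subset_span by blast
  then show "deg_part q c \<in> FI"
  proof (induct rule: FI_span.induct)
    case (gen u v r s t)
    have "mul (Poly_Mapping.single u s) (mul r' (Poly_Mapping.single v t)) \<in> FI"
      if "r' = r \<or> r' = 0" for r'
      using FI_left[OF FI_right[OF FI_rel[OF gen(3)] sym_keys[OF gen(2)]] sym_keys[OF gen(1)]] FI_zero that by auto
    then show ?case
      using deg_part_relation[OF gen(3)] FI_zero unfolding deg_part_mul_single by (simp only: split: if_split) blast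
  qed (auto simp: deg_part_add FI_zero FI_add)
qed

end

text \<open>Bookkeeping for the Leibniz rule: the first three terms are the differential of a
  multiple of the relation, and the groups on the right hand side are elements of the ideal.\<close>

lemma telescope:
  fixes T1 T2 T3 X1 X2 Y1 Y2 :: "'g::ab_group_add"
  shows "T1 - T2 - T3 = (T1 - X1 - X2) - (T2 - Y1 - X1) - (T3 - Y2 - X2) - (Y1 + Y2)"
  by (simp add: algebra_simps)

context forms begin

interpretation A: cring A by (rule cring_A)
interpretation SR: ring SR by (rule ring_SR)

lemma mul_single:
  "mul (Poly_Mapping.single (a, as) s) (Poly_Mapping.single (b, bs) t)
    = Poly_Mapping.single (a \<otimes>\<^bsub>A\<^esub> b, as @ bs) (s * t)"
  by simp

lemmas mul_expand = mr_mult_diff mr_mult_add_left mr_mult_add_right mul_single append_Cons append_Nil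
  append_assoc append_Nil2 mult_1_left mult_1_right A.l_one A.r_one A.m_closed A.a_closed A.one_closed

text \<open>Polarizing \<open>dx dx = 0\<close> gives \<open>dx dy = - dy dx\<close>. Interchanging \<open>x\<close> and \<open>y\<close> across \<open>n\<close>
  further factors takes an odd number of transpositions, so the sign does not depend on \<open>n\<close>.\<close>

lemma anticommute:
  assumes x: "x \<in> carrier A" and y: "y \<in> carrier A" and zs: "set zs \<subseteq> carrier A"
  shows "form \<one>\<^bsub>A\<^esub> (x # zs @ [y]) + form \<one>\<^bsub>A\<^esub> (y # zs @ [x]) \<in> FI"
proof -
  have two: "form \<one>\<^bsub>A\<^esub> [x, y] + form \<one>\<^bsub>A\<^esub> [y, x] \<in> FI" if x: "x \<in> carrier A" and y: "y \<in> carrier A" for x y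
  proof -
    let ?z = "x \<oplus>\<^bsub>A\<^esub> y"
    let ?E = "form \<one>\<^bsub>A\<^esub> [?z] - form \<one>\<^bsub>A\<^esub> [x] - form \<one>\<^bsub>A\<^esub> [y]"
    have E: "?E \<in> FI" by (rule FI_rel) (use x y in \<open>auto simp: form_relations_def\<close>)
    have sq: "form \<one>\<^bsub>A\<^esub> [w, w] \<in> FI" if "w \<in> carrier A" for w
      by (rule FI_rel) (use that in \<open>auto simp: form_relations_def\<close>)
    have k: "Poly_Mapping.keys (form \<one>\<^bsub>A\<^esub> [w]) \<subseteq> symb" if "w \<in> carrier A" for w using that by simp
    have 1: "form \<one>\<^bsub>A\<^esub> [?z, ?z] - form \<one>\<^bsub>A\<^esub> [x, ?z] - form \<one>\<^bsub>A\<^esub> [y, ?z] \<in> FI"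
      using FI_right[OF E k[of ?z]] x y by (simp only: mul_expand)
    have 2: "form \<one>\<^bsub>A\<^esub> [x, ?z] - form \<one>\<^bsub>A\<^esub> [x, x] - form \<one>\<^bsub>A\<^esub> [x, y] \<in> FI"
      using FI_left[OF E k[OF x]] x y by (simp only: mul_expand)
    have 3: "form \<one>\<^bsub>A\<^esub> [y, ?z] - form \<one>\<^bsub>A\<^esub> [y, x] - form \<one>\<^bsub>A\<^esub> [y, y] \<in> FI"
      using FI_left[OF E k[OF y]] x y by (simp only: mul_expand)
    have "form \<one>\<^bsub>A\<^esub> [?z, ?z] - form \<one>\<^bsub>A\<^esub> [x, x] - form \<one>\<^bsub>A\<^esub> [y, y]
        - ((form \<one>\<^bsub>A\<^esub> [?z, ?z] - form \<one>\<^bsub>A\<^esub> [x, ?z] - form \<one>\<^bsub>A\<^esub> [y, ?z])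
        + (form \<one>\<^bsub>A\<^esub> [x, ?z] - form \<one>\<^bsub>A\<^esub> [x, x] - form \<one>\<^bsub>A\<^esub> [x, y])
        + (form \<one>\<^bsub>A\<^esub> [y, ?z] - form \<one>\<^bsub>A\<^esub> [y, x] - form \<one>\<^bsub>A\<^esub> [y, y])) \<in> FI"
      by (intro FI_minus FI_add 1 2 3 sq x y A.a_closed)
    then show ?thesis by (simp add: algebra_simps)
  qed
  show ?thesis using zs
  proof (induct zs)
    case Nil then show ?case using two[OF x y] by simp
  next
    case (Cons z zs)
    then have z: "z \<in> carrier A" and zs: "set zs \<subseteq> carrier A" and IH: "form \<one>\<^bsub>A\<^esub> (x # zs @ [y]) + form \<one>\<^bsub>A\<^esub> (y # zs @ [x]) \<in> FI"
      by auto
    have k: "Poly_Mapping.keys (form \<one>\<^bsub>A\<^esub> (zs @ [w])) \<subseteq> symb" if "w \<in> carrier A" for w using that zs by auto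
    have 1: "form \<one>\<^bsub>A\<^esub> (x # z # zs @ [y]) + form \<one>\<^bsub>A\<^esub> (z # x # zs @ [y]) \<in> FI"
      using FI_right[OF two[OF x z] k[OF y]] by (simp add: mr_mult_add_left)
    have 2: "form \<one>\<^bsub>A\<^esub> (y # z # zs @ [x]) + form \<one>\<^bsub>A\<^esub> (z # y # zs @ [x]) \<in> FI"
      using FI_right[OF two[OF y z] k[OF x]] by (simp add: mr_mult_add_left)
    have "Poly_Mapping.keys (form \<one>\<^bsub>A\<^esub> [z]) \<subseteq> symb" using z by simp
    from FI_left[OF IH this] have 3: "form \<one>\<^bsub>A\<^esub> (z # x # zs @ [y]) + form \<one>\<^bsub>A\<^esub> (z # y # zs @ [x]) \<in> FI"
      by (simp add: mr_mult_add_right)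
    from FI_minus[OF FI_add[OF 1 2] 3] show ?case by (simp add: algebra_simps)
  qed
qed

lemma dif_mul_constant:
  assumes a: "a \<in> carrier A" and b: "b \<in> carrier A" and r: "Poly_Mapping.keys r \<subseteq> {\<one>\<^bsub>A\<^esub>} \<times> UNIV"
  shows "symbol_dif A (mul (Poly_Mapping.single (a, as) s) (mul r (Poly_Mapping.single (b, bs) t)))
    = mul (Poly_Mapping.single (\<one>\<^bsub>A\<^esub>, (a \<otimes>\<^bsub>A\<^esub> b) # as) s) (mul r (Poly_Mapping.single (\<one>\<^bsub>A\<^esub>, bs) t))"
  using r
  by (induct r rule: poly_mapping_induct)
    (use a b in \<open>auto simp: mr_mult_add_left mr_mult_add_right symbol_dif_add\<close>)

text \<open>The differential turns a multiple of a relation whose coefficients are one into a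
  multiple of the same relation, and a multiple of \<open>(x + y) - x - y\<close> into one of
  \<open>d(x + y) - dx - dy\<close>. For the Leibniz rule \<open>d(xy) - x dy - y dx\<close> with factors \<open>a\<close> and \<open>b\<close> on
  both sides, put \<open>c = ab\<close>: expanding \<open>d(cx)\<close> and \<open>d(cy)\<close> leaves terms with \<open>c dx dy\<close> and
  \<open>c dy dx\<close>, which cancel by anticommutativity.\<close>

lemma FI_dif_gen:
  assumes u: "u \<in> symb" and v: "v \<in> symb" and r: "r \<in> form_relations A0 A \<iota>"
  shows "symbol_dif A (mul (Poly_Mapping.single u s) (mul r (Poly_Mapping.single v t))) \<in> FI"
proof -
  obtain a as where u: "u = (a, as)" "a \<in> carrier A" "set as \<subseteq> carrier A" using u by auto
  obtain b bs where v: "v = (b, bs)" "b \<in> carrier A" "set bs \<subseteq> carrier A" using v by auto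
  let ?c = "a \<otimes>\<^bsub>A\<^esub> b" let ?k = "s * t"
  have const: ?thesis if k: "Poly_Mapping.keys r \<subseteq> {\<one>\<^bsub>A\<^esub>} \<times> UNIV"
    unfolding u(1) v(1) dif_mul_constant[OF u(2) v(2) k]
    by (intro FI_left FI_right FI_rel[OF r] sym_keys) (use u v in auto)
  have k1: "Poly_Mapping.keys (form \<one>\<^bsub>A\<^esub> ys) \<subseteq> {\<one>\<^bsub>A\<^esub>} \<times> UNIV" for ys by simp
  from r consider
      (1) x y where "x \<in> carrier A" "y \<in> carrier A" "r = form (x \<oplus>\<^bsub>A\<^esub> y) [] - form x [] - form y []"
    | (2) "Poly_Mapping.keys r \<subseteq> {\<one>\<^bsub>A\<^esub>} \<times> UNIV"
    | (3) x y where "x \<in> carrier A" "y \<in> carrier A" "r = form \<one>\<^bsub>A\<^esub> [x \<otimes>\<^bsub>A\<^esub> y] - form x [y] - form y [x]"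
    unfolding form_relations_def
    by (elim UnE CollectE exE conjE) (simp_all add: keys_diff_subset[OF keys_diff_subset] k1 del: keys_single)
  then show ?thesis
  proof cases
    case 2 then show ?thesis by (rule const)
  next
    case 1
    let ?p = "a \<otimes>\<^bsub>A\<^esub> (x \<otimes>\<^bsub>A\<^esub> b)" let ?q = "a \<otimes>\<^bsub>A\<^esub> (y \<otimes>\<^bsub>A\<^esub> b)"
    have pq: "?p \<in> carrier A" "?q \<in> carrier A" using 1 u v by auto
    have e: "a \<otimes>\<^bsub>A\<^esub> ((x \<oplus>\<^bsub>A\<^esub> y) \<otimes>\<^bsub>A\<^esub> b) = ?p \<oplus>\<^bsub>A\<^esub> ?q" using 1 u v by (simp add: A.l_distr A.r_distr)
    have "form \<one>\<^bsub>A\<^esub> [?p \<oplus>\<^bsub>A\<^esub> ?q] - form \<one>\<^bsub>A\<^esub> [?p] - form \<one>\<^bsub>A\<^esub> [?q] \<in> FI"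
      by (rule FI_rel) (use pq in \<open>auto simp: form_relations_def\<close>)
    moreover have "Poly_Mapping.keys (Poly_Mapping.single (\<one>\<^bsub>A\<^esub>, as @ bs) ?k) \<subseteq> symb"
      by (rule sym_keys) (use u v in auto)
    ultimately have "mul (form \<one>\<^bsub>A\<^esub> [?p \<oplus>\<^bsub>A\<^esub> ?q] - form \<one>\<^bsub>A\<^esub> [?p] - form \<one>\<^bsub>A\<^esub> [?q])
        (Poly_Mapping.single (\<one>\<^bsub>A\<^esub>, as @ bs) ?k) \<in> FI" by (rule FI_right)
    then show ?thesis unfolding 1(3) u(1) v(1) by (simp add: mr_mult_diff symbol_dif_diff e)
  next
    case 3
    let ?S = "\<lambda>w. Poly_Mapping.single w ?k :: 'a \<times> 'a list \<Rightarrow>\<^sub>0 rat"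
    let ?o = "\<one>\<^bsub>A\<^esub>"
    have c: "?c \<in> carrier A" using u v by simp
    have cx: "a \<otimes>\<^bsub>A\<^esub> (x \<otimes>\<^bsub>A\<^esub> b) = ?c \<otimes>\<^bsub>A\<^esub> x" "a \<otimes>\<^bsub>A\<^esub> (y \<otimes>\<^bsub>A\<^esub> b) = ?c \<otimes>\<^bsub>A\<^esub> y"
      using 3 u v by (simp_all add: A.m_assoc A.m_comm A.m_lcomm)
    have rel: "form ?o [p \<otimes>\<^bsub>A\<^esub> q] - form p [q] - form q [p] \<in> FI" if "p \<in> carrier A" "q \<in> carrier A" for p q
      by (rule FI_rel) (use that in \<open>auto simp: form_relations_def\<close>)
    have kk: "Poly_Mapping.keys (Poly_Mapping.single (p, ps) (z::rat)) \<subseteq> symb"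
      if "p \<in> carrier A" "set ps \<subseteq> carrier A" for p ps z by (rule sym_keys) (use that in auto)
    have "mul (form ?o (?c # as)) (mul (form ?o [x \<otimes>\<^bsub>A\<^esub> y] - form x [y] - form y [x]) (?S (?o, bs))) \<in> FI"
      by (intro FI_left FI_right rel kk) (use 3 u v c in auto)
    then have 1: "?S (?o, ?c # as @ [x \<otimes>\<^bsub>A\<^esub> y] @ bs) - ?S (x, ?c # as @ [y] @ bs) - ?S (y, ?c # as @ [x] @ bs) \<in> FI"
      using 3(1,2) c by (simp only: mul_expand)
    have "mul (form ?o [?c \<otimes>\<^bsub>A\<^esub> x] - form ?c [x] - form x [?c]) (?S (?o, as @ [y] @ bs)) \<in> FI"
      by (intro FI_left FI_right rel kk) (use 3 u v c in auto)
    then have 2: "?S (?o, (?c \<otimes>\<^bsub>A\<^esub> x) # as @ [y] @ bs) - ?S (?c, x # as @ [y] @ bs) - ?S (x, ?c # as @ [y] @ bs) \<in> FI"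
      using 3(1,2) c by (simp only: mul_expand)
    have "mul (form ?o [?c \<otimes>\<^bsub>A\<^esub> y] - form ?c [y] - form y [?c]) (?S (?o, as @ [x] @ bs)) \<in> FI"
      by (intro FI_left FI_right rel kk) (use 3 u v c in auto)
    then have m3: "?S (?o, (?c \<otimes>\<^bsub>A\<^esub> y) # as @ [x] @ bs) - ?S (?c, y # as @ [x] @ bs) - ?S (y, ?c # as @ [x] @ bs) \<in> FI"
      using 3(1,2) c by (simp only: mul_expand)
    have "mul (form ?c []) (mul (form ?o (x # as @ [y]) + form ?o (y # as @ [x])) (?S (?o, bs))) \<in> FI"
      by (intro FI_left FI_right anticommute kk) (use 3 u v c in auto)
    then have 4: "?S (?c, x # as @ [y] @ bs) + ?S (?c, y # as @ [x] @ bs) \<in> FI"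
      using 3(1,2) c by (simp only: mul_expand)
    have "symbol_dif A (mul (Poly_Mapping.single u s) (mul r (Poly_Mapping.single v t)))
        = ?S (?o, ?c # as @ [x \<otimes>\<^bsub>A\<^esub> y] @ bs) - ?S (?o, (?c \<otimes>\<^bsub>A\<^esub> x) # as @ [y] @ bs)
          - ?S (?o, (?c \<otimes>\<^bsub>A\<^esub> y) # as @ [x] @ bs)"
      unfolding 3(3) u(1) v(1) using v(2) 3(1,2) by (simp only: mul_expand symbol_dif_diff symbol_dif_single fst_conv snd_conv cx)
    also have "\<dots> = (?S (?o, ?c # as @ [x \<otimes>\<^bsub>A\<^esub> y] @ bs) - ?S (x, ?c # as @ [y] @ bs) - ?S (y, ?c # as @ [x] @ bs))
        - (?S (?o, (?c \<otimes>\<^bsub>A\<^esub> x) # as @ [y] @ bs) - ?S (?c, x # as @ [y] @ bs) - ?S (x, ?c # as @ [y] @ bs))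
        - (?S (?o, (?c \<otimes>\<^bsub>A\<^esub> y) # as @ [x] @ bs) - ?S (?c, y # as @ [x] @ bs) - ?S (y, ?c # as @ [x] @ bs))
        - (?S (?c, x # as @ [y] @ bs) + ?S (?c, y # as @ [x] @ bs))"
      by (rule telescope)
    also have "\<dots> \<in> FI" by (intro FI_minus 1 2 m3 4)
    finally show ?thesis .
  qed
qed

lemma FI_dif: "c \<in> FI \<Longrightarrow> symbol_dif A c \<in> FI"
proof -
  assume "c \<in> FI"
  then have "c \<in> FI_span" using FI_subset_span by blast
  then show ?thesis
    by (induct rule: FI_span.induct) (auto simp: symbol_dif_add FI_zero intro: FI_add FI_dif_gen)
qed

end

section \<open>The differential graded ring of rational differential forms\<close>

lemma keys_deg_part:
  assumes "Poly_Mapping.keys c \<subseteq> Z"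
  shows "Poly_Mapping.keys (deg_part q c) \<subseteq> {u \<in> Z. length (snd u) = q}"
  using assms
  by (induct c rule: poly_mapping_induct) (simp_all add: deg_part_add keys_add_subset keys_single_subset)

lemma deg_part_homogeneous:
  assumes "Poly_Mapping.keys c \<subseteq> {u. length (snd u) = r}"
  shows "deg_part q c = (if q = r then c else 0)"
  using assms by (induct c rule: poly_mapping_induct) (auto simp: deg_part_add)

lemma keys_symbol_dif:
  assumes "Poly_Mapping.keys c \<subseteq> Z" "\<And>u. u \<in> Z \<Longrightarrow> (\<one>\<^bsub>A\<^esub>, fst u # snd u) \<in> W"
  shows "Poly_Mapping.keys (symbol_dif A c) \<subseteq> W"
  using assms(1)
  by (induct c rule: poly_mapping_induct) (simp_all add: symbol_dif_add keys_add_subset keys_single_subset assms(2))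

lemma keys_mul:
  assumes x: "Poly_Mapping.keys x \<subseteq> Z" and y: "Poly_Mapping.keys y \<subseteq> Z'"
    and m: "\<And>u v. u \<in> Z \<Longrightarrow> v \<in> Z' \<Longrightarrow> u \<otimes>\<^bsub>M\<^esub> v \<in> W"
  shows "Poly_Mapping.keys (mr_mult M x y) \<subseteq> W"
  using x
proof (induct x rule: poly_mapping_induct)
  case (single g a)
  show ?case using y
    by (induct y rule: poly_mapping_induct)
      (simp_all add: mr_mult_add_right keys_add_subset keys_single_subset m[OF single])
qed (simp_all add: mr_mult_add_left keys_add_subset)

context forms begin

interpretation A: cring A by (rule cring_A)
interpretation SR: ring SR by (rule ring_SR)

abbreviation "\<Omega> \<equiv> Omega_Q A0 A \<iota>"
abbreviation "cl \<equiv> form_class A0 A \<iota>"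

definition hom_symb :: "nat \<Rightarrow> ('a \<times> 'a list) set"
  where "hom_symb q = {u \<in> symb. length (snd u) = q}"

lemma Omega_Q_simps:
  "carrier \<Omega> = cl ` carrier SR" "homog \<Omega> q = cl ` {c. Poly_Mapping.keys c \<subseteq> hom_symb q}"
  "dif \<Omega> = coset_map SR FI (symbol_dif A)" "htop \<Omega> q = discrete_topology (homog \<Omega> q)"
  "v \<otimes>\<^bsub>\<Omega>\<^esub> w = v \<otimes>\<^bsub>SR Quot FI\<^esub> w" "v \<oplus>\<^bsub>\<Omega>\<^esub> w = v \<oplus>\<^bsub>SR Quot FI\<^esub> w"
  "\<one>\<^bsub>\<Omega>\<^esub> = \<one>\<^bsub>SR Quot FI\<^esub>" "\<zero>\<^bsub>\<Omega>\<^esub> = \<zero>\<^bsub>SR Quot FI\<^esub>"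
proof -
  have "{c \<in> carrier SR. \<forall>(a, bs)\<in>Poly_Mapping.keys c. length bs = q} = {c. Poly_Mapping.keys c \<subseteq> hom_symb q}" for q
    unfolding hom_symb_def monoid_ring_simps form_symbols_simps split_beta by blast
  then show "homog \<Omega> q = cl ` {c. Poly_Mapping.keys c \<subseteq> hom_symb q}" "htop \<Omega> q = discrete_topology (homog \<Omega> q)"
    by (simp_all only: Omega_Q_def Let_def ring.defs dg_ring.defs dg_ring.simps)
qed (simp_all add: Omega_Q_def Let_def ring.defs dg_ring.defs carrier_Quot form_class_def)

lemma ring_Omega: "ring \<Omega>"
  by (rule ring_transfer[OF ideal.quotient_is_ring[OF ideal_FI]])
    (simp_all add: Omega_Q_simps carrier_Quot form_class_def)

interpretation O: ring \<Omega> by (rule ring_Omega)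

lemma cl_in: "Poly_Mapping.keys c \<subseteq> symb \<Longrightarrow> cl c \<in> carrier \<Omega>"
  by (simp add: Omega_Q_simps)

lemma cl_add: "Poly_Mapping.keys c \<subseteq> symb \<Longrightarrow> Poly_Mapping.keys d \<subseteq> symb \<Longrightarrow> cl c \<oplus>\<^bsub>\<Omega>\<^esub> cl d = cl (c + d)"
  using Quot_simps(1)[OF ideal_FI, of c d] by (simp add: Omega_Q_simps form_class_def)

lemma cl_mult: "Poly_Mapping.keys c \<subseteq> symb \<Longrightarrow> Poly_Mapping.keys d \<subseteq> symb \<Longrightarrow> cl c \<otimes>\<^bsub>\<Omega>\<^esub> cl d = cl (mul c d)"
  using Quot_simps(2)[OF ideal_FI, of c d] by (simp add: Omega_Q_simps form_class_def)

lemma cl_one: "\<one>\<^bsub>\<Omega>\<^esub> = cl (Poly_Mapping.single (\<one>\<^bsub>A\<^esub>, []) 1)"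
  using Quot_one[OF ideal_FI] by (simp add: Omega_Q_simps form_class_def)

lemma cl_zero: "\<zero>\<^bsub>\<Omega>\<^esub> = cl 0"
  using cl_add[of 0 0] cl_in[of 0] O.add.l_cancel_one'[of "cl 0" "cl 0"] by simp

lemma cl_eq_iff: "Poly_Mapping.keys c \<subseteq> symb \<Longrightarrow> Poly_Mapping.keys d \<subseteq> symb \<Longrightarrow> cl c = cl d \<longleftrightarrow> c - d \<in> FI"
  using coset_eq_iff[OF ideal_FI, of c d] monoid_ring_minus[OF mon, of c d] by (simp add: form_class_def)

lemma cl_map:
  assumes f: "\<And>c d. f (c + d) = f c + f d" and k: "\<And>c. Poly_Mapping.keys c \<subseteq> symb \<Longrightarrow> Poly_Mapping.keys (f c) \<subseteq> symb"
    and FI: "\<And>c. c \<in> FI \<Longrightarrow> f c \<in> FI"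
  shows "Poly_Mapping.keys c \<subseteq> symb \<Longrightarrow> coset_map SR FI f (cl c) = cl (f c)"
    and "coset_map SR FI f \<in> add_map \<Omega> \<Omega>"
proof -
  have am: "f \<in> add_map SR SR" using f k by (auto simp: add_map_def)
  have e: "coset_map SR FI f (cl c) = cl (f c)" if "Poly_Mapping.keys c \<subseteq> symb" for c
    unfolding form_class_def by (rule coset_map_coset[OF ideal_FI ideal_FI am]) (use FI that in auto)
  then show "Poly_Mapping.keys c \<subseteq> symb \<Longrightarrow> coset_map SR FI f (cl c) = cl (f c)" .
  show "coset_map SR FI f \<in> add_map \<Omega> \<Omega>"
    unfolding add_map_def
  proof (intro CollectI conjI ballI funcsetI)
    fix v assume "v \<in> carrier \<Omega>"
    then obtain c where c: "Poly_Mapping.keys c \<subseteq> symb" "v = cl c" by (auto simp: Omega_Q_simps)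
    show "coset_map SR FI f v \<in> carrier \<Omega>" unfolding c(2) e[OF c(1)] by (rule cl_in[OF k[OF c(1)]])
    fix w assume "w \<in> carrier \<Omega>"
    then obtain d where d: "Poly_Mapping.keys d \<subseteq> symb" "w = cl d" by (auto simp: Omega_Q_simps)
    show "coset_map SR FI f (v \<oplus>\<^bsub>\<Omega>\<^esub> w) = coset_map SR FI f v \<oplus>\<^bsub>\<Omega>\<^esub> coset_map SR FI f w"
      unfolding c(2) d(2) cl_add[OF c(1) d(1)] e[OF c(1)] e[OF d(1)] e[OF keys_add_subset[OF c(1) d(1)]]
        cl_add[OF k[OF c(1)] k[OF d(1)]] f ..
  qed
qed

definition "prO q = coset_map SR FI (deg_part q)"

lemma hom_symb_symb: "Poly_Mapping.keys c \<subseteq> hom_symb q \<Longrightarrow> Poly_Mapping.keys c \<subseteq> symb"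
  by (auto simp: hom_symb_def)

lemma deg_part_symb: "Poly_Mapping.keys c \<subseteq> symb \<Longrightarrow> Poly_Mapping.keys (deg_part q c) \<subseteq> hom_symb q"
  unfolding hom_symb_def by (rule keys_deg_part)

lemma prO: "Poly_Mapping.keys c \<subseteq> symb \<Longrightarrow> prO q (cl c) = cl (deg_part q c)" "prO q \<in> add_map \<Omega> \<Omega>"
  unfolding prO_def by (rule cl_map[OF deg_part_add hom_symb_symb[OF deg_part_symb] FI_deg_part], assumption+)+

lemma dif_symb: "Poly_Mapping.keys c \<subseteq> symb \<Longrightarrow> Poly_Mapping.keys (symbol_dif A c) \<subseteq> symb"
  by (rule keys_symbol_dif) auto

lemma difO: "Poly_Mapping.keys c \<subseteq> symb \<Longrightarrow> dif \<Omega> (cl c) = cl (symbol_dif A c)" "dif \<Omega> \<in> add_map \<Omega> \<Omega>"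
  unfolding Omega_Q_simps(3) by (rule cl_map[OF symbol_dif_add dif_symb FI_dif], assumption+)+

lemma homog_O: "homog \<Omega> q \<subseteq> carrier \<Omega>"
  unfolding Omega_Q_simps using hom_symb_symb by auto

lemma prO_homog: "v \<in> carrier \<Omega> \<Longrightarrow> prO q v \<in> homog \<Omega> q"
  unfolding Omega_Q_simps using prO(1) deg_part_symb by auto

lemma prO_same: "v \<in> homog \<Omega> r \<Longrightarrow> prO q v = (if q = r then v else \<zero>\<^bsub>\<Omega>\<^esub>)"
proof -
  assume "v \<in> homog \<Omega> r"
  then obtain c where c: "Poly_Mapping.keys c \<subseteq> hom_symb r" "v = cl c" by (auto simp: Omega_Q_simps)
  have "Poly_Mapping.keys c \<subseteq> {u. length (snd u) = r}" using c(1) by (auto simp: hom_symb_def)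
  from deg_part_homogeneous[OF this] show ?thesis
    unfolding c(2) prO(1)[OF hom_symb_symb[OF c(1)]] cl_zero by simp
qed

lemma homog_O_mult: "v \<in> homog \<Omega> q \<Longrightarrow> w \<in> homog \<Omega> r \<Longrightarrow> v \<otimes>\<^bsub>\<Omega>\<^esub> w \<in> homog \<Omega> (q + r)"
proof -
  assume "v \<in> homog \<Omega> q" "w \<in> homog \<Omega> r"
  then obtain c d where c: "Poly_Mapping.keys c \<subseteq> hom_symb q" "v = cl c" and d: "Poly_Mapping.keys d \<subseteq> hom_symb r" "w = cl d"
    by (auto simp: Omega_Q_simps)
  have "Poly_Mapping.keys (mul c d) \<subseteq> hom_symb (q + r)"
    by (rule keys_mul[OF c(1) d(1)]) (auto simp: hom_symb_def)
  then show ?thesis unfolding c(2) d(2) cl_mult[OF hom_symb_symb[OF c(1)] hom_symb_symb[OF d(1)]] Omega_Q_simps(2) by blast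
qed

lemma homog_O_dif: "v \<in> homog \<Omega> q \<Longrightarrow> dif \<Omega> v \<in> homog \<Omega> (Suc q)"
proof -
  assume "v \<in> homog \<Omega> q"
  then obtain c where c: "Poly_Mapping.keys c \<subseteq> hom_symb q" "v = cl c" by (auto simp: Omega_Q_simps)
  have "Poly_Mapping.keys (symbol_dif A c) \<subseteq> hom_symb (Suc q)"
    by (rule keys_symbol_dif[OF c(1)]) (auto simp: hom_symb_def)
  then show ?thesis unfolding c(2) difO(1)[OF hom_symb_symb[OF c(1)]] Omega_Q_simps(2) by blast
qed

lemma cl_degree0: "a \<in> carrier A \<Longrightarrow> cl (Poly_Mapping.single (a, []) s) \<in> homog \<Omega> 0"
  unfolding Omega_Q_simps by (intro imageI CollectI keys_single_subset) (simp add: hom_symb_def)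

lemma one_O: "\<one>\<^bsub>\<Omega>\<^esub> \<in> homog \<Omega> 0"
  unfolding cl_one by (rule cl_degree0) simp

end

section \<open>The product of the differential forms over \<open>S\<close>\<close>

locale forms_power = forms A0 A \<iota> + truncated S
  for A0 :: "('b, 'm) ring_scheme" and A :: "('a, 'n) ring_scheme" and \<iota> :: "'b \<Rightarrow> 'a" and S :: "nat set"
begin

interpretation A: cring A by (rule cring_A)
interpretation O: ring \<Omega> by (rule ring_Omega)

abbreviation "PO \<equiv> pow_ring S \<Omega>"
abbreviation "OP \<equiv> Omega_pow S A0 A \<iota>"

definition deg :: "nat \<Rightarrow> (nat \<Rightarrow> ('a \<times> 'a list \<Rightarrow>\<^sub>0 rat) set) set"
  where "deg q = (\<Pi>\<^sub>E n\<in>S. homog \<Omega> q)"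

definition difP :: "(nat \<Rightarrow> ('a \<times> 'a list \<Rightarrow>\<^sub>0 rat) set) \<Rightarrow> nat \<Rightarrow> ('a \<times> 'a list \<Rightarrow>\<^sub>0 rat) set"
  where "difP x = (\<lambda>n\<in>S. cl (Poly_Mapping.single (\<one>\<^bsub>A\<^esub>, []) (1 / of_nat n)) \<otimes>\<^bsub>\<Omega>\<^esub> dif \<Omega> (x n))"

definition prP :: "nat \<Rightarrow> (nat \<Rightarrow> ('a \<times> 'a list \<Rightarrow>\<^sub>0 rat) set) \<Rightarrow> nat \<Rightarrow> ('a \<times> 'a list \<Rightarrow>\<^sub>0 rat) set"
  where "prP q x = (\<lambda>n\<in>S. prO q (x n))"

lemma Omega_pow_simps:
  "carrier OP = generate (add_monoid PO) (\<Union>q. deg q)" "homog OP q = deg q" "dif OP = difP"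
  "htop OP q = product_topology (\<lambda>_. discrete_topology (homog \<Omega> q)) S"
  "x \<otimes>\<^bsub>OP\<^esub> y = (\<lambda>n\<in>S. x n \<otimes>\<^bsub>\<Omega>\<^esub> y n)" "x \<oplus>\<^bsub>OP\<^esub> y = (\<lambda>n\<in>S. x n \<oplus>\<^bsub>\<Omega>\<^esub> y n)"
  "\<one>\<^bsub>OP\<^esub> = (\<lambda>n\<in>S. \<one>\<^bsub>\<Omega>\<^esub>)" "\<zero>\<^bsub>OP\<^esub> = (\<lambda>n\<in>S. \<zero>\<^bsub>\<Omega>\<^esub>)"
  by (simp_all add: Omega_pow_def Let_def ring.defs dg_ring.defs deg_def difP_def[abs_def] pow_ring_def Omega_Q_simps(4))

lemma ring_PO: "ring PO"
  by (rule ring_pow_ring[OF ring_Omega])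

interpretation PO: ring PO by (rule ring_PO)

lemma deg_PO: "deg q \<subseteq> carrier PO"
  using homog_O by (auto simp: deg_def PiE_iff subset_iff)

lemma OP_PO: "carrier OP \<subseteq> carrier PO"
  unfolding Omega_pow_simps using PO.add.generate_incl[of "\<Union>q. deg q"] deg_PO by auto

lemma OP_subgroup: "additive_subgroup (carrier OP) PO"
  unfolding Omega_pow_simps by (rule generate_additive_subgroup[OF ring_PO]) (use deg_PO in blast)

lemma deg_OP: "deg q \<subseteq> carrier OP"
  unfolding Omega_pow_simps by (blast intro: generate.incl)

lemma OP_minimal:
  assumes "additive_subgroup Z PO" "\<And>q. deg q \<subseteq> Z" shows "carrier OP \<subseteq> Z"
  unfolding Omega_pow_simps by (rule generate_minimal[OF ring_PO assms(1)]) (use assms(2) in blast)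

lemma deg_mult: "x \<in> deg q \<Longrightarrow> y \<in> deg r \<Longrightarrow> x \<otimes>\<^bsub>PO\<^esub> y \<in> deg (q + r)"
  using homog_O_mult by (auto simp: deg_def PiE_iff)

text \<open>Products of homogeneous elements are homogeneous; distributivity extends this to sums,
  first in the left factor and then in the right one.\<close>

lemma OP_mult: "x \<in> carrier OP \<Longrightarrow> y \<in> carrier OP \<Longrightarrow> x \<otimes>\<^bsub>PO\<^esub> y \<in> carrier OP"
proof -
  have r: "(\<lambda>x. x \<otimes>\<^bsub>PO\<^esub> z) \<in> add_map PO PO" "(\<lambda>x. z \<otimes>\<^bsub>PO\<^esub> x) \<in> add_map PO PO" if "z \<in> carrier PO" for z
    using that PO.l_distr PO.r_distr PO.m_closed unfolding add_map_def by (auto simp del: pow_ring_simps)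
  have 1: "x \<otimes>\<^bsub>PO\<^esub> y \<in> carrier OP" if x: "x \<in> carrier OP" and y: "y \<in> deg r" for x y r
  proof -
    have "carrier OP \<subseteq> {x \<in> carrier PO. x \<otimes>\<^bsub>PO\<^esub> y \<in> carrier OP}"
    proof (rule OP_minimal[OF add_map_vimage[OF r(1) ring_PO ring_PO OP_subgroup]])
      show "y \<in> carrier PO" using y deg_PO by blast
      show "deg q \<subseteq> {x \<in> carrier PO. x \<otimes>\<^bsub>PO\<^esub> y \<in> carrier OP}" for q
        using deg_mult[OF _ y, of _ q] deg_OP[of "q + r"] deg_PO[of q] by blast
    qed
    then show ?thesis using x by blast
  qed
  assume x: "x \<in> carrier OP" and y: "y \<in> carrier OP"
  have "carrier OP \<subseteq> {y \<in> carrier PO. x \<otimes>\<^bsub>PO\<^esub> y \<in> carrier OP}"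
  proof (rule OP_minimal[OF add_map_vimage[OF r(2) ring_PO ring_PO OP_subgroup]])
    show "x \<in> carrier PO" using x OP_PO by blast
    show "deg q \<subseteq> {y \<in> carrier PO. x \<otimes>\<^bsub>PO\<^esub> y \<in> carrier OP}" for q
      using 1[OF x, of _ q] deg_PO[of q] by blast
  qed
  then show ?thesis using y by blast
qed

lemma one_deg: "\<one>\<^bsub>PO\<^esub> \<in> deg 0"
  using one_O by (simp add: deg_def)

lemma ring_OP: "ring OP"
proof -
  have "subring (carrier OP) PO"
    unfolding subring_iff[OF ring_PO] using OP_subgroup one_deg deg_OP[of 0] OP_mult by blast
  from PO.subring_is_ring[OF this] show ?thesis
    by (rule ring_transfer) (simp_all add: Omega_pow_simps)
qed

lemma scalar_in: "cl (Poly_Mapping.single (\<one>\<^bsub>A\<^esub>, []) s) \<in> homog \<Omega> 0"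
  by (rule cl_degree0) simp

lemma difP_add_PO: "difP \<in> add_map PO PO"
proof -
  have s: "cl (Poly_Mapping.single (\<one>\<^bsub>A\<^esub>, []) s) \<in> carrier \<Omega>" for s using scalar_in homog_O by blast
  have d: "v \<in> carrier \<Omega> \<Longrightarrow> dif \<Omega> v \<in> carrier \<Omega>" for v using add_map_closed[OF difO(2)] .
  show ?thesis
    unfolding add_map_def
  proof (intro CollectI conjI ballI funcsetI)
    fix x assume x: "x \<in> carrier PO"
    then show "difP x \<in> carrier PO" using s d by (auto simp: difP_def PiE_iff)
    fix y assume y: "y \<in> carrier PO"
    show "difP (x \<oplus>\<^bsub>PO\<^esub> y) = difP x \<oplus>\<^bsub>PO\<^esub> difP y"
      using x y s d by (auto simp: difP_def PiE_iff add_map_add[OF difO(2)] O.r_distr intro!: restrict_ext)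
  qed
qed

lemma difP_deg: "x \<in> deg q \<Longrightarrow> difP x \<in> deg (Suc q)"
  using homog_O_mult[OF scalar_in homog_O_dif] by (auto simp: deg_def difP_def PiE_iff)

lemma difP_OP: "x \<in> carrier OP \<Longrightarrow> difP x \<in> carrier OP"
proof -
  have "carrier OP \<subseteq> {x \<in> carrier PO. difP x \<in> carrier OP}"
    by (rule OP_minimal[OF add_map_vimage[OF difP_add_PO ring_PO ring_PO OP_subgroup]])
      (use difP_deg deg_OP deg_PO in blast)
  then show "x \<in> carrier OP \<Longrightarrow> difP x \<in> carrier OP" by blast
qed

lemma prP_deg: "x \<in> carrier PO \<Longrightarrow> prP q x \<in> deg q"
  using prO_homog by (auto simp: prP_def deg_def PiE_iff)

lemma OP_at: "x \<in> carrier OP \<Longrightarrow> n \<in> S \<Longrightarrow> x n \<in> carrier \<Omega>"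
  using OP_PO by auto

lemma graded_OP: "graded_dg OP prP"
proof (rule graded_dg.intro, goal_cases)
  case 1 show ?case by (rule ring_OP)
next
  case (2 q) show ?case unfolding Omega_pow_simps(2) by (rule deg_OP)
next
  case (3 q)
  have "prP q x \<in> carrier OP" if "x \<in> carrier OP" for x using prP_deg deg_OP OP_PO that by blast
  moreover have "prP q (x \<oplus>\<^bsub>OP\<^esub> y) = prP q x \<oplus>\<^bsub>OP\<^esub> prP q y" if x: "x \<in> carrier OP" and y: "y \<in> carrier OP" for x y
    unfolding prP_def Omega_pow_simps(6)
    by (intro restrict_ext) (simp add: add_map_add[OF prO(2)] OP_at[OF x] OP_at[OF y])
  ultimately show ?case unfolding add_map_def by blast
next
  case (4 x q) then show ?case unfolding Omega_pow_simps(2) using prP_deg OP_PO by blast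
next
  case (5 x q)
  then show ?case unfolding Omega_pow_simps(2) deg_def prP_def
    by (intro restrict_eqI) (auto simp: PiE_iff prO_same)
next
  case (6 x q r)
  then show ?case unfolding Omega_pow_simps(2,8) deg_def prP_def
    by (intro restrict_ext) (auto simp: PiE_iff prO_same)
next
  case (7 Z)
  have "additive_subgroup Z PO"
    unfolding additive_subgroup_iff_minus[OF ring_PO]
  proof (intro conjI ballI)
    have Z: "Z \<subseteq> carrier OP" "\<zero>\<^bsub>OP\<^esub> \<in> Z" "\<And>x y. x \<in> Z \<Longrightarrow> y \<in> Z \<Longrightarrow> x \<ominus>\<^bsub>OP\<^esub> y \<in> Z"
      using 7(1) unfolding additive_subgroup_iff_minus[OF ring_OP] by blast+
    show "Z \<subseteq> carrier PO" using Z(1) OP_PO by blast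
    show "\<zero>\<^bsub>PO\<^esub> \<in> Z" using Z(2) by (simp only: Omega_pow_simps(8) pow_ring_simps)
    fix x y assume xy: "x \<in> Z" "y \<in> Z"
    have "x \<in> carrier OP" "y \<in> carrier OP" using xy Z(1) by blast+
    from minus_transfer[OF ring_PO ring_OP OP_PO _ this] have "x \<ominus>\<^bsub>OP\<^esub> y = x \<ominus>\<^bsub>PO\<^esub> y"
      by (simp only: Omega_pow_simps(6) pow_ring_simps(5))
    then show "x \<ominus>\<^bsub>PO\<^esub> y \<in> Z" using Z(3)[OF xy] by simp
  qed
  then show ?case by (rule OP_minimal) (use 7(2) in \<open>simp only: Omega_pow_simps(2)\<close>)
next
  case 8
  show ?case using difP_OP add_map_add[OF difP_add_PO] OP_PO
    by (auto simp: add_map_def Omega_pow_simps(3,6) subset_iff simp del: Omega_pow_simps(1))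
next
  case (9 q) show ?case by (simp add: Omega_pow_simps(2,4) deg_def)
qed

abbreviation "emb \<equiv> Omega_emb S A0 A \<iota>"

lemma emb_deg: "x \<in> (\<Pi>\<^sub>E n\<in>S. carrier A) \<Longrightarrow> emb x \<in> deg 0"
  using cl_degree0 by (auto simp: Omega_emb_def deg_def PiE_iff)

lemma emb_add: "emb \<in> add_map (X_ring S A) OP"
proof -
  have XP: "X_group S A (carrier A) \<subseteq> (\<Pi>\<^sub>E n\<in>S. carrier A)" by (rule X_group_PiE[OF A.ring_axioms subset_refl])
  have add: "cl (form (a \<oplus>\<^bsub>A\<^esub> b) []) = cl (form a []) \<oplus>\<^bsub>\<Omega>\<^esub> cl (form b [])" if "a \<in> carrier A" "b \<in> carrier A" for a b
  proof -
    have k: "Poly_Mapping.keys (form a []) \<subseteq> symb" "Poly_Mapping.keys (form b []) \<subseteq> symb"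
      "Poly_Mapping.keys (form (a \<oplus>\<^bsub>A\<^esub> b) []) \<subseteq> symb" using that by simp_all
    have "form (a \<oplus>\<^bsub>A\<^esub> b) [] - form a [] - form b [] \<in> FI"
      by (rule FI_rel) (use that in \<open>auto simp: form_relations_def\<close>)
    then have "form (a \<oplus>\<^bsub>A\<^esub> b) [] - (form a [] + form b []) \<in> FI" by (simp add: diff_diff_eq)
    then show ?thesis using cl_eq_iff[OF k(3) keys_add_subset[OF k(1,2)]] cl_add[OF k(1,2)] by simp
  qed
  have "emb x \<in> carrier OP" if "x \<in> X_group S A (carrier A)" for x
    using emb_deg deg_OP that XP by blast
  then show ?thesis using XP
    unfolding add_map_def Omega_pow_simps(6) Omega_emb_def X_ring_simps
    by (intro CollectI conjI ballI funcsetI restrict_ext) (auto simp only: PiE_iff subset_iff add restrict_apply' intro!: add)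
qed

end

section \<open>Functoriality of the differential forms\<close>

lemma mr_map_diff: "mr_map f (c - d) = mr_map f c - mr_map f d"
  using mr_map_add[of f "c - d" d] by (simp add: algebra_simps)

definition symbol_map :: "('a \<Rightarrow> 'b) \<Rightarrow> 'a \<times> 'a list \<Rightarrow> 'b \<times> 'b list"
  where "symbol_map h u = (h (fst u), map h (snd u))"

lemma symbol_map_simps [simp]: "symbol_map h (a, bs) = (h a, map h bs)"
  by (simp add: symbol_map_def)

locale forms_map = F: forms_power A0 A \<iota> S + F': forms_power A0' A' \<iota>' S
  for A0 :: "('b, 'm) ring_scheme" and A :: "('a, 'n) ring_scheme" and \<iota> :: "'b \<Rightarrow> 'a"
    and A0' :: "('d, 'k) ring_scheme" and A' :: "('c, 'l) ring_scheme" and \<iota>' :: "'d \<Rightarrow> 'c" and S +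
  fixes h :: "'a \<Rightarrow> 'c" and h0 :: "'b \<Rightarrow> 'd"
  assumes h: "h \<in> ring_hom A A'" and h0: "\<And>r. r \<in> carrier A0 \<Longrightarrow> h0 r \<in> carrier A0'"
    and h_incl: "\<And>r. r \<in> carrier A0 \<Longrightarrow> h (\<iota> r) = \<iota>' (h0 r)"
begin

interpretation A: cring A by (rule F.cring_A)
interpretation A': cring A' by (rule F'.cring_A)

abbreviation "hS \<equiv> (mr_map (symbol_map h) :: ('a \<times> 'a list \<Rightarrow>\<^sub>0 rat) \<Rightarrow> 'c \<times> 'c list \<Rightarrow>\<^sub>0 rat)"

lemma h_closed: "a \<in> carrier A \<Longrightarrow> h a \<in> carrier A'"
  by (rule ring_hom_closed[OF h])

lemma symbol_map_symb: "symbol_map h ` F.symb \<subseteq> F'.symb"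
  using h_closed by (auto simp: symbol_map_def)

lemma hS_hom: "hS \<in> ring_hom F.SR F'.SR"
  by (rule mr_map_ring_hom)
    (use h_closed ring_hom_mult[OF h] ring_hom_one[OF h] in \<open>auto simp: symbol_map_def\<close>)

lemma hS_keys: "Poly_Mapping.keys c \<subseteq> F.symb \<Longrightarrow> Poly_Mapping.keys (hS c) \<subseteq> F'.symb"
  by (rule keys_mr_map[OF _ symbol_map_symb])

lemma hS_relation: "r \<in> form_relations A0 A \<iota> \<Longrightarrow> hS r \<in> form_relations A0' A' \<iota>'"
proof -
  note hom = ring_hom_mult[OF h] ring_hom_one[OF h] ring_hom_add[OF h] h_incl
  assume "r \<in> form_relations A0 A \<iota>"
  then show ?thesis
    unfolding form_relations_def
    apply (elim UnE CollectE exE conjE)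
        apply (simp_all add: mr_map_diff hom)
    using h_closed h0 apply blast+
    done
qed

text \<open>The preimage of the ideal of the target is an ideal, and it contains the relations.\<close>

lemma hS_FI: "hS ` F.FI \<subseteq> F'.FI"
proof -
  interpret SR: ring F.SR by (rule F.ring_SR)
  interpret hS: ring_hom_ring F.SR F'.SR hS
    by (rule ring_hom_ringI2[OF F.ring_SR F'.ring_SR hS_hom])
  have "ideal {c \<in> carrier F.SR. hS c \<in> F'.FI} F.SR"
    by (rule hS.ideal_vimage[OF F'.ideal_FI])
  then have "F.FI \<subseteq> {c \<in> carrier F.SR. hS c \<in> F'.FI}"
    unfolding form_ideal_def[of A0 A \<iota>]
    by (rule SR.genideal_minimal) (use F.relations_closed F'.FI_rel hS_relation in blast)
  then show ?thesis by blast
qed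

lemma hS_dif: "symbol_dif A' (hS c) = hS (symbol_dif A c)"
proof -
  have "Poly_Mapping.keys c \<subseteq> UNIV" by simp
  then show ?thesis
    by (induct c rule: poly_mapping_induct)
      (simp_all add: mr_map_add symbol_dif_add symbol_map_def ring_hom_one[OF h])
qed

definition "h\<Omega> = coset_map F'.SR F'.FI hS"

lemma h\<Omega>_cl: "Poly_Mapping.keys c \<subseteq> F.symb \<Longrightarrow> h\<Omega> (F.cl c) = F'.cl (hS c)"
  unfolding h\<Omega>_def form_class_def
  by (rule coset_map_coset[OF F.ideal_FI F'.ideal_FI ring_hom_add_map[OF hS_hom] hS_FI]) simp

lemma h\<Omega>_hom: "h\<Omega> \<in> ring_hom F.\<Omega> F'.\<Omega>"
proof -
  have "h\<Omega> \<in> ring_hom (F.SR Quot F.FI) (F'.SR Quot F'.FI)"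
    unfolding h\<Omega>_def by (rule coset_map_ring_hom[OF F.ideal_FI F'.ideal_FI hS_hom hS_FI])
  then show ?thesis
    unfolding ring_hom_def F.Omega_Q_simps F'.Omega_Q_simps carrier_Quot form_class_def .
qed

lemma h\<Omega>_homog: "v \<in> homog F.\<Omega> q \<Longrightarrow> h\<Omega> v \<in> homog F'.\<Omega> q"
proof -
  assume "v \<in> homog F.\<Omega> q"
  then obtain c where c: "Poly_Mapping.keys c \<subseteq> F.hom_symb q" "v = F.cl c" by (auto simp: F.Omega_Q_simps)
  have "Poly_Mapping.keys (hS c) \<subseteq> F'.hom_symb q"
    by (rule keys_mr_map[OF c(1)])
      (use h_closed in \<open>auto simp: F.hom_symb_def F'.hom_symb_def symbol_map_def\<close>)
  then show ?thesis
    unfolding c(2) h\<Omega>_cl[OF F.hom_symb_symb[OF c(1)]] F'.Omega_Q_simps(2) by blast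
qed

lemma h\<Omega>_dif: "v \<in> carrier F.\<Omega> \<Longrightarrow> h\<Omega> (dif F.\<Omega> v) = dif F'.\<Omega> (h\<Omega> v)"
proof -
  assume "v \<in> carrier F.\<Omega>"
  then obtain c where c: "Poly_Mapping.keys c \<subseteq> F.symb" "v = F.cl c" by (auto simp: F.Omega_Q_simps)
  show ?thesis
    unfolding c(2) F.difO(1)[OF c(1)] h\<Omega>_cl[OF c(1)] h\<Omega>_cl[OF F.dif_symb[OF c(1)]] F'.difO(1)[OF hS_keys[OF c(1)]] hS_dif ..
qed

definition "hP x = (\<lambda>n\<in>S. h\<Omega> (x n))"

lemma hP_deg: "x \<in> F.deg q \<Longrightarrow> hP x \<in> F'.deg q"
  using h\<Omega>_homog by (auto simp: F.deg_def F'.deg_def hP_def PiE_iff)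

lemma hP_PO: "hP \<in> add_map F.PO F'.PO"
  unfolding add_map_def
proof (intro CollectI conjI ballI funcsetI)
  fix x assume x: "x \<in> carrier F.PO"
  then show "hP x \<in> carrier F'.PO"
    using ring_hom_closed[OF h\<Omega>_hom] by (simp add: hP_def PiE_iff)
  fix y assume y: "y \<in> carrier F.PO"
  have "x n \<in> carrier F.\<Omega>" "y n \<in> carrier F.\<Omega>" if "n \<in> S" for n using x y that by (auto simp only: pow_ring_simps PiE_iff)
  then show "hP (x \<oplus>\<^bsub>F.PO\<^esub> y) = hP x \<oplus>\<^bsub>F'.PO\<^esub> hP y"
    unfolding hP_def pow_ring_simps by (intro restrict_ext) (simp add: ring_hom_add[OF h\<Omega>_hom])
qed

lemma hP_OP: "x \<in> carrier F.OP \<Longrightarrow> hP x \<in> carrier F'.OP"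
proof -
  have "carrier F.OP \<subseteq> {x \<in> carrier F.PO. hP x \<in> carrier F'.OP}"
    by (rule F.OP_minimal[OF add_map_vimage[OF hP_PO F.ring_PO F'.ring_PO F'.OP_subgroup]])
      (use hP_deg F'.deg_OP F.deg_PO in blast)
  then show "x \<in> carrier F.OP \<Longrightarrow> hP x \<in> carrier F'.OP" by blast
qed

lemma hP_scalar: "h\<Omega> (F.cl (Poly_Mapping.single (\<one>\<^bsub>A\<^esub>, []) s)) = F'.cl (Poly_Mapping.single (\<one>\<^bsub>A'\<^esub>, []) s)"
  by (subst h\<Omega>_cl) (simp_all add: ring_hom_one[OF h])

lemma hP_dif: "x \<in> carrier F.OP \<Longrightarrow> hP (F.difP x) = F'.difP (hP x)"
proof -
  assume x: "x \<in> carrier F.OP"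
  have s: "F.cl (Poly_Mapping.single (\<one>\<^bsub>A\<^esub>, []) s) \<in> carrier F.\<Omega>" for s using F.scalar_in F.homog_O by blast
  show ?thesis unfolding hP_def F.difP_def F'.difP_def
  proof (intro restrict_ext)
    fix n assume n: "n \<in> S"
    have xn: "x n \<in> carrier F.\<Omega>" by (rule F.OP_at[OF x n])
    show "h\<Omega> ((\<lambda>n\<in>S. F.cl (Poly_Mapping.single (\<one>\<^bsub>A\<^esub>, []) (1 / of_nat n)) \<otimes>\<^bsub>F.\<Omega>\<^esub> dif F.\<Omega> (x n)) n)
      = F'.cl (Poly_Mapping.single (\<one>\<^bsub>A'\<^esub>, []) (1 / of_nat n)) \<otimes>\<^bsub>F'.\<Omega>\<^esub> dif F'.\<Omega> ((\<lambda>n\<in>S. h\<Omega> (x n)) n)"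
      unfolding restrict_apply'[OF n] ring_hom_mult[OF h\<Omega>_hom s add_map_closed[OF F.difO(2) xn]]
        hP_scalar h\<Omega>_dif[OF xn] ..
  qed
qed

lemma hP_dg_map: "dg_map F.OP F'.OP hP"
  unfolding dg_map_def dg_continuous_def
proof (intro conjI allI ballI)
  have at: "x n \<in> carrier F.\<Omega>" if "x \<in> carrier F.OP" "n \<in> S" for x n by (rule F.OP_at[OF that])
  show "hP \<in> ring_hom F.OP F'.OP"
  proof (rule ring_hom_memI)
    fix x assume x: "x \<in> carrier F.OP"
    show "hP x \<in> carrier F'.OP" by (rule hP_OP[OF x])
    fix y assume y: "y \<in> carrier F.OP"
    show "hP (x \<otimes>\<^bsub>F.OP\<^esub> y) = hP x \<otimes>\<^bsub>F'.OP\<^esub> hP y" "hP (x \<oplus>\<^bsub>F.OP\<^esub> y) = hP x \<oplus>\<^bsub>F'.OP\<^esub> hP y"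
      unfolding hP_def F.Omega_pow_simps(5,6) F'.Omega_pow_simps(5,6)
      by (intro restrict_ext, simp add: ring_hom_mult[OF h\<Omega>_hom] ring_hom_add[OF h\<Omega>_hom] at[OF x] at[OF y])+
  next
    show "hP \<one>\<^bsub>F.OP\<^esub> = \<one>\<^bsub>F'.OP\<^esub>"
      unfolding hP_def F.Omega_pow_simps(7) F'.Omega_pow_simps(7)
      by (intro restrict_ext) (simp add: ring_hom_one[OF h\<Omega>_hom])
  qed
  show "hP ` homog F.OP q \<subseteq> homog F'.OP q" for q
    unfolding F.Omega_pow_simps(2) F'.Omega_pow_simps(2) using hP_deg by blast
  show "hP (dif F.OP x) = dif F'.OP (hP x)" if "x \<in> carrier F.OP" for x
    unfolding F.Omega_pow_simps(3) F'.Omega_pow_simps(3) by (rule hP_dif[OF that])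
  show "continuous_map (htop F.OP q) (htop F'.OP q) hP" for q
  proof -
    have "continuous_map (subtopology (product_topology (\<lambda>_. discrete_topology (homog F.\<Omega> q)) S) UNIV)
        (subtopology (product_topology (\<lambda>_. discrete_topology (homog F'.\<Omega> q)) S) UNIV) (\<lambda>x. \<lambda>n\<in>S. h\<Omega> (x n))"
      by (rule continuous_subpower) (simp add: PiE_iff h\<Omega>_homog)
    then show ?thesis
      unfolding F.Omega_pow_simps(4) F'.Omega_pow_simps(4) subtopology_UNIV hP_def[abs_def] .
  qed
qed

lemma hP_emb: "x \<in> (\<Pi>\<^sub>E n\<in>S. carrier A) \<Longrightarrow> hP (F.emb x) = F'.emb (\<lambda>n\<in>S. h (x n))"
  unfolding hP_def Omega_emb_def
  by (intro restrict_ext) (auto simp: PiE_iff h\<Omega>_cl)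

end

section \<open>Polynomial rings\<close>

definition monomial_eval :: "('c, 'm) ring_scheme \<Rightarrow> ('x \<Rightarrow> 'c) \<Rightarrow> 'x multiset \<Rightarrow> 'c"
  where "monomial_eval C v m = (\<Otimes>\<^bsub>C\<^esub>x\<in>set_mset m. v x [^]\<^bsub>C\<^esub> count m x)"

text \<open>Substitution of \<open>v\<close> in polynomials whose coefficients are mapped by \<open>\<phi>\<close>. The evaluation
  \<^const>\<open>poly_eval\<close> is the case where indeterminates are elements of the ring and are substituted
  for themselves.\<close>

definition eval_at ::
  "('c, 'm) ring_scheme \<Rightarrow> ('b, 'n) ring_scheme \<Rightarrow> ('b \<Rightarrow> 'c) \<Rightarrow> ('x \<Rightarrow> 'c) \<Rightarrow> ('x multiset \<Rightarrow> 'b) \<Rightarrow> 'c"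
  where "eval_at C B \<phi> v p = (\<Oplus>\<^bsub>C\<^esub>m\<in>{m. p m \<noteq> \<zero>\<^bsub>B\<^esub>}. \<phi> (p m) \<otimes>\<^bsub>C\<^esub> monomial_eval C v m)"

lemma poly_eval_eq: "poly_eval A B \<iota> = eval_at A B \<iota> (\<lambda>x. x)"
  by (rule ext) (simp only: poly_eval_def eval_at_def monomial_eval_def)

locale evaluation = B: cring B + C: cring C
  for B :: "('b, 'n) ring_scheme" and C :: "('c, 'm) ring_scheme" +
  fixes \<phi> :: "'b \<Rightarrow> 'c" and v :: "'x \<Rightarrow> 'c" and T :: "'x set"
  assumes \<phi>: "\<phi> \<in> ring_hom B C" and v: "\<And>t. t \<in> T \<Longrightarrow> v t \<in> carrier C"
begin

abbreviation "polys \<equiv> B.indexed_pset T (carrier B)"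
abbreviation "supp p \<equiv> {m. p m \<noteq> \<zero>\<^bsub>B\<^esub>}"
abbreviation "val \<equiv> monomial_eval C v"
abbreviation "ev \<equiv> eval_at C B \<phi> v"

lemma \<phi>_closed: "b \<in> carrier B \<Longrightarrow> \<phi> b \<in> carrier C"
  by (rule ring_hom_closed[OF \<phi>])

lemma \<phi>_zero: "\<phi> \<zero>\<^bsub>B\<^esub> = \<zero>\<^bsub>C\<^esub>"
  by (rule ring_hom_zero[OF \<phi> B.ring_axioms C.ring_axioms])

lemma val_superset:
  assumes "finite K" "set_mset m \<subseteq> K" "K \<subseteq> T"
  shows "val m = (\<Otimes>\<^bsub>C\<^esub>x\<in>K. v x [^]\<^bsub>C\<^esub> count m x)"
  unfolding monomial_eval_def
proof (rule C.finprod_mono_neutral_cong_left)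
  show "v i [^]\<^bsub>C\<^esub> count m i = \<one>\<^bsub>C\<^esub>" if "i \<in> K - set_mset m" for i
    using that by (simp add: not_in_iff)
qed (use assms v in auto)

lemma val_closed: "set_mset m \<subseteq> T \<Longrightarrow> val m \<in> carrier C"
  unfolding monomial_eval_def by (rule C.finprod_closed) (use v in auto)

lemma val_empty [simp]: "val {#} = \<one>\<^bsub>C\<^esub>"
  by (simp add: monomial_eval_def)

lemma val_add_mset:
  assumes m: "set_mset m \<subseteq> T" and i: "i \<in> T"
  shows "val (add_mset i m) = val m \<otimes>\<^bsub>C\<^esub> v i"
proof -
  let ?K = "insert i (set_mset m)"
  have K: "finite ?K" "?K \<subseteq> T" using m i by auto
  have vK: "v x \<in> carrier C" if "x \<in> ?K" for x using that K(2) v by blast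
  have "val (add_mset i m) = (\<Otimes>\<^bsub>C\<^esub>x\<in>?K. v x [^]\<^bsub>C\<^esub> count (add_mset i m) x)"
    by (rule val_superset[OF K(1) _ K(2)]) simp
  also have "\<dots> = (\<Otimes>\<^bsub>C\<^esub>x\<in>?K. v x [^]\<^bsub>C\<^esub> count m x \<otimes>\<^bsub>C\<^esub> (if i = x then v x else \<one>\<^bsub>C\<^esub>))"
    by (rule C.finprod_cong') (use vK in \<open>auto simp: C.nat_pow_Suc\<close>)
  also have "\<dots> = (\<Otimes>\<^bsub>C\<^esub>x\<in>?K. v x [^]\<^bsub>C\<^esub> count m x) \<otimes>\<^bsub>C\<^esub> (\<Otimes>\<^bsub>C\<^esub>x\<in>?K. if i = x then v x else \<one>\<^bsub>C\<^esub>)"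
    by (rule C.finprod_multf) (use vK in auto)
  also have "(\<Otimes>\<^bsub>C\<^esub>x\<in>?K. if i = x then v x else \<one>\<^bsub>C\<^esub>) = v i"
    by (rule C.finprod_singleton) (use vK in auto)
  also have "(\<Otimes>\<^bsub>C\<^esub>x\<in>?K. v x [^]\<^bsub>C\<^esub> count m x) = val m"
    by (rule val_superset[OF K(1) _ K(2), symmetric]) auto
  finally show ?thesis .
qed

text \<open>What is needed of a polynomial for the sums in \<^const>\<open>eval_at\<close> to be finite sums of elements
  of the carrier.\<close>

definition poly_like :: "('x multiset \<Rightarrow> 'b) \<Rightarrow> bool"
  where "poly_like p \<longleftrightarrow> finite (supp p) \<and> (\<forall>m\<in>supp p. set_mset m \<subseteq> T) \<and> (\<forall>m. p m \<in> carrier B)"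

lemma ev_superset:
  assumes p: "poly_like p" and M: "finite M" "supp p \<subseteq> M" "\<And>m. m \<in> M \<Longrightarrow> set_mset m \<subseteq> T"
  shows "ev p = (\<Oplus>\<^bsub>C\<^esub>m\<in>M. \<phi> (p m) \<otimes>\<^bsub>C\<^esub> val m)"
  unfolding eval_at_def
proof (rule C.add.finprod_mono_neutral_cong_left[OF M(1,2)])
  have c: "\<phi> (p m) \<in> carrier C" for m using p \<phi>_closed by (simp add: poly_like_def)
  show "\<phi> (p m) \<otimes>\<^bsub>C\<^esub> val m = \<zero>\<^bsub>C\<^esub>" if "m \<in> M - supp p" for m
    using that val_closed[OF M(3)] by (auto simp: \<phi>_zero)
  show "(\<lambda>m. \<phi> (p m) \<otimes>\<^bsub>C\<^esub> val m) \<in> M \<rightarrow> carrier C"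
    using c val_closed[OF M(3)] by auto
qed simp

lemma ev_closed: "poly_like p \<Longrightarrow> ev p \<in> carrier C"
  unfolding eval_at_def by (rule C.finsum_closed) (auto simp: poly_like_def intro!: C.m_closed \<phi>_closed val_closed)

lemma ev_const:
  assumes b: "b \<in> carrier B"
  shows "poly_like (B.indexed_const b)" "ev (B.indexed_const b) = \<phi> b"
proof -
  show p: "poly_like (B.indexed_const b)"
    using b by (auto simp: poly_like_def B.indexed_const_def split: if_splits)
  have "ev (B.indexed_const b) = (\<Oplus>\<^bsub>C\<^esub>m\<in>{{#}}. \<phi> (B.indexed_const b m) \<otimes>\<^bsub>C\<^esub> val m)"
    by (rule ev_superset[OF p]) (auto simp: B.indexed_const_def)
  then show "ev (B.indexed_const b) = \<phi> b"
    using \<phi>_closed[OF b] by (simp add: B.indexed_const_def)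
qed

lemma ev_padd:
  assumes p: "poly_like p" and q: "poly_like q"
  shows "poly_like (B.indexed_padd p q)" "ev (B.indexed_padd p q) = ev p \<oplus>\<^bsub>C\<^esub> ev q"
proof -
  let ?M = "supp p \<union> supp q"
  have s: "supp (B.indexed_padd p q) \<subseteq> ?M" by (auto simp: B.indexed_padd_def)
  have M: "finite ?M" "\<And>m. m \<in> ?M \<Longrightarrow> set_mset m \<subseteq> T" using p q by (auto simp: poly_like_def)
  have c: "p m \<in> carrier B" "q m \<in> carrier B" for m using p q by (auto simp: poly_like_def)
  show pq: "poly_like (B.indexed_padd p q)"
    unfolding poly_like_def using finite_subset[OF s M(1)] s M(2) c by (auto simp: B.indexed_padd_def)
  have "ev (B.indexed_padd p q) = (\<Oplus>\<^bsub>C\<^esub>m\<in>?M. \<phi> (B.indexed_padd p q m) \<otimes>\<^bsub>C\<^esub> val m)"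
    by (rule ev_superset[OF pq M(1) s M(2)])
  also have "\<dots> = (\<Oplus>\<^bsub>C\<^esub>m\<in>?M. \<phi> (p m) \<otimes>\<^bsub>C\<^esub> val m \<oplus>\<^bsub>C\<^esub> \<phi> (q m) \<otimes>\<^bsub>C\<^esub> val m)"
  proof (rule C.add.finprod_cong'[OF refl])
    show "\<phi> (B.indexed_padd p q m) \<otimes>\<^bsub>C\<^esub> val m = \<phi> (p m) \<otimes>\<^bsub>C\<^esub> val m \<oplus>\<^bsub>C\<^esub> \<phi> (q m) \<otimes>\<^bsub>C\<^esub> val m" if "m \<in> ?M" for m
      using c \<phi>_closed val_closed[OF M(2)[OF that]]
      by (simp add: B.indexed_padd_def ring_hom_add[OF \<phi>] C.l_distr)
    show "(\<lambda>m. \<phi> (p m) \<otimes>\<^bsub>C\<^esub> val m \<oplus>\<^bsub>C\<^esub> \<phi> (q m) \<otimes>\<^bsub>C\<^esub> val m) \<in> ?M \<rightarrow> carrier C"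
      by (intro funcsetI C.a_closed C.m_closed \<phi>_closed c val_closed M(2))
  qed
  also have "\<dots> = (\<Oplus>\<^bsub>C\<^esub>m\<in>?M. \<phi> (p m) \<otimes>\<^bsub>C\<^esub> val m) \<oplus>\<^bsub>C\<^esub> (\<Oplus>\<^bsub>C\<^esub>m\<in>?M. \<phi> (q m) \<otimes>\<^bsub>C\<^esub> val m)"
    by (rule C.finsum_addf) (intro funcsetI C.m_closed \<phi>_closed c val_closed M(2), assumption)+
  also have "\<dots> = ev p \<oplus>\<^bsub>C\<^esub> ev q"
    using ev_superset[OF p M(1) _ M(2)] ev_superset[OF q M(1) _ M(2)] by simp
  finally show "ev (B.indexed_padd p q) = ev p \<oplus>\<^bsub>C\<^esub> ev q" .
qed

lemma ev_pmult:
  assumes p: "poly_like p" and i: "i \<in> T"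
  shows "poly_like (B.indexed_pmult p i)" "ev (B.indexed_pmult p i) = ev p \<otimes>\<^bsub>C\<^esub> v i"
proof -
  let ?M = "add_mset i ` supp p"
  have M: "finite (supp p)" "\<And>m. m \<in> supp p \<Longrightarrow> set_mset m \<subseteq> T" "\<And>m. p m \<in> carrier B"
    using p by (auto simp: poly_like_def)
  have s: "supp (B.indexed_pmult p i) \<subseteq> ?M"
  proof
    fix m assume "m \<in> supp (B.indexed_pmult p i)"
    then have "i \<in># m" "m - {#i#} \<in> supp p" by (auto simp: B.indexed_pmult_def split: if_splits)
    then show "m \<in> ?M" by (intro image_eqI[of _ _ "m - {#i#}"]) auto
  qed
  have MT: "\<And>m. m \<in> ?M \<Longrightarrow> set_mset m \<subseteq> T" using M(2) i by fastforce
  show pi: "poly_like (B.indexed_pmult p i)"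
    unfolding poly_like_def
  proof (intro conjI ballI allI)
    show "finite (supp (B.indexed_pmult p i))" by (rule finite_subset[OF s finite_imageI[OF M(1)]])
    show "set_mset m \<subseteq> T" if "m \<in> supp (B.indexed_pmult p i)" for m by (rule MT[OF subsetD[OF s that]])
    show "B.indexed_pmult p i m \<in> carrier B" for m using M(3) by (simp add: B.indexed_pmult_def)
  qed
  have c: "\<phi> (p m) \<otimes>\<^bsub>C\<^esub> val m \<in> carrier C" if "m \<in> supp p" for m
    using M(3) \<phi>_closed val_closed[OF M(2)[OF that]] by simp
  have "ev (B.indexed_pmult p i) = (\<Oplus>\<^bsub>C\<^esub>m\<in>?M. \<phi> (B.indexed_pmult p i m) \<otimes>\<^bsub>C\<^esub> val m)"
    by (rule ev_superset[OF pi _ s MT]) (use M(1) in auto)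
  also have "\<dots> = (\<Oplus>\<^bsub>C\<^esub>m\<in>supp p. \<phi> (B.indexed_pmult p i (add_mset i m)) \<otimes>\<^bsub>C\<^esub> val (add_mset i m))"
  proof (rule C.add.finprod_reindex)
    show "(\<lambda>m. \<phi> (B.indexed_pmult p i m) \<otimes>\<^bsub>C\<^esub> val m) \<in> ?M \<rightarrow> carrier C"
      using val_closed[OF MT] pi \<phi>_closed by (auto simp: poly_like_def)
    show "inj_on (add_mset i) (supp p)" by (simp add: inj_on_def)
  qed
  also have "\<dots> = (\<Oplus>\<^bsub>C\<^esub>m\<in>supp p. (\<phi> (p m) \<otimes>\<^bsub>C\<^esub> val m) \<otimes>\<^bsub>C\<^esub> v i)"
  proof (rule C.add.finprod_cong'[OF refl])
    show "\<phi> (B.indexed_pmult p i (add_mset i m)) \<otimes>\<^bsub>C\<^esub> val (add_mset i m) = (\<phi> (p m) \<otimes>\<^bsub>C\<^esub> val m) \<otimes>\<^bsub>C\<^esub> v i"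
      if "m \<in> supp p" for m
      using M(3) \<phi>_closed val_closed[OF M(2)[OF that]] v[OF i]
      by (simp add: B.indexed_pmult_def val_add_mset[OF M(2)[OF that] i] C.m_assoc)
    show "(\<lambda>m. (\<phi> (p m) \<otimes>\<^bsub>C\<^esub> val m) \<otimes>\<^bsub>C\<^esub> v i) \<in> supp p \<rightarrow> carrier C"
      by (intro funcsetI) (rule C.m_closed[OF c v[OF i]])
  qed
  also have "\<dots> = ev p \<otimes>\<^bsub>C\<^esub> v i"
    unfolding eval_at_def by (rule C.finsum_ldistr[symmetric]) (use M(1) c v[OF i] in auto)
  finally show "ev (B.indexed_pmult p i) = ev p \<otimes>\<^bsub>C\<^esub> v i" .
qed

lemma polys_like: "p \<in> polys \<Longrightarrow> poly_like p"
  by (induct rule: B.indexed_pset.induct) (auto intro: ev_const ev_padd ev_pmult)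

end

locale polynomial_ring = B: cring B + A: cring A
  for B :: "('b, 'n) ring_scheme" and A :: "('a, 'm) ring_scheme" +
  fixes \<iota> :: "'b \<Rightarrow> 'a" and T :: "'a set"
  assumes incl: "\<iota> \<in> ring_hom B A" and T: "T \<subseteq> carrier A"
    and bij: "bij_betw (poly_eval A B \<iota>) (ring.indexed_pset B T (carrier B)) (carrier A)"
begin

sublocale ev: evaluation B A \<iota> "\<lambda>x. x" T
  by unfold_locales (use incl T in auto)

lemma ev_surj: "a \<in> carrier A \<Longrightarrow> \<exists>p\<in>ev.polys. a = ev.ev p"
  using bij unfolding poly_eval_eq bij_betw_def by auto

lemma ev_inj: "p \<in> ev.polys \<Longrightarrow> q \<in> ev.polys \<Longrightarrow> ev.ev p = ev.ev q \<Longrightarrow> p = q"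
  using bij unfolding poly_eval_eq bij_betw_def inj_on_def by blast

text \<open>Each element of \<open>A\<close> is the value of a polynomial, and polynomials are built from
  constants by addition and multiplication by an indeterminate.\<close>

lemma polynomial_induct [consumes 1, case_names const add mult]:
  assumes a: "a \<in> carrier A"
    and const: "\<And>b. b \<in> carrier B \<Longrightarrow> P (\<iota> b)"
    and add: "\<And>x y. x \<in> carrier A \<Longrightarrow> y \<in> carrier A \<Longrightarrow> P x \<Longrightarrow> P y \<Longrightarrow> P (x \<oplus>\<^bsub>A\<^esub> y)"
    and mult: "\<And>x t. x \<in> carrier A \<Longrightarrow> t \<in> T \<Longrightarrow> P x \<Longrightarrow> P (x \<otimes>\<^bsub>A\<^esub> t)"
  shows "P a"
proof -
  have "P (ev.ev p)" if "p \<in> ev.polys" for p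
    using that
    by (induct rule: B.indexed_pset.induct)
      (simp_all add: ev.ev_const ev.ev_padd ev.ev_pmult ev.polys_like ev.ev_closed const add mult)
  then show ?thesis using ev_surj[OF a] by blast
qed

text \<open>Injectivity of the evaluation allows \<open>g\<close> to be defined through polynomials. It is
  compatible with sums and with multiplication by an indeterminate by construction;
  compatibility with all products follows by induction, first for multiplication by constants.\<close>

lemma extension_exists:
  assumes C: "cring C" and \<phi>: "\<phi> \<in> ring_hom B C" and v: "\<And>t. t \<in> T \<Longrightarrow> v t \<in> carrier C"
  shows "\<exists>g\<in>ring_hom A C. (\<forall>b\<in>carrier B. g (\<iota> b) = \<phi> b) \<and> (\<forall>t\<in>T. g t = v t)"
proof -
  interpret C: cring C by (rule C)
  interpret w: evaluation B C \<phi> v T by unfold_locales (use \<phi> v in auto)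
  define g where "g a = w.ev (the_inv_into ev.polys ev.ev a)" for a
  have g: "g (ev.ev p) = w.ev p" if "p \<in> ev.polys" for p
    unfolding g_def using the_inv_into_f_f[of ev.ev ev.polys p] ev_inj that by (simp add: inj_on_def)
  have const: "g (\<iota> b) = \<phi> b" if b: "b \<in> carrier B" for b
    using g[OF B.indexed_const[OF b]] by (simp add: ev.ev_const[OF b] w.ev_const[OF b])
  have add: "g (x \<oplus>\<^bsub>A\<^esub> y) = g x \<oplus>\<^bsub>C\<^esub> g y" if x: "x \<in> carrier A" and y: "y \<in> carrier A" for x y
  proof -
    obtain p q where p: "p \<in> ev.polys" "x = ev.ev p" and q: "q \<in> ev.polys" "y = ev.ev q"
      using ev_surj[OF x] ev_surj[OF y] by blast
    show ?thesis
      using g[OF B.indexed_padd[OF p(1) q(1)]] g[OF p(1)] g[OF q(1)] p q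
      by (simp add: ev.ev_padd ev.polys_like w.ev_padd w.polys_like)
  qed
  have mult_t: "g (x \<otimes>\<^bsub>A\<^esub> t) = g x \<otimes>\<^bsub>C\<^esub> v t" if x: "x \<in> carrier A" and t: "t \<in> T" for x t
  proof -
    obtain p where p: "p \<in> ev.polys" "x = ev.ev p" using ev_surj[OF x] by blast
    show ?thesis
      using g[OF B.indexed_pmult[OF p(1) t]] g[OF p(1)] p t
      by (simp add: ev.ev_pmult ev.polys_like w.ev_pmult w.polys_like)
  qed
  have clo: "g x \<in> carrier C" if "x \<in> carrier A" for x
    using ev_surj[OF that] g w.ev_closed[OF w.polys_like] by auto
  have tA: "t \<in> carrier A" if "t \<in> T" for t using that T by blast
  have mult_b: "g (x \<otimes>\<^bsub>A\<^esub> \<iota> b) = g x \<otimes>\<^bsub>C\<^esub> \<phi> b" if x: "x \<in> carrier A" and b: "b \<in> carrier B" for x b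
    using x
  proof (induct x rule: polynomial_induct)
    case (const c)
    then show ?case using b by (simp add: ring_hom_mult[OF incl, symmetric] \<open>\<And>b. b \<in> carrier B \<Longrightarrow> g (\<iota> b) = \<phi> b\<close> ring_hom_mult[OF \<phi>])
  next
    case (add x y)
    then show ?case using ev.\<phi>_closed[OF b] w.\<phi>_closed[OF b]
      by (simp add: A.l_distr \<open>\<And>x y. x \<in> carrier A \<Longrightarrow> y \<in> carrier A \<Longrightarrow> g (x \<oplus>\<^bsub>A\<^esub> y) = g x \<oplus>\<^bsub>C\<^esub> g y\<close> clo C.l_distr)
  next
    case (mult x t)
    have "x \<otimes>\<^bsub>A\<^esub> t \<otimes>\<^bsub>A\<^esub> \<iota> b = x \<otimes>\<^bsub>A\<^esub> \<iota> b \<otimes>\<^bsub>A\<^esub> t"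
      using mult(1) tA[OF mult(2)] ev.\<phi>_closed[OF b] by (simp add: A.m_ac)
    moreover have "g x \<otimes>\<^bsub>C\<^esub> v t \<otimes>\<^bsub>C\<^esub> \<phi> b = g x \<otimes>\<^bsub>C\<^esub> \<phi> b \<otimes>\<^bsub>C\<^esub> v t"
      using clo[OF mult(1)] v[OF mult(2)] w.\<phi>_closed[OF b] by (simp add: C.m_ac)
    ultimately show ?case
      using mult ev.\<phi>_closed[OF b] by (simp add: mult_t)
  qed
  have mult: "g (x \<otimes>\<^bsub>A\<^esub> y) = g x \<otimes>\<^bsub>C\<^esub> g y" if x: "x \<in> carrier A" and y: "y \<in> carrier A" for x y
    using y
  proof (induct y rule: polynomial_induct)
    case (const b)
    then show ?case by (simp add: mult_b[OF x] \<open>\<And>b. b \<in> carrier B \<Longrightarrow> g (\<iota> b) = \<phi> b\<close>)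
  next
    case (add y z)
    then show ?case using x
      by (simp add: A.r_distr \<open>\<And>x y. x \<in> carrier A \<Longrightarrow> y \<in> carrier A \<Longrightarrow> g (x \<oplus>\<^bsub>A\<^esub> y) = g x \<oplus>\<^bsub>C\<^esub> g y\<close> clo C.r_distr)
  next
    case (mult y t)
    have "x \<otimes>\<^bsub>A\<^esub> (y \<otimes>\<^bsub>A\<^esub> t) = (x \<otimes>\<^bsub>A\<^esub> y) \<otimes>\<^bsub>A\<^esub> t" using mult(1) tA[OF mult(2)] x by (simp add: A.m_assoc)
    then show ?case using mult x v by (simp add: mult_t clo C.m_assoc)
  qed
  have one: "g \<one>\<^bsub>A\<^esub> = \<one>\<^bsub>C\<^esub>"
    using const[OF B.one_closed] by (simp add: ring_hom_one[OF incl] ring_hom_one[OF \<phi>])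
  have "g t = v t" if t: "t \<in> T" for t
    using mult_t[OF A.one_closed t] one tA[OF t] v[OF t] by simp
  moreover have "g \<in> ring_hom A C" using clo mult add one by (intro ring_hom_memI) auto
  ultimately show ?thesis using const by blast
qed

text \<open>Polynomial rings are projective: preimages of the images of the indeterminates can be
  chosen freely.\<close>

lemma lift_exists:
  assumes C: "cring C" and \<phi>: "\<phi> \<in> ring_hom B C"
    and p: "p \<in> ring_hom C R" "p ` carrier C = carrier R" and f: "f \<in> ring_hom A R"
    and compat: "\<And>b. b \<in> carrier B \<Longrightarrow> p (\<phi> b) = f (\<iota> b)"
  shows "\<exists>g\<in>ring_hom A C. (\<forall>b\<in>carrier B. g (\<iota> b) = \<phi> b) \<and> (\<forall>a\<in>carrier A. p (g a) = f a)"
proof -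
  have "\<forall>t\<in>T. \<exists>c\<in>carrier C. p c = f t"
    using ring_hom_closed[OF f] T p(2) by (metis imageE subsetD)
  then obtain v where v: "\<And>t. t \<in> T \<Longrightarrow> v t \<in> carrier C" "\<And>t. t \<in> T \<Longrightarrow> p (v t) = f t" by metis
  obtain g where g: "g \<in> ring_hom A C" "\<And>b. b \<in> carrier B \<Longrightarrow> g (\<iota> b) = \<phi> b" "\<And>t. t \<in> T \<Longrightarrow> g t = v t"
    using extension_exists[OF C \<phi>, of v] v(1) by blast
  have "p (g a) = f a" if "a \<in> carrier A" for a
    using that
  proof (induct a rule: polynomial_induct)
    case (const b) then show ?case by (simp add: g(2) compat)
  next
    case (add x y) then show ?case
      by (simp add: ring_hom_add[OF g(1)] ring_hom_add[OF p(1)] ring_hom_add[OF f] ring_hom_closed[OF g(1)])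
  next
    case (mult x t)
    moreover have "t \<in> carrier A" using mult T by blast
    ultimately show ?case
      by (simp add: ring_hom_mult[OF g(1)] ring_hom_mult[OF p(1)] ring_hom_mult[OF f] ring_hom_closed[OF g(1)] g(3) v)
  qed
  then show ?thesis using g by blast
qed

text \<open>Multiplication by \<open>n\<close> corresponds to multiplication of all coefficients by \<open>n\<close>.\<close>

lemma torsion_free:
  assumes tf: "\<And>n b. 0 < (n::nat) \<Longrightarrow> b \<in> carrier B \<Longrightarrow> add_pow B n b = \<zero>\<^bsub>B\<^esub> \<Longrightarrow> b = \<zero>\<^bsub>B\<^esub>"
  shows "torsion_free_cring A"
proof
  fix n :: nat and a assume n: "0 < n" and a: "a \<in> carrier A" and na: "add_pow A n a = \<zero>\<^bsub>A\<^esub>"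
  have step: "(\<lambda>m. add_pow B n (p m)) \<in> ev.polys \<and> ev.ev (\<lambda>m. add_pow B n (p m)) = add_pow A n (ev.ev p)"
    if "p \<in> ev.polys" for p
    using that
  proof (induct rule: B.indexed_pset.induct)
    case (indexed_const b)
    have e: "(\<lambda>m. add_pow B n (B.indexed_const b m)) = B.indexed_const (add_pow B n b)"
      by (auto simp: B.indexed_const_def)
    have c: "add_pow B n b \<in> carrier B" using indexed_const by simp
    show ?case
      unfolding e ev.ev_const[OF c] ev.ev_const[OF indexed_const] using B.indexed_const[OF c]
        ring_hom_add_pow[OF ring_hom_add_map[OF incl] B.ring_axioms A.ring_axioms indexed_const] by simp
  next
    case (indexed_padd p q)
    note pl = ev.polys_like[OF indexed_padd(1)] ev.polys_like[OF indexed_padd(3)]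
    have e: "(\<lambda>m. add_pow B n (B.indexed_padd p q m)) = B.indexed_padd (\<lambda>m. add_pow B n (p m)) (\<lambda>m. add_pow B n (q m))"
      using pl by (auto simp: B.indexed_padd_def ev.poly_like_def B.add.nat_pow_distrib)
    show ?case
      unfolding e using indexed_padd(2,4) pl
      by (simp add: B.indexed_padd ev.ev_padd ev.polys_like A.add.nat_pow_distrib ev.ev_closed)
  next
    case (indexed_pmult p i)
    note pl = ev.polys_like[OF indexed_pmult(1)]
    have e: "(\<lambda>m. add_pow B n (B.indexed_pmult p i m)) = B.indexed_pmult (\<lambda>m. add_pow B n (p m)) i"
      by (auto simp: B.indexed_pmult_def)
    have i: "i \<in> carrier A" using indexed_pmult(3) T by blast
    show ?case
      unfolding e using indexed_pmult(2,3) pl i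
      by (simp add: B.indexed_pmult ev.ev_pmult ev.polys_like A.add_pow_ldistr ev.ev_closed)
  qed
  obtain p where p: "p \<in> ev.polys" "a = ev.ev p" using ev_surj[OF a] by blast
  have z: "B.indexed_const \<zero>\<^bsub>B\<^esub> \<in> ev.polys" "ev.ev (B.indexed_const \<zero>\<^bsub>B\<^esub>) = \<zero>\<^bsub>A\<^esub>"
    using B.indexed_const[OF B.zero_closed] by (simp_all add: ev.ev_const ev.\<phi>_zero)
  have "(\<lambda>m. add_pow B n (p m)) = B.indexed_const \<zero>\<^bsub>B\<^esub>"
    by (rule ev_inj) (use step[OF p(1)] z na p(2) in simp_all)
  then have "add_pow B n (p m) = \<zero>\<^bsub>B\<^esub>" for m
    by (simp add: B.indexed_zero_def fun_eq_iff)
  moreover have "p m \<in> carrier B" for m using ev.polys_like[OF p(1)] by (simp add: ev.poly_like_def)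
  ultimately have "p = B.indexed_const \<zero>\<^bsub>B\<^esub>"
    unfolding B.indexed_zero_def using tf[OF n] by blast
  then show "a = \<zero>\<^bsub>A\<^esub>" using p(2) z(2) by simp
qed

end

lemma polynomial_ring_overE:
  assumes "polynomial_ring_over A B \<iota>" "cring A" "cring B" "\<iota> \<in> ring_hom B A"
  obtains T where "polynomial_ring B A \<iota> T"
  using assms unfolding polynomial_ring_over_def polynomial_ring_def polynomial_ring_axioms_def by blast

text \<open>The integers are initial among rings.\<close>

lemma int_scalar_hom:
  assumes C: "cring C" shows "(\<lambda>k::int. add_pow C k \<one>\<^bsub>C\<^esub>) \<in> ring_hom \<Z> C"
proof -
  interpret C: cring C by (rule C)
  show ?thesis
    by (rule ring_hom_memI)
      (simp_all add: C.add.int_pow_mult C.add_pow_ldistr_int C.add.int_pow_pow mult.commute)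
qed

lemma ring_hom_int_scalar:
  assumes f: "f \<in> ring_hom C D" and C: "cring C" and D: "cring D"
  shows "f (add_pow C (k::int) \<one>\<^bsub>C\<^esub>) = add_pow D k \<one>\<^bsub>D\<^esub>"
proof -
  interpret C: cring C by (rule C)
  interpret D: cring D by (rule D)
  interpret f: ring_hom_ring C D f by (rule ring_hom_ringI2[OF C.ring_axioms D.ring_axioms f])
  have n: "f (add_pow C (n::nat) \<one>\<^bsub>C\<^esub>) = add_pow D n \<one>\<^bsub>D\<^esub>" for n
    using ring_hom_add_pow[OF ring_hom_add_map[OF f] C.ring_axioms D.ring_axioms C.one_closed] ring_hom_one[OF f] by simp
  show ?thesis
    using n by (cases "k < 0") (simp_all add: add_pow_int_lt add_pow_int_ge)
qed

section \<open>The differential graded ring of a presentation\<close>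

locale presented = truncated S
  for S :: "nat set" +
  fixes R0 :: "'s ring" and R :: "'r ring" and \<rho> :: "'s \<Rightarrow> 'r"
    and P :: "('b, 'a, 's, 'r) algebra_presentation"
  assumes R0: "cring R0" and R: "cring R" and \<rho>: "\<rho> \<in> ring_hom R0 R" and pres: "presentation R0 R \<rho> P"
begin

lemma presentation_simps:
  "cring (base P)" "cring (total P)"
  "proj0 P \<in> ring_hom (base P) R0" "proj0 P ` carrier (base P) = carrier R0"
  "proj P \<in> ring_hom (total P) R" "proj P ` carrier (total P) = carrier R"
  "incl P \<in> ring_hom (base P) (total P)"
  "\<And>b. b \<in> carrier (base P) \<Longrightarrow> proj P (incl P b) = \<rho> (proj0 P b)"
  "polynomial_ring_over (total P) (base P) (incl P)"
  using pres by (simp_all add: presentation_def)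

lemma torsion_base: "0 < (n::nat) \<Longrightarrow> b \<in> carrier (base P) \<Longrightarrow> add_pow (base P) n b = \<zero>\<^bsub>base P\<^esub> \<Longrightarrow> b = \<zero>\<^bsub>base P\<^esub>"
  using pres by (simp add: presentation_def)

lemma polynomial_total: obtains T where "polynomial_ring (base P) (total P) (incl P) T"
  using polynomial_ring_overE[OF presentation_simps(9,2,1,7)] .

lemma presents_base: "presents (base P) R0 (proj0 P)"
  unfolding presents_def torsion_free_cring_def torsion_free_cring_axioms_def
  using presentation_simps R0 torsion_base by blast

lemma presents_total: "presents (total P) R (proj P)"
proof -
  obtain T where "polynomial_ring (base P) (total P) (incl P) T" by (rule polynomial_total)
  then have "torsion_free_cring (total P)" by (rule polynomial_ring.torsion_free) (rule torsion_base)
  then show ?thesis unfolding presents_def using presentation_simps R by blast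
qed

sublocale F: forms_power "base P" "total P" "incl P" S
  using presentation_simps(2) ring_hom_closed[OF presentation_simps(7)] truncated_axioms
  by (simp add: forms_power_def forms_def)

abbreviation "XD \<equiv> X_dg S P"
abbreviation "XI \<equiv> X_dg_ideal S R P"
abbreviation "EO \<equiv> E_Omega S R P"
abbreviation "XG \<equiv> X_group S (total P) (carrier (total P))"
abbreviation "XK \<equiv> X_group S (total P) (a_kernel (total P) R (proj P))"

interpretation A: cring "total P" by (rule presentation_simps)
interpretation B: cring "base P" by (rule presentation_simps)

lemma emb_OP: "F.emb ` XG \<subseteq> carrier F.OP"
  using add_map_closed[OF F.emb_add] by auto

lemma XD_subring: "dg_subring (carrier XD) F.OP" "dg_closed (carrier XD) F.OP"
  unfolding X_dg_def sub_dg_ring_simps by (rule graded_dg.dg_subring_hull[OF F.graded_OP emb_OP])+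

lemma XD_eq: "XD = sub_dg_ring F.OP (carrier XD)"
  by (simp add: X_dg_def)

lemma graded_XD: "graded_dg XD F.prP"
  using graded_dg.graded_sub[OF F.graded_OP XD_subring(1)] XD_eq by simp

lemma emb_XD: "x \<in> XG \<Longrightarrow> F.emb x \<in> carrier XD"
  unfolding X_dg_def sub_dg_ring_simps
  by (rule subsetD[OF hull_subset[of "F.emb ` XG"]]) (rule imageI)

lemma emb_XD_add: "F.emb \<in> add_map (X_ring S (total P)) XD"
  using F.emb_add emb_XD unfolding add_map_def X_dg_def by (simp add: Pi_iff)

text \<open>A closed differential graded subring of a closed differential graded subring is one of
  the ambient ring, so minimality in \<open>\<Omega>\<^sub>\<rat>\<^sup>S\<close> implies minimality within \<open>X\<^sub>S\<^sup>\<bullet>(A)\<close>.\<close>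

lemma XD_generated:
  assumes "dg_subring Z XD" "dg_closed Z XD" "\<And>x. x \<in> XG \<Longrightarrow> F.emb x \<in> Z"
  shows "carrier XD \<subseteq> Z"
proof -
  have Z: "dg_subring Z F.OP \<and> dg_closed Z F.OP"
    using graded_dg.dg_closed_subring_trans[OF F.graded_OP XD_subring] assms(1,2) XD_eq by metis
  have "F.emb ` XG \<subseteq> Z" using assms(3) by blast
  then show ?thesis
    unfolding X_dg_def sub_dg_ring_simps by (rule hull_minimal) (rule Z)
qed

lemma XK_XG: "XK \<subseteq> XG"
  by (rule X_group_mono) (auto simp: A.ring_axioms mem_kernel)

lemma XI_ideal: "dg_ideal XI XD" "dg_closed XI XD"
proof -
  have "F.emb ` XK \<subseteq> carrier XD" using emb_XD XK_XG by blast
  from graded_dg.dg_ideal_hull[OF graded_XD this] show "dg_ideal XI XD" "dg_closed XI XD"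
    unfolding X_dg_ideal_def .
qed

lemma emb_XI: "x \<in> XK \<Longrightarrow> F.emb x \<in> XI"
  unfolding X_dg_ideal_def by (rule subsetD[OF hull_subset[of "F.emb ` XK"]]) (rule imageI)

lemma ideal_XI: "ideal XI XD"
  by (rule graded_dg.quot_ideal[OF graded_XD XI_ideal(1)])

lemma EO_carrier: "carrier EO = (\<lambda>x. XI +>\<^bsub>XD\<^esub> x) ` carrier XD"
  unfolding E_Omega_def by simp

lemma graded_EO: "graded_dg EO (\<lambda>q. coset_map XD XI (F.prP q))"
  unfolding E_Omega_def by (rule graded_dg.graded_quot[OF graded_XD XI_ideal(1)])

lemma EO_proj: "dg_map XD EO (\<lambda>x. XI +>\<^bsub>XD\<^esub> x)"
  unfolding E_Omega_def by (rule dg_map_quot_proj[OF graded_XD XI_ideal(1)])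

text \<open>In each degree this is the quotient of a subgroup of a power of a discrete group by a
  closed subgroup.\<close>

lemma Hausdorff_EO: "Hausdorff_space (htop EO q)"
proof -
  let ?T = "htop XD q" and ?G = "carrier XD \<inter> F.deg q"
  have h: "homog XD q = ?G" unfolding X_dg_def sub_dg_ring_simps F.Omega_pow_simps(2) ..
  let ?PT = "product_topology (\<lambda>_. discrete_topology (homog F.\<Omega> q)) S"
  have "?T = subtopology ?PT (carrier XD)"
    using arg_cong[OF XD_eq, of "\<lambda>D. htop D q"] by (simp only: sub_dg_ring_simps F.Omega_pow_simps(4))
  moreover have "topspace ?PT = F.deg q" by (simp add: F.deg_def)
  ultimately have T: "?T = subtopology ?PT ?G" by (metis Int_commute subtopology_restrict)
  have sub: "carrier XD \<subseteq> carrier F.OP" by (rule graded_dg.sub_carrier[OF F.graded_OP XD_subring(1)])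
  interpret XD: graded_dg XD F.prP by (rule graded_XD)
  have pw: "pointwise XD S F.\<Omega>"
  proof (rule pointwise.intro)
    show "ring XD" by (rule XD.ring_D)
    show "ring F.\<Omega>" by (rule F.ring_Omega)
    show "carrier XD \<subseteq> (\<Pi>\<^sub>E n\<in>S. carrier F.\<Omega>)" using sub F.OP_PO by auto
    show "x \<oplus>\<^bsub>XD\<^esub> y = (\<lambda>n\<in>S. x n \<oplus>\<^bsub>F.\<Omega>\<^esub> y n)" for x y
      unfolding X_dg_def sub_dg_ring_simps F.Omega_pow_simps(6) ..
  qed
  have cl: "closedin ?T (XI \<inter> ?G)" using XI_ideal(2) unfolding dg_closed_def h[symmetric] by blast
  have "Hausdorff_space (quot_topology ?T (\<lambda>x. XI +>\<^bsub>XD\<^esub> x))"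
  proof (rule pointwise.Hausdorff_quot[OF pw ideal_XI _ _ _ T cl])
    show "?G \<subseteq> carrier XD" by blast
    show "?G \<subseteq> (\<Pi>\<^sub>E n\<in>S. homog F.\<Omega> q)" unfolding F.deg_def by blast
    show "x \<ominus>\<^bsub>XD\<^esub> y \<in> ?G" if "x \<in> ?G" "y \<in> ?G" for x y
      using XD.homog_minus[of x q y] that unfolding h by blast
  qed
  then show ?thesis unfolding E_Omega_def quot_dg_ring_simps .
qed

lemma witt_XG: "a \<in> S \<rightarrow> carrier (total P) \<Longrightarrow> witt S (total P) a \<in> XG"
  by (rule witt_in_X_group[OF presentation_simps(2) subset_refl])

text \<open>The class of \<open>\<Sum> V\<^sub>n\<langle>a\<^sub>n\<rangle>\<close> in degree zero. Both the identification of \<open>E\<^sub>S(R)\<close> with the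
  degree zero part and the structure map from \<open>E\<^sub>S(R\<^sub>0)\<close> have all their values of this form.\<close>

definition symbol :: "(nat \<Rightarrow> 'a) \<Rightarrow> (nat \<Rightarrow> ('a \<times> 'a list \<Rightarrow>\<^sub>0 rat) set) set"
  where "symbol a = XI +>\<^bsub>XD\<^esub> F.emb (witt S (total P) a)"

lemma symbol_EO: "a \<in> S \<rightarrow> carrier (total P) \<Longrightarrow> symbol a \<in> carrier EO"
  unfolding symbol_def EO_carrier using emb_XD[OF witt_XG] by blast

lemma E_Omega_zero_witt:
  assumes a: "a \<in> S \<rightarrow> carrier (total P)"
  shows "E_Omega_zero S R P (E_std_class R (std_witt R (\<lambda>n. proj P (a n)))) = symbol a"
  unfolding E_Omega_zero_def E_canonical_witt[OF presents_total a] E_class_def[of S "total P"] symbol_def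
  by (rule coset_map_coset[OF ideal_E[OF presents_total] ideal_XI emb_XD_add])
    (use emb_XI witt_XG[OF a] in auto)

lemma E_Omega_structure_witt:
  assumes b: "b \<in> S \<rightarrow> carrier (base P)"
  shows "E_Omega_structure S R0 R P (E_std_class R0 (std_witt R0 (\<lambda>n. proj0 P (b n)))) = symbol (\<lambda>n. incl P (b n))"
proof -
  note i = presentation_simps(7)
  have ker: "incl P ` a_kernel (base P) R0 (proj0 P) \<subseteq> a_kernel (total P) R (proj P)"
    using presentation_simps(8) ring_hom_closed[OF i] ring_hom_zero[OF \<rho> cring.axioms(1)[OF R0] cring.axioms(1)[OF R]]
    by (auto simp: mem_kernel)
  have k: "a_kernel (base P) R0 (proj0 P) \<subseteq> carrier (base P)" "a_kernel (total P) R (proj P) \<subseteq> carrier (total P)"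
    by (auto simp: mem_kernel)
  let ?f = "\<lambda>x. F.emb (\<lambda>n\<in>S. incl P (x n))"
  have f: "?f \<in> add_map (X_ring S (base P)) XD"
    by (rule add_map_comp[OF ring_hom_add_map[OF X_ring_hom[OF presentation_simps(1,2) i]] emb_XD_add])
  have fk: "?f ` X_group S (base P) (a_kernel (base P) R0 (proj0 P)) \<subseteq> XI"
    using X_group_map[OF B.ring_axioms A.ring_axioms i k ker] emb_XI by blast
  have w: "witt S (base P) b \<in> carrier (X_ring S (base P))"
    using witt_in_X_group[OF presentation_simps(1) subset_refl b] by simp
  have "E_Omega_structure S R0 R P (E_std_class R0 (std_witt R0 (\<lambda>n. proj0 P (b n))))
      = XI +>\<^bsub>XD\<^esub> ?f (witt S (base P) b)"
    unfolding E_Omega_structure_def E_canonical_witt[OF presents_base b] E_class_def[of S "base P"]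
    by (rule coset_map_coset[OF ideal_E[OF presents_base] ideal_XI f fk w])
  also have "\<dots> = symbol (\<lambda>n. incl P (b n))"
    unfolding symbol_def witt_map[OF i presentation_simps(1,2) b] ..
  finally show ?thesis .
qed

lemma E_std_total:
  assumes y: "y \<in> carrier (E_std S R)"
  obtains a where "a \<in> S \<rightarrow> carrier (total P)" "y = E_std_class R (std_witt R (\<lambda>n. proj P (a n)))"
proof -
  obtain r where r: "r \<in> S \<rightarrow> carrier R" "y = E_std_class R (std_witt R r)" using E_std_cases[OF R y] by blast
  have "\<forall>n\<in>S. \<exists>a\<in>carrier (total P). proj P a = r n"
    using r(1) presentation_simps(6) by (metis funcset_mem imageE)
  then obtain a where a: "\<forall>n\<in>S. a n \<in> carrier (total P) \<and> proj P (a n) = r n" by metis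
  have "std_witt R r = std_witt R (\<lambda>n. proj P (a n))" by (rule witt_eqI) (simp add: a)
  with r(2) a show ?thesis by (intro that[of a]) auto
qed

lemma E_std_base:
  assumes y: "y \<in> carrier (E_std S R0)"
  obtains b where "b \<in> S \<rightarrow> carrier (base P)" "y = E_std_class R0 (std_witt R0 (\<lambda>n. proj0 P (b n)))"
proof -
  obtain r where r: "r \<in> S \<rightarrow> carrier R0" "y = E_std_class R0 (std_witt R0 r)" using E_std_cases[OF R0 y] by blast
  have "\<forall>n\<in>S. \<exists>a\<in>carrier (base P). proj0 P a = r n"
    using r(1) presentation_simps(4) by (metis funcset_mem imageE)
  then obtain b where b: "\<forall>n\<in>S. b n \<in> carrier (base P) \<and> proj0 P (b n) = r n" by metis
  have "std_witt R0 r = std_witt R0 (\<lambda>n. proj0 P (b n))" by (rule witt_eqI) (simp add: b)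
  with r(2) b show ?thesis by (intro that[of b]) auto
qed

lemma incl_family: "b \<in> S \<rightarrow> carrier (base P) \<Longrightarrow> (\<lambda>n. incl P (b n)) \<in> S \<rightarrow> carrier (total P)"
  using ring_hom_closed[OF presentation_simps(7)] by auto

lemma E_Omega_structure_closed: "y \<in> carrier (E_std S R0) \<Longrightarrow> E_Omega_structure S R0 R P y \<in> carrier EO"
  by (erule E_std_base) (simp only: E_Omega_structure_witt symbol_EO incl_family)

text \<open>Composed with the projection from \<open>X\<^sub>S\<^sup>\<bullet>(A)\<close>, the two maps agree on a closed differential
  graded subring. It contains \<open>X\<^sub>S(A)\<close>, whose elements have classes in the image of \<open>E\<^sub>S(R)\<close>.\<close>

lemma EO_map_unique:
  assumes E: "graded_dg E pr'" "\<And>q. Hausdorff_space (htop E q)"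
    and f: "dg_map EO E f" and g: "dg_map EO E g"
    and zero: "\<And>y. y \<in> carrier (E_std S R) \<Longrightarrow> f (E_Omega_zero S R P y) = g (E_Omega_zero S R P y)"
    and v: "v \<in> carrier EO"
  shows "f v = g v"
proof -
  let ?f = "\<lambda>x. f (XI +>\<^bsub>XD\<^esub> x)" and ?g = "\<lambda>x. g (XI +>\<^bsub>XD\<^esub> x)"
  let ?Z = "{x \<in> carrier XD. ?f x = ?g x}"
  have "carrier XD \<subseteq> ?Z"
  proof (rule XD_generated)
    note fg = dg_map_comp[OF EO_proj f] dg_map_comp[OF EO_proj g]
    show "dg_subring ?Z XD" "dg_closed ?Z XD"
      by (rule dg_equalizer[OF graded_XD E(1) fg E(2)])+
    fix x assume x: "x \<in> XG"
    then obtain a where a: "a \<in> S \<rightarrow> carrier (total P)" "x = witt S (total P) a"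
      using X_group_carrier_witt[OF presentsD(1)[OF presents_total]] by blast
    have pa: "(\<lambda>n. proj P (a n)) \<in> S \<rightarrow> carrier R" using a(1) presentation_simps(6) by auto
    have "?f (F.emb x) = ?g (F.emb x)"
      using zero[OF E_std_class_in[OF R pa]] unfolding E_Omega_zero_witt[OF a(1)] symbol_def a(2) .
    then show "F.emb x \<in> ?Z" using emb_XD[OF x] by blast
  qed
  then show ?thesis using v unfolding EO_carrier by blast
qed

end

lemma presentedI:
  assumes "truncation_set S" "cring R0" "cring R" "\<rho> \<in> ring_hom R0 R" "presentation R0 R \<rho> P"
  shows "presented S R0 R \<rho> P"
  using assms by (simp add: presented_def presented_axioms_def truncated_def)

locale presented_map = P: presented S R0 R \<rho> P + P': presented S R0' R' \<rho>' P'
  for S :: "nat set" and R0 :: "'r0 ring" and R :: "'r ring" and \<rho> and P :: "('a0, 'a, 'r0, 'r) algebra_presentation"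
    and R0' :: "'s0 ring" and R' :: "'s ring" and \<rho>' and P' :: "('b0, 'b, 's0, 's) algebra_presentation" +
  fixes f0 :: "'r0 \<Rightarrow> 's0" and f :: "'r \<Rightarrow> 's" and h0 :: "'a0 \<Rightarrow> 'b0" and h :: "'a \<Rightarrow> 'b"
  assumes f0: "f0 \<in> ring_hom R0 R0'" and f: "f \<in> ring_hom R R'"
    and h0_hom: "h0 \<in> ring_hom (base P) (base P')" and h_hom: "h \<in> ring_hom (total P) (total P')"
    and h_compat: "\<And>b. b \<in> carrier (base P) \<Longrightarrow> h (incl P b) = incl P' (h0 b)"
    and proj0_h0: "\<And>b. b \<in> carrier (base P) \<Longrightarrow> proj0 P' (h0 b) = f0 (proj0 P b)"
    and proj_h: "\<And>a. a \<in> carrier (total P) \<Longrightarrow> proj P' (h a) = f (proj P a)"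
begin

sublocale forms_map "base P" "total P" "incl P" "base P'" "total P'" "incl P'" S h h0
  using h_hom h_compat ring_hom_closed[OF h0_hom] by unfold_locales auto

lemma h_XG:
  assumes I: "I \<subseteq> carrier (total P)" and J: "J \<subseteq> carrier (total P')" and IJ: "h ` I \<subseteq> J"
    and x: "x \<in> X_group S (total P) I"
  shows "hP (P.F.emb x) = P'.F.emb (\<lambda>n\<in>S. h (x n))" "(\<lambda>n\<in>S. h (x n)) \<in> X_group S (total P') J"
proof -
  note r = cring.axioms(1)[OF P.presentation_simps(2)] cring.axioms(1)[OF P'.presentation_simps(2)]
  show "hP (P.F.emb x) = P'.F.emb (\<lambda>n\<in>S. h (x n))"
    by (rule hP_emb) (use P.X_group_PiE[OF r(1) I] x in blast)
  show "(\<lambda>n\<in>S. h (x n)) \<in> X_group S (total P') J"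
    by (rule P.X_group_map[OF r h I J IJ x])
qed

text \<open>The preimage of \<open>X\<^sub>S\<^sup>\<bullet>(A')\<close> is a closed differential graded subring that contains
  \<open>X\<^sub>S(A)\<close>; the analogous argument applies to the ideals.\<close>

lemma hP_XD: "hP ` carrier P.XD \<subseteq> carrier P'.XD"
proof -
  let ?Z = "{x \<in> carrier P.F.OP. hP x \<in> carrier P'.XD}"
  note g = P.F.graded_OP P'.F.graded_OP hP_dg_map
  have Z: "dg_subring ?Z P.F.OP \<and> dg_closed ?Z P.F.OP"
    using dg_subring_vimage[OF g P'.XD_subring(1)] dg_closed_vimage[OF g P'.XD_subring(2)] by blast
  have "h ` carrier (total P) \<subseteq> carrier (total P')" using h_closed by blast
  note hx = h_XG[OF subset_refl subset_refl this]
  have "P.F.emb ` P.XG \<subseteq> ?Z"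
    using P.emb_OP P'.emb_XD[OF hx(2)] hx(1) by auto
  then have "carrier P.XD \<subseteq> ?Z"
    unfolding X_dg_def[of S P] sub_dg_ring_simps by (rule hull_minimal) (rule Z)
  then show ?thesis by blast
qed

lemma hP_XD_map: "dg_map P.XD P'.XD hP"
  using dg_map_sub[OF P.F.graded_OP hP_dg_map graded_dg.sub_carrier[OF P.F.graded_OP P.XD_subring(1)] hP_XD]
  by (simp only: P.XD_eq[symmetric] P'.XD_eq[symmetric])

lemma hP_XI: "hP ` P.XI \<subseteq> P'.XI"
proof -
  let ?Z = "{x \<in> carrier P.XD. hP x \<in> P'.XI}"
  note g = P.graded_XD P'.graded_XD hP_XD_map
  have Z: "dg_ideal ?Z P.XD \<and> dg_closed ?Z P.XD"
    using dg_ideal_vimage[OF g P'.XI_ideal(1)] dg_closed_vimage[OF g P'.XI_ideal(2)] by blast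
  have ker: "h ` a_kernel (total P) R (proj P) \<subseteq> a_kernel (total P') R' (proj P')"
    using h_closed proj_h ring_hom_zero[OF f cring.axioms(1)[OF P.R] cring.axioms(1)[OF P'.R]]
    by (auto simp: mem_kernel)
  have k: "a_kernel (total P) R (proj P) \<subseteq> carrier (total P)" "a_kernel (total P') R' (proj P') \<subseteq> carrier (total P')"
    by (auto simp: mem_kernel)
  note hx = h_XG[OF k ker]
  have "P.F.emb ` P.XK \<subseteq> ?Z"
    using P.emb_XD P.XK_XG P'.emb_XI[OF hx(2)] hx(1) by auto
  then have "P.XI \<subseteq> ?Z"
    unfolding X_dg_ideal_def[of S R P] by (rule hull_minimal) (rule Z)
  then show ?thesis by blast
qed

definition "hE = coset_map P'.XD P'.XI hP"

lemma hE_map: "dg_map P.EO P'.EO hE"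
  unfolding hE_def E_Omega_def
  by (rule dg_map_quot(1)[OF P.graded_XD P'.graded_XD P.XI_ideal(1) P'.XI_ideal(1) hP_XD_map hP_XI])

lemma hE_symbol:
  assumes a: "a \<in> S \<rightarrow> carrier (total P)"
  shows "hE (P.symbol a) = P'.symbol (\<lambda>n. h (a n))"
proof -
  have IJ: "h ` carrier (total P) \<subseteq> carrier (total P')" using h_closed by blast
  show ?thesis
    unfolding P.symbol_def hE_def
      dg_map_quot(2)[OF P.graded_XD P'.graded_XD P.XI_ideal(1) P'.XI_ideal(1) hP_XD_map hP_XI P.emb_XD[OF P.witt_XG[OF a]]]
      h_XG(1)[OF subset_refl subset_refl IJ P.witt_XG[OF a]]
      P.witt_map[OF h P.presentation_simps(2) P'.presentation_simps(2) a] P'.symbol_def ..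
qed

lemma hE_zero:
  assumes y: "y \<in> carrier (E_std S R)"
  shows "hE (E_Omega_zero S R P y) = E_Omega_zero S R' P' (E_map S R' f y)"
proof -
  obtain a where a: "a \<in> S \<rightarrow> carrier (total P)" "y = P.E_std_class R (P.std_witt R (\<lambda>n. proj P (a n)))"
    using y by (rule P.E_std_total)
  have pa: "(\<lambda>n. proj P (a n)) \<in> S \<rightarrow> carrier R" using a(1) P.presentation_simps(6) by auto
  have ha: "(\<lambda>n. h (a n)) \<in> S \<rightarrow> carrier (total P')" using a(1) h_closed by auto
  have "P.std_witt R' (\<lambda>n. f (proj P (a n))) = P.std_witt R' (\<lambda>n. proj P' (h (a n)))"
    by (rule witt_eqI) (use a(1) in \<open>simp add: proj_h Pi_iff\<close>)
  then show ?thesis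
    unfolding a(2) P.E_Omega_zero_witt[OF a(1)] hE_symbol[OF a(1)] P.E_map_witt[OF P.R P'.R f pa]
    by (simp only: P'.E_Omega_zero_witt[OF ha])
qed

lemma hE_structure:
  assumes y: "y \<in> carrier (E_std S R0)"
  shows "hE (E_Omega_structure S R0 R P y) = E_Omega_structure S R0' R' P' (E_map S R0' f0 y)"
proof -
  obtain b where b: "b \<in> S \<rightarrow> carrier (base P)" "y = P.E_std_class R0 (P.std_witt R0 (\<lambda>n. proj0 P (b n)))"
    using y by (rule P.E_std_base)
  have pb: "(\<lambda>n. proj0 P (b n)) \<in> S \<rightarrow> carrier R0" using b(1) P.presentation_simps(4) by auto
  have hb: "(\<lambda>n. h0 (b n)) \<in> S \<rightarrow> carrier (base P')" using b(1) ring_hom_closed[OF h0_hom] by auto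
  have "P.std_witt R0' (\<lambda>n. f0 (proj0 P (b n))) = P.std_witt R0' (\<lambda>n. proj0 P' (h0 (b n)))"
    by (rule witt_eqI) (use b(1) in \<open>simp add: proj0_h0 Pi_iff\<close>)
  moreover have "witt S (total P') (\<lambda>n. h (incl P (b n))) = witt S (total P') (\<lambda>n. incl P' (h0 (b n)))"
    by (rule witt_eqI) (use b(1) in \<open>simp add: h_incl Pi_iff\<close>)
  ultimately show ?thesis
    unfolding b(2) P.E_Omega_structure_witt[OF b(1)] hE_symbol[OF P.incl_family[OF b(1)]] P.E_map_witt[OF P.R0 P'.R0 f0 pb]
    by (simp only: P'.E_Omega_structure_witt[OF hb] P'.symbol_def)
qed

end

section \<open>Free presentations\<close>

text \<open>The map \<open>R\<^sub>0 \<rightarrow> R\<^sub>0'\<close> lifts to \<open>A\<^sub>0 \<rightarrow> A\<^sub>0'\<close>, since \<open>A\<^sub>0\<close> is a polynomial ring over \<open>\<int>\<close>,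
  and the composite \<open>A\<^sub>0 \<rightarrow> A\<^sub>0' \<rightarrow> A'\<close> extends to a lift \<open>A \<rightarrow> A'\<close> of \<open>R \<rightarrow> R'\<close>, since \<open>A\<close> is a
  polynomial ring over \<open>A\<^sub>0\<close>. The lifts are not unique, but the induced map is, by
  \<open>EO_map_unique\<close>.\<close>

lemma (in presented) free_map_exists:
  fixes R0' :: "'s0 ring" and R' :: "'q ring" and P' :: "('b0, 'c, 's0, 'q) algebra_presentation"
  assumes free: "free_presentation R0 R \<rho> P" and P': "presented S R0' R' \<rho>' P'"
    and f0: "f0 \<in> ring_hom R0 R0'" and f: "f \<in> ring_hom R R'"
    and sq: "\<And>r. r \<in> carrier R0 \<Longrightarrow> f (\<rho> r) = \<rho>' (f0 r)"
  shows "\<exists>\<phi>. dg_map EO (E_Omega S R' P') \<phi> \<and>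
    (\<forall>y\<in>carrier (E_std S R). \<phi> (E_Omega_zero S R P y) = E_Omega_zero S R' P' (E_map S R' f y)) \<and>
    (\<forall>y\<in>carrier (E_std S R0). \<phi> (E_Omega_structure S R0 R P y) = E_Omega_structure S R0' R' P' (E_map S R0' f0 y))"
proof -
  interpret P': presented S R0' R' \<rho>' P' by (rule P')
  note p = presentation_simps and p' = P'.presentation_simps
  have "polynomial_ring_over (base P) \<Z> (\<lambda>k. add_pow (base P) k \<one>\<^bsub>base P\<^esub>)"
    using free by (simp add: free_presentation_def)
  then obtain T0 where T0: "polynomial_ring \<Z> (base P) (\<lambda>k. add_pow (base P) k \<one>\<^bsub>base P\<^esub>) T0"
    using polynomial_ring_overE[OF _ p(1) int_is_cring int_scalar_hom[OF p(1)]] by blast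
  have f0p: "(\<lambda>b. f0 (proj0 P b)) \<in> ring_hom (base P) R0'"
    using ring_hom_trans[OF p(3) f0] by (simp add: comp_def)
  have "proj0 P' (add_pow (base P') k \<one>\<^bsub>base P'\<^esub>) = f0 (proj0 P (add_pow (base P) k \<one>\<^bsub>base P\<^esub>))" for k :: int
    unfolding ring_hom_int_scalar[OF p'(3) p'(1) P'.R0] ring_hom_int_scalar[OF f0p p(1) P'.R0] ..
  from polynomial_ring.lift_exists[OF T0 p'(1) int_scalar_hom[OF p'(1)] p'(3,4) f0p this]
  obtain h0 where h0: "h0 \<in> ring_hom (base P) (base P')" "\<And>b. b \<in> carrier (base P) \<Longrightarrow> proj0 P' (h0 b) = f0 (proj0 P b)"
    by blast
  obtain T where T: "polynomial_ring (base P) (total P) (incl P) T" by (rule polynomial_total)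
  have ih: "(\<lambda>b. incl P' (h0 b)) \<in> ring_hom (base P) (total P')"
    using ring_hom_trans[OF h0(1) p'(7)] by (simp add: comp_def)
  have fp: "(\<lambda>a. f (proj P a)) \<in> ring_hom (total P) R'"
    using ring_hom_trans[OF p(5) f] by (simp add: comp_def)
  have "proj P' (incl P' (h0 b)) = f (proj P (incl P b))" if b: "b \<in> carrier (base P)" for b
    using p'(8)[OF ring_hom_closed[OF h0(1) b]] h0(2)[OF b] p(8)[OF b] sq[OF ring_hom_closed[OF p(3) b]] by simp
  from polynomial_ring.lift_exists[OF T p'(2) ih p'(5,6) fp this]
  obtain h where h: "h \<in> ring_hom (total P) (total P')" "\<And>b. b \<in> carrier (base P) \<Longrightarrow> h (incl P b) = incl P' (h0 b)"
      "\<And>a. a \<in> carrier (total P) \<Longrightarrow> proj P' (h a) = f (proj P a)"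
    by blast
  interpret M: presented_map S R0 R \<rho> P R0' R' \<rho>' P' f0 f h0 h
    by unfold_locales (use f0 f h0 h in auto)
  show ?thesis using M.hE_map M.hE_zero M.hE_structure by blast
qed

lemma (in truncated) E_map_id:
  assumes R: "cring R" and y: "y \<in> carrier (E_std S R)"
  shows "E_map S R (\<lambda>r. r) y = y"
proof -
  have id: "(\<lambda>r. r) \<in> ring_hom R R" by (rule ring_hom_memI) auto
  obtain r where r: "r \<in> S \<rightarrow> carrier R" "y = E_std_class R (std_witt R r)" using E_std_cases[OF R y] by blast
  show ?thesis unfolding r(2) E_map_witt[OF R R id r(1)] ..
qed

lemma dga_hom_iff:
  "\<phi> \<in> dga_hom K u v D E \<and> dg_continuous D E \<phi> \<longleftrightarrow> dg_map D E \<phi> \<and> (\<forall>k\<in>carrier K. \<phi> (u k) = v k)"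
  by (auto simp: dga_hom_def dg_map_def)

lemma (in presented) unique_map:
  fixes R0' :: "'s0 ring" and R' :: "'q ring" and P' :: "('b0, 'c, 's0, 'q) algebra_presentation"
  assumes free: "free_presentation R0 R \<rho> P" and P': "presented S R0' R' \<rho>' P'"
    and f0: "f0 \<in> ring_hom R0 R0'" and f: "f \<in> ring_hom R R'"
    and sq: "\<And>r. r \<in> carrier R0 \<Longrightarrow> f (\<rho> r) = \<rho>' (f0 r)"
  shows "\<exists>!\<phi>. \<phi> \<in> extensional (carrier EO) \<and>
    \<phi> \<in> dga_hom (E_std S R0) (E_Omega_structure S R0 R P) (\<lambda>y. E_Omega_structure S R0' R' P' (E_map S R0' f0 y))
      EO (E_Omega S R' P') \<and>
    dg_continuous EO (E_Omega S R' P') \<phi> \<and>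
    (\<forall>y\<in>carrier (E_std S R). \<phi> (E_Omega_zero S R P y) = E_Omega_zero S R' P' (E_map S R' f y))"
proof -
  interpret P': presented S R0' R' \<rho>' P' by (rule P')
  obtain \<phi> where \<phi>: "dg_map EO P'.EO \<phi>"
    "\<And>y. y \<in> carrier (E_std S R) \<Longrightarrow> \<phi> (E_Omega_zero S R P y) = E_Omega_zero S R' P' (E_map S R' f y)"
    "\<And>y. y \<in> carrier (E_std S R0) \<Longrightarrow> \<phi> (E_Omega_structure S R0 R P y) = E_Omega_structure S R0' R' P' (E_map S R0' f0 y)"
    using free_map_exists[OF free P' f0 f sq] by blast
  have zero_EO: "E_Omega_zero S R P y \<in> carrier EO" if "y \<in> carrier (E_std S R)" for y
    using that by (rule E_std_total) (simp only: E_Omega_zero_witt symbol_EO)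
  let ?\<psi> = "restrict \<phi> (carrier EO)"
  have \<psi>: "dg_map EO P'.EO ?\<psi>" by (rule dg_map_cong[OF graded_EO \<phi>(1)]) simp
  show ?thesis
  proof (rule ex1I[of _ ?\<psi>])
    show "?\<psi> \<in> extensional (carrier EO) \<and>
      ?\<psi> \<in> dga_hom (E_std S R0) (E_Omega_structure S R0 R P) (\<lambda>y. E_Omega_structure S R0' R' P' (E_map S R0' f0 y))
        EO P'.EO \<and>
      dg_continuous EO P'.EO ?\<psi> \<and>
      (\<forall>y\<in>carrier (E_std S R). ?\<psi> (E_Omega_zero S R P y) = E_Omega_zero S R' P' (E_map S R' f y))"
      using \<psi> \<phi>(2,3) E_Omega_structure_closed zero_EO
        dga_hom_iff[of ?\<psi> "E_std S R0" "E_Omega_structure S R0 R P"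
          "\<lambda>y. E_Omega_structure S R0' R' P' (E_map S R0' f0 y)" EO P'.EO]
      by (simp add: restrict_apply')
    fix \<eta>
    assume \<eta>: "\<eta> \<in> extensional (carrier EO) \<and>
      \<eta> \<in> dga_hom (E_std S R0) (E_Omega_structure S R0 R P) (\<lambda>y. E_Omega_structure S R0' R' P' (E_map S R0' f0 y))
        EO P'.EO \<and>
      dg_continuous EO P'.EO \<eta> \<and>
      (\<forall>y\<in>carrier (E_std S R). \<eta> (E_Omega_zero S R P y) = E_Omega_zero S R' P' (E_map S R' f y))"
    then have m: "dg_map EO P'.EO \<eta>" using dga_hom_iff by blast
    have "\<eta> v = ?\<psi> v" if "v \<in> carrier EO" for v
      by (rule EO_map_unique[OF P'.graded_EO P'.Hausdorff_EO m \<psi> _ that])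
        (use \<eta> \<phi>(2) zero_EO in \<open>simp add: restrict_apply'\<close>)
    then show "\<eta> = ?\<psi>" using \<eta> by (intro extensionalityI[of _ "carrier EO"]) auto
  qed
qed

text \<open>A map in the opposite direction exists by the same argument, and both composites are
  identities because they are identities in degree zero.\<close>

lemma (in presented) free_map_homeomorphic:
  fixes Q :: "('c0, 'c, 's, 'r) algebra_presentation"
  assumes free: "free_presentation R0 R \<rho> P" "free_presentation R0 R \<rho> Q"
    and \<phi>: "dg_map EO (E_Omega S R Q) \<phi>"
    and zero: "\<And>y. y \<in> carrier (E_std S R) \<Longrightarrow> \<phi> (E_Omega_zero S R P y) = E_Omega_zero S R Q y"
  shows "dg_homeomorphic EO (E_Omega S R Q) \<phi>"
proof -
  interpret Q: presented S R0 R \<rho> Q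
    by (rule presentedI) (use trunc R0 R \<rho> free(2) in \<open>auto simp: free_presentation_def\<close>)
  have id: "(\<lambda>r. r) \<in> ring_hom K K" for K :: "('z, 'w) ring_scheme" by (rule ring_hom_memI) auto
  have P: "presented S R0 R \<rho> P" by unfold_locales
  obtain \<psi> where \<psi>: "dg_map Q.EO EO \<psi>"
    "\<And>y. y \<in> carrier (E_std S R) \<Longrightarrow> \<psi> (E_Omega_zero S R Q y) = E_Omega_zero S R P y"
    using Q.free_map_exists[OF free(2) P id id] E_map_id[OF R] by auto
  have idm: "dg_map D D (\<lambda>x. x)" for D :: "'z dg_ring"
    using id[of D] by (auto simp: dg_map_def dg_continuous_def)
  have 1: "\<psi> (\<phi> v) = v" if "v \<in> carrier EO" for v
    by (rule EO_map_unique[OF graded_EO Hausdorff_EO dg_map_comp[OF \<phi> \<psi>(1)] idm _ that]) (simp add: zero \<psi>(2))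
  have 2: "\<phi> (\<psi> v) = v" if "v \<in> carrier Q.EO" for v
    by (rule Q.EO_map_unique[OF Q.graded_EO Q.Hausdorff_EO dg_map_comp[OF \<psi>(1) \<phi>] idm _ that]) (simp add: zero \<psi>(2))
  have "bij_betw \<phi> (carrier EO) (carrier Q.EO)"
    using 1 2 ring_hom_closed[OF dg_mapD(1)[OF \<phi>]] ring_hom_closed[OF dg_mapD(1)[OF \<psi>(1)]]
    by (intro bij_betw_byWitness[of _ \<psi>]) auto
  moreover have "homeomorphic_map (htop EO q) (htop Q.EO q) \<phi>" for q
  proof -
    have t: "topspace (htop EO q) \<subseteq> carrier EO" "topspace (htop Q.EO q) \<subseteq> carrier Q.EO"
      using graded_dg.top[OF graded_EO] graded_dg.homog_carrier[OF graded_EO]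
        graded_dg.top[OF Q.graded_EO] graded_dg.homog_carrier[OF Q.graded_EO] by auto
    have "homeomorphic_maps (htop EO q) (htop Q.EO q) \<phi> \<psi>"
      unfolding homeomorphic_maps_def using dg_mapD(5)[OF \<phi>] dg_mapD(5)[OF \<psi>(1)] 1 2 t by blast
    then show ?thesis using homeomorphic_map_maps by blast
  qed
  ultimately show ?thesis by (simp add: dg_homeomorphic_def)
qed

theorem corollary3p4:
  fixes S :: "nat set"
    and R0 :: "'r0 ring" and R :: "'r ring" and \<rho> :: "'r0 \<Rightarrow> 'r"
    and R0' :: "'s0 ring" and R' :: "'s ring" and \<rho>' :: "'s0 \<Rightarrow> 's"
    and f0 :: "'r0 \<Rightarrow> 's0" and f :: "'r \<Rightarrow> 's"
    and P :: "('a0, 'a, 'r0, 'r) algebra_presentation"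
    and P' :: "('b0, 'b, 's0, 's) algebra_presentation"
    and Q :: "('c0, 'c, 'r0, 'r) algebra_presentation"
  assumes "truncation_set S"
    and "cring R0" and "cring R" and "\<rho> \<in> ring_hom R0 R"
    and "free_presentation R0 R \<rho> P"
  shows
    "(cring R0' \<and> cring R' \<and> \<rho>' \<in> ring_hom R0' R' \<and>
      f0 \<in> ring_hom R0 R0' \<and> f \<in> ring_hom R R' \<and>
      (\<forall>r\<in>carrier R0. f (\<rho> r) = \<rho>' (f0 r)) \<and>
      presentation R0' R' \<rho>' P' \<longrightarrow>
      (\<exists>!\<phi>. \<phi> \<in> extensional (carrier (E_Omega S R P)) \<and>
        \<phi> \<in> dga_hom (E_std S R0) (E_Omega_structure S R0 R P)
               (\<lambda>y. E_Omega_structure S R0' R' P' (E_map S R0' f0 y))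
               (E_Omega S R P) (E_Omega S R' P') \<and>
        dg_continuous (E_Omega S R P) (E_Omega S R' P') \<phi> \<and>
        (\<forall>y\<in>carrier (E_std S R).
           \<phi> (E_Omega_zero S R P y) = E_Omega_zero S R' P' (E_map S R' f y))))
     \<and>
     (free_presentation R0 R \<rho> Q \<longrightarrow>
      (\<exists>!\<phi>. \<phi> \<in> extensional (carrier (E_Omega S R P)) \<and>
        \<phi> \<in> dga_hom (E_std S R0) (E_Omega_structure S R0 R P) (E_Omega_structure S R0 R Q)
               (E_Omega S R P) (E_Omega S R Q) \<and>
        dg_homeomorphic (E_Omega S R P) (E_Omega S R Q) \<phi> \<and>
        (\<forall>y\<in>carrier (E_std S R). \<phi> (E_Omega_zero S R P y) = E_Omega_zero S R Q y)))"
proof (intro conjI impI)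
  interpret P: presented S R0 R \<rho> P
    by (rule presentedI) (use assms in \<open>auto simp: free_presentation_def\<close>)
  show "\<exists>!\<phi>. \<phi> \<in> extensional (carrier (E_Omega S R P)) \<and>
      \<phi> \<in> dga_hom (E_std S R0) (E_Omega_structure S R0 R P)
             (\<lambda>y. E_Omega_structure S R0' R' P' (E_map S R0' f0 y))
             (E_Omega S R P) (E_Omega S R' P') \<and>
      dg_continuous (E_Omega S R P) (E_Omega S R' P') \<phi> \<and>
      (\<forall>y\<in>carrier (E_std S R). \<phi> (E_Omega_zero S R P y) = E_Omega_zero S R' P' (E_map S R' f y))"
    if a: "cring R0' \<and> cring R' \<and> \<rho>' \<in> ring_hom R0' R' \<and> f0 \<in> ring_hom R0 R0' \<and> f \<in> ring_hom R R' \<and>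
      (\<forall>r\<in>carrier R0. f (\<rho> r) = \<rho>' (f0 r)) \<and> presentation R0' R' \<rho>' P'"
  proof -
    have "presented S R0' R' \<rho>' P'" by (rule presentedI) (use assms(1) a in auto)
    then show ?thesis by (rule P.unique_map[OF assms(5)]) (use a in auto)
  qed
  assume free: "free_presentation R0 R \<rho> Q"
  interpret Q: presented S R0 R \<rho> Q
    by (rule presentedI) (use assms free in \<open>auto simp: free_presentation_def\<close>)
  have id: "(\<lambda>r. r) \<in> ring_hom K K" for K :: "('z, 'w) ring_scheme" by (rule ring_hom_memI) auto
  let ?m = "\<lambda>\<phi>. \<phi> \<in> extensional (carrier P.EO) \<and>
      dg_map P.EO Q.EO \<phi> \<and> (\<forall>y\<in>carrier (E_std S R0). \<phi> (E_Omega_structure S R0 R P y) = E_Omega_structure S R0 R Q y) \<and>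
      (\<forall>y\<in>carrier (E_std S R). \<phi> (E_Omega_zero S R P y) = E_Omega_zero S R Q y)"
  have "\<exists>!\<phi>. ?m \<phi>"
  proof -
    have "\<phi> \<in> extensional (carrier P.EO) \<and>
        \<phi> \<in> dga_hom (E_std S R0) (E_Omega_structure S R0 R P)
          (\<lambda>y. E_Omega_structure S R0 R Q (E_map S R0 (\<lambda>r. r) y)) P.EO Q.EO \<and>
        dg_continuous P.EO Q.EO \<phi> \<and>
        (\<forall>y\<in>carrier (E_std S R). \<phi> (E_Omega_zero S R P y) = E_Omega_zero S R Q (E_map S R (\<lambda>r. r) y)) \<longleftrightarrow> ?m \<phi>" for \<phi>
      using dga_hom_iff[of \<phi> "E_std S R0" "E_Omega_structure S R0 R P"
          "\<lambda>y. E_Omega_structure S R0 R Q (E_map S R0 (\<lambda>r. r) y)" P.EO Q.EO]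
        P.E_map_id[OF assms(2)] P.E_map_id[OF assms(3)] by simp blast
    then show ?thesis
      using P.unique_map[OF assms(5) Q.presented_axioms id id refl] by (simp only:)
  qed
  moreover have "\<phi> \<in> extensional (carrier P.EO) \<and>
      \<phi> \<in> dga_hom (E_std S R0) (E_Omega_structure S R0 R P) (E_Omega_structure S R0 R Q) P.EO Q.EO \<and>
      dg_homeomorphic P.EO Q.EO \<phi> \<and>
      (\<forall>y\<in>carrier (E_std S R). \<phi> (E_Omega_zero S R P y) = E_Omega_zero S R Q y) \<longleftrightarrow> ?m \<phi>" for \<phi>
  proof -
    have "dg_homeomorphic P.EO Q.EO \<phi> \<Longrightarrow> dg_continuous P.EO Q.EO \<phi>"
      by (auto simp: dg_homeomorphic_def dg_continuous_def intro: homeomorphic_imp_continuous_map)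
    moreover have "?m \<phi> \<Longrightarrow> dg_homeomorphic P.EO Q.EO \<phi>"
      using P.free_map_homeomorphic[OF assms(5) free] by blast
    ultimately show ?thesis using dga_hom_iff by blast
  qed
  ultimately show "\<exists>!\<phi>. \<phi> \<in> extensional (carrier (E_Omega S R P)) \<and>
      \<phi> \<in> dga_hom (E_std S R0) (E_Omega_structure S R0 R P) (E_Omega_structure S R0 R Q)
             (E_Omega S R P) (E_Omega S R Q) \<and>
      dg_homeomorphic (E_Omega S R P) (E_Omega S R Q) \<phi> \<and>
      (\<forall>y\<in>carrier (E_std S R). \<phi> (E_Omega_zero S R P y) = E_Omega_zero S R Q y)"
    by (simp only:)
qed

end
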